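(* Let $\mathbb{K}$ be a commutative superring and $\mathfrak{g}$ a Lie $\mathbb{K}$-superalgebra. Assume that $\frac12\in\mathbb{K}$, or that $\mathbb{K}=\mathbb{K}_0$ and $\mathfrak{g}=\mathfrak{g}_0$. Assume moreover that either $\mathbb{K}\supseteq\mathbb{Q}$, or $\mathfrak{g}$ is $N$-nilpotent for some $N\ge2$ with $\frac12,\dots,\frac1N\in\mathbb{K}$. Then the symmetrization map $\beta=\sigma^{-1}:S(\mathfrak{g})\to U(\mathfrak{g})$ satisfies $$\Delta'\circ\beta=(\beta\otimes\beta)\circ\Delta,$$ where $\Delta$ and $\Delta'$ are the comultiplications of $S(\mathfrak{g})$ and $U(\mathfrak{g})$. In particular, for every $a\in\mathfrak{g}$ and $c\in\mathbb{K}_0^\times\cup\{0\}$, $\beta\circ\Phi_c^a\circ\beta^{-1}$ is a coderivation of $U(\mathfrak{g})$.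
   Context: Conventions. A commutative superring $\mathbb{K}=\mathbb{K}_0\oplus\mathbb{K}_1$ is a unital $\mathbb{Z}/2$-graded ring with $ab=(-1)^{p(a)p(b)}ba$ and $a^2=0$ for $a\in\mathbb{K}_1$; $p$ denotes parity, and formulas containing $p(\cdot)$ are written for nonzero homogeneous elements and extended by linearity. $\mathbb{K}_0^\times$ is the group of units of $\mathbb{K}_0$; $\mathbb{K}\supseteq\mathbb{Q}$ means all positive integers are invertible in $\mathbb{K}$. A $\mathbb{K}$-module $M=M_0\oplus M_1$ is a graded right module with $p(m\alpha)=p(m)+p(\alpha)$, and $\alpha m:=(-1)^{p(\alpha)p(m)}m\alpha$. $Hom(M,N)$ is the graded group of right $\mathbb{K}$-linear maps; $(F\otimes G)(v\otimes w)=(-1)^{p(G)p(v)}F(v)\otimes G(w)$. A Lie $\mathbb{K}$-superalgebra is a $\mathbb{K}$-module $\mathfrak{g}$ with an even $\mathbb{K}$-bilinear bracket satisfying $[X,Y]=-(-1)^{p(X)p(Y)}[Y,X]$; $[X,X]=0$ for $X\in\mathfrak{g}_0$; $[[X,Y],Z]=[X,[Y,Z]]-(-1)^{p(X)p(Y)}[Y,[X,Z]]$; $[Y,[Y,Y]]=0$ for $Y\in\mathfrak{g}_1$. $\mathfrak{g}$ is $N$-nilpotent if $\mathrm{ad}X_1\circ\cdots\circ\mathrm{ad}X_N=0$ for all $X_i\in\mathfrak{g}$, where $\mathrm{ad}X=[X,\cdot]$. $S(\mathfrak{g})$ is the quotient of $T(\mathfrak{g})$ by the ideal generated by $v\otimes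 w-(-1)^{p(v)p(w)}w\otimes v$ and $u\otimes u$ ($u\in\mathfrak{g}_1$); $\Delta:S(\mathfrak{g})\to S(\mathfrak{g})\otimes S(\mathfrak{g})$ is the superalgebra morphism with $\Delta(X)=X\otimes1+1\otimes X$, $X\in\mathfrak{g}$. $U(\mathfrak{g})$ is the quotient of $T(\mathfrak{g})$ by the ideal generated by $a\otimes b-(-1)^{p(a)p(b)}b\otimes a-[a,b]$, with canonical map $j:\mathfrak{g}\to U(\mathfrak{g})$; $\Delta':U(\mathfrak{g})\to U(\mathfrak{g})\otimes U(\mathfrak{g})$ is the superalgebra morphism with $\Delta'(j(a))=1\otimes j(a)+j(a)\otimes1$. A coderivation of a module $A$ with comultiplication $\Delta_A$ is a $D\in Hom(A,A)$ with $\Delta_A\circ D=(D\otimes id+id\otimes D)\circ\Delta_A$. Let $\varphi_0(t)=-t$ and, for $c\in\mathbb{K}_0^\times$, $\varphi_c(t)=\frac{t}{e^{t/c}-1}$ (in the $N$-nilpotent case, truncated modulo $t^N$; the rational numbers occurring lie in $\mathbb{Z}[\frac1{N!}]$). For $\varphi_c=\sum_nc_nt^n$ and $a\in\mathfrak{g}$ let $\varphi_c^a\in Hom(S(\mathfrak{g}),\mathfrak{g})$ be given by $\varphi_c^a(1)=c_0a$ and $$\varphi_c^a(X_1\cdots X_n)=(-1)^{p(a)(p(X_1)+\cdots+p(X_n))}c_n\sum_{s\in\Sigma_n}\alpha(X_{s(1)},\dots,X_{s(n)})\,\mathrm{ad}X_{s(1)}\circ\cdots\circ\mathrm{ad}X_{s(n)}(a)$$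 (zero for $n\ge N$ in the nilpotent case), with $\alpha=\pm1$ the Koszul sign such that $\alpha(X_{s(1)},\dots,X_{s(n)})X_{s(1)}\cdots X_{s(n)}=X_1\cdots X_n$ in $S(\mathfrak{g})$; put $\Phi_c^a=\mathrm{Mult}\circ(id\otimes\varphi_c^a)\circ\Delta$, $\mathrm{Mult}$ being the multiplication of $S(\mathfrak g)$. The map $a\mapsto\Phi_1^a$ is a representation of $\mathfrak{g}$ in $S(\mathfrak{g})$, so it extends to an algebra morphism $\Phi:U(\mathfrak{g})\to Hom(S(\mathfrak{g}),S(\mathfrak{g}))$ with $\Phi(j(a))=\Phi_1^a$; the symbol map is $\sigma:U(\mathfrak{g})\to S(\mathfrak{g})$, $\sigma(u):=\Phi(u)(1)$. Under the stated assumptions $\sigma$ is invertible, and $\beta:=\sigma^{-1}$. *)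

theory Defs
  imports
    "HOL-Algebra.QuotRing"
    "HOL-Algebra.Free_Abelian_Groups"
    "HOL-Library.Z2"
    "HOL-Library.Extended_Nat"
    "HOL-Combinatorics.Permutations"
    "HOL-Computational_Algebra.Formal_Power_Series"
begin

section \<open>Superrings and supermodules\<close>

text \<open>
  Parities are elements of the two-element field \<^typ>\<open>bit\<close>, so that the exponents of the
  sign rule can be written literally as sums and products of parities. As usual in HOL-Algebra,
  a module is a ring record whose multiplicative fields are left unspecified. Superalgebras are
  supermodules whose multiplicative fields are meaningful.
\<close>

record 'a graded_ring = "'a ring" +
  hpart :: "bit \<Rightarrow> 'a set"

record ('a, 'k) smodule = "'a graded_ring" +
  rscale :: "'a \<Rightarrow> 'k \<Rightarrow> 'a" (infixl \<open>\<bullet>\<index>\<close> 70)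

record ('a, 'k) lie_super = "('a, 'k) smodule" +
  bracket :: "'a \<Rightarrow> 'a \<Rightarrow> 'a"

definition is_graded :: "('a, 'm) graded_ring_scheme \<Rightarrow> bool" where
  "is_graded M \<longleftrightarrow>
     (\<forall>i. additive_subgroup (hpart M i) M) \<and>
     hpart M 0 \<inter> hpart M 1 = {\<zero>\<^bsub>M\<^esub>} \<and>
     hpart M 0 <+>\<^bsub>M\<^esub> hpart M 1 = carrier M"

text \<open>\<open>hcomp M i x\<close> is the component of parity \<open>i\<close> of \<open>x\<close>.\<close>

definition hcomp :: "('a, 'm) graded_ring_scheme \<Rightarrow> bit \<Rightarrow> 'a \<Rightarrow> 'a" where
  "hcomp M i x = (THE y. y \<in> hpart M i \<and> (\<exists>z \<in> hpart M (i + 1). x = y \<oplus>\<^bsub>M\<^esub> z))"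

text \<open>\<open>sg M i x\<close> is \<open>(-1)\<^sup>i x\<close>.\<close>

definition sg :: "('a, 'm) ring_scheme \<Rightarrow> bit \<Rightarrow> 'a \<Rightarrow> 'a" where
  "sg M i x = (if i = 1 then \<ominus>\<^bsub>M\<^esub> x else x)"

locale superring = ring K for K :: "('k, 'm) graded_ring_scheme" (structure) +
  assumes K_graded: "is_graded K"
    and one_even: "\<one> \<in> hpart K 0"
    and mult_parity: "\<lbrakk>a \<in> hpart K i; b \<in> hpart K j\<rbrakk> \<Longrightarrow> a \<otimes> b \<in> hpart K (i + j)"
    and supercomm: "\<lbrakk>a \<in> hpart K i; b \<in> hpart K j\<rbrakk> \<Longrightarrow> a \<otimes> b = sg K (i * j) (b \<otimes> a)"
    and odd_square: "a \<in> hpart K 1 \<Longrightarrow> a \<otimes> a = \<zero>"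

locale supermodule = superring K + M: abelian_group M
  for K :: "('k, 'm) graded_ring_scheme"
    and M :: "('a, 'k, 'n) smodule_scheme" +
  assumes M_graded: "is_graded M"
    and scale_closed: "\<lbrakk>x \<in> carrier M; \<alpha> \<in> carrier K\<rbrakk> \<Longrightarrow> x \<bullet>\<^bsub>M\<^esub> \<alpha> \<in> carrier M"
    and scale_add_left: "\<lbrakk>x \<in> carrier M; y \<in> carrier M; \<alpha> \<in> carrier K\<rbrakk>
          \<Longrightarrow> (x \<oplus>\<^bsub>M\<^esub> y) \<bullet>\<^bsub>M\<^esub> \<alpha> = x \<bullet>\<^bsub>M\<^esub> \<alpha> \<oplus>\<^bsub>M\<^esub> y \<bullet>\<^bsub>M\<^esub> \<alpha>"
    and scale_add_right: "\<lbrakk>x \<in> carrier M; \<alpha> \<in> carrier K; \<gamma> \<in> carrier K\<rbrakk>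
          \<Longrightarrow> x \<bullet>\<^bsub>M\<^esub> (\<alpha> \<oplus>\<^bsub>K\<^esub> \<gamma>) = x \<bullet>\<^bsub>M\<^esub> \<alpha> \<oplus>\<^bsub>M\<^esub> x \<bullet>\<^bsub>M\<^esub> \<gamma>"
    and scale_mult: "\<lbrakk>x \<in> carrier M; \<alpha> \<in> carrier K; \<gamma> \<in> carrier K\<rbrakk>
          \<Longrightarrow> x \<bullet>\<^bsub>M\<^esub> (\<alpha> \<otimes>\<^bsub>K\<^esub> \<gamma>) = (x \<bullet>\<^bsub>M\<^esub> \<alpha>) \<bullet>\<^bsub>M\<^esub> \<gamma>"
    and scale_one: "x \<in> carrier M \<Longrightarrow> x \<bullet>\<^bsub>M\<^esub> \<one>\<^bsub>K\<^esub> = x"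
    and scale_parity: "\<lbrakk>x \<in> hpart M i; \<alpha> \<in> hpart K j\<rbrakk> \<Longrightarrow> x \<bullet>\<^bsub>M\<^esub> \<alpha> \<in> hpart M (i + j)"

text \<open>The left action \<open>\<alpha> m = (-1)\<^bsup>p(\<alpha>)p(m)\<^esup> m \<alpha>\<close>.\<close>

definition lscale ::
  "('k, 'm) graded_ring_scheme \<Rightarrow> ('a, 'k, 'n) smodule_scheme \<Rightarrow> 'k \<Rightarrow> 'a \<Rightarrow> 'a" where
  "lscale K M \<alpha> x =
     (\<Oplus>\<^bsub>M\<^esub>i\<in>{0, 1}. \<Oplus>\<^bsub>M\<^esub>j\<in>{0, 1}. sg M (i * j) (hcomp M j x \<bullet>\<^bsub>M\<^esub> hcomp K i \<alpha>))"

text \<open>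
  \<open>Hom(M, N)\<close>. Functions are extensional, so that equality in the record is equality
  of maps on the carrier.
\<close>

definition sHom ::
  "('k, 'm) graded_ring_scheme \<Rightarrow> ('a, 'k, 'n) smodule_scheme \<Rightarrow> ('b, 'k, 'o) smodule_scheme
    \<Rightarrow> ('a \<Rightarrow> 'b, 'k) smodule" where
  "sHom K M N =
    (let H = {f \<in> carrier M \<rightarrow>\<^sub>E carrier N.
           (\<forall>x \<in> carrier M. \<forall>y \<in> carrier M. f (x \<oplus>\<^bsub>M\<^esub> y) = f x \<oplus>\<^bsub>N\<^esub> f y) \<and>
           (\<forall>x \<in> carrier M. \<forall>\<alpha> \<in> carrier K. f (x \<bullet>\<^bsub>M\<^esub> \<alpha>) = f x \<bullet>\<^bsub>N\<^esub> \<alpha>)}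
     in \<lparr>carrier = H, monoid.mult = undefined, one = undefined,
         ring.zero = (\<lambda>x \<in> carrier M. \<zero>\<^bsub>N\<^esub>),
         add = (\<lambda>F G. \<lambda>x \<in> carrier M. F x \<oplus>\<^bsub>N\<^esub> G x),
         hpart = (\<lambda>i. {f \<in> H. \<forall>j. f ` hpart M j \<subseteq> hpart N (i + j)}),
         rscale = (\<lambda>F \<alpha>. \<lambda>x \<in> carrier M. F (lscale K M \<alpha> x))\<rparr>)"

definition sEnd ::
  "('k, 'm) graded_ring_scheme \<Rightarrow> ('a, 'k, 'n) smodule_scheme \<Rightarrow> ('a \<Rightarrow> 'a, 'k) smodule" where
  "sEnd K M = (sHom K M M)\<lparr>monoid.mult := compose (carrier M),
                           one := (\<lambda>x \<in> carrier M. x)\<rparr>"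

definition superalg_hom ::
  "('k, 'm) graded_ring_scheme \<Rightarrow> ('a, 'k, 'n) smodule_scheme \<Rightarrow> ('b, 'k, 'o) smodule_scheme
    \<Rightarrow> ('a \<Rightarrow> 'b) set" where
  "superalg_hom K A B =
     {f \<in> ring_hom A B \<inter> extensional (carrier A).
        (\<forall>x \<in> carrier A. \<forall>\<alpha> \<in> carrier K. f (x \<bullet>\<^bsub>A\<^esub> \<alpha>) = f x \<bullet>\<^bsub>B\<^esub> \<alpha>) \<and>
        (\<forall>i. f ` hpart A i \<subseteq> hpart B i)}"

text \<open>
  The quotient of \<open>A\<close> by \<open>I\<close>, elements being cosets as in \<^const>\<open>FactRing\<close>. It is also used for
  structures \<open>A\<close> that satisfy the axioms only modulo the additive subgroup \<open>I\<close>.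
\<close>

definition squot :: "('a, 'k, 'n) smodule_scheme \<Rightarrow> 'a set \<Rightarrow> ('a set, 'k) smodule" where
  "squot A I = ring.extend (A Quot I)
     \<lparr>hpart = (\<lambda>i. (\<lambda>x. I +>\<^bsub>A\<^esub> x) ` hpart A i),
      rscale = (\<lambda>X \<alpha>. \<Union>x \<in> X. I +>\<^bsub>A\<^esub> (x \<bullet>\<^bsub>A\<^esub> \<alpha>)), \<dots> = ()\<rparr>"


section \<open>Tensor products over the base superring\<close>

text \<open>
  The free abelian group on pairs, with multiplication
  \<open>(a \<otimes> b)(c \<otimes> d) = (-1)\<^bsup>p(b)p(c)\<^esup> ac \<otimes> bd\<close>, and the relations defining \<open>M \<otimes>\<^sub>K N\<close>.
  The multiplication is meaningful only if \<open>M\<close> and \<open>N\<close> are superalgebras.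
\<close>

definition free_pairs ::
  "('a, 'k, 'n) smodule_scheme \<Rightarrow> ('b, 'k, 'o) smodule_scheme
    \<Rightarrow> ('a \<times> 'b \<Rightarrow>\<^sub>0 int, 'k) smodule" where
  "free_pairs M N =
     \<lparr>carrier = carrier (free_Abelian_group (carrier M \<times> carrier N)),
      monoid.mult = (\<lambda>u v. frag_extend (\<lambda>(a, b). frag_extend (\<lambda>(c, d).
               \<Sum>j\<in>{0, 1}. \<Sum>k\<in>{0, 1}.
                 frag_of (sg M (j * k) (a \<otimes>\<^bsub>M\<^esub> hcomp M k c), hcomp N j b \<otimes>\<^bsub>N\<^esub> d)) v) u),
      one = frag_of (\<one>\<^bsub>M\<^esub>, \<one>\<^bsub>N\<^esub>),
      ring.zero = 0,
      add = (+),
      hpart = (\<lambda>i. carrier (free_Abelian_group (\<Union>j. hpart M j \<times> hpart N (i - j)))),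
      rscale = (\<lambda>u \<alpha>. frag_extend (\<lambda>(x, y). frag_of (x, y \<bullet>\<^bsub>N\<^esub> \<alpha>)) u)\<rparr>"

definition tensor_rels ::
  "('k, 'm) graded_ring_scheme \<Rightarrow> ('a, 'k, 'n) smodule_scheme \<Rightarrow> ('b, 'k, 'o) smodule_scheme
    \<Rightarrow> ('a \<times> 'b \<Rightarrow>\<^sub>0 int) set" where
  "tensor_rels K M N =
     {frag_of (x \<oplus>\<^bsub>M\<^esub> x', y) - frag_of (x, y) - frag_of (x', y) | x x' y.
        x \<in> carrier M \<and> x' \<in> carrier M \<and> y \<in> carrier N} \<union>
     {frag_of (x, y \<oplus>\<^bsub>N\<^esub> y') - frag_of (x, y) - frag_of (x, y') | x y y'.
        x \<in> carrier M \<and> y \<in> carrier N \<and> y' \<in> carrier N} \<union>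
     {frag_of (x \<bullet>\<^bsub>M\<^esub> \<alpha>, y) - frag_of (x, lscale K N \<alpha> y) | x \<alpha> y.
        x \<in> carrier M \<and> \<alpha> \<in> carrier K \<and> y \<in> carrier N}"

definition tensor_null ::
  "('k, 'm) graded_ring_scheme \<Rightarrow> ('a, 'k, 'n) smodule_scheme \<Rightarrow> ('b, 'k, 'o) smodule_scheme
    \<Rightarrow> ('a \<times> 'b \<Rightarrow>\<^sub>0 int) set" where
  "tensor_null K M N = generate (add_monoid (free_pairs M N)) (tensor_rels K M N)"

definition tensor ::
  "('k, 'm) graded_ring_scheme \<Rightarrow> ('a, 'k, 'n) smodule_scheme \<Rightarrow> ('b, 'k, 'o) smodule_scheme
    \<Rightarrow> (('a \<times> 'b \<Rightarrow>\<^sub>0 int) set, 'k) smodule" where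
  "tensor K M N = squot (free_pairs M N) (tensor_null K M N)"

definition pure ::
  "('k, 'm) graded_ring_scheme \<Rightarrow> ('a, 'k, 'n) smodule_scheme \<Rightarrow> ('b, 'k, 'o) smodule_scheme
    \<Rightarrow> 'a \<Rightarrow> 'b \<Rightarrow> ('a \<times> 'b \<Rightarrow>\<^sub>0 int) set" where
  "pure K M N x y = tensor_null K M N +>\<^bsub>free_pairs M N\<^esub> frag_of (x, y)"

text \<open>The additive map on \<open>M \<otimes> N\<close> sending \<open>x \<otimes> y\<close> to \<open>f x y\<close>.\<close>

definition tensor_lift ::
  "('k, 'm) graded_ring_scheme \<Rightarrow> ('a, 'k, 'n) smodule_scheme \<Rightarrow> ('b, 'k, 'o) smodule_scheme
    \<Rightarrow> ('c, 'p) ring_scheme \<Rightarrow> ('a \<Rightarrow> 'b \<Rightarrow> 'c) \<Rightarrow> ('a \<times> 'b \<Rightarrow>\<^sub>0 int) set \<Rightarrow> 'c" where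
  "tensor_lift K M N P f =
     (THE h. h \<in> hom (add_monoid (tensor K M N)) (add_monoid P)
               \<inter> extensional (carrier (tensor K M N)) \<and>
             (\<forall>x \<in> carrier M. \<forall>y \<in> carrier N. h (pure K M N x y) = f x y))"

text \<open>\<open>(F \<otimes> G)(v \<otimes> w) = (-1)\<^bsup>p(G)p(v)\<^esup> F v \<otimes> G w\<close>.\<close>

definition tensor_map ::
  "('k, 'm) graded_ring_scheme \<Rightarrow> ('a, 'k, 'n) smodule_scheme \<Rightarrow> ('b, 'k, 'o) smodule_scheme
    \<Rightarrow> ('c, 'k, 'p) smodule_scheme \<Rightarrow> ('d, 'k, 'q) smodule_scheme
    \<Rightarrow> ('a \<Rightarrow> 'c) \<Rightarrow> ('b \<Rightarrow> 'd) \<Rightarrow> ('a \<times> 'b \<Rightarrow>\<^sub>0 int) set \<Rightarrow> ('c \<times> 'd \<Rightarrow>\<^sub>0 int) set" where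
  "tensor_map K M N M' N' F G =
     tensor_lift K M N (tensor K M' N')
       (\<lambda>v w. \<Oplus>\<^bsub>tensor K M' N'\<^esub>i\<in>{0, 1}. \<Oplus>\<^bsub>tensor K M' N'\<^esub>j\<in>{0, 1}.
          sg (tensor K M' N') (i * j)
            (pure K M' N' (F (hcomp M j v)) (hcomp (sHom K N N') i G w)))"


section \<open>Lie superalgebras\<close>

text \<open>
  \<open>K\<close>-bilinearity of the bracket means that it induces a right linear map
  \<open>g \<otimes>\<^sub>K g \<rightarrow> g\<close>; hence \<open>br_scale_middle\<close> and \<open>br_scale_right\<close>.
\<close>

locale lie_superalgebra = supermodule K g
  for K :: "('k, 'm) graded_ring_scheme"
    and g :: "('g, 'k, 'n) lie_super_scheme" +
  assumes br_closed: "\<lbrakk>X \<in> carrier g; Y \<in> carrier g\<rbrakk> \<Longrightarrow> bracket g X Y \<in> carrier g"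
    and br_add_left: "\<lbrakk>X \<in> carrier g; X' \<in> carrier g; Y \<in> carrier g\<rbrakk>
          \<Longrightarrow> bracket g (X \<oplus>\<^bsub>g\<^esub> X') Y = bracket g X Y \<oplus>\<^bsub>g\<^esub> bracket g X' Y"
    and br_add_right: "\<lbrakk>X \<in> carrier g; Y \<in> carrier g; Y' \<in> carrier g\<rbrakk>
          \<Longrightarrow> bracket g X (Y \<oplus>\<^bsub>g\<^esub> Y') = bracket g X Y \<oplus>\<^bsub>g\<^esub> bracket g X Y'"
    and br_scale_middle: "\<lbrakk>X \<in> carrier g; \<alpha> \<in> carrier K; Y \<in> carrier g\<rbrakk>
          \<Longrightarrow> bracket g (X \<bullet>\<^bsub>g\<^esub> \<alpha>) Y = bracket g X (lscale K g \<alpha> Y)"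
    and br_scale_right: "\<lbrakk>X \<in> carrier g; Y \<in> carrier g; \<alpha> \<in> carrier K\<rbrakk>
          \<Longrightarrow> bracket g X (Y \<bullet>\<^bsub>g\<^esub> \<alpha>) = bracket g X Y \<bullet>\<^bsub>g\<^esub> \<alpha>"
    and br_parity: "\<lbrakk>X \<in> hpart g i; Y \<in> hpart g j\<rbrakk> \<Longrightarrow> bracket g X Y \<in> hpart g (i + j)"
    and br_antisym: "\<lbrakk>X \<in> hpart g i; Y \<in> hpart g j\<rbrakk>
          \<Longrightarrow> bracket g X Y = \<ominus>\<^bsub>g\<^esub> sg g (i * j) (bracket g Y X)"
    and br_even: "X \<in> hpart g 0 \<Longrightarrow> bracket g X X = \<zero>\<^bsub>g\<^esub>"
    and jacobi: "\<lbrakk>X \<in> hpart g i; Y \<in> hpart g j; Z \<in> carrier g\<rbrakk>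
          \<Longrightarrow> bracket g (bracket g X Y) Z =
              bracket g X (bracket g Y Z) \<ominus>\<^bsub>g\<^esub> sg g (i * j) (bracket g Y (bracket g X Z))"
    and br_odd: "Y \<in> hpart g 1 \<Longrightarrow> bracket g Y (bracket g Y Y) = \<zero>\<^bsub>g\<^esub>"

text \<open>\<open>ad_list g [X\<^sub>1, \<dots>, X\<^sub>n] = ad X\<^sub>1 \<circ> \<dots> \<circ> ad X\<^sub>n\<close>\<close>

definition ad_list :: "('g, 'k, 'n) lie_super_scheme \<Rightarrow> 'g list \<Rightarrow> 'g \<Rightarrow> 'g" where
  "ad_list g Xs = foldr (bracket g) Xs"

definition lie_nilpotent :: "('g, 'k, 'n) lie_super_scheme \<Rightarrow> nat \<Rightarrow> bool" where
  "lie_nilpotent g n \<longleftrightarrow>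
     (\<forall>Xs \<in> lists (carrier g). length Xs = n \<longrightarrow>
        (\<forall>Y \<in> carrier g. ad_list g Xs Y = \<zero>\<^bsub>g\<^esub>))"


section \<open>Tensor, symmetric and enveloping superalgebra\<close>

text \<open>
  \<open>T(g)\<close> is the direct sum of all \<open>g \<otimes>\<^sub>K \<dots> \<otimes>\<^sub>K g\<close> (\<open>n\<close> factors, \<open>n \<ge> 0\<close>). In the free abelian
  group on pairs of a word in \<open>g\<close> and a scalar, the pair \<open>([X\<^sub>1, \<dots>, X\<^sub>n], \<alpha>)\<close> stands for
  \<open>(X\<^sub>1 \<otimes> \<dots> \<otimes> X\<^sub>n) \<alpha>\<close>; the empty word accounts for the summand \<open>K\<close>. In a product, the
  scalar of the left factor is moved into the first letter of the right factor.
\<close>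

fun word_mult ::
  "('k, 'm) graded_ring_scheme \<Rightarrow> ('g, 'k, 'n) smodule_scheme
    \<Rightarrow> 'g list \<times> 'k \<Rightarrow> 'g list \<times> 'k \<Rightarrow> 'g list \<times> 'k" where
  "word_mult K g (u, \<alpha>) ([], \<gamma>) = (u, \<alpha> \<otimes>\<^bsub>K\<^esub> \<gamma>)"
| "word_mult K g (u, \<alpha>) (Y # v, \<gamma>) = (u @ lscale K g \<alpha> Y # v, \<gamma>)"

definition free_words ::
  "('k, 'm) graded_ring_scheme \<Rightarrow> ('g, 'k, 'n) smodule_scheme
    \<Rightarrow> ('g list \<times> 'k \<Rightarrow>\<^sub>0 int, 'k) smodule" where
  "free_words K g =
     \<lparr>carrier = carrier (free_Abelian_group (lists (carrier g) \<times> carrier K)),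
      monoid.mult = (\<lambda>s t. frag_extend (\<lambda>p. frag_extend (\<lambda>q. frag_of (word_mult K g p q)) t) s),
      one = frag_of ([], \<one>\<^bsub>K\<^esub>),
      ring.zero = 0,
      add = (+),
      hpart = (\<lambda>i. carrier (free_Abelian_group
                 {(u, \<alpha>). \<exists>ps k. list_all2 (\<lambda>p X. X \<in> hpart g p) ps u \<and>
                                 \<alpha> \<in> hpart K k \<and> i = sum_list ps + k})),
      rscale = (\<lambda>t \<gamma>. frag_extend (\<lambda>(u, \<alpha>). frag_of (u, \<alpha> \<otimes>\<^bsub>K\<^esub> \<gamma>)) t)\<rparr>"

definition word_rels ::
  "('k, 'm) graded_ring_scheme \<Rightarrow> ('g, 'k, 'n) smodule_scheme \<Rightarrow> ('g list \<times> 'k \<Rightarrow>\<^sub>0 int) set" where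
  "word_rels K g =
     {frag_of (u, \<alpha> \<oplus>\<^bsub>K\<^esub> \<gamma>) - frag_of (u, \<alpha>) - frag_of (u, \<gamma>) | u \<alpha> \<gamma>.
        u \<in> lists (carrier g) \<and> \<alpha> \<in> carrier K \<and> \<gamma> \<in> carrier K} \<union>
     {frag_of (u @ (X \<oplus>\<^bsub>g\<^esub> Y) # v, \<alpha>) - frag_of (u @ X # v, \<alpha>) - frag_of (u @ Y # v, \<alpha>)
        | u v X Y \<alpha>. u \<in> lists (carrier g) \<and> v \<in> lists (carrier g) \<and>
                     X \<in> carrier g \<and> Y \<in> carrier g \<and> \<alpha> \<in> carrier K} \<union>
     {frag_of (u @ X \<bullet>\<^bsub>g\<^esub> \<gamma> # Y # v, \<alpha>) - frag_of (u @ X # lscale K g \<gamma> Y # v, \<alpha>)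
        | u v X Y \<alpha> \<gamma>. u \<in> lists (carrier g) \<and> v \<in> lists (carrier g) \<and>
                       X \<in> carrier g \<and> Y \<in> carrier g \<and> \<alpha> \<in> carrier K \<and> \<gamma> \<in> carrier K} \<union>
     {frag_of (u @ [X \<bullet>\<^bsub>g\<^esub> \<gamma>], \<alpha>) - frag_of (u @ [X], \<gamma> \<otimes>\<^bsub>K\<^esub> \<alpha>) | u X \<alpha> \<gamma>.
        u \<in> lists (carrier g) \<and> X \<in> carrier g \<and> \<alpha> \<in> carrier K \<and> \<gamma> \<in> carrier K}"

definition word_null ::
  "('k, 'm) graded_ring_scheme \<Rightarrow> ('g, 'k, 'n) smodule_scheme \<Rightarrow> ('g list \<times> 'k \<Rightarrow>\<^sub>0 int) set" where
  "word_null K g = generate (add_monoid (free_words K g)) (word_rels K g)"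

type_synonym ('g, 'k) tens = "('g list \<times> 'k \<Rightarrow>\<^sub>0 int) set"

definition tensor_alg ::
  "('k, 'm) graded_ring_scheme \<Rightarrow> ('g, 'k, 'n) smodule_scheme
    \<Rightarrow> (('g, 'k) tens, 'k) smodule" where
  "tensor_alg K g = squot (free_words K g) (word_null K g)"

definition tgen ::
  "('k, 'm) graded_ring_scheme \<Rightarrow> ('g, 'k, 'n) smodule_scheme \<Rightarrow> 'g \<Rightarrow> ('g, 'k) tens" where
  "tgen K g X = word_null K g +>\<^bsub>free_words K g\<^esub> frag_of ([X], \<one>\<^bsub>K\<^esub>)"

definition sym_ideal ::
  "('k, 'm) graded_ring_scheme \<Rightarrow> ('g, 'k, 'n) smodule_scheme \<Rightarrow> ('g, 'k) tens set" where
  "sym_ideal K g =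
    (let T = tensor_alg K g; \<iota> = tgen K g in
     Idl\<^bsub>T\<^esub> ({\<iota> v \<otimes>\<^bsub>T\<^esub> \<iota> w \<ominus>\<^bsub>T\<^esub> sg T (i * j) (\<iota> w \<otimes>\<^bsub>T\<^esub> \<iota> v) | v w i j.
                 v \<in> hpart g i \<and> w \<in> hpart g j} \<union>
              {\<iota> u \<otimes>\<^bsub>T\<^esub> \<iota> u | u. u \<in> hpart g 1}))"

definition Sym ::
  "('k, 'm) graded_ring_scheme \<Rightarrow> ('g, 'k, 'n) smodule_scheme
    \<Rightarrow> (('g, 'k) tens set, 'k) smodule" where
  "Sym K g = squot (tensor_alg K g) (sym_ideal K g)"

definition sgen ::
  "('k, 'm) graded_ring_scheme \<Rightarrow> ('g, 'k, 'n) smodule_scheme \<Rightarrow> 'g \<Rightarrow> ('g, 'k) tens set" where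
  "sgen K g X = sym_ideal K g +>\<^bsub>tensor_alg K g\<^esub> tgen K g X"

definition env_ideal ::
  "('k, 'm) graded_ring_scheme \<Rightarrow> ('g, 'k, 'n) lie_super_scheme \<Rightarrow> ('g, 'k) tens set" where
  "env_ideal K g =
    (let T = tensor_alg K g; \<iota> = tgen K g in
     Idl\<^bsub>T\<^esub> {\<iota> a \<otimes>\<^bsub>T\<^esub> \<iota> b \<ominus>\<^bsub>T\<^esub> sg T (i * j) (\<iota> b \<otimes>\<^bsub>T\<^esub> \<iota> a) \<ominus>\<^bsub>T\<^esub> \<iota> (bracket g a b) | a b i j.
                a \<in> hpart g i \<and> b \<in> hpart g j})"

definition Env ::
  "('k, 'm) graded_ring_scheme \<Rightarrow> ('g, 'k, 'n) lie_super_scheme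
    \<Rightarrow> (('g, 'k) tens set, 'k) smodule" where
  "Env K g = squot (tensor_alg K g) (env_ideal K g)"

text \<open>The canonical map \<open>j : g \<rightarrow> U(g)\<close>\<close>

definition ugen ::
  "('k, 'm) graded_ring_scheme \<Rightarrow> ('g, 'k, 'n) lie_super_scheme \<Rightarrow> 'g \<Rightarrow> ('g, 'k) tens set" where
  "ugen K g X = env_ideal K g +>\<^bsub>tensor_alg K g\<^esub> tgen K g X"

definition sym_comult ::
  "('k, 'm) graded_ring_scheme \<Rightarrow> ('g, 'k, 'n) smodule_scheme
    \<Rightarrow> ('g, 'k) tens set \<Rightarrow> (('g, 'k) tens set \<times> ('g, 'k) tens set \<Rightarrow>\<^sub>0 int) set" where
  "sym_comult K g =
    (let S = Sym K g; SS = tensor K S S in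
     THE D. D \<in> superalg_hom K S SS \<and>
            (\<forall>X \<in> carrier g. D (sgen K g X) =
               pure K S S (sgen K g X) \<one>\<^bsub>S\<^esub> \<oplus>\<^bsub>SS\<^esub> pure K S S \<one>\<^bsub>S\<^esub> (sgen K g X)))"

definition env_comult ::
  "('k, 'm) graded_ring_scheme \<Rightarrow> ('g, 'k, 'n) lie_super_scheme
    \<Rightarrow> ('g, 'k) tens set \<Rightarrow> (('g, 'k) tens set \<times> ('g, 'k) tens set \<Rightarrow>\<^sub>0 int) set" where
  "env_comult K g =
    (let U = Env K g; UU = tensor K U U in
     THE D. D \<in> superalg_hom K U UU \<and>
            (\<forall>a \<in> carrier g. D (ugen K g a) =
               pure K U U \<one>\<^bsub>U\<^esub> (ugen K g a) \<oplus>\<^bsub>UU\<^esub> pure K U U (ugen K g a) \<one>\<^bsub>U\<^esub>))"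

definition coderivation ::
  "('k, 'm) graded_ring_scheme \<Rightarrow> ('a, 'k, 'n) smodule_scheme
    \<Rightarrow> ('a \<Rightarrow> ('a \<times> 'a \<Rightarrow>\<^sub>0 int) set) \<Rightarrow> ('a \<Rightarrow> 'a) \<Rightarrow> bool" where
  "coderivation K A \<Delta> D \<longleftrightarrow>
     D \<in> carrier (sHom K A A) \<and>
     (\<forall>x \<in> carrier A.
        \<Delta> (D x) = tensor_map K A A A A D (\<lambda>y \<in> carrier A. y) (\<Delta> x)
                    \<oplus>\<^bsub>tensor K A A\<^esub> tensor_map K A A A A (\<lambda>y \<in> carrier A. y) D (\<Delta> x))"


section \<open>The operators and the symbol map\<close>

definition even_units :: "('k, 'm) graded_ring_scheme \<Rightarrow> 'k set" where
  "even_units K = {c \<in> hpart K 0. \<exists>d \<in> hpart K 0. c \<otimes>\<^bsub>K\<^esub> d = \<one>\<^bsub>K\<^esub> \<and> d \<otimes>\<^bsub>K\<^esub> c = \<one>\<^bsub>K\<^esub>}"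

text \<open>The image in \<open>K\<close> of a rational number whose denominator is invertible in \<open>K\<close>.\<close>

definition rat_in :: "('k, 'm) ring_scheme \<Rightarrow> rat \<Rightarrow> 'k" where
  "rat_in K q = [fst (quotient_of q)] \<cdot>\<^bsub>K\<^esub> \<one>\<^bsub>K\<^esub>
                  \<otimes>\<^bsub>K\<^esub> inv\<^bsub>K\<^esub> ([snd (quotient_of q)] \<cdot>\<^bsub>K\<^esub> \<one>\<^bsub>K\<^esub>)"

text \<open>
  The coefficient of \<open>t\<^sup>n\<close> in \<open>\<phi>\<^sub>c\<close>, using \<open>\<phi>\<^sub>c(t) = c \<phi>\<^sub>1(t/c)\<close>. The series is truncated
  modulo \<open>t\<^sup>N\<close>, and \<open>N = \<infinity>\<close> means no truncation.
\<close>

definition phi_coeff :: "('k, 'm) ring_scheme \<Rightarrow> enat \<Rightarrow> 'k \<Rightarrow> nat \<Rightarrow> 'k" where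
  "phi_coeff K N c n =
     (if N \<le> enat n then \<zero>\<^bsub>K\<^esub>
      else if c = \<zero>\<^bsub>K\<^esub> then (if n = 1 then \<ominus>\<^bsub>K\<^esub> \<one>\<^bsub>K\<^esub> else \<zero>\<^bsub>K\<^esub>)
      else rat_in K (fps_nth (fps_X / (fps_exp 1 - 1)) n) \<otimes>\<^bsub>K\<^esub> (c \<otimes>\<^bsub>K\<^esub> (inv\<^bsub>K\<^esub> c) [^]\<^bsub>K\<^esub> n))"

text \<open>
  The exponent of the Koszul sign of \<open>X\<^sub>s\<^sub>(\<^sub>1\<^sub>) \<dots> X\<^sub>s\<^sub>(\<^sub>n\<^sub>)\<close>, where \<open>ps\<close> is the list of the parities of
  \<open>X\<^sub>1, \<dots>, X\<^sub>n\<close>: the number of pairs of odd factors whose order is reversed.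
\<close>

definition koszul :: "bit list \<Rightarrow> (nat \<Rightarrow> nat) \<Rightarrow> bit" where
  "koszul ps s = (\<Sum>(i, j) \<in> {(i, j). i < j \<and> j < length ps \<and> s j < s i}. ps ! s i * ps ! s j)"

text \<open>
  \<open>\<phi>\<^sub>c\<^sup>a \<in> Hom(S(g), g)\<close>. The empty list gives \<open>\<phi>\<^sub>c\<^sup>a(1) = c\<^sub>0 a\<close>. Arbitrary \<open>a\<close> are split into
  homogeneous components.
\<close>

definition phi ::
  "('k, 'm) graded_ring_scheme \<Rightarrow> ('g, 'k, 'n) lie_super_scheme \<Rightarrow> enat \<Rightarrow> 'k \<Rightarrow> 'g
    \<Rightarrow> ('g, 'k) tens set \<Rightarrow> 'g" where
  "phi K g N c a =
    (let S = Sym K g in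
     THE f. f \<in> carrier (sHom K S g) \<and>
       (\<forall>ps Xs. list_all2 (\<lambda>p X. X \<in> hpart g p) ps Xs \<longrightarrow>
          f (foldr (\<otimes>\<^bsub>S\<^esub>) (map (sgen K g) Xs) \<one>\<^bsub>S\<^esub>) =
            (\<Oplus>\<^bsub>g\<^esub>i\<in>{0, 1}. sg g (i * sum_list ps)
               ((\<Oplus>\<^bsub>g\<^esub>s\<in>{s. s permutes {..<length Xs}}.
                   sg g (koszul ps s) (ad_list g (permute_list s Xs) (hcomp g i a)))
                 \<bullet>\<^bsub>g\<^esub> phi_coeff K N c (length Xs)))))"

text \<open>
  \<open>\<Phi>\<^sub>c\<^sup>a = Mult \<circ> (id \<otimes> \<phi>\<^sub>c\<^sup>a) \<circ> \<Delta>\<close>, with values of \<open>\<phi>\<^sub>c\<^sup>a\<close> regarded as elements of \<open>S(g)\<close>.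
\<close>

definition Phi ::
  "('k, 'm) graded_ring_scheme \<Rightarrow> ('g, 'k, 'n) lie_super_scheme \<Rightarrow> enat \<Rightarrow> 'k \<Rightarrow> 'g
    \<Rightarrow> ('g, 'k) tens set \<Rightarrow> ('g, 'k) tens set" where
  "Phi K g N c a =
    (let S = Sym K g in
     compose (carrier S) (tensor_lift K S S S (\<lambda>x y. x \<otimes>\<^bsub>S\<^esub> y))
       (compose (carrier S)
         (tensor_map K S S S S (\<lambda>x \<in> carrier S. x)
           (compose (carrier S) (sgen K g) (phi K g N c a)))
         (sym_comult K g)))"

definition Phi_env ::
  "('k, 'm) graded_ring_scheme \<Rightarrow> ('g, 'k, 'n) lie_super_scheme \<Rightarrow> enat
    \<Rightarrow> ('g, 'k) tens set \<Rightarrow> ('g, 'k) tens set \<Rightarrow> ('g, 'k) tens set" where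
  "Phi_env K g N =
     (THE F. F \<in> superalg_hom K (Env K g) (sEnd K (Sym K g)) \<and>
             (\<forall>a \<in> carrier g. F (ugen K g a) = Phi K g N \<one>\<^bsub>K\<^esub> a))"

definition symbol_map ::
  "('k, 'm) graded_ring_scheme \<Rightarrow> ('g, 'k, 'n) lie_super_scheme \<Rightarrow> enat
    \<Rightarrow> ('g, 'k) tens set \<Rightarrow> ('g, 'k) tens set" where
  "symbol_map K g N = (\<lambda>u \<in> carrier (Env K g). Phi_env K g N u \<one>\<^bsub>Sym K g\<^esub>)"

definition symmetrization ::
  "('k, 'm) graded_ring_scheme \<Rightarrow> ('g, 'k, 'n) lie_super_scheme \<Rightarrow> enat
    \<Rightarrow> ('g, 'k) tens set \<Rightarrow> ('g, 'k) tens set" where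
  "symmetrization K g N =
     (\<lambda>x \<in> carrier (Sym K g). inv_into (carrier (Env K g)) (symbol_map K g N) x)"

end

theory Submission
  imports Defs "HOL-Computational_Algebra.Polynomial" "HOL-Combinatorics.Multiset_Permutations"
begin

text \<open>
  All maps \<open>S(g) \<rightarrow> g\<close> that occur are built from the projection \<open>x\<close> onto \<open>g\<close> and the constants
  \<open>\<epsilon>(\<cdot>) a\<close> by the bracket \<open>{f, h} = [\<cdot>, \<cdot>] \<circ> (f \<otimes> h) \<circ> \<Delta>\<close>: the part of degree \<open>n\<close> of \<open>\<phi>\<^sub>c\<^sup>a\<close> is \<open>c\<^sub>n \<psi>\<^sub>n\<close>
  with \<open>\<psi>\<^sub>0 = \<epsilon>(\<cdot>) a\<close> and \<open>\<psi>\<^sub>n\<^sub>+\<^sub>1 = {x, \<psi>\<^sub>n}\<close>. Since \<open>PH \<psi> = Mult \<circ> (id \<otimes> \<psi>) \<circ> \<Delta>\<close> is a derivation of such brackets,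
  the commutator of \<open>\<Phi>\<^sup>a\<close> and \<open>\<Phi>\<^sup>b\<close> is again of this form, with coefficients given by polynomials in \<open>u\<close>
  that the functional equation of \<open>t / (e\<^sup>t - 1)\<close> identifies with those of \<open>\<Phi>\<close> of the bracket of \<open>a\<close> and \<open>b\<close>.
  Hence the symbol map exists. It is bijective because \<open>\<Phi>\<^sup>a y = a y\<close> modulo shorter words and because
  the relations of \<open>S(g)\<close> hold in \<open>U(g)\<close> modulo shorter words. Finally \<open>PH \<psi>\<close> satisfies
  \<open>\<Delta> \<circ> PH \<psi> = (PH \<psi> \<otimes> id + id \<otimes> PH \<psi>) \<circ> \<Delta>\<close>, which gives \<open>\<Delta> \<circ> \<sigma> = (\<sigma> \<otimes> \<sigma>) \<circ> \<Delta>'\<close> by induction on words,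
  and coderivations are transported along \<open>\<beta>\<close>.
\<close>

\<comment> \<open>The base ring is arbitrary, so no basis of g is at hand, and S(g) and U(g) are not
  known beforehand to be free, or even to be direct sums of their parity parts. Every identity is
  therefore proved by induction on words. A letter X in front of a word turns a map f into y |-> f
  (X y), and \<open>conv_gen\<close> is a Leibniz rule for convolutions in these shifted maps.
  Coassociativity and cocommutativity are not stated on their own: they are absorbed into inductions
  in which all maps and their parities are generalised. The bracket of a under i and b under j
  applications of {x, .} behaves like a monomial s^i t^j, on which {x, .} acts as multiplication by
  s + t. In a fixed total degree only u = s / t matters, and {x, .} becomes multiplication by u + 1.
  The invertibility of 2 enters twice: the parity automorphism separates even from odd elements, and
  the square of an odd v in U(g) is half of [v, v]. Rational coefficients need denominators that are
  units of K, so the functional equation is used only as far as the coefficients exist; beyond that,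
  nilpotency makes the brackets vanish.\<close>
syntax (input) "_index" :: "logic => index" (\<open>\<^sub>_\<close> [1000] 1000)

abbreviation (input) elt (infix \<open>\<in>.\<close> 50) where "x \<in>. A \<equiv> x \<in> carrier A"
abbreviation (input) fof where "fof \<equiv> frag_of"

lemmas (in abelian_group) ag = abelian_group_axioms
lemmas (in supermodule) smx = supermodule_axioms

section \<open>Graded groups and supermodules\<close>

declare add_bit_eq_xor [simp del] mult_bit_eq_and [simp del]

text \<open>A predicate on bare functions, constrained on carriers only, so that composites, sums
  and signs of additive maps can be written as lambda terms without restricting them.\<close>

definition amap :: "('a, 'm) ring_scheme => ('b, 'n) ring_scheme => ('a => 'b) => bool" where
 "amap M N f \<longleftrightarrow> f \<in> carrier M \<rightarrow> carrier N \<and>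
   (\<forall>x \<in> carrier M. \<forall>y \<in> carrier M. f (x \<oplus>\<^sub>M y) = f x \<oplus>\<^sub>N f y)"

lemma amapI:
 "[|!!x. x \<in>. M ==> f x \<in>. N;
  !!x y. [|x \<in>. M; y \<in>. M|] ==> f (x \<oplus>\<^sub>M y) = f x \<oplus>\<^sub>N f y|] ==> amap M N f"
 by (simp add: amap_def)

lemma amapc: "[|amap M N f; x \<in>. M|] ==> f x \<in>. N"
 by (auto simp: amap_def)

lemma ama: "[|amap M N f; x \<in>. M; y \<in>. M|] ==> f (x \<oplus>\<^sub>M y) = f x \<oplus>\<^sub>N f y"
 by (simp add: amap_def)

lemma amap_hom: "[|abelian_group M; abelian_group N; amap M N f|] ==> abelian_group_hom M N f"
 by (intro abelian_group_homI group_hom.intro group_hom_axioms.intro)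
   (auto simp: amap_def hom_def abelian_group.a_group)

lemma amap_zero: "[|amap M N f; abelian_group M; abelian_group N|] ==> f \<zero>\<^sub>M = \<zero>\<^sub>N"
 by (rule abelian_group_hom.hom_zero[OF amap_hom])

lemma amap_neg: "[|amap M N f; abelian_group M; abelian_group N; x \<in>. M|]
  ==> f (\<ominus>\<^sub>M x) = \<ominus>\<^sub>N f x"
 by (rule abelian_group_hom.hom_a_inv[OF amap_hom])

lemma amap_minus: "[|amap M N f; abelian_group M; abelian_group N; x \<in>. M; y \<in>. M|]
  ==> f (x \<ominus>\<^sub>M y) = f x \<ominus>\<^sub>N f y"
 by (simp add: a_minus_def ama amap_neg abelian_group.a_inv_closed)

lemma amap_sg: "[|amap M N f; abelian_group M; abelian_group N; x \<in>. M|]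
  ==> f (sg M i x) = sg N i (f x)"
 by (simp add: sg_def amap_neg)

lemma amc: "[|amap M N f; amap N P h|] ==> amap M P (%x. h (f x))"
 by (auto simp: amap_def Pi_iff)

lemma amap_id: "amap M M (%x. x)"
 by (simp add: amap_def)

lemma amap_cong: "(!!x. x \<in>. M ==> f x = h x) ==> abelian_monoid M ==> amap M N f \<longleftrightarrow> amap M N h"
 by (auto simp: amap_def Pi_iff abelian_monoid.a_closed)

lemma amap_plus:
 assumes "abelian_group N" "amap M N f" "amap M N h"
 shows "amap M N (%x. f x \<oplus>\<^sub>N h x)"
proof -
 interpret N: abelian_group N by fact
 show ?thesis using assms(2,3) by (auto simp: amap_def Pi_iff N.a_ac)
qed

lemma amap_const0: "abelian_group N ==> amap M N (%x. \<zero>\<^sub>N)"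
 by (auto simp: amap_def abelian_group.axioms abelian_monoid.zero_closed abelian_monoid.l_zero)

section \<open>Parities and signs\<close>

lemma bit_add_self [simp]: "(i::bit) + i = 0"
 by (cases i) auto

lemma bit_mult_self [simp]: "(i::bit) * i = i"
 by (cases i) auto

lemma bit_add_self_left [simp]: "(i::bit) + (i + j) = j"
 by (cases i; cases j) auto

lemma bit_eq_add1_iff [simp]: "(i::bit) = i + 1 \<longleftrightarrow> False" "(i + 1 = (i::bit)) \<longleftrightarrow> False"
 by (cases i; simp)+

lemmas bit_ac = add.assoc[where 'a=bit] add.commute[where 'a=bit] add.left_commute[where 'a=bit]
 mult.assoc[where 'a=bit] mult.commute[where 'a=bit] mult.left_commute[where 'a=bit]
 distrib_left[where 'a=bit] distrib_right[where 'a=bit]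

lemma sg_0 [simp]: "sg M 0 x = x"
 by (simp add: sg_def)

lemma sg_1 [simp]: "sg M 1 x = \<ominus>\<^sub>M x"
 by (simp add: sg_def)

context abelian_group begin

lemma sg_closed [simp]: "x \<in>. G ==> sg G i x \<in>. G"
 by (simp add: sg_def)

lemma sg_add: "[|x \<in>. G; y \<in>. G|] ==> sg G i (x \<oplus> y) = sg G i x \<oplus> sg G i y"
 by (cases i) (simp_all add: minus_add)

lemma sg_sg: "x \<in>. G ==> sg G i (sg G j x) = sg G (i + j) x"
 by (cases i; cases j) simp_all

lemma sg_zero [simp]: "sg G i \<zero> = \<zero>"
 by (cases i) simp_all

lemma sg_neg: "x \<in>. G ==> sg G i (\<ominus> x) = \<ominus> sg G i x"
 by (cases i) simp_all

lemma amap_sgm: "amap G G (sg G i)"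
 by (auto intro!: amapI simp: sg_add)

lemma finsum_bit: "[|f 0 \<in>. G; f 1 \<in>. G|] ==> (\<Oplus>i\<in>{0, 1::bit}. f i) = f 0 \<oplus> f 1"
 by (subst finsum_insert) auto

lemma minus_zero_eq: "[|x \<ominus> y = \<zero>; x \<in>. G; y \<in>. G|] ==> x = y"
 by (metis a_inv_closed a_minus_def add.inv_equality minus_minus)

lemma add4: "[|a \<in>. G; b \<in>. G; c \<in>. G; d \<in>. G|]
  ==> (a \<oplus> b) \<oplus> (c \<oplus> d) = (a \<oplus> c) \<oplus> (b \<oplus> d)"
 by (simp add: a_ac)

end

lemma additive_subgroup_closed:
 assumes "additive_subgroup H G"
 shows "x \<in> H ==> x \<in>. G" "[|x \<in> H; y \<in> H|] ==> x \<oplus>\<^sub>G y \<in> H" "\<zero>\<^sub>G \<in> H"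
 using additive_subgroup.a_Hcarr[OF assms] additive_subgroup.a_closed[OF assms]
  additive_subgroup.zero_closed[OF assms] by auto

lemma additive_subgroup_neg:
 assumes "additive_subgroup H G" "abelian_group G" "x \<in> H"
 shows "\<ominus>\<^sub>G x \<in> H"
proof -
 interpret abelian_group G by fact
 show ?thesis
  using additive_subgroup.a_subgroup[OF assms(1)] assms(3) subgroup.m_inv_closed
  by (metis a_inv_def)
qed

lemma additive_subgroupI':
 assumes "abelian_group G" "H <= carrier G" "\<zero>\<^sub>G \<in> H" "!!x y. [|x \<in> H; y \<in> H|] ==> x \<oplus>\<^sub>G y \<in> H"
  "!!x. x \<in> H ==> \<ominus>\<^sub>G x \<in> H"
 shows "additive_subgroup H G"
proof -
 interpret abelian_group G by fact
 show ?thesis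
  using assms(2-5)
  by (intro additive_subgroup.intro subgroup.intro) (auto simp: a_inv_def)
qed

section \<open>Homogeneous components\<close>

locale graded = abelian_group M for M :: "('a, 'm) graded_ring_scheme" (structure) +
 assumes grd: "is_graded M"
begin

lemma hp_sub: "additive_subgroup (hpart M i) M"
 using grd by (auto simp: is_graded_def)

lemma hpc [intro]: "x \<in> hpart M i ==> x \<in>. M"
 using additive_subgroup_closed(1)[OF hp_sub] .

lemma hp_add: "[|x \<in> hpart M i; y \<in> hpart M i|] ==> x \<oplus> y \<in> hpart M i"
 using additive_subgroup_closed(2)[OF hp_sub] .

lemma hp_zero [simp]: "\<zero> \<in> hpart M i"
 using additive_subgroup_closed(3)[OF hp_sub] .

lemma hp_neg: "x \<in> hpart M i ==> \<ominus> x \<in> hpart M i"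
 using additive_subgroup_neg[OF hp_sub ag] .

lemma hp_sg: "x \<in> hpart M i ==> sg M j x \<in> hpart M i"
 by (simp add: sg_def hp_neg)

lemma hp_inter: "[|x \<in> hpart M 0; x \<in> hpart M 1|] ==> x = \<zero>"
 using grd by (auto simp: is_graded_def)

lemma hp_inter': "[|x \<in> hpart M i; x \<in> hpart M j; i \<noteq> j|] ==> x = \<zero>"
 by (cases i; cases j) (auto intro: hp_inter)

lemma decomp: assumes "x \<in>. M" shows "\<exists>y\<in>hpart M i. \<exists>z\<in>hpart M (i + 1). x = y \<oplus> z"
proof -
 have "x \<in> hpart M 0 <+> hpart M 1" using grd assms by (simp add: is_graded_def)
 then obtain a b where ab: "a \<in> hpart M 0" "b \<in> hpart M 1" "x = a \<oplus> b"
  by (auto simp: set_add_def')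
 show ?thesis
 proof (cases "i = 0")
  case True then show ?thesis using ab by auto
 next
  case False then have "i = 1" by simp
  then show ?thesis
   using ab by (intro bexI[of _ b] bexI[of _ a]) (auto simp: a_comm hpc)
 qed
qed

text \<open>Two decompositions of one element differ by something both even and odd, hence zero.
  This resolves the description operator in \<open>hcomp\<close>.\<close>

lemma hc_eq: assumes "y \<in> hpart M i" "z \<in> hpart M (i + 1)"
 shows "hcomp M i (y \<oplus> z) = y"
 unfolding hcomp_def
proof (rule the_equality)
 show "y \<in> hpart M i \<and> (\<exists>z'\<in>hpart M (i + 1). y \<oplus> z = y \<oplus> z')" using assms by auto
next
 fix y' assume "y' \<in> hpart M i \<and> (\<exists>z'\<in>hpart M (i + 1). y \<oplus> z = y' \<oplus> z')"
 then obtain z' where a: "y' \<in> hpart M i" "z' \<in> hpart M (i + 1)" "y \<oplus> z = y' \<oplus> z'" by auto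
 have c: "y \<in>. M" "z \<in>. M" "y' \<in>. M" "z' \<in>. M"
  using assms a by (auto intro: hpc)
 have "y' \<ominus> y = z \<ominus> z'" using a(3) c
  by (metis (no_types, lifting) a_assoc a_comm a_inv_closed a_minus_def minus_closed r_neg1)
 moreover have "y' \<ominus> y \<in> hpart M i" "z \<ominus> z' \<in> hpart M (i + 1)"
  unfolding a_minus_def by (intro hp_add hp_neg assms a(1,2))+
 ultimately have "y' \<ominus> y = \<zero>" using hp_inter'[of "y' \<ominus> y" i "i + 1"] by auto
 then show "y' = y" using c using minus_zero_eq by blast
qed

lemma hc_in: "x \<in>. M ==> hcomp M i x \<in> hpart M i"
 using decomp[of x i] hc_eq[of _ i] by auto

lemma hc_closed [simp]: "x \<in>. M ==> hcomp M i x \<in>. M"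
 using hc_in by blast

lemma hc_sum: "x \<in>. M ==> hcomp M 0 x \<oplus> hcomp M 1 x = x"
proof -
 assume "x \<in>. M"
 from decomp[OF this, of 0] obtain y z where h: "y \<in> hpart M 0" "z \<in> hpart M 1" "x = y \<oplus> z" by auto
 have "hcomp M 0 x = y" using hc_eq[of y 0 z] h by simp
 moreover have "hcomp M 1 x = z" using hc_eq[of z 1 y] h by (simp add: a_comm hpc)
 ultimately show ?thesis using h by simp
qed

lemma hc_homog: "x \<in> hpart M j ==> hcomp M i x = (if i = j then x else \<zero>)"
proof -
 assume a: "x \<in> hpart M j"
 then have c: "x \<in>. M" by auto
 show ?thesis
 proof (cases "i = j")
  case True then show ?thesis using hc_eq[of x i \<zero>] a c by simp
 next
  case False then have "j = i + 1" by (cases i; cases j) auto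
  then show ?thesis using hc_eq[of \<zero> i x] a c by simp
 qed
qed

lemma hc_add: assumes "x \<in>. M" "y \<in>. M"
 shows "hcomp M i (x \<oplus> y) = hcomp M i x \<oplus> hcomp M i y"
proof -
 from decomp[OF assms(1), of i] obtain a b where x: "a \<in> hpart M i" "b \<in> hpart M (i+1)" "x = a \<oplus> b" by auto
 from decomp[OF assms(2), of i] obtain c d where y: "c \<in> hpart M i" "d \<in> hpart M (i+1)" "y = c \<oplus> d" by auto
 have "x \<oplus> y = (a \<oplus> c) \<oplus> (b \<oplus> d)" using x y by (auto simp: add4 hpc)
 then show ?thesis using x y hc_eq[of "a \<oplus> c" i "b \<oplus> d"] by (auto simp: hc_eq hp_add)
qed

lemma hc_amap: "amap M M (hcomp M i)"
 by (auto intro!: amapI simp: hc_add)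

lemma homog_induct [consumes 1, case_names homog add]:
 assumes "x \<in>. M" "!!i x. x \<in> hpart M i ==> P x"
  "!!x y. [|x \<in>. M; y \<in>. M; P x; P y|] ==> P (x \<oplus> y)"
 shows "P x"
proof -
 have "P (hcomp M 0 x \<oplus> hcomp M 1 x)"
  by (intro assms(3) assms(2)[OF hc_in] hc_closed assms(1))
 then show ?thesis using hc_sum assms(1) by simp
qed

text \<open>The standard device for sign identities: they are checked on homogeneous elements, where
  signs are explicit, and extended by additivity, one argument at a time.\<close>

lemma amap_eqI:
 assumes "amap M N f" "amap M N h" "!!i x. x \<in> hpart M i ==> f x = h x" "x \<in>. M"
 shows "f x = h x"
 using assms(4) by (induction rule: homog_induct) (auto simp: assms(1-3) ama[OF assms(1)] ama[OF assms(2)])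

text \<open>The Koszul sign (-1)^(d p(x)) x, extended additively to inhomogeneous x. It turns the
  passage of a map of parity d over x into an additive map that can be composed like any
  other.\<close>

definition tw :: "bit => 'a => 'a" where "tw d x = hcomp M 0 x \<oplus> sg M d (hcomp M 1 x)"

lemma tw_amap: "amap M M (tw d)"
 unfolding tw_def by (intro amap_plus hc_amap amc[OF hc_amap amap_sgm] ag)

lemma tw_closed [simp]: "x \<in>. M ==> tw d x \<in>. M"
 by (rule amapc[OF tw_amap])

lemma tw_homog: "x \<in> hpart M j ==> tw d x = sg M (d * j) x"
 by (cases j) (auto simp: tw_def hc_homog hpc)

lemma tw_0 [simp]: "x \<in>. M ==> tw 0 x = x"
 by (simp add: tw_def hc_sum)

lemma tw_tw: assumes "x \<in>. M" shows "tw d (tw e x) = tw (d + e) x"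
proof (rule amap_eqI[OF amc[OF tw_amap tw_amap] tw_amap _ assms])
 fix i x assume "x \<in> hpart M i"
 then show "tw d (tw e x) = tw (d + e) x"
  by (simp add: tw_homog[of x i] tw_homog[OF hp_sg, of x i] sg_sg hpc distrib_right)
qed

lemma tw_hp: "x \<in> hpart M j ==> tw d x \<in> hpart M j"
 by (simp add: tw_homog hp_sg)

end

sublocale superring < KG: graded K
 by unfold_locales (rule K_graded)

sublocale supermodule < MG: graded M
 by unfold_locales (rule M_graded)

section \<open>The left scalar action of a supermodule\<close>

context supermodule begin

lemma scale_amap1: "al \<in>. K ==> amap M M (%x. x \<bullet>\<^sub>M al)"
 by (auto intro!: amapI simp: scale_closed scale_add_left)

lemma scale_amap2: "x \<in>. M ==> amap K M (%al. x \<bullet>\<^sub>M al)"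
 by (auto intro!: amapI simp: scale_closed scale_add_right)

lemma scale_zero1 [simp]: "al \<in>. K ==> \<zero>\<^sub>M \<bullet>\<^sub>M al = \<zero>\<^sub>M"
 by (rule amap_zero[OF scale_amap1]) (auto intro: M.ag)

lemma scale_zero2 [simp]: "x \<in>. M ==> x \<bullet>\<^sub>M \<zero>\<^sub>K = \<zero>\<^sub>M"
 by (rule amap_zero[OF scale_amap2]) (auto intro: M.ag ag)

lemma scale_sg1: "[|x \<in>. M; al \<in>. K|] ==> sg M i x \<bullet>\<^sub>M al = sg M i (x \<bullet>\<^sub>M al)"
 using amap_sg[OF scale_amap1] M.ag by auto

lemma scale_sg2: "[|x \<in>. M; al \<in>. K|] ==> x \<bullet>\<^sub>M sg K i al = sg M i (x \<bullet>\<^sub>M al)"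
 using amap_sg[OF scale_amap2] M.ag ag by auto

lemma scale_neg1: "[|x \<in>. M; al \<in>. K|] ==> (\<ominus>\<^sub>M x) \<bullet>\<^sub>M al = \<ominus>\<^sub>M (x \<bullet>\<^sub>M al)"
 using scale_sg1[of x al 1] by simp

text \<open>The double sum is regrouped by the parity of the scalar: the even part acts as on the
  right, the odd part twists x first. Both arguments then visibly enter additively.\<close>

lemma lscale_alt: assumes "al \<in>. K" "x \<in>. M"
 shows "lscale K M al x = (x \<bullet>\<^sub>M hcomp K 0 al) \<oplus>\<^sub>M (MG.tw 1 x \<bullet>\<^sub>M hcomp K 1 al)"
proof -
 have [simp]: "hcomp K i al \<in>. K" "hcomp M i x \<in>. M" for i
  using assms by auto
 have "lscale K M al x = (hcomp M 0 x \<bullet>\<^sub>M hcomp K 0 al \<oplus>\<^sub>M hcomp M 1 x \<bullet>\<^sub>M hcomp K 0 al)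
  \<oplus>\<^sub>M (hcomp M 0 x \<bullet>\<^sub>M hcomp K 1 al \<oplus>\<^sub>M sg M 1 (hcomp M 1 x \<bullet>\<^sub>M hcomp K 1 al))"
  unfolding lscale_def by (simp add: M.finsum_bit scale_closed M.add4[of _ "hcomp M 0 x \<bullet>\<^sub>M hcomp K 1 al"])
 also have "hcomp M 0 x \<bullet>\<^sub>M hcomp K 0 al \<oplus>\<^sub>M hcomp M 1 x \<bullet>\<^sub>M hcomp K 0 al = x \<bullet>\<^sub>M hcomp K 0 al"
  using scale_add_left[of "hcomp M 0 x" "hcomp M 1 x" "hcomp K 0 al"] MG.hc_sum[OF assms(2)] by simp
 also have "hcomp M 0 x \<bullet>\<^sub>M hcomp K 1 al \<oplus>\<^sub>M sg M 1 (hcomp M 1 x \<bullet>\<^sub>M hcomp K 1 al)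
   = MG.tw 1 x \<bullet>\<^sub>M hcomp K 1 al"
  unfolding MG.tw_def by (simp add: scale_add_left scale_neg1)
 finally show ?thesis .
qed

lemma lscale_closed [simp]: "[|al \<in>. K; x \<in>. M|] ==> lscale K M al x \<in>. M"
 by (simp add: lscale_alt scale_closed)

lemma lscale_amap1: assumes "al \<in>. K" shows "amap M M (lscale K M al)"
proof (rule iffD1[OF amap_cong])
 show "amap M M (%x. (x \<bullet>\<^sub>M hcomp K 0 al) \<oplus>\<^sub>M (MG.tw 1 x \<bullet>\<^sub>M hcomp K 1 al))"
  using assms by (intro amap_plus scale_amap1 amc[OF MG.tw_amap scale_amap1] M.ag) auto
qed (use assms in \<open>auto simp: lscale_alt intro: M.abelian_monoid_axioms\<close>)

lemma lscale_amap2: assumes "x \<in>. M" shows "amap K M (%al. lscale K M al x)"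
proof (rule iffD1[OF amap_cong])
 show "amap K M (%al. (x \<bullet>\<^sub>M hcomp K 0 al) \<oplus>\<^sub>M (MG.tw 1 x \<bullet>\<^sub>M hcomp K 1 al))"
  using assms by (intro amap_plus amc[OF KG.hc_amap scale_amap2] M.ag) auto
qed (use assms in \<open>auto simp: lscale_alt intro: abelian_monoid_axioms\<close>)

lemma lscale_homog: "[|al \<in> hpart K i; x \<in>. M|] ==> lscale K M al x = MG.tw i x \<bullet>\<^sub>M al"
 by (cases i) (auto simp: lscale_alt KG.hpc KG.hc_homog scale_closed)

lemma lscale_homog2: "[|al \<in> hpart K i; x \<in> hpart M j|] ==> lscale K M al x = sg M (i * j) (x \<bullet>\<^sub>M al)"
 by (simp add: lscale_homog MG.hpc MG.tw_homog scale_sg1 KG.hpc)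

lemma lscale_hp: "[|al \<in> hpart K i; x \<in> hpart M j|] ==> lscale K M al x \<in> hpart M (i + j)"
 using scale_parity[of x j al i] by (simp add: lscale_homog2 MG.hp_sg add.commute)

lemma lscale_one [simp]: "x \<in>. M ==> lscale K M \<one>\<^sub>K x = x"
 by (simp add: lscale_homog[OF one_even] scale_one)

text \<open>For homogeneous a, y, c of parities i, j, k, moving a past y c costs (-1)^(i(j+k)). The
  factor (-1)^(ik) is used up by exchanging a and c inside K, which leaves the sign for a and y
  alone.\<close>

lemma lscale_scale: assumes "al \<in>. K" "ga \<in>. K" "x \<in>. M"
 shows "lscale K M al (x \<bullet>\<^sub>M ga) = lscale K M al x \<bullet>\<^sub>M ga"
proof (rule KG.amap_eqI[where x=al and N=M and f="%al. lscale K M al (x \<bullet>\<^sub>M ga)"])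
 show "amap K M (%al. lscale K M al (x \<bullet>\<^sub>M ga))" "amap K M (%al. lscale K M al x \<bullet>\<^sub>M ga)"
  using assms by (auto intro!: lscale_amap2 scale_closed amc[OF lscale_amap2 scale_amap1])
next
 fix i a assume a: "a \<in> hpart K i"
 show "lscale K M a (x \<bullet>\<^sub>M ga) = lscale K M a x \<bullet>\<^sub>M ga"
 proof (rule MG.amap_eqI[where x=x and N=M and f="%x. lscale K M a (x \<bullet>\<^sub>M ga)"])
  show "amap M M (%x. lscale K M a (x \<bullet>\<^sub>M ga))" "amap M M (%x. lscale K M a x \<bullet>\<^sub>M ga)"
   using assms a by (auto intro!: amc[OF scale_amap1 lscale_amap1] amc[OF lscale_amap1 scale_amap1])
 next
  fix j y assume y: "y \<in> hpart M j"
  show "lscale K M a (y \<bullet>\<^sub>M ga) = lscale K M a y \<bullet>\<^sub>M ga"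
  proof (rule KG.amap_eqI[where x=ga and N=M and f="%ga. lscale K M a (y \<bullet>\<^sub>M ga)"])
   show "amap K M (%ga. lscale K M a (y \<bullet>\<^sub>M ga))" "amap K M (%ga. lscale K M a y \<bullet>\<^sub>M ga)"
    using y a by (auto intro!: amc[OF scale_amap2 lscale_amap1] scale_amap2 lscale_closed)
  next
   fix k c assume c: "c \<in> hpart K k"
   have "a \<otimes>\<^sub>K c = sg K (i * k) (c \<otimes>\<^sub>K a)" by (rule supercomm[OF a c])
   then have e: "y \<bullet>\<^sub>M (a \<otimes>\<^sub>K c) = sg M (i * k) (y \<bullet>\<^sub>M (c \<otimes>\<^sub>K a))"
    using a c y by (simp only: scale_sg2 MG.hpc KG.hpc m_closed)
   note ca = KG.hpc[OF a] KG.hpc[OF c] MG.hpc[OF y]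
   have "lscale K M a (y \<bullet>\<^sub>M c) = sg M (i * (j + k)) (y \<bullet>\<^sub>M (c \<otimes>\<^sub>K a))"
    by (simp only: lscale_homog2[OF a scale_parity[OF y c]] scale_mult ca)
   also have "... = sg M (i * j) (y \<bullet>\<^sub>M (a \<otimes>\<^sub>K c))"
    by (simp only: e M.sg_sg scale_closed ca m_closed distrib_left)
   also have "... = lscale K M a y \<bullet>\<^sub>M c"
    by (simp only: lscale_homog2[OF a y] scale_sg1 scale_closed ca scale_mult)
   finally show "lscale K M a (y \<bullet>\<^sub>M c) = lscale K M a y \<bullet>\<^sub>M c" .
  qed (use assms in auto)
 qed (use assms in auto)
qed (use assms in auto)

lemma lscale_mult: assumes "al \<in>. K" "ga \<in>. K" "x \<in>. M"
 shows "lscale K M (al \<otimes>\<^sub>K ga) x = lscale K M al (lscale K M ga x)"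
proof (rule KG.amap_eqI[where x=al and N=M and f="%al. lscale K M (al \<otimes>\<^sub>K ga) x"])
 have r: "amap K K (%al. al \<otimes>\<^sub>K c)" "amap K K (%al. c \<otimes>\<^sub>K al)" if "c \<in>. K" for c
  using that by (auto intro!: amapI simp: l_distr r_distr)
 show "amap K M (%al. lscale K M (al \<otimes>\<^sub>K ga) x)" "amap K M (%al. lscale K M al (lscale K M ga x))"
  using assms by (auto intro!: lscale_amap2 amc[OF r(1) lscale_amap2])
 fix i a assume a: "a \<in> hpart K i"
 show "lscale K M (a \<otimes>\<^sub>K ga) x = lscale K M a (lscale K M ga x)"
 proof (rule MG.amap_eqI[where x=x and N=M])
  show "amap M M (lscale K M (a \<otimes>\<^sub>K ga))" "amap M M (%x. lscale K M a (lscale K M ga x))"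
   using assms a by (auto intro!: lscale_amap1 amc[OF lscale_amap1 lscale_amap1])
 next
  fix j y assume y: "y \<in> hpart M j"
  show "lscale K M (a \<otimes>\<^sub>K ga) y = lscale K M a (lscale K M ga y)"
  proof (rule KG.amap_eqI[where x=ga and N=M and f="%ga. lscale K M (a \<otimes>\<^sub>K ga) y"])
   show "amap K M (%ga. lscale K M (a \<otimes>\<^sub>K ga) y)" "amap K M (%ga. lscale K M a (lscale K M ga y))"
    using y a by (auto intro!: amc[OF r(2) lscale_amap2] amc[OF lscale_amap2 lscale_amap1])
  next
   fix k c assume c: "c \<in> hpart K k"
   have e: "a \<otimes>\<^sub>K c = sg K (i * k) (c \<otimes>\<^sub>K a)" by (rule supercomm[OF a c])
   have m: "a \<otimes>\<^sub>K c \<in> hpart K (i + k)" by (rule mult_parity[OF a c])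
   note ca = KG.hpc[OF a] KG.hpc[OF c] MG.hpc[OF y]
   have "lscale K M (a \<otimes>\<^sub>K c) y = sg M ((i + k) * j) (sg M (i * k) (y \<bullet>\<^sub>M (c \<otimes>\<^sub>K a)))"
    by (subst lscale_homog2[OF m y], subst e) (simp only: scale_sg2 ca m_closed)
   also have "... = sg M (i * (k + j)) (sg M (k * j) (y \<bullet>\<^sub>M (c \<otimes>\<^sub>K a)))"
    by (simp only: M.sg_sg scale_closed ca m_closed) (cases i; cases j; cases k; simp)
   also have "... = lscale K M a (lscale K M c y)"
    by (subst lscale_homog2[OF a lscale_hp[OF c y]]) (simp only: lscale_homog2[OF c y] scale_sg1 scale_mult scale_closed ca)
   finally show "lscale K M (a \<otimes>\<^sub>K c) y = lscale K M a (lscale K M c y)" .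
  qed (use assms in auto)
 qed (use assms in auto)
qed (use assms in auto)

end

section \<open>Quotients of abelian groups and rings\<close>

lemma abelian_group_surj:
 assumes "abelian_group A" "carrier B = f ` carrier A"
  "!!x y. [|x \<in>. A; y \<in>. A|] ==> f (x \<oplus>\<^sub>A y) = f x \<oplus>\<^sub>B f y" "f \<zero>\<^sub>A = \<zero>\<^sub>B"
 shows "abelian_group B"
proof -
 interpret A: abelian_group A by fact
 note f = assms(3,4)[symmetric]
 show ?thesis
 proof (rule abelian_groupI)
  fix x assume "x \<in>. B"
  then obtain a where a: "a \<in>. A" "x = f a" using assms(2) by auto
  have "f (\<ominus>\<^sub>A a) \<oplus>\<^sub>B x = \<zero>\<^sub>B" using a by (simp add: f A.l_neg)
  then show "\<exists>y\<in>carrier B. y \<oplus>\<^sub>B x = \<zero>\<^sub>B" using a assms(2) by auto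
 qed (auto simp: assms(2) f A.a_ac)
qed

lemma ring_surj:
 assumes "ring A" "carrier B = f ` carrier A"
  "!!x y. [|x \<in>. A; y \<in>. A|] ==> f (x \<oplus>\<^sub>A y) = f x \<oplus>\<^sub>B f y" "f \<zero>\<^sub>A = \<zero>\<^sub>B"
  "!!x y. [|x \<in>. A; y \<in>. A|] ==> f (x \<otimes>\<^sub>A y) = f x \<otimes>\<^sub>B f y" "f \<one>\<^sub>A = \<one>\<^sub>B"
 shows "ring B"
proof -
 interpret A: ring A by fact
 note f = assms(3,4,5,6)[symmetric]
 show ?thesis
  by (intro ringI abelian_group_surj[OF A.ag assms(2-4)] monoidI)
    (auto simp: assms(2) f A.m_assoc A.l_distr A.r_distr)
qed

locale quo = A: abelian_group A + I: additive_subgroup I A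
 for A :: "('a, 'k, 'n) smodule_scheme" (structure) and I
begin

abbreviation Q where "Q \<equiv> squot A I"
abbreviation cl where "cl x \<equiv> I +>\<^sub>A x"

sublocale S: abelian_subgroup I A
 by (intro abelian_subgroupI3 A.ag I.additive_subgroup_axioms)

lemma Q_simps: "carrier Q = cl ` carrier A" "\<zero>\<^sub>Q = I" "\<one>\<^sub>Q = cl \<one>" "X \<oplus>\<^sub>Q Y = X <+>\<^sub>A Y"
 "X \<otimes>\<^sub>Q Y = rcoset_mult A I X Y" "hpart Q i = cl ` hpart A i" "X \<bullet>\<^sub>Q al = (\<Union>x \<in> X. cl (x \<bullet> al))"
 by (auto simp: squot_def ring.defs FactRing_def A_RCOSETS_def' a_r_coset_def')

lemma cl_closed [simp]: "x \<in>. A ==> cl x \<in>. Q"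
 by (simp add: Q_simps)

lemma cl_add: "[|x \<in>. A; y \<in>. A|] ==> cl (x \<oplus> y) = cl x \<oplus>\<^sub>Q cl y"
 by (simp add: Q_simps S.a_rcos_sum)

lemma cl_zero: "cl \<zero> = \<zero>\<^sub>Q"
 by (simp add: Q_simps I.a_subset)

lemma grp: "abelian_group Q"
 by (rule abelian_group_surj[OF A.ag Q_simps(1) cl_add cl_zero])

lemma cl_amap: "amap A Q cl"
 by (simp add: amap_def cl_add)

lemma cl_eq_iff: "[|x \<in>. A; y \<in>. A|] ==> cl x = cl y \<longleftrightarrow> x \<ominus> y \<in> I"
proof -
 assume xy: "x \<in>. A" "y \<in>. A"
 have "cl x = cl y \<longleftrightarrow> x \<in> cl y"
  using S.a_repr_independence'[of x y] S.a_rcos_self[OF xy(1)] xy by auto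
 also have "... \<longleftrightarrow> x \<ominus> y \<in> I" using S.a_rcos_module[OF xy(2,1)] by (simp add: a_minus_def)
 finally show ?thesis .
qed

lemma cl_zero_iff: "x \<in>. A ==> cl x = \<zero>\<^sub>Q \<longleftrightarrow> x \<in> I"
 using cl_eq_iff[of x \<zero>] by (metis A.a_inv_closed A.abelian_monoid_axioms A.r_zero A.zero_closed a_minus_def abelian_monoid.r_zero A.r_neg cl_zero A.minus_equality)

lemma cl_mem: "x \<in>. A ==> y \<in> cl x ==> y \<in>. A \<and> cl y = cl x"
 using S.a_elemrcos_carrier S.a_repr_independence'[of y x] by blast

lemma cl_self: "x \<in>. A ==> x \<in> cl x"
 using S.a_rcos_self by blast

text \<open>Only biadditivity of the product and absorption by I are asked for, not a ring structure
  on A: the product of \<open>free_pairs\<close> obeys the ring axioms only modulo the tensor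
  relations.\<close>

lemma cl_mult:
 assumes "!!x. x \<in>. A ==> amap A A (%y. x \<otimes> y)" "!!y. y \<in>. A ==> amap A A (%x. x \<otimes> y)"
  "!!x y. [|x \<in> I; y \<in>. A|] ==> x \<otimes> y \<in> I" "!!x y. [|x \<in>. A; y \<in> I|] ==> x \<otimes> y \<in> I"
  "x \<in>. A" "y \<in>. A"
 shows "cl (x \<otimes> y) = cl x \<otimes>\<^sub>Q cl y"
proof -
 note cl1 = amapc[OF assms(1)]
 have m: "cl (a \<otimes> b) = cl (x \<otimes> y)" if "a \<in> cl x" "b \<in> cl y" for a b
 proof -
  have c: "a \<in>. A" "b \<in>. A" "cl a = cl x" "cl b = cl y"
   using cl_mem[OF assms(5) that(1)] cl_mem[OF assms(6) that(2)] by auto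
  have "(a \<ominus> x) \<otimes> b \<in> I" "x \<otimes> (b \<ominus> y) \<in> I"
   using c assms(5,6) cl_eq_iff by (auto intro: assms(3,4))
  moreover have "(a \<ominus> x) \<otimes> b = a \<otimes> b \<ominus> x \<otimes> b"
   using amap_minus[OF assms(2) A.ag A.ag, of b a x] c assms(5) by simp
  moreover have "x \<otimes> (b \<ominus> y) = x \<otimes> b \<ominus> x \<otimes> y"
   using amap_minus[OF assms(1) A.ag A.ag, of x b y] c assms(5,6) by simp
  ultimately have "cl (a \<otimes> b) = cl (x \<otimes> b)" "cl (x \<otimes> b) = cl (x \<otimes> y)"
   using c assms(5,6) cl1 by (auto simp: cl_eq_iff)
  then show ?thesis by simp
 qed
 have "cl x \<otimes>\<^sub>Q cl y = (\<Union>a\<in>cl x. \<Union>b\<in>cl y. cl (a \<otimes> b))" by (simp add: Q_simps rcoset_mult_def)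
 also have "... = (\<Union>a\<in>cl x. \<Union>b\<in>cl y. cl (x \<otimes> y))" using m by auto
 also have "... = cl (x \<otimes> y)" using cl_self[OF assms(5)] cl_self[OF assms(6)] by auto
 finally show ?thesis by simp
qed

lemma cl_scale:
 assumes "amap A A (%x. x \<bullet> al)" "!!x. x \<in> I ==> x \<bullet> al \<in> I" "x \<in>. A"
 shows "cl x \<bullet>\<^sub>Q al = cl (x \<bullet> al)"
proof -
 have m: "cl (a \<bullet> al) = cl (x \<bullet> al)" if "a \<in> cl x" for a
 proof -
  have c: "a \<in>. A" "cl a = cl x" using cl_mem[OF assms(3) that] by auto
  have "(a \<ominus> x) \<bullet> al \<in> I" using c assms(3) cl_eq_iff by (auto intro: assms(2))
  moreover have "(a \<ominus> x) \<bullet> al = a \<bullet> al \<ominus> x \<bullet> al"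
   using amap_minus[OF assms(1) A.ag A.ag, of a x] c assms(3) by simp
  ultimately show ?thesis using c assms(3) amapc[OF assms(1)] by (simp add: cl_eq_iff)
 qed
 have "cl x \<bullet>\<^sub>Q al = (\<Union>a\<in>cl x. cl (x \<bullet> al))" using m by (auto simp: Q_simps)
 then show ?thesis using cl_self[OF assms(3)] by auto
qed

lemma factor:
 assumes "abelian_group P" "amap A P h" "!!x. x \<in> I ==> h x = \<zero>\<^sub>P"
 obtains h' where "amap Q P h'" "!!x. x \<in>. A ==> h' (cl x) = h x"
proof -
 interpret P: abelian_group P by fact
 have eq: "h x = h y" if "x \<in>. A" "y \<in>. A" "cl x = cl y" for x y
 proof -
  have "h (x \<ominus> y) = \<zero>\<^sub>P" using that assms(3) cl_eq_iff by auto
  then have "h x \<ominus>\<^sub>P h y = \<zero>\<^sub>P"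
   using amap_minus[OF assms(2) A.ag assms(1)] that by simp
  then show ?thesis using P.minus_zero_eq amapc[OF assms(2)] that by blast
 qed
 define h' where "h' = (%X. h (SOME x. x \<in>. A \<and> cl x = X))"
 have h': "h' (cl x) = h x" if "x \<in>. A" for x
 proof -
  have "(SOME y. y \<in>. A \<and> cl y = cl x) \<in>. A \<and> cl (SOME y. y \<in>. A \<and> cl y = cl x) = cl x"
   by (rule someI[of _ x]) (use that in simp)
  then show ?thesis unfolding h'_def using eq that by blast
 qed
 have "amap Q P h'"
 proof (rule amapI)
  fix X assume "X \<in>. Q"
  then show "h' X \<in>. P" using h' amapc[OF assms(2)] by (auto simp: Q_simps(1))
 next
  fix X Y assume "X \<in>. Q" "Y \<in>. Q"
  then obtain x y where "x \<in>. A" "y \<in>. A" "X = cl x" "Y = cl y" by (auto simp: Q_simps(1))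
  then show "h' (X \<oplus>\<^sub>Q Y) = h' X \<oplus>\<^sub>P h' Y"
   using ama[OF assms(2)] by (simp add: cl_add[symmetric] h')
 qed
 then show ?thesis using h' that by blast
qed

end

lemma (in ring) ideal_quo: "ideal I R ==> additive_subgroup I R"
 by (rule ideal.axioms(1))

lemma ring_amapL: "ring R ==> x \<in>. R ==> amap R R (%y. x \<otimes>\<^sub>R y)"
 and ring_amapR: "ring R ==> x \<in>. R ==> amap R R (%y. y \<otimes>\<^sub>R x)"
 by (auto intro!: amapI simp: ring.ring_simprules)

lemma ring_hom_amap: "f \<in> ring_hom R S ==> amap R S f"
 by (auto intro!: amapI simp: ring_hom_closed ring_hom_add)

locale rquo = A: ring A + I: ideal I A for A :: "('a, 'k, 'n) smodule_scheme" (structure) and I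
begin

sublocale quo A I by unfold_locales

lemma cl_mult': "[|x \<in>. A; y \<in>. A|] ==> cl (x \<otimes> y) = cl x \<otimes>\<^sub>Q cl y"
 by (intro cl_mult ring_amapL ring_amapR A.ring_axioms) (auto intro: I.I_l_closed I.I_r_closed)

lemma ringQ: "ring Q"
 by (rule ring_surj[OF A.ring_axioms Q_simps(1) cl_add cl_zero cl_mult' Q_simps(3)[symmetric]])

lemma cl_hom: "(%x. cl x) \<in> ring_hom A Q"
 by (intro ring_hom_memI cl_closed cl_add cl_mult' Q_simps(3)[symmetric])

lemma cl_scale':
 assumes "!!x. x \<in>. A ==> x \<bullet> al = x \<otimes> e" "e \<in>. A" "X \<in>. Q"
 shows "X \<bullet>\<^sub>Q al = X \<otimes>\<^sub>Q cl e"
proof -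
 obtain x where x: "x \<in>. A" "X = cl x" using assms(3) by (auto simp: Q_simps(1))
 have "amap A A (%x. x \<bullet> al)"
  using assms(1,2) by (auto intro!: amapI simp: A.l_distr)
 moreover have "x \<bullet> al \<in> I" if "x \<in> I" for x
  using that assms(1)[of x] assms(2) I.I_r_closed[OF that, of e] I.a_Hcarr[OF that] by simp
 ultimately have "X \<bullet>\<^sub>Q al = cl (x \<bullet> al)"
  unfolding x(2) by (rule cl_scale) (use x(1) in auto)
 then have "X \<bullet>\<^sub>Q al = cl (x \<otimes> e)" by (simp only: assms(1)[OF x(1)])
 then show ?thesis using x assms(2) by (simp only: cl_mult')
qed

end

lemma ideal_img:
 assumes "ring A" "ring B" "f \<in> ring_hom A B" "carrier B = f ` carrier A" "ideal J A"
 shows "ideal (f ` J) B"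
proof -
 interpret A: ring A by fact
 interpret B: ring B by fact
 interpret J: ideal J A by fact
 interpret h: ring_hom_ring A B f by (rule ring_hom_ringI2[OF assms(1-3)])
 show ?thesis
 proof (rule idealI)
  have "additive_subgroup (f ` J) B"
  proof (rule additive_subgroupI'[OF B.ag])
   fix x assume "x \<in> f ` J"
   then obtain a where "a \<in> J" "x = f a" by auto
   then show "\<ominus>\<^sub>B x \<in> f ` J" by (auto intro!: image_eqI[of _ _ "\<ominus>\<^sub>A a"])
  next
   fix x y assume "x \<in> f ` J" "y \<in> f ` J"
   then obtain a b where "a \<in> J" "x = f a" "b \<in> J" "y = f b" by auto
   then show "x \<oplus>\<^sub>B y \<in> f ` J" by (auto intro!: image_eqI[of _ _ "a \<oplus>\<^sub>A b"])
  qed (auto intro!: image_eqI[of _ _ "\<zero>\<^sub>A"])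
  then show "subgroup (f ` J) (add_monoid B)" by (rule additive_subgroup.a_subgroup)
 next
  fix a x assume "a \<in> f ` J" "x \<in>. B"
  then obtain b y where "b \<in> J" "a = f b" "y \<in>. A" "x = f y" using assms(4) by auto
  then show "x \<otimes>\<^sub>B a \<in> f ` J" "a \<otimes>\<^sub>B x \<in> f ` J"
   using imageI[of "y \<otimes>\<^sub>A b" J f] imageI[of "b \<otimes>\<^sub>A y" J f] by (auto simp: J.I_l_closed J.I_r_closed)
 qed (rule assms(2))
qed

text \<open>The common part of \<open>free_words\<close> and \<open>free_pairs\<close>. Only
  carrier, addition and zero are fixed, so the same lemmas also serve for the subgroup spanned by
  the homogeneous words of one parity.\<close>

locale fragg =
 fixes F :: "('b \<Rightarrow>\<^sub>0 int, 'k, 'n) smodule_scheme" and B :: "'b set"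
 assumes F_carrier: "carrier F = carrier (free_Abelian_group B)"
  and F_add: "add F = (+)" and F_zero: "\<zero>\<^sub>F = 0"
begin

lemma F_carr_iff: "x \<in>. F \<longleftrightarrow> Poly_Mapping.keys x <= B"
 by (simp add: F_carrier)

lemma F_of [simp]: "fof b \<in>. F \<longleftrightarrow> b \<in> B"
 by (simp add: F_carrier)

lemma F_plus: "x \<oplus>\<^sub>F y = x + y"
 by (simp add: F_add)

lemma F_group: "abelian_group F"
proof (rule abelian_groupI)
 fix x assume "x \<in>. F"
 then show "\<exists>y\<in>carrier F. y \<oplus>\<^sub>F x = \<zero>\<^sub>F"
  by (intro bexI[of _ "- x"]) (auto simp: F_add F_zero F_carr_iff)
next
 fix x y assume "x \<in>. F" "y \<in>. F"
 then show "x \<oplus>\<^sub>F y \<in>. F"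
  using keys_add[of x y] by (auto simp: F_add F_carr_iff)
qed (auto simp: F_add F_zero F_carr_iff ac_simps)

lemma F_neg: "x \<in>. F ==> \<ominus>\<^sub>F x = - x"
 by (rule abelian_group.minus_equality[OF F_group]) (auto simp: F_plus F_zero F_carr_iff)

lemma F_minus: "y \<in>. F ==> x \<ominus>\<^sub>F y = x - y"
 by (simp add: a_minus_def F_neg F_plus)

lemma F_diff_closed: "[|x \<in>. F; y \<in>. F|] ==> x - y \<in>. F"
 using F_minus[of y x] abelian_group.minus_closed[OF F_group] by metis

lemma F_add_closed: "[|x \<in>. F; y \<in>. F|] ==> x + y \<in>. F"
 using F_plus[of x y] abelian_group.axioms(1)[OF F_group] abelian_monoid.a_closed by metis

lemma F_induct [consumes 1, case_names zero diff of]: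
 assumes "x \<in>. F" "P 0" "!!x y. [|x \<in>. F; y \<in>. F; P x; P y|] ==> P (x - y)"
  "!!b. b \<in> B ==> P (fof b)"
 shows "P x"
 by (rule free_Abelian_group_induct[of x B]) (use assms in \<open>auto simp: F_carr_iff\<close>)

lemma F_amap_diff: "[|amap F P h; abelian_group P; x \<in>. F; y \<in>. F|] ==> h (x - y) = h x \<ominus>\<^sub>P h y"
 using amap_minus[OF _ F_group, of P h x y] by (simp add: F_minus)

lemma F_amap_zero: "[|amap F P h; abelian_group P|] ==> h 0 = \<zero>\<^sub>P"
 using amap_zero[OF _ F_group] by (simp add: F_zero)

lemma F_ext:
 assumes "amap F P h" "amap F P h'" "abelian_group P" "!!b. b \<in> B ==> h (fof b) = h' (fof b)" "x \<in>. F"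
 shows "h x = h' x"
 using assms(5) by (induction rule: F_induct) (auto simp: assms(1-4) F_amap_diff[OF assms(1)] F_amap_diff[OF assms(2)] F_amap_zero[of P])

lemma F_lift:
 assumes "abelian_group P" "!!b. b \<in> B ==> f b \<in>. P"
 obtains h where "amap F P h" "!!b. b \<in> B ==> h (fof b) = f b"
proof -
 interpret P: abelian_group P by fact
 have "f ` B <= carrier (add_monoid P)" using assms(2) by auto
 from comm_group.free_Abelian_group_universal[OF P.a_comm_group this] obtain h
  where h: "h \<in> hom (free_Abelian_group B) (add_monoid P)" "!!x. x \<in> B ==> h (fof x) = f x" by metis
 have "amap F P h" using h(1) by (auto simp: amap_def F_carr_iff hom_def F_plus)
 then show ?thesis using h(2) that by blast
qed

lemma F_extend_amap:
 assumes "fragg F' B'" "!!b. b \<in> B ==> f b \<in>. F'"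
 shows "amap F F' (frag_extend f)"
proof -
 interpret F': fragg F' B' by fact
 show ?thesis
 proof (rule amapI)
  fix x assume "x \<in>. F"
  then show "frag_extend f x \<in>. F'"
  proof (induction rule: F_induct)
   case zero then show ?case by (simp add: F'.F_carr_iff)
  next
   case (diff x y) then show ?case by (simp add: frag_extend_diff F'.F_diff_closed)
  next
   case (of b) then show ?case by (simp add: assms(2))
  qed
 qed (simp add: F_plus F'.F_plus frag_extend_add)
qed

lemma gen_subgroup: "R <= carrier F ==> additive_subgroup (generate (add_monoid F) R) F"
 by (intro additive_subgroup.intro group.generate_is_subgroup abelian_group.a_group[OF F_group]) simp

lemma gen_incl: "r \<in> R ==> r \<in> generate (add_monoid F) R"
 by (rule generate.incl)

lemma gen_least: assumes "R <= J" "additive_subgroup J F" shows "generate (add_monoid F) R <= J"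
proof
 fix x assume "x \<in> generate (add_monoid F) R"
 then show "x \<in> J"
 proof induction
  case (inv h) then show ?case using additive_subgroup_neg[OF assms(2) F_group] assms(1) by (auto simp: a_inv_def)
 qed (use assms additive_subgroup_closed[OF assms(2)] in auto)
qed

lemma ker_subgroup: assumes "amap F P h" "abelian_group P"
 shows "additive_subgroup {x \<in> carrier F. h x = \<zero>\<^sub>P} F"
proof -
 interpret F: abelian_group F by (rule F_group)
 interpret P: abelian_group P by fact
 show ?thesis
  by (rule additive_subgroupI'[OF F_group])
    (auto simp: amap_zero[OF assms(1) F_group assms(2)] ama[OF assms(1)] amap_neg[OF assms(1) F_group assms(2)])
qed

lemma gen_kill:
 assumes "amap F P h" "abelian_group P" "R <= carrier F" "!!r. r \<in> R ==> h r = \<zero>\<^sub>P" "r \<in> generate (add_monoid F) R"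
 shows "h r = \<zero>\<^sub>P"
 using gen_least[OF _ ker_subgroup[OF assms(1,2)], of R] assms(3-5) by auto

end

lemma frag_extend_plus_fun: "frag_extend (%x. f x + h x) c = frag_extend f c + frag_extend h c"
 by (simp add: frag_extend_def frag_cmul_distrib2 sum.distrib)

section \<open>Algebras generated by words\<close>

context supermodule begin

lemma tw_mult_K: assumes "al \<in>. K" "ga \<in>. K"
 shows "KG.tw d (al \<otimes>\<^sub>K ga) = KG.tw d al \<otimes>\<^sub>K KG.tw d ga"
proof (rule KG.amap_eqI[where x=al and N=K and f="%al. KG.tw d (al \<otimes>\<^sub>K ga)"])
 show "amap K K (%al. KG.tw d (al \<otimes>\<^sub>K ga))" "amap K K (%al. KG.tw d al \<otimes>\<^sub>K KG.tw d ga)"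
  using assms by (auto intro!: amc[OF ring_amapR KG.tw_amap] amc[OF KG.tw_amap ring_amapR] ring_axioms)
 fix i a assume a: "a \<in> hpart K i"
 show "KG.tw d (a \<otimes>\<^sub>K ga) = KG.tw d a \<otimes>\<^sub>K KG.tw d ga"
 proof (rule KG.amap_eqI[where x=ga and N=K and f="%ga. KG.tw d (a \<otimes>\<^sub>K ga)"])
  show "amap K K (%ga. KG.tw d (a \<otimes>\<^sub>K ga))" "amap K K (%ga. KG.tw d a \<otimes>\<^sub>K KG.tw d ga)"
   using KG.hpc[OF a] by (auto intro!: amc[OF ring_amapL KG.tw_amap] amc[OF KG.tw_amap ring_amapL] ring_axioms)
  fix j c assume c: "c \<in> hpart K j"
  note ca = KG.hpc[OF a] KG.hpc[OF c]
  show "KG.tw d (a \<otimes>\<^sub>K c) = KG.tw d a \<otimes>\<^sub>K KG.tw d c"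
   unfolding KG.tw_homog[OF mult_parity[OF a c]] KG.tw_homog[OF a] KG.tw_homog[OF c]
   using ca by (cases d; cases i; cases j) (simp_all add: l_minus r_minus)
 qed (use assms in auto)
qed (use assms in auto)

lemma tw_scale: assumes "x \<in>. M" "al \<in>. K"
 shows "MG.tw d (x \<bullet>\<^sub>M al) = MG.tw d x \<bullet>\<^sub>M KG.tw d al"
proof (rule MG.amap_eqI[where x=x and N=M and f="%x. MG.tw d (x \<bullet>\<^sub>M al)"])
 show "amap M M (%x. MG.tw d (x \<bullet>\<^sub>M al))" "amap M M (%x. MG.tw d x \<bullet>\<^sub>M KG.tw d al)"
  using assms by (auto intro!: amc[OF scale_amap1 MG.tw_amap] amc[OF MG.tw_amap scale_amap1])
 fix i a assume a: "a \<in> hpart M i"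
 show "MG.tw d (a \<bullet>\<^sub>M al) = MG.tw d a \<bullet>\<^sub>M KG.tw d al"
 proof (rule KG.amap_eqI[where x=al and N=M and f="%al. MG.tw d (a \<bullet>\<^sub>M al)"])
  show "amap K M (%al. MG.tw d (a \<bullet>\<^sub>M al))" "amap K M (%al. MG.tw d a \<bullet>\<^sub>M KG.tw d al)"
   using MG.hpc[OF a] by (auto intro!: amc[OF scale_amap2 MG.tw_amap] amc[OF KG.tw_amap scale_amap2])
  fix j c assume c: "c \<in> hpart K j"
  note ca = MG.hpc[OF a] KG.hpc[OF c]
  show "MG.tw d (a \<bullet>\<^sub>M c) = MG.tw d a \<bullet>\<^sub>M KG.tw d c"
   unfolding MG.tw_homog[OF scale_parity[OF a c]] MG.tw_homog[OF a] KG.tw_homog[OF c]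
   using ca by (simp add: scale_sg1 scale_sg2 scale_closed M.sg_sg distrib_left add.commute)
 qed (use assms in auto)
qed (use assms in auto)

lemma tw_lscale: assumes "x \<in>. M" "al \<in>. K"
 shows "MG.tw d (lscale K M al x) = lscale K M (KG.tw d al) (MG.tw d x)"
proof (rule KG.amap_eqI[where x=al and N=M and f="%al. MG.tw d (lscale K M al x)"])
 show "amap K M (%al. MG.tw d (lscale K M al x))" "amap K M (%al. lscale K M (KG.tw d al) (MG.tw d x))"
  using assms by (auto intro!: amc[OF lscale_amap2 MG.tw_amap] amc[OF KG.tw_amap lscale_amap2])
 fix i a assume a: "a \<in> hpart K i"
 then show "MG.tw d (lscale K M a x) = lscale K M (KG.tw d a) (MG.tw d x)"
  using assms(1) by (simp add: lscale_homog tw_scale lscale_homog[OF KG.tw_hp[OF a]] KG.hpc MG.tw_tw add.commute)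
qed (use assms in auto)

abbreviation LM where "LM \<equiv> lists (carrier M)"
abbreviation WB where "WB \<equiv> LM \<times> carrier K"
abbreviation WR where "WR \<equiv> word_rels K M"
abbreviation wm where "wm \<equiv> word_mult K M"
abbreviation FW where "FW \<equiv> free_words K M"

sublocale W: fragg "free_words K M" WB
 by unfold_locales (auto simp: free_words_def)

lemma wm_closed: "[|p \<in> WB; r \<in> WB|]
  ==> wm p r \<in> WB"
 by (cases "(K, M, p, r)" rule: word_mult.cases) auto

lemma wm_assoc: "[|p \<in> WB; r \<in> WB; t \<in> WB|]
  ==> wm (wm p r) t = wm p (wm r t)"
 by (cases p; cases r; cases t; cases "fst r"; cases "fst t") (auto simp: m_assoc lscale_mult)

lemma wm_one: "p \<in> WB ==> wm ([], \<one>\<^sub>K) p = p"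
 "p \<in> WB ==> wm p ([], \<one>\<^sub>K) = p"
 by (cases p; cases "fst p"; auto)+

lemma FW_mult: "s \<otimes>\<^sub>FW t = frag_extend (%p. frag_extend (%r. fof (wm p r)) t) s"
 and FW_one: "\<one>\<^sub>FW = fof ([], \<one>\<^sub>K)"
 and FW_scale: "t \<bullet>\<^sub>FW ga = frag_extend (%(u, al). fof (u, al \<otimes>\<^sub>K ga)) t"
 by (simp_all add: free_words_def)

lemma FW_mult_of [simp]: "fof p \<otimes>\<^sub>FW fof r = fof (wm p r)"
 by (simp add: FW_mult)

lemma FW_amapR: "t \<in>. FW ==> amap FW FW (%s. s \<otimes>\<^sub>FW t)"
 unfolding FW_mult
 by (rule W.F_extend_amap[OF W.fragg_axioms], rule amapc[OF W.F_extend_amap[OF W.fragg_axioms]])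
   (auto intro: wm_closed)

lemma FW_amapL: assumes "s \<in>. FW" shows "amap FW FW (%t. s \<otimes>\<^sub>FW t)"
proof (rule amapI)
 fix x assume "x \<in>. FW" then show "s \<otimes>\<^sub>FW x \<in>. FW" using amapc[OF FW_amapR assms] by simp
next
 fix x y
 show "s \<otimes>\<^sub>FW (x \<oplus>\<^sub>FW y) = s \<otimes>\<^sub>FW x \<oplus>\<^sub>FW s \<otimes>\<^sub>FW y"
  by (simp add: FW_mult W.F_plus frag_extend_add frag_extend_plus_fun)
qed

lemma FW_ring: "ring FW"
proof (rule ringI)
 show "abelian_group FW" by (rule W.F_group)
 note cl = amapc[OF FW_amapL]
 show "Group.monoid FW"
 proof (rule monoidI)
  fix x y z assume x: "x \<in>. FW" and y: "y \<in>. FW" and z: "z \<in>. FW"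
  show "x \<otimes>\<^sub>FW y \<otimes>\<^sub>FW z = x \<otimes>\<^sub>FW (y \<otimes>\<^sub>FW z)"
  proof (rule W.F_ext[OF _ _ W.F_group _ x, of "%x. x \<otimes>\<^sub>FW y \<otimes>\<^sub>FW z"])
   show "amap FW FW (%x. x \<otimes>\<^sub>FW y \<otimes>\<^sub>FW z)" "amap FW FW (%x. x \<otimes>\<^sub>FW (y \<otimes>\<^sub>FW z))"
    using y z by (auto intro!: FW_amapR amc[OF FW_amapR FW_amapR] cl)
   fix p :: "'a list \<times> 'k" assume p: "p \<in> WB"
   then have p': "fof p \<in>. FW" by simp
   show "fof p \<otimes>\<^sub>FW y \<otimes>\<^sub>FW z = fof p \<otimes>\<^sub>FW (y \<otimes>\<^sub>FW z)"
   proof (rule W.F_ext[OF _ _ W.F_group _ y, of "%y. fof p \<otimes>\<^sub>FW y \<otimes>\<^sub>FW z"])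
    show "amap FW FW (%y. fof p \<otimes>\<^sub>FW y \<otimes>\<^sub>FW z)" "amap FW FW (%y. fof p \<otimes>\<^sub>FW (y \<otimes>\<^sub>FW z))"
     by (rule amc[OF FW_amapL[OF p'] FW_amapR[OF z]] amc[OF FW_amapR[OF z] FW_amapL[OF p']])+
    fix r :: "'a list \<times> 'k" assume r: "r \<in> WB"
    then have r': "fof r \<in>. FW" by simp
    show "fof p \<otimes>\<^sub>FW fof r \<otimes>\<^sub>FW z = fof p \<otimes>\<^sub>FW (fof r \<otimes>\<^sub>FW z)"
    proof (rule W.F_ext[OF _ _ W.F_group _ z, of "%z. fof p \<otimes>\<^sub>FW fof r \<otimes>\<^sub>FW z"])
     show "amap FW FW (%z. fof p \<otimes>\<^sub>FW fof r \<otimes>\<^sub>FW z)"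
      by (rule FW_amapL[OF cl[OF p' r']])
     show "amap FW FW (%z. fof p \<otimes>\<^sub>FW (fof r \<otimes>\<^sub>FW z))"
      by (rule amc[OF FW_amapL[OF r'] FW_amapL[OF p']])
    qed (use p r in \<open>simp add: wm_assoc\<close>)
   qed
  qed
 next
  fix x assume x: "x \<in>. FW"
  show "\<one>\<^sub>FW \<otimes>\<^sub>FW x = x" unfolding FW_one
   by (rule W.F_ext[OF FW_amapL amap_id W.F_group _ x]) (auto simp: wm_one)
  show "x \<otimes>\<^sub>FW \<one>\<^sub>FW = x" unfolding FW_one
   by (rule W.F_ext[OF FW_amapR amap_id W.F_group _ x]) (auto simp: wm_one)
 qed (auto simp: FW_one cl)
qed (auto simp: ama[OF FW_amapL] ama[OF FW_amapR])

text \<open>Scaling is right multiplication by a word without letters; the scalar action therefore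
  descends to every quotient by an ideal.\<close>

lemma FW_scale_mult: "[|t \<in>. FW; ga \<in>. K|] ==> t \<bullet>\<^sub>FW ga = t \<otimes>\<^sub>FW fof ([], ga)"
proof -
 assume a: "t \<in>. FW" "ga \<in>. K"
 show ?thesis unfolding FW_scale
  by (rule W.F_ext[OF W.F_extend_amap[OF W.fragg_axioms] FW_amapR W.F_group _ a(1)]) (use a(2) in auto)
qed

lemma word_rels_sub: "WR <= carrier FW"
 unfolding word_rels_def by (auto intro!: W.F_diff_closed simp: scale_closed)

lemma word_null_sub: "additive_subgroup (word_null K M) FW"
 unfolding word_null_def by (rule W.gen_subgroup[OF word_rels_sub])

end

section \<open>Evaluation of words in a ring\<close>

definition wev :: "('p, 'm) ring_scheme => ('a => 'p) => ('k => 'p) => 'a list \<times> 'k => 'p" where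
 "wev P f e w = foldr (%X y. f X \<otimes>\<^sub>P y) (fst w) (e (snd w))"

text \<open>The data of an algebra morphism out of the tensor algebra. \<open>f_scale\<close> and
  \<open>e_f\<close> are what the relations moving scalars between letters demand;
  \<open>e_f\<close> is also what makes evaluation compatible with \<open>word_mult\<close>.\<close>

locale whom = supermodule K M + P: ring P
 for K :: "('k, 'm) graded_ring_scheme" and M :: "('a, 'k, 'n) smodule_scheme"
  and P :: "('p, 'o) ring_scheme" +
 fixes f :: "'a => 'p" and e :: "'k => 'p"
 assumes e_hom: "e \<in> ring_hom K P" and f_amap: "amap M P f"
  and f_scale: "[|Y \<in>. M; al \<in>. K|] ==> f (Y \<bullet>\<^sub>M al) = f Y \<otimes>\<^sub>P e al"
  and e_f: "[|Y \<in>. M; al \<in>. K|] ==> e al \<otimes>\<^sub>P f Y = f (lscale K M al Y)"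
begin

lemma e_closed [simp]: "al \<in>. K ==> e al \<in>. P"
 using e_hom by (rule ring_hom_closed)

lemma f_closed [simp]: "X \<in>. M ==> f X \<in>. P"
 by (rule amapc[OF f_amap])

lemma e_simps: "[|al \<in>. K; ga \<in>. K|] ==> e (al \<otimes>\<^sub>K ga) = e al \<otimes>\<^sub>P e ga"
 "[|al \<in>. K; ga \<in>. K|] ==> e (al \<oplus>\<^sub>K ga) = e al \<oplus>\<^sub>P e ga" "e \<one>\<^sub>K = \<one>\<^sub>P"
 using e_hom by (auto simp: ring_hom_mult ring_hom_add ring_hom_one)

lemma wev_Nil: "wev P f e ([], al) = e al"
 by (simp add: wev_def)

lemma wev_Cons: "wev P f e (X # u, al) = f X \<otimes>\<^sub>P wev P f e (u, al)"
 by (simp add: wev_def)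

lemma wev_closed: "[|u \<in> LM; al \<in>. K|] ==> wev P f e (u, al) \<in>. P"
 by (induction u) (auto simp: wev_Nil wev_Cons)

lemma wev_append: "[|u \<in> LM; v \<in> LM; al \<in>. K|]
  ==> wev P f e (u @ v, al) = wev P f e (u, \<one>\<^sub>K) \<otimes>\<^sub>P wev P f e (v, al)"
 by (induction u) (auto simp: wev_Nil wev_Cons e_simps wev_closed P.m_assoc)

lemma wev_scale: "[|u \<in> LM; al \<in>. K; ga \<in>. K|]
  ==> wev P f e (u, al \<otimes>\<^sub>K ga) = wev P f e (u, al) \<otimes>\<^sub>P e ga"
 by (induction u) (auto simp: wev_Nil wev_Cons e_simps wev_closed P.m_assoc)

lemma wev_mult: assumes "w \<in> WB" "w' \<in> WB"
 shows "wev P f e (wm w w') = wev P f e w \<otimes>\<^sub>P wev P f e w'"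
proof -
 obtain u al v ga where w: "w = (u, al)" "w' = (v, ga)" by (cases w; cases w')
 have c: "u \<in> LM" "v \<in> LM" "al \<in>. K" "ga \<in>. K" using assms w by auto
 have u: "wev P f e (u, al) = wev P f e (u, \<one>\<^sub>K) \<otimes>\<^sub>P e al" using wev_scale[of u "\<one>\<^sub>K" al] c by simp
 show ?thesis
 proof (cases v)
  case Nil then show ?thesis using c by (simp add: w wev_Nil wev_scale)
 next
  case (Cons Y v')
  then have "wev P f e (wm w w') = wev P f e (u, \<one>\<^sub>K) \<otimes>\<^sub>P ((e al \<otimes>\<^sub>P f Y) \<otimes>\<^sub>P wev P f e (v', ga))"
   using c by (simp add: w wev_append wev_Cons e_f)
  also have "... = wev P f e w \<otimes>\<^sub>P wev P f e w'"
   using c Cons by (simp add: w u wev_Cons P.m_assoc wev_closed)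
  finally show ?thesis .
 qed
qed

lemma word_hom:
 obtains h where "h \<in> ring_hom FW P" "!!w. w \<in> WB ==> h (fof w) = wev P f e w"
  "!!r. r \<in> WR ==> h r = \<zero>\<^sub>P"
proof -
 have wc: "wev P f e w \<in>. P" if "w \<in> WB" for w
  using that wev_closed by (cases w) auto
 obtain h where h: "amap FW P h" "!!w. w \<in> WB ==> h (fof w) = wev P f e w"
  by (rule W.F_lift[OF P.ag, of "wev P f e"]) (use wc in auto)
 have m: "h (x \<otimes>\<^sub>FW y) = h x \<otimes>\<^sub>P h y" if x: "x \<in>. FW" and y: "y \<in>. FW" for x y
 proof (rule W.F_ext[OF _ _ P.ag _ x, of "%x. h (x \<otimes>\<^sub>FW y)"])
  show "amap FW P (%x. h (x \<otimes>\<^sub>FW y))" by (rule amc[OF FW_amapR[OF y] h(1)])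
  show "amap FW P (%x. h x \<otimes>\<^sub>P h y)" by (rule amc[OF h(1) ring_amapR[OF P.ring_axioms amapc[OF h(1) y]]])
  fix p :: "'a list \<times> 'k" assume p: "p \<in> WB"
  then have p': "fof p \<in>. FW" by simp
  show "h (fof p \<otimes>\<^sub>FW y) = h (fof p) \<otimes>\<^sub>P h y"
  proof (rule W.F_ext[OF _ _ P.ag _ y, of "%y. h (fof p \<otimes>\<^sub>FW y)"])
   show "amap FW P (%y. h (fof p \<otimes>\<^sub>FW y))" by (rule amc[OF FW_amapL[OF p'] h(1)])
   show "amap FW P (%y. h (fof p) \<otimes>\<^sub>P h y)" by (rule amc[OF h(1) ring_amapL[OF P.ring_axioms amapc[OF h(1) p']]])
  qed (use p in \<open>simp add: h wm_closed wev_mult\<close>)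
 qed
 have "h \<in> ring_hom FW P"
  using h m by (intro ring_hom_memI) (auto simp: amapc ama FW_one wev_Nil e_simps)
 moreover have "h r = \<zero>\<^sub>P" if "r \<in> WR" for r
 proof -
  note d = W.F_amap_diff[OF h(1) P.ag]
  have z: "h (fof w - fof w1 - fof w2) = \<zero>\<^sub>P"
   if "w \<in> WB" "w1 \<in> WB" "w2 \<in> WB"
    "wev P f e w = wev P f e w1 \<oplus>\<^sub>P wev P f e w2" for w w1 w2
  proof -
   note c = wc[OF that(2)] wc[OF that(3)]
   have "wev P f e w1 \<oplus>\<^sub>P wev P f e w2 \<ominus>\<^sub>P wev P f e w1 = wev P f e w2"
    using c by (simp add: P.a_comm[of "wev P f e w1"] P.minus_eq P.a_assoc P.r_neg)
   then show ?thesis using that(1-3) c by (simp add: d W.F_diff_closed h(2) that(4) P.minus_eq P.r_neg del: mem_Sigma_iff)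
  qed
  have z2: "h (fof w - fof w1) = \<zero>\<^sub>P"
   if "w \<in> WB" "w1 \<in> WB"
    "wev P f e w = wev P f e w1" for w w1
   using that(1,2) wc[OF that(2)] by (simp add: d h(2) that(3) P.minus_eq P.r_neg del: mem_Sigma_iff)
  have a1: "wev P f e (u, al \<oplus>\<^sub>K ga) = wev P f e (u, al) \<oplus>\<^sub>P wev P f e (u, ga)"
   if "u \<in> LM" "al \<in>. K" "ga \<in>. K" for u al ga
   using that by (induction u) (auto simp: wev_Nil wev_Cons e_simps wev_closed P.r_distr)
  from that show ?thesis unfolding word_rels_def
  proof (elim UnE CollectE exE conjE)
   fix u al ga assume "r = fof (u, al \<oplus>\<^sub>K ga) - fof (u, al) - fof (u, ga)"
    "u \<in> LM" "al \<in>. K" "ga \<in>. K"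
   then show ?thesis by (auto intro!: z a1)
  next
   fix u v X Y al assume a: "r = fof (u @ (X \<oplus>\<^sub>M Y) # v, al) - fof (u @ X # v, al) - fof (u @ Y # v, al)"
    "u \<in> LM" "v \<in> LM" "X \<in>. M" "Y \<in>. M" "al \<in>. K"
   have "wev P f e (u @ (X \<oplus>\<^sub>M Y) # v, al)
     = wev P f e (u, \<one>\<^sub>K) \<otimes>\<^sub>P ((f X \<oplus>\<^sub>P f Y) \<otimes>\<^sub>P wev P f e (v, al))"
    using a(2-) by (subst wev_append) (auto simp: wev_Cons ama[OF f_amap])
   also have "... = wev P f e (u, \<one>\<^sub>K) \<otimes>\<^sub>P (f X \<otimes>\<^sub>P wev P f e (v, al))
     \<oplus>\<^sub>P wev P f e (u, \<one>\<^sub>K) \<otimes>\<^sub>P (f Y \<otimes>\<^sub>P wev P f e (v, al))"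
    using a(2-) wev_closed[of u "\<one>\<^sub>K"] wev_closed[of v al] by (simp add: P.l_distr P.r_distr)
   also have "... = wev P f e (u @ X # v, al) \<oplus>\<^sub>P wev P f e (u @ Y # v, al)"
    using a(2-) by (subst (1 2) wev_append) (auto simp: wev_Cons)
   finally show ?thesis unfolding a(1) using a(2-) by (intro z) auto
  next
   fix u v X Y al ga assume "r = fof (u @ X \<bullet>\<^sub>M ga # Y # v, al) - fof (u @ X # lscale K M ga Y # v, al)"
    "u \<in> LM" "v \<in> LM" "X \<in>. M" "Y \<in>. M" "al \<in>. K" "ga \<in>. K"
   then show ?thesis using wev_closed[of v al]
    by (simp only:, intro z2) (simp_all add: wev_append wev_Cons f_scale e_f[symmetric] wev_closed scale_closed P.m_assoc)
  next
   fix u X al ga assume "r = fof (u @ [X \<bullet>\<^sub>M ga], al) - fof (u @ [X], ga \<otimes>\<^sub>K al)"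
    "u \<in> LM" "X \<in>. M" "al \<in>. K" "ga \<in>. K"
   then show ?thesis
    by (simp only:, intro z2) (simp_all add: wev_append wev_Cons wev_Nil f_scale e_simps wev_closed scale_closed P.m_assoc)
  qed
 qed
 ultimately show ?thesis using h(2) that by blast
qed

end

section \<open>Algebras given by a presentation\<close>

lemma ring_kernel_ideal:
 assumes "ring A" "ring B" "f \<in> ring_hom A B"
 shows "ideal {x \<in> carrier A. f x = \<zero>\<^sub>B} A"
 using ring_hom_ring.kernel_is_ideal[OF ring_hom_ringI2[OF assms]]
 by (simp add: a_kernel_def kernel_def)

lemma keys_induct [consumes 1, case_names zero diff of]:
 assumes "Poly_Mapping.keys x <= S" "P 0"
  "!!x y. [|Poly_Mapping.keys x <= S; Poly_Mapping.keys y <= S; P x; P y|] ==> P (x - y)"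
  "!!a. a \<in> S ==> P (fof a)"
 shows "P x"
 by (rule free_Abelian_group_induct[OF assms])

context supermodule begin

lemma word_rels1: "[|u \<in> LM; al \<in>. K; ga \<in>. K|]
  ==> fof (u, al \<oplus>\<^sub>K ga) - fof (u, al) - fof (u, ga) \<in> WR"
 and word_rels2: "[|u \<in> LM; v \<in> LM; X \<in>. M; Y \<in>. M; al \<in>. K|]
  ==> fof (u @ (X \<oplus>\<^sub>M Y) # v, al) - fof (u @ X # v, al) - fof (u @ Y # v, al) \<in> WR"
 and word_rels3: "[|u \<in> LM; v \<in> LM; X \<in>. M; Y \<in>. M; al \<in>. K; ga \<in>. K|]
  ==> fof (u @ X \<bullet>\<^sub>M ga # Y # v, al) - fof (u @ X # lscale K M ga Y # v, al) \<in> WR"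
 and word_rels4: "[|u \<in> LM; X \<in>. M; al \<in>. K; ga \<in>. K|]
  ==> fof (u @ [X \<bullet>\<^sub>M ga], al) - fof (u @ [X], ga \<otimes>\<^sub>K al) \<in> WR"
 unfolding word_rels_def by blast+

lemma word_rels_cases [consumes 1]:
 assumes "r \<in> WR"
 obtains u al ga where "r = fof (u, al \<oplus>\<^sub>K ga) - fof (u, al) - fof (u, ga)"
  "u \<in> LM" "al \<in>. K" "ga \<in>. K"
 | u v X Y al where "r = fof (u @ (X \<oplus>\<^sub>M Y) # v, al) - fof (u @ X # v, al) - fof (u @ Y # v, al)"
  "u \<in> LM" "v \<in> LM" "X \<in>. M" "Y \<in>. M" "al \<in>. K"
 | u v X Y al ga where "r = fof (u @ X \<bullet>\<^sub>M ga # Y # v, al) - fof (u @ X # lscale K M ga Y # v, al)"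
  "u \<in> LM" "v \<in> LM" "X \<in>. M" "Y \<in>. M" "al \<in>. K" "ga \<in>. K"
 | u X al ga where "r = fof (u @ [X \<bullet>\<^sub>M ga], al) - fof (u @ [X], ga \<otimes>\<^sub>K al)"
  "u \<in> LM" "X \<in>. M" "al \<in>. K" "ga \<in>. K"
 using assms unfolding word_rels_def by blast

end

text \<open>A presentation: \<open>q\<close> maps words onto A, \<open>G\<close> collects the
  relations beyond those of the tensor algebra, and \<open>q_min\<close> says that nothing vanishes
  in A except what these relations force. Phrasing minimality by ideals of the word ring treats S(g)
  and U(g) alike and hides that they are quotients of a quotient.\<close>

locale walg = supermodule K M + A: ring A
 for K :: "('k, 'm) graded_ring_scheme" and M :: "('a, 'k, 'n) smodule_scheme"
  and A :: "('b, 'k, 'o) smodule_scheme" +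
 fixes q :: "('a list \<times> 'k \<Rightarrow>\<^sub>0 int) => 'b" and G :: "('a list \<times> 'k \<Rightarrow>\<^sub>0 int) set"
 assumes q_hom: "q \<in> ring_hom FW A" and q_surj: "carrier A = q ` carrier FW"
  and G_sub: "G <= carrier FW"
  and q_rels: "r \<in> WR ==> q r = \<zero>\<^sub>A" and q_G: "r \<in> G ==> q r = \<zero>\<^sub>A"
  and A_scale: "[|x \<in>. A; al \<in>. K|] ==> x \<bullet>\<^sub>A al = x \<otimes>\<^sub>A q (fof ([], al))"
  and A_hpart: "hpart A i = q ` hpart FW i"
  and q_min: "[|ideal J FW; WR <= J; G <= J; t \<in>. FW; q t = \<zero>\<^sub>A |] ==> t \<in> J"
begin

definition \<eta> where "\<eta> al = q (fof ([], al))"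
definition gen where "gen X = q (fof ([X], \<one>\<^sub>K))"

lemma q_amap: "amap FW A q"
 by (rule ring_hom_amap[OF q_hom])

lemma q_mult: "[|s \<in>. FW; t \<in>. FW|] ==> q (s \<otimes>\<^sub>FW t) = q s \<otimes>\<^sub>A q t"
 by (rule ring_hom_mult[OF q_hom])

lemmas q_diff = W.F_amap_diff[OF q_amap A.ag]

lemma q_zero: "q 0 = \<zero>\<^sub>A"
 by (rule W.F_amap_zero[OF q_amap A.ag])

lemma q_of_closed [simp]: "u \<in> LM ==> al \<in>. K ==> q (fof (u, al)) \<in>. A"
 by (rule amapc[OF q_amap]) simp

lemma \<eta>_closed [simp]: "al \<in>. K ==> \<eta> al \<in>. A"
 by (simp add: \<eta>_def)

lemma gen_closed [simp]: "X \<in>. M ==> gen X \<in>. A"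
 by (simp add: gen_def)

lemma q_rel3: assumes "fof w - fof w1 - fof w2 \<in> WR"
  "w \<in> WB" "w1 \<in> WB" "w2 \<in> WB"
 shows "q (fof w) = q (fof w1) \<oplus>\<^sub>A q (fof w2)"
proof -
 have c: "fof w \<in>. FW" "fof w1 \<in>. FW" "fof w2 \<in>. FW" using assms(2-4) by simp_all
 note qc = c[THEN amapc[OF q_amap]]
 have "q (fof w) \<ominus>\<^sub>A (q (fof w1) \<oplus>\<^sub>A q (fof w2)) = \<zero>\<^sub>A"
  using q_rels[OF assms(1)] c qc by (simp add: q_diff W.F_diff_closed A.minus_eq A.minus_add A.a_assoc)
 then show ?thesis using A.minus_zero_eq qc by blast
qed

lemma q_rel2: assumes "fof w - fof w1 \<in> WR"
  "w \<in> WB" "w1 \<in> WB"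
 shows "q (fof w) = q (fof w1)"
proof -
 have c: "fof w \<in>. FW" "fof w1 \<in>. FW" using assms(2-3) by simp_all
 note qc = c[THEN amapc[OF q_amap]]
 have "q (fof w) \<ominus>\<^sub>A q (fof w1) = \<zero>\<^sub>A"
  using q_rels[OF assms(1)] c qc by (simp add: q_diff)
 then show ?thesis using A.minus_zero_eq qc by blast
qed

lemma \<eta>_hom: "\<eta> \<in> ring_hom K A"
proof (rule ring_hom_memI)
 fix al ga assume a: "al \<in>. K" "ga \<in>. K"
 show "\<eta> (al \<otimes>\<^sub>K ga) = \<eta> al \<otimes>\<^sub>A \<eta> ga"
  using a by (simp add: \<eta>_def q_mult[symmetric])
 show "\<eta> (al \<oplus>\<^sub>K ga) = \<eta> al \<oplus>\<^sub>A \<eta> ga"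
  unfolding \<eta>_def by (rule q_rel3[OF word_rels1]) (use a in auto)
next
 show "\<eta> \<one>\<^sub>K = \<one>\<^sub>A" unfolding \<eta>_def using ring_hom_one[OF q_hom] by (simp add: FW_one)
qed simp

lemma q_Cons: "[|X \<in>. M; u \<in> LM; al \<in>. K|]
  ==> q (fof (X # u, al)) = gen X \<otimes>\<^sub>A q (fof (u, al))"
 by (cases u) (auto simp: gen_def q_mult[symmetric])

lemma gen_amap: "amap M A gen"
proof (rule amapI)
 fix X Y assume a: "X \<in>. M" "Y \<in>. M"
 have "fof ([] @ (X \<oplus>\<^sub>M Y) # [], \<one>\<^sub>K) - fof ([] @ X # [], \<one>\<^sub>K) - fof ([] @ Y # [], \<one>\<^sub>K) \<in> WR"
  by (rule word_rels2) (use a in auto)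
 then show "gen (X \<oplus>\<^sub>M Y) = gen X \<oplus>\<^sub>A gen Y"
  unfolding gen_def by (intro q_rel3) (use a in auto)
qed simp

lemma gen_scale: assumes "X \<in>. M" "al \<in>. K" shows "gen (X \<bullet>\<^sub>M al) = gen X \<otimes>\<^sub>A \<eta> al"
proof -
 have "fof ([] @ [X \<bullet>\<^sub>M al], \<one>\<^sub>K) - fof ([] @ [X], al \<otimes>\<^sub>K \<one>\<^sub>K) \<in> WR"
  by (rule word_rels4) (use assms in auto)
 then have "q (fof ([X \<bullet>\<^sub>M al], \<one>\<^sub>K)) = q (fof ([X], al))"
  by (intro q_rel2) (use assms in \<open>auto simp: scale_closed\<close>)
 then show ?thesis using assms unfolding gen_def \<eta>_def by (simp add: q_mult[symmetric])
qed

lemma \<eta>_gen: "[|X \<in>. M; al \<in>. K|] ==> \<eta> al \<otimes>\<^sub>A gen X = gen (lscale K M al X)"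
 unfolding gen_def \<eta>_def by (simp add: q_mult[symmetric])

lemma scale_\<eta>: "[|x \<in>. A; al \<in>. K|] ==> x \<bullet>\<^sub>A al = x \<otimes>\<^sub>A \<eta> al"
 by (simp add: A_scale \<eta>_def)

sublocale gw: whom K M A gen \<eta>
 by unfold_locales (auto simp: \<eta>_hom gen_amap gen_scale \<eta>_gen)

text \<open>The kernel of the evaluation of words is an ideal containing all relations, so by
  \<open>q_min\<close> it contains the kernel of \<open>q\<close>, and the evaluation factors
  through A.\<close>

lemma universal:
 assumes "whom K M P f e"
  "!!h r. [|h \<in> ring_hom FW P; !!w. w \<in> WB ==> h (fof w) = wev P f e w; r \<in> G|] ==> h r = \<zero>\<^sub>P"
 obtains h where "h \<in> ring_hom A P" "!!X. X \<in>. M ==> h (gen X) = f X" "!!al. al \<in>. K ==> h (\<eta> al) = e al"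
proof -
 interpret w: whom K M P f e by fact
 obtain h where h: "h \<in> ring_hom FW P" "!!w. w \<in> WB ==> h (fof w) = wev P f e w"
  "!!r. r \<in> WR ==> h r = \<zero>\<^sub>P" by (rule w.word_hom, rule that) blast+
 have hG: "h r = \<zero>\<^sub>P" if "r \<in> G" for r by (rule assms(2)[OF h(1,2) that])
 note idl = ring_kernel_ideal[OF FW_ring w.P.ring_axioms h(1)]
 have ker: "h t = \<zero>\<^sub>P" if "t \<in>. FW" "q t = \<zero>\<^sub>A" for t
  proof -
  have "WR <= {x \<in> carrier FW. h x = \<zero>\<^sub>P}" "G <= {x \<in> carrier FW. h x = \<zero>\<^sub>P}"
   using word_rels_sub G_sub h(3) hG by blast+
  from q_min[OF idl this that] show ?thesis by blast
 qed
 have eq: "h s = h t" if "s \<in>. FW" "t \<in>. FW" "q s = q t" for s t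
 proof -
  have "q (s - t) = \<zero>\<^sub>A" using that amapc[OF q_amap] by (simp add: q_diff A.minus_eq A.r_neg)
  then have "h s \<ominus>\<^sub>P h t = \<zero>\<^sub>P"
   using ker[of "s - t"] that W.F_amap_diff[OF ring_hom_amap[OF h(1)] w.P.ag] by (simp add: W.F_diff_closed)
  then show ?thesis using w.P.minus_zero_eq[of "h s" "h t"] ring_hom_closed[OF h(1)] that by blast
 qed
 define h' where "h' = (%x. h (SOME t. t \<in>. FW \<and> q t = x))"
 have h': "h' (q t) = h t" if "t \<in>. FW" for t
 proof -
  have "(SOME s. s \<in>. FW \<and> q s = q t) \<in>. FW \<and> q (SOME s. s \<in>. FW \<and> q s = q t) = q t"
   by (rule someI[of _ t]) (use that in simp)
  then show ?thesis unfolding h'_def using eq that by blast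
 qed
 have "h' \<in> ring_hom A P"
 proof (rule ring_hom_memI)
  fix x assume "x \<in>. A" then show "h' x \<in>. P" using ring_hom_closed[OF h(1)] by (auto simp: q_surj h')
 next
  fix x y assume "x \<in>. A" "y \<in>. A"
  then obtain s t where s: "s \<in>. FW" "t \<in>. FW" "x = q s" "y = q t" by (auto simp: q_surj)
  then have c: "s \<otimes>\<^sub>FW t \<in>. FW" "s \<oplus>\<^sub>FW t \<in>. FW"
   using FW_ring by (auto intro: ring.ring_simprules)
  have "h' (x \<otimes>\<^sub>A y) = h (s \<otimes>\<^sub>FW t)" using h'[OF c(1)] s q_mult[of s t] by simp
  then show "h' (x \<otimes>\<^sub>A y) = h' x \<otimes>\<^sub>P h' y" using s h' ring_hom_mult[OF h(1)] by simp
  have "h' (x \<oplus>\<^sub>A y) = h (s \<oplus>\<^sub>FW t)" using h'[OF c(2)] s ama[OF q_amap, of s t] by simp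
  then show "h' (x \<oplus>\<^sub>A y) = h' x \<oplus>\<^sub>P h' y" using s h' ring_hom_add[OF h(1)] by simp
 next
  show "h' \<one>\<^sub>A = \<one>\<^sub>P" using h'[of "\<one>\<^sub>FW"] ring_hom_one[OF q_hom] ring_hom_one[OF h(1)] FW_one by simp
 qed
 moreover have "h' (gen X) = f X" if "X \<in>. M" for X
  using that by (simp add: gen_def h' h(2) w.wev_Cons w.wev_Nil w.e_simps)
 moreover have "h' (\<eta> al) = e al" if "al \<in>. K" for al
  using that by (simp add: \<eta>_def h' h(2) w.wev_Nil)
 ultimately show ?thesis using that by blast
qed

text \<open>A sign can be absorbed into the scalar of a word. For this reason the induction
  principles below need no case for negatives.\<close>

lemma q_frag_neg: assumes "u \<in> LM" "al \<in>. K"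
 shows "\<ominus>\<^sub>A q (fof (u, al)) = q (fof (u, \<ominus>\<^sub>K al))"
proof -
 have "q (fof (u, \<ominus>\<^sub>K al)) \<oplus>\<^sub>A q (fof (u, al)) = q (fof (u, \<ominus>\<^sub>K al \<oplus>\<^sub>K al))"
  by (rule q_rel3[OF word_rels1, symmetric]) (use assms in auto)
 also have "... = \<zero>\<^sub>A"
 proof -
  have "q (fof (u, \<zero>\<^sub>K)) = q (fof (u, \<zero>\<^sub>K)) \<oplus>\<^sub>A q (fof (u, \<zero>\<^sub>K))"
   using assms word_rels1[of u "\<zero>\<^sub>K" "\<zero>\<^sub>K"] by (intro q_rel3) auto
  then show ?thesis using assms by (simp add: l_neg)
 qed
 finally show ?thesis using assms by (intro A.minus_equality) auto
qed

lemma A_induct [consumes 1, case_names \<eta> gen add]: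
 assumes "x \<in>. A" "!!i al. al \<in> hpart K i ==> Q (\<eta> al)"
  "!!i X x. [|X \<in> hpart M i; x \<in>. A; Q x|] ==> Q (gen X \<otimes>\<^sub>A x)"
  "!!x y. [|x \<in>. A; y \<in>. A; Q x; Q y|] ==> Q (x \<oplus>\<^sub>A y)"
 shows "Q x"
proof -
 have w: "Q (q (fof (u, al)))" if "u \<in> LM" "al \<in>. K" for u al
  using that(1)
 proof (induction u)
  case Nil
  from that(2) show ?case unfolding \<eta>_def[symmetric]
  proof (induction rule: KG.homog_induct)
   case (homog i a) then show ?case by (rule assms(2))
  next
   case (add a b) then show ?case using assms(4) ring_hom_add[OF \<eta>_hom] by simp
  qed
 next
  case (Cons X u)
  then have c: "q (fof (u, al)) \<in>. A" using that by simp
  have "Q (gen X \<otimes>\<^sub>A q (fof (u, al)))" using Cons(1)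
  proof (induction rule: MG.homog_induct)
   case (homog i X) then show ?case using assms(3) c Cons.IH by blast
  next
   case (add X Y) then show ?case using assms(4) c by (simp add: ama[OF gen_amap] A.l_distr)
  qed
  then show ?case using Cons that by (simp add: q_Cons)
 qed
 obtain t where t: "t \<in>. FW" "x = q t" using assms(1) by (auto simp: q_surj)
 note qc = amapc[OF q_amap]
 \<comment> \<open>Induction over a free abelian group proceeds by differences, so the claim is
   carried together with its negative.\<close>
 have "Q (q t) \<and> Q (\<ominus>\<^sub>A q t)" using t(1)
 proof (induction rule: W.F_induct)
  case zero
  have "\<eta> \<zero>\<^sub>K = \<zero>\<^sub>A" using amap_zero[OF ring_hom_amap[OF \<eta>_hom]] ag A.ag by auto
  then show ?case using assms(2)[OF KG.hp_zero] by (simp add: q_zero)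
 next
  case (diff s t)
  have "Q (q s \<oplus>\<^sub>A \<ominus>\<^sub>A q t)" "Q (q t \<oplus>\<^sub>A \<ominus>\<^sub>A q s)" using diff qc by (auto intro!: assms(4))
  then show ?case using diff qc by (simp add: q_diff A.minus_eq A.minus_add A.a_comm)
 next
  case (of w) then show ?case using w by (cases w) (auto simp: q_frag_neg)
 qed
 then show ?thesis using t by simp
qed

abbreviation HW where "HW i \<equiv> {(u, al). \<exists>ps k. list_all2 (%p X. X \<in> hpart M p) ps u \<and> al \<in> hpart K k \<and> i = sum_list ps + k}"

lemma HW_sub: "HW i <= WB"
proof -
 have "u \<in> LM" if "list_all2 (%p X. X \<in> hpart M p) ps u" for ps u
  using that by (induction) auto
 then show ?thesis by auto
qed

lemma FW_hpart: "t \<in> hpart FW i \<longleftrightarrow> Poly_Mapping.keys t <= HW i"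
 by (simp add: free_words_def)

lemma hpart_FW_sub: "hpart FW i <= carrier FW"
proof
 fix t assume "t \<in> hpart FW i"
 then have "Poly_Mapping.keys t <= HW i" by (simp only: FW_hpart)
 then have "Poly_Mapping.keys t <= WB" using HW_sub[of i] by (rule order_trans)
 then show "t \<in>. FW" by (simp only: W.F_carr_iff)
qed

lemma A_hpart_of: "(u, al) \<in> HW i ==> q (fof (u, al)) \<in> hpart A i"
 unfolding A_hpart by (rule imageI) (subst FW_hpart, simp)

lemma A_hp_sub: "additive_subgroup (hpart A i) A"
proof (rule additive_subgroupI'[OF A.ag])
 show "hpart A i <= carrier A" using hpart_FW_sub amapc[OF q_amap] by (auto simp: A_hpart)
 show "\<zero>\<^sub>A \<in> hpart A i" unfolding A_hpart q_zero[symmetric] by (rule imageI) (simp add: FW_hpart)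
next
 fix x y assume "x \<in> hpart A i" "y \<in> hpart A i"
 then obtain s t where s: "s \<in> hpart FW i" "t \<in> hpart FW i" "x = q s" "y = q t" by (auto simp: A_hpart)
 then have c: "s \<in>. FW" "t \<in>. FW" using hpart_FW_sub by auto
 have "x \<oplus>\<^sub>A y = q (s + t)" using ama[OF q_amap c] s by (simp add: W.F_plus)
 moreover have "s + t \<in> hpart FW i" using s(1,2) keys_add[of s t] by (auto simp: FW_hpart)
 ultimately show "x \<oplus>\<^sub>A y \<in> hpart A i" by (simp add: A_hpart)
next
 fix x assume "x \<in> hpart A i"
 then obtain s where s: "s \<in> hpart FW i" "x = q s" by (auto simp: A_hpart)
 then have c: "s \<in>. FW" using hpart_FW_sub by auto
 have "\<ominus>\<^sub>A x = q (- s)" using amap_neg[OF q_amap W.F_group A.ag c] s c by (simp add: W.F_neg)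
 moreover have "- s \<in> hpart FW i" using s(1) by (auto simp: FW_hpart)
 ultimately show "\<ominus>\<^sub>A x \<in> hpart A i" by (simp add: A_hpart)
qed

lemmas A_hp_closed = additive_subgroup_closed[OF A_hp_sub]

text \<open>Follows the parity along the word. It rests on the description of
  \<open>hpart A j\<close> as the image of combinations of homogeneous words, and so is available
  before the two parts are known to meet in zero.\<close>

lemma A_hinduct [consumes 1, case_names \<eta> gen add]:
 assumes "x \<in> hpart A j" "!!i al. al \<in> hpart K i ==> Q i (\<eta> al)"
  "!!i j X x. [|X \<in> hpart M i; x \<in> hpart A j; Q j x|] ==> Q (i + j) (gen X \<otimes>\<^sub>A x)"
  "!!j x y. [|x \<in> hpart A j; y \<in> hpart A j; Q j x; Q j y|] ==> Q j (x \<oplus>\<^sub>A y)"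
 shows "Q j x"
proof -
 have w: "Q (sum_list ps + k) (q (fof (u, al)))" if "list_all2 (%p X. X \<in> hpart M p) ps u" "al \<in> hpart K k" for ps u al k
  using that(1)
 proof induction
  case Nil
  then show ?case using assms(2) that(2) by (simp add: \<eta>_def)
 next
  case (Cons p ps X u)
  have "(u, al) \<in> HW (sum_list ps + k)" using Cons that(2) by auto
  then have "q (fof (u, al)) \<in> hpart A (sum_list ps + k)" and u: "u \<in> LM"
   using A_hpart_of HW_sub by blast+
  from assms(3)[OF Cons(1) this(1) Cons.IH] show ?case
   using q_Cons[OF MG.hpc[OF Cons(1)] u KG.hpc[OF that(2)]] by (simp add: add.assoc)
 qed
 have w': "Q i (q (fof b)) \<and> Q i (\<ominus>\<^sub>A q (fof b))" if bm: "b \<in> HW i" for b i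
 proof -
  obtain u al ps k where b: "b = (u, al)" "list_all2 (%p X. X \<in> hpart M p) ps u" "al \<in> hpart K k" "i = sum_list ps + k"
   using bm by (cases b) auto
  have "u \<in> LM" using bm HW_sub b(1) by blast
  then have "\<ominus>\<^sub>A q (fof b) = q (fof (u, \<ominus>\<^sub>K al))" using b q_frag_neg by auto
  then show ?thesis using w[OF b(2,3)] w[OF b(2) KG.hp_neg[OF b(3)]] b by simp
 qed
 obtain t where t: "t \<in> hpart FW j" "x = q t" using assms(1) by (auto simp: A_hpart)
 note qc = amapc[OF q_amap]
 have t': "Poly_Mapping.keys t <= HW j" using t FW_hpart by simp
 have "Q j (q t) \<and> Q j (\<ominus>\<^sub>A q t)" using t'
 proof (induction rule: keys_induct)
  case zero
  have z: "q (fof ([], \<zero>\<^sub>K)) = \<zero>\<^sub>A"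
   using amap_zero[OF ring_hom_amap[OF \<eta>_hom] ag A.ag] by (simp add: \<eta>_def)
  have "([], \<zero>\<^sub>K) \<in> HW j" by (auto intro!: exI[of _ "[]"] exI[of _ j])
  from w'[OF this] show ?case by (simp add: q_zero z)
 next
  case (diff s t)
  have h: "s \<in> hpart FW j" "t \<in> hpart FW j" using diff(1,2) by (simp_all only: FW_hpart)
  then have c: "s \<in>. FW" "t \<in>. FW" using hpart_FW_sub by auto
  have m: "q s \<in> hpart A j" "q t \<in> hpart A j" using h by (auto simp: A_hpart)
  then have n: "\<ominus>\<^sub>A q s \<in> hpart A j" "\<ominus>\<^sub>A q t \<in> hpart A j"
   using additive_subgroup_neg[OF A_hp_sub A.ag] by auto
  have "Q j (q s \<oplus>\<^sub>A \<ominus>\<^sub>A q t)" "Q j (q t \<oplus>\<^sub>A \<ominus>\<^sub>A q s)" using diff(3,4) m n by (auto intro!: assms(4))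
  then show ?case using c qc by (simp add: q_diff A.minus_eq A.minus_add A.a_comm)
 next
  case (of b) then show ?case using w' by blast
 qed
 then show ?thesis using t by simp
qed

lemma \<eta>_hp: "al \<in> hpart K i ==> \<eta> al \<in> hpart A i"
 unfolding \<eta>_def by (rule A_hpart_of) (auto intro!: exI[of _ "[]"])

lemma gen_hp: "X \<in> hpart M i ==> gen X \<in> hpart A i"
 unfolding gen_def by (rule A_hpart_of) (auto intro!: exI[of _ "[i]"] exI[of _ 0] simp: one_even)

lemma HW_mult: assumes "p \<in> HW i" "r \<in> HW j" shows "wm p r \<in> HW (i + j)"
proof -
 obtain u al ps k where p: "p = (u, al)" "list_all2 (%p X. X \<in> hpart M p) ps u" "al \<in> hpart K k" "i = sum_list ps + k"
  using assms(1) by (cases p) auto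
 obtain v ga rs l where r: "r = (v, ga)" "list_all2 (%p X. X \<in> hpart M p) rs v" "ga \<in> hpart K l" "j = sum_list rs + l"
  using assms(2) by (cases r) auto
 show ?thesis
 proof (cases v)
  case Nil
  then show ?thesis using p r mult_parity[OF p(3) r(3)]
   by (auto intro!: exI[of _ ps] exI[of _ "k + l"] simp: add.assoc)
 next
  case (Cons Y v')
  then obtain b rs' where rs: "rs = b # rs'" "Y \<in> hpart M b" "list_all2 (%p X. X \<in> hpart M p) rs' v'"
   using r(2) by (auto simp: list_all2_Cons2)
  have "list_all2 (%p X. X \<in> hpart M p) (ps @ (k + b) # rs') (u @ lscale K M al Y # v')"
   using p rs lscale_hp by (auto intro!: list_all2_appendI)
  then show ?thesis using p(1) r rs Cons
   by (auto intro!: exI[of _ "ps @ (k + b) # rs'"] exI[of _ l] simp: p(4) add.assoc)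
 qed
qed

lemma FW_hp_mult: assumes "s \<in> hpart FW i" "t \<in> hpart FW j" shows "s \<otimes>\<^sub>FW t \<in> hpart FW (i + j)"
proof -
 \<comment> \<open>The homogeneous words of one parity span a free group of their own; extending
   \<open>word_mult\<close> between such groups keeps track of the parity.\<close>
 have fr: "fragg (FW\<lparr>carrier := hpart FW i\<rparr>) (HW i)" for i
  by unfold_locales (auto simp: FW_hpart free_words_def)
 have t: "t \<in>. (FW\<lparr>carrier := hpart FW j\<rparr>)" and s: "s \<in>. (FW\<lparr>carrier := hpart FW i\<rparr>)" using assms by simp_all
 have "frag_extend (%p. frag_extend (%r. fof (wm p r)) t) s \<in> carrier (FW\<lparr>carrier := hpart FW (i + j)\<rparr>)"
 proof (rule amapc[OF fragg.F_extend_amap[OF fr fr] s])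
  fix p assume p: "p \<in> HW i"
  show "frag_extend (%r. fof (wm p r)) t \<in> carrier (FW\<lparr>carrier := hpart FW (i + j)\<rparr>)"
   by (rule amapc[OF fragg.F_extend_amap[OF fr fr] t], subst fragg.F_of[OF fr], rule HW_mult[OF p])
 qed
 then show ?thesis by (simp add: FW_mult)
qed

lemma A_hp_mult: assumes "x \<in> hpart A i" "y \<in> hpart A j" shows "x \<otimes>\<^sub>A y \<in> hpart A (i + j)"
proof -
 obtain s t where s: "s \<in> hpart FW i" "t \<in> hpart FW j" "x = q s" "y = q t" using assms by (auto simp: A_hpart)
 then have "x \<otimes>\<^sub>A y = q (s \<otimes>\<^sub>FW t)" using hpart_FW_sub by (auto intro!: q_mult[symmetric])
 then show ?thesis using FW_hp_mult[OF s(1,2)] by (simp add: A_hpart)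
qed

lemma A_decomp: "x \<in>. A ==> \<exists>y\<in>hpart A 0. \<exists>z\<in>hpart A 1. x = y \<oplus>\<^sub>A z"
proof (induction rule: A_induct)
 case (\<eta> i al)
 have h: "\<eta> al \<in> hpart A i" "\<eta> al \<in>. A" using \<eta>_hp[OF \<eta>] A_hp_closed(1) by auto
 show ?case
 proof (cases "i = 0")
  case True then show ?thesis using h A_hp_closed(3)[of 1] by (intro bexI[of _ "\<eta> al"] bexI[of _ "\<zero>\<^sub>A"]) auto
 next
  case False then have "i = 1" by simp
  then show ?thesis using h A_hp_closed(3)[of 0] by (intro bexI[of _ "\<zero>\<^sub>A"] bexI[of _ "\<eta> al"]) auto
 qed
next
 case (gen i X x)
 then obtain y z where x: "y \<in> hpart A 0" "z \<in> hpart A 1" "x = y \<oplus>\<^sub>A z" by blast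
 then have c: "y \<in>. A" "z \<in>. A" "X \<in>. M" using gen A_hp_closed(1) by auto
 have m: "gen X \<otimes>\<^sub>A y \<in> hpart A i" "gen X \<otimes>\<^sub>A z \<in> hpart A (i + 1)"
  using A_hp_mult[OF gen_hp[OF gen(1)] x(1)] A_hp_mult[OF gen_hp[OF gen(1)] x(2)] by auto
 have e: "gen X \<otimes>\<^sub>A x = gen X \<otimes>\<^sub>A y \<oplus>\<^sub>A gen X \<otimes>\<^sub>A z" using c x by (simp add: A.r_distr)
 show ?case
 proof (cases "i = 0")
  case True then show ?thesis using m e by auto
 next
  case False then have "i = 1" by simp
  then show ?thesis using m c unfolding e
   by (intro bexI[of _ "gen X \<otimes>\<^sub>A z"] bexI[of _ "gen X \<otimes>\<^sub>A y"] A.a_comm) auto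
 qed
next
 case (add x y)
 then obtain a b c d where "a \<in> hpart A 0" "b \<in> hpart A 1" "x = a \<oplus>\<^sub>A b" "c \<in> hpart A 0" "d \<in> hpart A 1" "y = c \<oplus>\<^sub>A d"
  by blast
 then show ?case
  by (intro bexI[of _ "a \<oplus>\<^sub>A c"] bexI[of _ "b \<oplus>\<^sub>A d"]) (auto simp: A_hp_closed A.add4)
qed

text \<open>Yields the parity automorphism of A, which multiplies homogeneous letters and scalars by
  (-1)^p.\<close>

lemma theta_whom: "whom K M A (%X. gen (MG.tw 1 X)) (%al. \<eta> (KG.tw 1 al))"
proof unfold_locales
 show "(%al. \<eta> (KG.tw 1 al)) \<in> ring_hom K A"
  using ring_hom_mult[OF \<eta>_hom] ring_hom_add[OF \<eta>_hom] ring_hom_one[OF \<eta>_hom]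
  by (intro ring_hom_memI) (auto simp: tw_mult_K ama[OF KG.tw_amap] KG.tw_homog[OF one_even])
 show "amap M A (%X. gen (MG.tw 1 X))" by (rule amc[OF MG.tw_amap gen_amap])
qed (auto simp: tw_scale tw_lscale gen_scale \<eta>_gen)

text \<open>The parity automorphism is the identity on the even part and minus the identity on the
  odd part. A common element x satisfies 2 x = 0, and 2 is a unit. Assumption \<open>G\<close> says
  that the automorphism respects the relations.\<close>

lemma inter_theta:
 assumes two: "[(2::nat)] \<cdot>\<^sub>K \<one>\<^sub>K \<in> Units K"
  and G: "!!h r. [|h \<in> ring_hom FW A; !!w. w \<in> WB ==>
    h (fof w) = wev A (%X. gen (MG.tw 1 X)) (%al. \<eta> (KG.tw 1 al)) w; r \<in> G|] ==> h r = \<zero>\<^sub>A"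
  and x: "x \<in> hpart A 0" "x \<in> hpart A 1"
 shows "x = \<zero>\<^sub>A"
proof -
 obtain h where h: "h \<in> ring_hom A A" "!!X. X \<in>. M ==> h (gen X) = gen (MG.tw 1 X)"
  "!!al. al \<in>. K ==> h (\<eta> al) = \<eta> (KG.tw 1 al)"
  by (rule universal[OF theta_whom]) (use G in blast)+
 have s: "h x = sg A j x" if "x \<in> hpart A j" for x j using that
 proof (induction rule: A_hinduct)
  case (\<eta> i al)
  then show ?case using amap_sg[OF ring_hom_amap[OF \<eta>_hom] ag A.ag]
   by (simp add: h KG.tw_homog KG.hpc)
 next
  case (gen i j X x)
  then have c: "X \<in>. M" "x \<in>. A" using A_hp_closed by auto
  have "h (gen X \<otimes>\<^sub>A x) = sg A i (gen X) \<otimes>\<^sub>A sg A j x"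
   using c gen ring_hom_mult[OF h(1)] amap_sg[OF gen_amap M.ag A.ag]
   by (simp add: h MG.tw_homog)
  then show ?case using c by (cases i; cases j) (simp_all add: A.l_minus A.r_minus)
 next
  case (add j x y) then show ?case using ring_hom_add[OF h(1)] A_hp_closed(1) by (simp add: A.sg_add)
 qed
 have c: "x \<in>. A" using x A_hp_closed by auto
 have "x = \<ominus>\<^sub>A x" using s[OF x(1)] s[OF x(2)] by simp
 then have "x \<oplus>\<^sub>A x = \<zero>\<^sub>A" using c A.r_neg by metis
 moreover have t: "[(2::nat)] \<cdot>\<^sub>K \<one>\<^sub>K = \<one>\<^sub>K \<oplus>\<^sub>K \<one>\<^sub>K" by (simp add: numeral_2_eq_2)
 note ea = ring_hom_one[OF \<eta>_hom] ring_hom_add[OF \<eta>_hom] ring_hom_mult[OF \<eta>_hom]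
 have "x \<oplus>\<^sub>A x = x \<otimes>\<^sub>A \<eta> (\<one>\<^sub>K \<oplus>\<^sub>K \<one>\<^sub>K)" using c by (simp add: ea A.r_distr)
 ultimately have z: "x \<otimes>\<^sub>A \<eta> (\<one>\<^sub>K \<oplus>\<^sub>K \<one>\<^sub>K) = \<zero>\<^sub>A" by simp
 obtain d where d: "d \<in>. K" "(\<one>\<^sub>K \<oplus>\<^sub>K \<one>\<^sub>K) \<otimes>\<^sub>K d = \<one>\<^sub>K" using two t unfolding Units_def by auto
 have "x = x \<otimes>\<^sub>A \<eta> ((\<one>\<^sub>K \<oplus>\<^sub>K \<one>\<^sub>K) \<otimes>\<^sub>K d)" using c d(2) by (simp add: ea)
 also have "... = (x \<otimes>\<^sub>A \<eta> (\<one>\<^sub>K \<oplus>\<^sub>K \<one>\<^sub>K)) \<otimes>\<^sub>A \<eta> d"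
  using c d(1) by (subst ea(3)) (auto simp: A.m_assoc)
 finally show ?thesis using z d(1) by simp
qed

text \<open>If K and M have no odd elements other than zero, induction on words shows that the odd
  part of A is zero as well.\<close>

lemma inter_even:
 assumes "carrier K = hpart K 0" "carrier M = hpart M 0" and x: "x \<in> hpart A 0" "x \<in> hpart A 1"
 shows "x = \<zero>\<^sub>A"
proof -
 have k: "a = \<zero>\<^sub>K" if "a \<in> hpart K 1" for a using assms(1) KG.hp_inter[of a] that KG.hpc by auto
 have m: "a = \<zero>\<^sub>M" if "a \<in> hpart M 1" for a using assms(2) MG.hp_inter[of a] that MG.hpc by auto
 have "j = 1 --> x = \<zero>\<^sub>A" if "x \<in> hpart A j" for x j using that
 proof (induction rule: A_hinduct)
  case (\<eta> i al) then show ?case using k amap_zero[OF ring_hom_amap[OF \<eta>_hom] ag A.ag] by auto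
 next
  case (gen i j X x)
  then have c: "x \<in>. A" "X \<in>. M" using A_hp_closed by auto
  show ?case
  proof (cases "i = 1")
   case True then have "X = \<zero>\<^sub>M" using gen m by simp
   then have "gen X = \<zero>\<^sub>A" using amap_zero[OF gen_amap M.ag A.ag] by simp
   then show ?thesis using c by simp
  next
   case False then show ?thesis using gen c by auto
  qed
 next
  case (add j x y) then show ?case by auto
 qed
 then show ?thesis using x by auto
qed

end

section \<open>The tensor algebra and its quotients S(g) and U(g)\<close>

lemma preimage_subgroup:
 assumes "abelian_group F" "abelian_group P" "amap F P h" "additive_subgroup J P"
 shows "additive_subgroup {x \<in> carrier F. h x \<in> J} F"
proof -
 interpret F: abelian_group F by fact
 note J = additive_subgroup_closed[OF assms(4)] additive_subgroup_neg[OF assms(4,2)]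
 show ?thesis
  by (rule additive_subgroupI'[OF assms(1)])
    (auto simp: amap_zero[OF assms(3,1,2)] ama[OF assms(3)] amap_neg[OF assms(3,1,2)] J)
qed

lemma image_setcompr4:
 assumes "!!v w i j. P v w i j ==> F (f v w i j) = f' v w i j"
 shows "F ` {f v w i j | v w i j. P v w i j} = {f' v w i j | v w i j. P v w i j}"
 using assms by (fastforce simp: image_iff)

lemma image_setcompr1:
 assumes "!!u. P u ==> F (f u) = f' u" shows "F ` {f u | u. P u} = {f' u | u. P u}"
 using assms by (fastforce simp: image_iff)

context supermodule begin

lemma FW_diffL: "[|s \<in>. FW; a \<in>. FW; b \<in>. FW|] ==> s \<otimes>\<^sub>FW (a - b) = s \<otimes>\<^sub>FW a - s \<otimes>\<^sub>FW b"
 using W.F_amap_diff[OF FW_amapL W.F_group] W.F_minus amapc[OF FW_amapL] by metis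

lemma FW_diffR: "[|s \<in>. FW; a \<in>. FW; b \<in>. FW|] ==> (a - b) \<otimes>\<^sub>FW s = a \<otimes>\<^sub>FW s - b \<otimes>\<^sub>FW s"
 using W.F_amap_diff[OF FW_amapR W.F_group] W.F_minus amapc[OF FW_amapR] by metis

lemma FW_of_diffs:
 assumes "p \<in> WB" "a \<in> WB"
  "b \<in> WB"
 shows "fof p \<otimes>\<^sub>FW (fof a - fof b) = fof (wm p a) - fof (wm p b)"
  "(fof a - fof b) \<otimes>\<^sub>FW fof p = fof (wm a p) - fof (wm b p)"
 using assms FW_diffL[of "fof p" "fof a" "fof b"] FW_diffR[of "fof p" "fof a" "fof b"]
 by (simp_all del: mem_Sigma_iff)

lemma FW_of_diffs3:
 assumes "p \<in> WB" "a \<in> WB"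
  "b \<in> WB" "c \<in> WB"
 shows "fof p \<otimes>\<^sub>FW (fof a - fof b - fof c)
   = fof (wm p a) - fof (wm p b) - fof (wm p c)"
  "(fof a - fof b - fof c) \<otimes>\<^sub>FW fof p
   = fof (wm a p) - fof (wm b p) - fof (wm c p)"
proof -
 have c: "fof p \<in>. FW" "fof a - fof b \<in>. FW" "fof c \<in>. FW"
  using assms by (auto intro!: W.F_diff_closed simp del: mem_Sigma_iff)
 show "fof p \<otimes>\<^sub>FW (fof a - fof b - fof c)
   = fof (wm p a) - fof (wm p b) - fof (wm p c)"
  using FW_diffL[OF c] FW_of_diffs(1)[OF assms(1-3)] by simp
 show "(fof a - fof b - fof c) \<otimes>\<^sub>FW fof p
   = fof (wm a p) - fof (wm b p) - fof (wm c p)"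
  using FW_diffR[OF c] FW_of_diffs(2)[OF assms(1-3)] by simp
qed

text \<open>A word times a relation is again a single relation, not just a combination of relations.
  The scalar of the word lands on the first letter of the other factor, and interferes with the
  relation only if \<open>u\<close> is empty.\<close>

lemma rels_wordL: assumes "r \<in> WR" "p \<in> WB"
 shows "fof p \<otimes>\<^sub>FW r \<in> WR"
proof -
 obtain w \<delta> where p: "p = (w, \<delta>)" "w \<in> LM" "\<delta> \<in>. K" using assms(2) by auto
 from assms(1) show ?thesis
 proof (cases rule: word_rels_cases)
  case (1 u al ga)
  have "fof p \<otimes>\<^sub>FW r = fof (wm p (u, al \<oplus>\<^sub>K ga)) - fof (wm p (u, al)) - fof (wm p (u, ga))"
   unfolding 1(1) using 1 assms(2) by (intro FW_of_diffs3) auto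
  moreover have "... \<in> WR"
  proof (cases u)
   case Nil then show ?thesis using word_rels1[of w "\<delta> \<otimes>\<^sub>K al" "\<delta> \<otimes>\<^sub>K ga"] 1 p by (simp add: r_distr)
  next
   case (Cons Y u') then show ?thesis using word_rels1[of "w @ lscale K M \<delta> Y # u'" al ga] 1 p by simp
  qed
  ultimately show ?thesis by simp
 next
  case (2 u v X Y al)
  have "fof p \<otimes>\<^sub>FW r = fof (wm p (u @ (X \<oplus>\<^sub>M Y) # v, al)) - fof (wm p (u @ X # v, al))
    - fof (wm p (u @ Y # v, al))"
   unfolding 2(1) using 2 assms(2) by (intro FW_of_diffs3) auto
  moreover have "... \<in> WR"
  proof (cases u)
   case Nil then show ?thesis using word_rels2[of w v "lscale K M \<delta> X" "lscale K M \<delta> Y" al] 2 p by (simp add: ama[OF lscale_amap1])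
  next
   case (Cons Z u') then show ?thesis using word_rels2[of "w @ lscale K M \<delta> Z # u'" v X Y al] 2 p by simp
  qed
  ultimately show ?thesis by simp
 next
  case (3 u v X Y al ga)
  have "fof p \<otimes>\<^sub>FW r = fof (wm p (u @ X \<bullet>\<^sub>M ga # Y # v, al))
    - fof (wm p (u @ X # lscale K M ga Y # v, al))"
   unfolding 3(1) using 3 assms(2) by (intro FW_of_diffs) (auto simp: scale_closed)
  moreover have "... \<in> WR"
  proof (cases u)
   case Nil then show ?thesis using word_rels3[of w v "lscale K M \<delta> X" Y al ga] 3 p by (simp add: lscale_scale)
  next
   case (Cons Z u') then show ?thesis using word_rels3[of "w @ lscale K M \<delta> Z # u'" v X Y al ga] 3 p by simp
  qed
  ultimately show ?thesis by simp
 next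
  case (4 u X al ga)
  have "fof p \<otimes>\<^sub>FW r = fof (wm p (u @ [X \<bullet>\<^sub>M ga], al)) - fof (wm p (u @ [X], ga \<otimes>\<^sub>K al))"
   unfolding 4(1) using 4 assms(2) by (intro FW_of_diffs) (auto simp: scale_closed)
  moreover have "... \<in> WR"
  proof (cases u)
   case Nil then show ?thesis using word_rels4[of w "lscale K M \<delta> X" al ga] 4 p by (simp add: lscale_scale)
  next
   case (Cons Z u') then show ?thesis using word_rels4[of "w @ lscale K M \<delta> Z # u'" X al ga] 4 p by simp
  qed
  ultimately show ?thesis by simp
 qed
qed

text \<open>Here the type of the relation may change: one that concerns the final scalar turns into
  one between letters, as the scalar moves into the first letter of the word on the right.\<close>

lemma rels_wordR: assumes "r \<in> WR" "p \<in> WB"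
 shows "r \<otimes>\<^sub>FW fof p \<in> WR"
proof -
 obtain w \<delta> where p: "p = (w, \<delta>)" "w \<in> LM" "\<delta> \<in>. K" using assms(2) by auto
 from assms(1) show ?thesis
 proof (cases rule: word_rels_cases)
  case (1 u al ga)
  have "r \<otimes>\<^sub>FW fof p = fof (wm (u, al \<oplus>\<^sub>K ga) p) - fof (wm (u, al) p) - fof (wm (u, ga) p)"
   unfolding 1(1) using 1 assms(2) by (intro FW_of_diffs3) auto
  moreover have "... \<in> WR"
  proof (cases w)
   case Nil then show ?thesis using word_rels1[of u "al \<otimes>\<^sub>K \<delta>" "ga \<otimes>\<^sub>K \<delta>"] 1 p by (simp add: l_distr)
  next
   case (Cons Y u') then show ?thesis using word_rels2[of u u' "lscale K M al Y" "lscale K M ga Y" \<delta>] 1 p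
    by (simp add: ama[OF lscale_amap2])
  qed
  ultimately show ?thesis by simp
 next
  case (2 u v X Y al)
  have "r \<otimes>\<^sub>FW fof p = fof (wm (u @ (X \<oplus>\<^sub>M Y) # v, al) p) - fof (wm (u @ X # v, al) p)
    - fof (wm (u @ Y # v, al) p)"
   unfolding 2(1) using 2 assms(2) by (intro FW_of_diffs3) auto
  moreover have "... \<in> WR"
  proof (cases w)
   case Nil then show ?thesis using word_rels2[of u v X Y "al \<otimes>\<^sub>K \<delta>"] 2 p by simp
  next
   case (Cons Z u') then show ?thesis using word_rels2[of u "v @ lscale K M al Z # u'" X Y \<delta>] 2 p by simp
  qed
  ultimately show ?thesis by simp
 next
  case (3 u v X Y al ga)
  have "r \<otimes>\<^sub>FW fof p = fof (wm (u @ X \<bullet>\<^sub>M ga # Y # v, al) p)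
    - fof (wm (u @ X # lscale K M ga Y # v, al) p)"
   unfolding 3(1) using 3 assms(2) by (intro FW_of_diffs) (auto simp: scale_closed)
  moreover have "... \<in> WR"
  proof (cases w)
   case Nil then show ?thesis using word_rels3[of u v X Y "al \<otimes>\<^sub>K \<delta>" ga] 3 p by simp
  next
   case (Cons Z u') then show ?thesis using word_rels3[of u "v @ lscale K M al Z # u'" X Y \<delta> ga] 3 p by simp
  qed
  ultimately show ?thesis by simp
 next
  case (4 u X al ga)
  have "r \<otimes>\<^sub>FW fof p = fof (wm (u @ [X \<bullet>\<^sub>M ga], al) p) - fof (wm (u @ [X], ga \<otimes>\<^sub>K al) p)"
   unfolding 4(1) using 4 assms(2) by (intro FW_of_diffs) (auto simp: scale_closed)
  moreover have "... \<in> WR"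
  proof (cases w)
   case Nil then show ?thesis using word_rels4[of u X "al \<otimes>\<^sub>K \<delta>" ga] 4 p by (simp add: m_assoc)
  next
   case (Cons Z u') then show ?thesis using word_rels3[of u u' X "lscale K M al Z" \<delta> ga] 4 p by (simp add: lscale_mult)
  qed
  ultimately show ?thesis by simp
 qed
qed

lemma word_null_ideal: "ideal (word_null K M) FW"
proof (rule idealI[OF FW_ring])
 show "subgroup (word_null K M) (add_monoid FW)" using word_null_sub by (rule additive_subgroup.a_subgroup)
 note I = additive_subgroup_closed[OF word_null_sub] additive_subgroup_neg[OF word_null_sub W.F_group]
 have Id: "x - y \<in> word_null K M" if "x \<in> word_null K M" "y \<in> word_null K M" for x y
  using I(2)[OF that(1) I(4)[OF that(2)]] W.F_minus[OF I(1)[OF that(2)], of x] by (simp add: a_minus_def)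
 have I0: "0 \<in> word_null K M" using I(3) by (simp add: W.F_zero)
 fix a x assume a: "a \<in> word_null K M" and x: "x \<in>. FW"
 have r: "r \<in> word_null K M" if "r \<in> WR" for r using that unfolding word_null_def by (rule W.gen_incl)
 have gl: "word_null K M <= J" if "WR <= J" "additive_subgroup J FW" for J
  unfolding word_null_def using that by (rule W.gen_least)
 note a' = I(1)[OF a]
 show "x \<otimes>\<^sub>FW a \<in> word_null K M" using x
 proof (induction rule: W.F_induct)
  case zero then show ?case using I0 by (simp add: FW_mult)
 next
  case (diff x y) then show ?case using FW_diffR[OF a'] Id by simp
 next
  case (of p)
  then have p: "fof p \<in>. FW" by simp
  have "word_null K M <= {x \<in> carrier FW. fof p \<otimes>\<^sub>FW x \<in> word_null K M}"
  proof (rule gl)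
   show "additive_subgroup {x \<in> carrier FW. fof p \<otimes>\<^sub>FW x \<in> word_null K M} FW"
    by (rule preimage_subgroup[OF W.F_group W.F_group FW_amapL[OF p] word_null_sub])
   show "WR <= {x \<in> carrier FW. fof p \<otimes>\<^sub>FW x \<in> word_null K M}"
    using rels_wordL[OF _ of] r word_rels_sub by blast
  qed
  then show ?case using a by auto
 qed
 show "a \<otimes>\<^sub>FW x \<in> word_null K M" using x
 proof (induction rule: W.F_induct)
  case zero then show ?case using I0 amap_zero[OF FW_amapL[OF a'] W.F_group W.F_group] by (simp add: W.F_zero)
 next
  case (diff x y) then show ?case using FW_diffL[OF a'] Id by simp
 next
  case (of p)
  then have p: "fof p \<in>. FW" by simp
  have "word_null K M <= {x \<in> carrier FW. x \<otimes>\<^sub>FW fof p \<in> word_null K M}"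
  proof (rule gl)
   show "additive_subgroup {x \<in> carrier FW. x \<otimes>\<^sub>FW fof p \<in> word_null K M} FW"
    by (rule preimage_subgroup[OF W.F_group W.F_group FW_amapR[OF p] word_null_sub])
   show "WR <= {x \<in> carrier FW. x \<otimes>\<^sub>FW fof p \<in> word_null K M}"
    using rels_wordR[OF _ of] r word_rels_sub by blast
  qed
  then show ?case using a by auto
 qed
qed

abbreviation TA where "TA \<equiv> tensor_alg K M"
abbreviation tcl where "tcl t \<equiv> word_null K M +>\<^sub>FW t"

lemma TA_facts:
 shows TA_ring: "ring TA" and tcl_hom: "(%t. tcl t) \<in> ring_hom FW TA" and TA_carrier: "carrier TA = (%t. tcl t) ` carrier FW"
  and TA_hpart: "hpart TA i = (%t. tcl t) ` hpart FW i"
  and TA_scale: "[|X \<in>. TA; al \<in>. K|] ==> X \<bullet>\<^sub>TA al = X \<otimes>\<^sub>TA tcl (fof ([], al))"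
  and tcl_zero_iff: "t \<in>. FW ==> tcl t = \<zero>\<^sub>TA \<longleftrightarrow> t \<in> word_null K M"
  and tcl_eq_iff: "[|s \<in>. FW; t \<in>. FW|] ==> tcl s = tcl t \<longleftrightarrow> s \<ominus>\<^sub>FW t \<in> word_null K M"
proof -
 interpret R1: rquo FW "word_null K M" by (intro rquo.intro FW_ring word_null_ideal)
 show "ring TA" unfolding tensor_alg_def by (rule R1.ringQ)
 show "(%t. tcl t) \<in> ring_hom FW TA" unfolding tensor_alg_def by (rule R1.cl_hom)
 show "carrier TA = (%t. tcl t) ` carrier FW" unfolding tensor_alg_def by (rule R1.Q_simps)
 show "hpart TA i = (%t. tcl t) ` hpart FW i" unfolding tensor_alg_def by (rule R1.Q_simps)
 show "X \<bullet>\<^sub>TA al = X \<otimes>\<^sub>TA tcl (fof ([], al))" if "X \<in>. TA" "al \<in>. K"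
  using that unfolding tensor_alg_def by (intro R1.cl_scale' FW_scale_mult) auto
 show "tcl t = \<zero>\<^sub>TA \<longleftrightarrow> t \<in> word_null K M" if "t \<in>. FW"
  unfolding tensor_alg_def using that by (rule R1.cl_zero_iff)
 show "tcl s = tcl t \<longleftrightarrow> s \<ominus>\<^sub>FW t \<in> word_null K M" if "s \<in>. FW" "t \<in>. FW"
  using that by (rule R1.cl_eq_iff)
qed

lemma walg_quot:
 assumes G: "G <= carrier FW" and I: "I = Idl\<^bsub>TA\<^esub> ((%t. tcl t) ` G)"
 shows "walg K M (squot TA I) (%t. I +>\<^sub>TA tcl t) G"
proof -
 note T = TA_ring tcl_hom TA_carrier TA_hpart TA_scale tcl_zero_iff tcl_eq_iff
 have GT: "(%t. tcl t) ` G <= carrier TA" using G T(3) by auto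
 have idl: "ideal I TA" unfolding I by (rule ring.genideal_ideal[OF T(1) GT])
 interpret R2: rquo TA I by (intro rquo.intro T(1) idl)
 have tc: "tcl t \<in>. TA" if "t \<in>. FW" for t using that T(3) by auto
 show ?thesis
 proof (intro walg.intro walg_axioms.intro smx R2.ringQ)
  show "(%t. I +>\<^sub>TA tcl t) \<in> ring_hom FW (squot TA I)"
   using ring_hom_trans[OF T(2) R2.cl_hom] by (simp add: comp_def)
  show "carrier (squot TA I) = (%t. I +>\<^sub>TA tcl t) ` carrier FW"
   unfolding R2.Q_simps(1) T(3) image_image ..
  show "hpart (squot TA I) i = (%t. I +>\<^sub>TA tcl t) ` hpart FW i" for i
   unfolding R2.Q_simps(6) T(4) image_image ..
  show "G <= carrier FW" by fact
  fix r
  show "I +>\<^sub>TA tcl r = \<zero>\<^sub>(squot TA I)" if "r \<in> WR"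
  proof -
   have "r \<in>. FW" using that word_rels_sub by auto
   moreover have "r \<in> word_null K M" using that unfolding word_null_def by (rule W.gen_incl)
   ultimately have "tcl r = \<zero>\<^sub>TA" using T(6) by blast
   then show ?thesis using R2.cl_zero by simp
  qed
  show "I +>\<^sub>TA tcl r = \<zero>\<^sub>(squot TA I)" if "r \<in> G"
  proof -
   have "tcl r \<in> I" unfolding I using ring.genideal_self[OF T(1) GT] that by blast
   then show ?thesis using R2.cl_zero_iff[OF tc] that G by blast
  qed
 next
  fix x al assume x: "x \<in>. (squot TA I)" and al: "al \<in>. K"
  show "x \<bullet>\<^sub>(squot TA I) al = x \<otimes>\<^sub>(squot TA I) (I +>\<^sub>TA tcl (fof ([], al)))"
   by (rule R2.cl_scale'[OF T(5) _ x]) (use al tc in auto)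
 next
  \<comment> \<open>The image of J in the tensor algebra is an ideal containing the generators of I.
    Hence t agrees with an element of J up to \<open>word_null\<close>, and \<open>word_null\<close>
    lies in J because J contains the word relations.\<close>
  fix J t assume J: "ideal J FW" "WR <= J" "G <= J" and t: "t \<in>. FW" "I +>\<^sub>TA tcl t = \<zero>\<^sub>(squot TA I)"
  have nJ: "word_null K M <= J" unfolding word_null_def by (rule W.gen_least[OF J(2) ideal.axioms(1)[OF J(1)]])
  have "ideal ((%t. tcl t) ` J) TA" by (rule ideal_img[OF FW_ring T(1,2,3) J(1)])
  then have "I <= (%t. tcl t) ` J" unfolding I using J(3) by (intro ring.genideal_minimal[OF T(1)]) auto
  moreover have "tcl t \<in> I" using R2.cl_zero_iff[OF tc[OF t(1)]] t(2) by simp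
  ultimately obtain s where s: "s \<in> J" "tcl t = tcl s" by auto
  have sc: "s \<in>. FW" using s(1) additive_subgroup_closed(1)[OF ideal.axioms(1)[OF J(1)]] by blast
  have "t \<ominus>\<^sub>FW s \<in> J" using T(7)[OF t(1) sc] s(2) nJ by auto
  then have "(t \<ominus>\<^sub>FW s) \<oplus>\<^sub>FW s \<in> J" using additive_subgroup_closed(2)[OF ideal.axioms(1)[OF J(1)]] s(1) by blast
  then show "t \<in> J" using sc by (simp add: W.F_minus W.F_plus)
 qed
qed

text \<open>Lifts to words of the generators of \<open>sym_ideal\<close>.\<close>

definition Gsym where "Gsym = {fof ([v], \<one>\<^sub>K) \<otimes>\<^sub>FW fof ([w], \<one>\<^sub>K)
   \<ominus>\<^sub>FW sg FW (i * j) (fof ([w], \<one>\<^sub>K) \<otimes>\<^sub>FW fof ([v], \<one>\<^sub>K)) | v w i j. v \<in> hpart M i \<and> w \<in> hpart M j}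
  \<union> {fof ([u], \<one>\<^sub>K) \<otimes>\<^sub>FW fof ([u], \<one>\<^sub>K) | u. u \<in> hpart M 1}"

lemma FW_letter [simp]: "v \<in>. M ==> fof ([v], \<one>\<^sub>K) \<in>. FW"
 by simp

lemma FW_letters: "[|v \<in>. M; w \<in>. M|] ==> fof ([v], \<one>\<^sub>K) \<otimes>\<^sub>FW fof ([w], \<one>\<^sub>K) \<in>. FW"
 by (rule amapc[OF FW_amapL]) simp_all

lemma hom_comm:
 assumes "ring P" "h \<in> ring_hom FW P" "v \<in>. M" "w \<in>. M"
 shows "h (fof ([v], \<one>\<^sub>K) \<otimes>\<^sub>FW fof ([w], \<one>\<^sub>K)
   \<ominus>\<^sub>FW sg FW i (fof ([w], \<one>\<^sub>K) \<otimes>\<^sub>FW fof ([v], \<one>\<^sub>K)))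
  = h (fof ([v], \<one>\<^sub>K)) \<otimes>\<^sub>P h (fof ([w], \<one>\<^sub>K))
   \<ominus>\<^sub>P sg P i (h (fof ([w], \<one>\<^sub>K)) \<otimes>\<^sub>P h (fof ([v], \<one>\<^sub>K)))"
proof -
 have P: "abelian_group P" using assms(1) by (rule ring.is_abelian_group)
 note am = ring_hom_amap[OF assms(2)]
 note l = FW_letters[OF assms(3,4)] FW_letters[OF assms(4,3)] FW_letter[OF assms(3)] FW_letter[OF assms(4)]
 show ?thesis
  by (simp only: amap_minus[OF am W.F_group P l(1) abelian_group.sg_closed[OF W.F_group l(2)]]
    amap_sg[OF am W.F_group P l(2)] ring_hom_mult[OF assms(2) l(3,4)] ring_hom_mult[OF assms(2) l(4,3)])
qed

lemma Gsym_sub: "Gsym <= carrier FW"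
 unfolding Gsym_def
proof (intro Un_least subsetI; clarify)
 fix v w i j assume "v \<in> hpart M i" "w \<in> hpart M j"
 then show "fof ([v], \<one>\<^sub>K) \<otimes>\<^sub>FW fof ([w], \<one>\<^sub>K)
   \<ominus>\<^sub>FW sg FW (i * j) (fof ([w], \<one>\<^sub>K) \<otimes>\<^sub>FW fof ([v], \<one>\<^sub>K)) \<in>. FW"
  by (intro abelian_group.minus_closed[OF W.F_group] abelian_group.sg_closed[OF W.F_group] FW_letters MG.hpc)
next
 fix u assume "u \<in> hpart M 1"
 then show "fof ([u], \<one>\<^sub>K) \<otimes>\<^sub>FW fof ([u], \<one>\<^sub>K) \<in>. FW" by (intro FW_letters MG.hpc)
qed

lemma sym_ideal_eq: "sym_ideal K M = Idl\<^bsub>TA\<^esub> ((%t. tcl t) ` Gsym)"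
proof -
 note h = hom_comm[OF TA_ring tcl_hom]
 have "(%t. tcl t) ` Gsym = {tgen K M v \<otimes>\<^sub>TA tgen K M w \<ominus>\<^sub>TA sg TA (i * j) (tgen K M w \<otimes>\<^sub>TA tgen K M v) | v w i j.
    v \<in> hpart M i \<and> w \<in> hpart M j} \<union> {tgen K M u \<otimes>\<^sub>TA tgen K M u | u. u \<in> hpart M 1}"
 proof -
  have 1: "tcl (fof ([v], \<one>\<^sub>K) \<otimes>\<^sub>FW fof ([w], \<one>\<^sub>K)
   \<ominus>\<^sub>FW sg FW (i * j) (fof ([w], \<one>\<^sub>K) \<otimes>\<^sub>FW fof ([v], \<one>\<^sub>K)))
   = tgen K M v \<otimes>\<^sub>TA tgen K M w \<ominus>\<^sub>TA sg TA (i * j) (tgen K M w \<otimes>\<^sub>TA tgen K M v)"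
   if "v \<in> hpart M i" "w \<in> hpart M j" for v w i j
   unfolding tgen_def by (rule h[OF MG.hpc[OF that(1)] MG.hpc[OF that(2)]])
  have 2: "tcl (fof ([u], \<one>\<^sub>K) \<otimes>\<^sub>FW fof ([u], \<one>\<^sub>K)) = tgen K M u \<otimes>\<^sub>TA tgen K M u"
   if "u \<in> hpart M 1" for u
   unfolding tgen_def by (intro ring_hom_mult[OF tcl_hom FW_letter FW_letter] MG.hpc[OF that])
  show ?thesis unfolding Gsym_def image_Un
   by (rule arg_cong2[where f="(\<union>)", OF image_setcompr4 image_setcompr1]; (elim conjE)?) (rule 1 2; assumption)+
 qed
 then show ?thesis unfolding sym_ideal_def Let_def by simp
qed

lemma Sym_walg: "walg K M (Sym K M) (%t. sym_ideal K M +>\<^sub>TA tcl t) Gsym"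
 unfolding Sym_def by (rule walg_quot[OF Gsym_sub sym_ideal_eq])

end

context lie_superalgebra begin

definition Genv where "Genv = {fof ([v], \<one>\<^sub>K) \<otimes>\<^sub>(free_words K g) fof ([w], \<one>\<^sub>K)
   \<ominus>\<^sub>(free_words K g) sg (free_words K g) (i * j) (fof ([w], \<one>\<^sub>K) \<otimes>\<^sub>(free_words K g) fof ([v], \<one>\<^sub>K))
   \<ominus>\<^sub>(free_words K g) fof ([bracket g v w], \<one>\<^sub>K) | v w i j. v \<in> hpart g i \<and> w \<in> hpart g j}"

lemma hom_comm_br:
 assumes "ring P" "h \<in> ring_hom FW P" "v \<in>. g" "w \<in>. g"
 shows "h (fof ([v], \<one>\<^sub>K) \<otimes>\<^sub>FW fof ([w], \<one>\<^sub>K)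
   \<ominus>\<^sub>FW sg FW i (fof ([w], \<one>\<^sub>K) \<otimes>\<^sub>FW fof ([v], \<one>\<^sub>K)) \<ominus>\<^sub>FW fof ([bracket g v w], \<one>\<^sub>K))
  = h (fof ([v], \<one>\<^sub>K)) \<otimes>\<^sub>P h (fof ([w], \<one>\<^sub>K))
   \<ominus>\<^sub>P sg P i (h (fof ([w], \<one>\<^sub>K)) \<otimes>\<^sub>P h (fof ([v], \<one>\<^sub>K))) \<ominus>\<^sub>P h (fof ([bracket g v w], \<one>\<^sub>K))"
proof -
 have P: "abelian_group P" using assms(1) by (rule ring.is_abelian_group)
 note am = ring_hom_amap[OF assms(2)]
 note l = abelian_group.minus_closed[OF W.F_group FW_letters[OF assms(3,4)] abelian_group.sg_closed[OF W.F_group FW_letters[OF assms(4,3)]]]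
 show ?thesis
  by (simp only: amap_minus[OF am W.F_group P l FW_letter[OF br_closed[OF assms(3,4)]]] hom_comm[OF assms])
qed

lemma Genv_sub: "Genv <= carrier FW"
 unfolding Genv_def
proof (intro subsetI; clarify)
 fix v w i j assume "v \<in> hpart g i" "w \<in> hpart g j"
 then show "fof ([v], \<one>\<^sub>K) \<otimes>\<^sub>FW fof ([w], \<one>\<^sub>K)
   \<ominus>\<^sub>FW sg FW (i * j) (fof ([w], \<one>\<^sub>K) \<otimes>\<^sub>FW fof ([v], \<one>\<^sub>K))
   \<ominus>\<^sub>FW fof ([bracket g v w], \<one>\<^sub>K) \<in>. FW"
  by (intro abelian_group.minus_closed[OF W.F_group] abelian_group.sg_closed[OF W.F_group] FW_letters FW_letter
    br_closed MG.hpc)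
qed

lemma env_ideal_eq: "env_ideal K g = Idl\<^bsub>TA\<^esub> ((%t. tcl t) ` Genv)"
proof -
 note h = hom_comm_br[OF TA_ring tcl_hom]
 have 1: "tcl (fof ([v], \<one>\<^sub>K) \<otimes>\<^sub>FW fof ([w], \<one>\<^sub>K)
   \<ominus>\<^sub>FW sg FW (i * j) (fof ([w], \<one>\<^sub>K) \<otimes>\<^sub>FW fof ([v], \<one>\<^sub>K)) \<ominus>\<^sub>FW fof ([bracket g v w], \<one>\<^sub>K))
   = tgen K g v \<otimes>\<^sub>TA tgen K g w \<ominus>\<^sub>TA sg TA (i * j) (tgen K g w \<otimes>\<^sub>TA tgen K g v) \<ominus>\<^sub>TA tgen K g (bracket g v w)"
   if "v \<in> hpart g i" "w \<in> hpart g j" for v w i j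
   unfolding tgen_def by (rule h[OF MG.hpc[OF that(1)] MG.hpc[OF that(2)]])
 have "(%t. tcl t) ` Genv = {tgen K g v \<otimes>\<^sub>TA tgen K g w \<ominus>\<^sub>TA sg TA (i * j) (tgen K g w \<otimes>\<^sub>TA tgen K g v)
    \<ominus>\<^sub>TA tgen K g (bracket g v w) | v w i j. v \<in> hpart g i \<and> w \<in> hpart g j}"
  unfolding Genv_def by (rule image_setcompr4; elim conjE; rule 1)
 then show ?thesis unfolding env_ideal_def Let_def by simp
qed

lemma Env_walg: "walg K g (Env K g) (%t. env_ideal K g +>\<^sub>TA tcl t) Genv"
 unfolding Env_def by (rule walg_quot[OF Genv_sub env_ideal_eq])

end

text \<open>\<open>scale_e\<close> and \<open>lscale_e\<close> together say that the scalars,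
  embedded by \<open>e\<close>, supercommute with A; the module structure is thereby expressed by
  multiplication.\<close>

locale kalg = supermodule K A + R: ring A
 for K :: "('k, 'm) graded_ring_scheme" and A :: "('b, 'k, 'o) smodule_scheme" +
 fixes e :: "'k => 'b"
 assumes e_hom: "e \<in> ring_hom K A"
  and scale_e: "[|x \<in>. A; al \<in>. K|] ==> x \<bullet>\<^sub>A al = x \<otimes>\<^sub>A e al"
  and lscale_e: "[|x \<in>. A; al \<in>. K|] ==> e al \<otimes>\<^sub>A x = lscale K A al x"
  and one_hp: "\<one>\<^sub>A \<in> hpart A 0"
  and mult_hp: "[|x \<in> hpart A i; y \<in> hpart A j|] ==> x \<otimes>\<^sub>A y \<in> hpart A (i + j)"

text \<open>A presentation supplies every axiom except that the even and the odd part meet in zero,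
  which is why this is the assumption.\<close>

lemma (in walg) kalgI:
 assumes inter: "!!x. [|x \<in> hpart A 0; x \<in> hpart A 1|] ==> x = \<zero>\<^sub>A"
 shows "kalg K A \<eta>"
proof -
 note eh = ring_hom_mult[OF \<eta>_hom] ring_hom_add[OF \<eta>_hom] ring_hom_one[OF \<eta>_hom]
 have gr: "is_graded A"
  unfolding is_graded_def
 proof (intro conjI allI)
  show "hpart A 0 \<inter> hpart A 1 = {\<zero>\<^sub>A}" using inter A_hp_closed(3) by blast
  show "hpart A 0 <+>\<^sub>A hpart A 1 = carrier A"
   using A_decomp A_hp_closed(1) by (fastforce simp: set_add_def')
 qed (rule A_hp_sub)
 interpret N: supermodule K A
 proof (unfold_locales)
  show "is_graded A" by (rule gr)
 next
  fix x i al j assume x: "x \<in> hpart A i" and a: "al \<in> hpart K j"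
  then show "x \<bullet>\<^sub>A al \<in> hpart A (i + j)"
   using A_hp_mult[OF x \<eta>_hp[OF a]] scale_\<eta>[OF A_hp_closed(1)[OF x] KG.hpc[OF a]] by simp
 qed (auto simp: scale_\<eta> eh A.l_distr A.r_distr A.m_assoc)
 \<comment> \<open>A scalar of parity i is moved through the word letter by letter; a letter of
   parity k contributes (-1)^(ik).\<close>
 have hom: "\<eta> al \<otimes>\<^sub>A x = sg A (i * j) (x \<otimes>\<^sub>A \<eta> al)" if a: "al \<in> hpart K i" and x: "x \<in> hpart A j" for al x i j
  using x
 proof (induction rule: A_hinduct)
  case (\<eta> j ga)
  have "\<eta> al \<otimes>\<^sub>A \<eta> ga = \<eta> (sg K (i * j) (ga \<otimes>\<^sub>K al))"
   using supercomm[OF a \<eta>] a \<eta> by (simp only: eh[symmetric] KG.hpc)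
  then show ?case using a \<eta> amap_sg[OF ring_hom_amap[OF \<eta>_hom] ag A.ag]
   by (simp add: eh KG.hpc)
 next
  case (gen k j X x)
  note ca = KG.hpc[OF a] MG.hpc[OF gen(1)] A_hp_closed(1)[OF gen(2)]
  have "\<eta> al \<otimes>\<^sub>A (gen X \<otimes>\<^sub>A x) = gen (lscale K M al X) \<otimes>\<^sub>A x"
   using ca by (simp add: \<eta>_gen[symmetric] A.m_assoc)
  also have "... = sg A (i * k) (gen X \<otimes>\<^sub>A \<eta> al) \<otimes>\<^sub>A x"
   using ca amap_sg[OF gen_amap M.ag A.ag]
   by (simp add: lscale_homog2[OF a gen(1)] scale_closed gen_scale)
  also have "... = sg A (i * k) (gen X \<otimes>\<^sub>A (\<eta> al \<otimes>\<^sub>A x))"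
   using ca by (cases i; cases k) (simp_all add: A.m_assoc A.l_minus)
  also have "... = sg A (i * (k + j)) (gen X \<otimes>\<^sub>A (x \<otimes>\<^sub>A \<eta> al))"
   unfolding gen(3) using ca by (cases i; cases k; cases j) (simp_all add: A.r_minus)
  finally show ?case using ca by (simp add: A.m_assoc)
 next
  case (add j x y)
  then show ?case using KG.hpc[OF a] A_hp_closed(1) by (simp add: A.r_distr A.l_distr A.sg_add)
 qed
 show ?thesis
 proof (unfold_locales)
  show "\<eta> \<in> ring_hom K A" by (rule \<eta>_hom)
  show "\<one>\<^sub>A \<in> hpart A 0" using \<eta>_hp[OF one_even] by (simp add: eh)
 next
  fix x al assume x: "x \<in>. A" and a: "al \<in>. K"
  show "x \<bullet>\<^sub>A al = x \<otimes>\<^sub>A \<eta> al" using x a by (rule scale_\<eta>)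
  show "\<eta> al \<otimes>\<^sub>A x = lscale K A al x"
  proof (rule KG.amap_eqI[where x=al and N=A and f="%al. \<eta> al \<otimes>\<^sub>A x"])
   show "amap K A (%al. \<eta> al \<otimes>\<^sub>A x)" by (rule amc[OF ring_hom_amap[OF \<eta>_hom] ring_amapR[OF A.ring_axioms x]])
   show "amap K A (%al. lscale K A al x)" by (rule N.lscale_amap2[OF x])
   fix i c assume c: "c \<in> hpart K i"
   show "\<eta> c \<otimes>\<^sub>A x = lscale K A c x"
   proof (rule N.MG.amap_eqI[where x=x and N=A and f="%x. \<eta> c \<otimes>\<^sub>A x"])
    show "amap A A (%x. \<eta> c \<otimes>\<^sub>A x)" using c by (intro ring_amapL A.ring_axioms \<eta>_closed KG.hpc)
    show "amap A A (%x. lscale K A c x)" using c by (intro N.lscale_amap1 KG.hpc)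
    fix j y assume y: "y \<in> hpart A j"
    show "\<eta> c \<otimes>\<^sub>A y = lscale K A c y"
     using hom[OF c y] N.lscale_homog2[OF c y] scale_\<eta>[OF A_hp_closed(1)[OF y] KG.hpc[OF c]] by simp
   qed (rule x)
  qed (rule a)
 next
  fix x y i j assume "x \<in> hpart A i" "y \<in> hpart A j" then show "x \<otimes>\<^sub>A y \<in> hpart A (i + j)" by (rule A_hp_mult)
 qed
qed

section \<open>Tensor products\<close>

lemma (in fragg) F_rel3:
 assumes "amap F P h" "abelian_group P" "a \<in> B" "b \<in> B" "c \<in> B" "h (fof a - fof b - fof c) = \<zero>\<^sub>P"
 shows "h (fof a) = h (fof b) \<oplus>\<^sub>P h (fof c)"
proof -
 interpret P: abelian_group P by fact
 have f: "fof a \<in>. F" "fof b \<in>. F" "fof c \<in>. F" using assms by simp_all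
 note hc = f[THEN amapc[OF assms(1)]]
 have "h (fof a) \<ominus>\<^sub>P (h (fof b) \<oplus>\<^sub>P h (fof c)) = \<zero>\<^sub>P"
  using assms(6) f hc by (simp add: F_amap_diff[OF assms(1,2)] F_diff_closed P.minus_eq P.minus_add P.a_assoc)
 then show ?thesis using P.minus_zero_eq hc by blast
qed

lemma (in fragg) F_rel2:
 assumes "amap F P h" "abelian_group P" "a \<in> B" "b \<in> B" "h (fof a - fof b) = \<zero>\<^sub>P"
 shows "h (fof a) = h (fof b)"
proof -
 interpret P: abelian_group P by fact
 have f: "fof a \<in>. F" "fof b \<in>. F" using assms by simp_all
 note hc = f[THEN amapc[OF assms(1)]]
 have "h (fof a) \<ominus>\<^sub>P h (fof b) = \<zero>\<^sub>P"
  using assms(5) f by (simp add: F_amap_diff[OF assms(1,2)])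
 then show ?thesis using P.minus_zero_eq hc by blast
qed

lemma (in abelian_group) neg_zero: "\<ominus> \<zero> = \<zero>"
 by (rule sg_zero[of 1, unfolded sg_1])

lemma (in abelian_group) minus3_zero: "[|b \<in>. G; c \<in>. G|] ==> (b \<oplus> c) \<ominus> b \<ominus> c = \<zero>"
 by (simp add: a_comm[of b] minus_eq a_assoc r_neg)

context graded begin
lemma am_tw: "amap X M f ==> amap X M (%x. tw d (f x))" by (rule amc[OF _ tw_amap])
lemma am_hc: "amap X M f ==> amap X M (%x. hcomp M i (f x))" by (rule amc[OF _ hc_amap])
lemma am_sg: "amap X M f ==> amap X M (%x. sg M i (f x))" by (rule amc[OF _ amap_sgm])
end

context supermodule begin
lemma am_scale1: "amap X M f ==> al \<in>. K ==> amap X M (%x. f x \<bullet>\<^sub>M al)" by (rule amc[OF _ scale_amap1])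
lemma am_scale2: "amap X K f ==> y \<in>. M ==> amap X M (%x. y \<bullet>\<^sub>M f x)" by (rule amc[OF _ scale_amap2])
lemma am_lscale1: "amap X M f ==> al \<in>. K ==> amap X M (%x. lscale K M al (f x))" by (rule amc[OF _ lscale_amap1])
lemma am_lscale2: "amap X K f ==> y \<in>. M ==> amap X M (%x. lscale K M (f x) y)" by (rule amc[OF _ lscale_amap2])
lemmas am_intros = MG.am_tw MG.am_hc MG.am_sg am_scale1 am_scale2 am_lscale1 am_lscale2 amap_id
end

context kalg begin
lemma am_mult1: "amap X A f ==> c \<in>. A ==> amap X A (%x. f x \<otimes>\<^sub>A c)" by (rule amc[OF _ ring_amapR[OF R.ring_axioms]])
lemma am_mult2: "amap X A f ==> c \<in>. A ==> amap X A (%x. c \<otimes>\<^sub>A f x)" by (rule amc[OF _ ring_amapL[OF R.ring_axioms]])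
lemma e_closed [simp]: "al \<in>. K ==> e al \<in>. A" by (rule ring_hom_closed[OF e_hom])
lemmas e_simps = ring_hom_mult[OF e_hom] ring_hom_add[OF e_hom] ring_hom_one[OF e_hom]

lemma scale_mult_r: "[|x \<in>. A; y \<in>. A; al \<in>. K|] ==> x \<otimes>\<^sub>A (y \<bullet>\<^sub>A al) = (x \<otimes>\<^sub>A y) \<bullet>\<^sub>A al"
 by (simp add: scale_e R.m_assoc)

lemma scale_mult_l: "[|x \<in>. A; y \<in>. A; al \<in>. K|] ==> (x \<bullet>\<^sub>A al) \<otimes>\<^sub>A y = x \<otimes>\<^sub>A lscale K A al y"
 by (simp add: scale_e R.m_assoc lscale_e[symmetric])

lemma lscale_mult_l: "[|x \<in>. A; y \<in>. A; al \<in>. K|] ==> lscale K A al x \<otimes>\<^sub>A y = lscale K A al (x \<otimes>\<^sub>A y)"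
 by (simp add: R.m_assoc lscale_e[symmetric])

lemma sg_mult1: "[|x \<in>. A; y \<in>. A|] ==> sg A i x \<otimes>\<^sub>A y = sg A i (x \<otimes>\<^sub>A y)"
 by (cases i) (simp_all add: R.l_minus)

lemma sg_mult2: "[|x \<in>. A; y \<in>. A|] ==> x \<otimes>\<^sub>A sg A i y = sg A i (x \<otimes>\<^sub>A y)"
 by (cases i) (simp_all add: R.r_minus)
end

text \<open>The target is just an abelian group: balanced maps into the tensor product itself are
  used to construct the scalar action and the product there.\<close>

definition balanced where
 "balanced K M N P f \<longleftrightarrow> (\<forall>x \<in> carrier M. amap N P (f x)) \<and> (\<forall>y \<in> carrier N. amap M P (%x. f x y)) \<and>
   (\<forall>x \<in> carrier M. \<forall>y \<in> carrier N. \<forall>al \<in> carrier K. f (x \<bullet>\<^sub>M al) y = f x (lscale K N al y))"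

locale tens = M: supermodule K M + N: supermodule K N
 for K :: "('k, 'm) graded_ring_scheme" and M :: "('a, 'k, 'n) smodule_scheme"
  and N :: "('b, 'k, 'o) smodule_scheme"
begin

abbreviation FP where "FP \<equiv> free_pairs M N"
abbreviation T where "T \<equiv> tensor K M N"
abbreviation pu where "pu \<equiv> pure K M N"

sublocale F: fragg "free_pairs M N" "carrier M \<times> carrier N"
 by unfold_locales (auto simp: free_pairs_def)

lemma tensor_rels_cases [consumes 1]:
 assumes "r \<in> tensor_rels K M N"
 obtains x x' y where "r = fof (x \<oplus>\<^sub>M x', y) - fof (x, y) - fof (x', y)"
  "x \<in>. M" "x' \<in>. M" "y \<in>. N"
 | x y y' where "r = fof (x, y \<oplus>\<^sub>N y') - fof (x, y) - fof (x, y')"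
  "x \<in>. M" "y \<in>. N" "y' \<in>. N"
 | x al y where "r = fof (x \<bullet>\<^sub>M al, y) - fof (x, lscale K N al y)" "x \<in>. M" "al \<in>. K" "y \<in>. N"
 using assms unfolding tensor_rels_def by blast

lemma tensor_rels1: "[|x \<in>. M; x' \<in>. M; y \<in>. N|] ==> fof (x \<oplus>\<^sub>M x', y) - fof (x, y) - fof (x', y) \<in> tensor_rels K M N"
 and tensor_rels2: "[|x \<in>. M; y \<in>. N; y' \<in>. N|] ==> fof (x, y \<oplus>\<^sub>N y') - fof (x, y) - fof (x, y') \<in> tensor_rels K M N"
 and tensor_rels3: "[|x \<in>. M; al \<in>. K; y \<in>. N|] ==> fof (x \<bullet>\<^sub>M al, y) - fof (x, lscale K N al y) \<in> tensor_rels K M N"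
 unfolding tensor_rels_def by blast+

lemma tensor_rels_sub: "tensor_rels K M N <= carrier FP"
proof
 fix r assume "r \<in> tensor_rels K M N"
 then show "r \<in>. FP"
  by (cases rule: tensor_rels_cases) (auto intro!: F.F_diff_closed simp: M.scale_closed)
qed

lemma null_sub: "additive_subgroup (tensor_null K M N) FP"
 unfolding tensor_null_def by (rule F.gen_subgroup[OF tensor_rels_sub])

lemma null_rel: "r \<in> tensor_rels K M N ==> r \<in> tensor_null K M N"
 unfolding tensor_null_def by (rule F.gen_incl)

sublocale Qt: quo "free_pairs M N" "tensor_null K M N"
 by (intro quo.intro F.F_group null_sub)

lemma QtT: "squot FP (tensor_null K M N) = T"
 by (simp add: tensor_def)

lemma pu_cl: "pu x y = Qt.cl (fof (x, y))"
 by (simp add: pure_def)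

lemma T_grp: "abelian_group T"
 using Qt.grp by (simp add: QtT)

lemma cl_amap: "amap FP T Qt.cl"
 using Qt.cl_amap by (simp add: QtT)

lemma T_surj: "carrier T = Qt.cl ` carrier FP"
 using Qt.Q_simps(1) by (simp add: QtT)

lemma cl_rel: "r \<in> tensor_rels K M N ==> Qt.cl r = \<zero>\<^sub>T"
 using Qt.cl_zero_iff[of r] null_rel[of r] tensor_rels_sub by (auto simp: QtT)

lemma pu_closed [simp]: "[|x \<in>. M; y \<in>. N|] ==> pu x y \<in>. T"
 unfolding pu_cl by (rule amapc[OF cl_amap]) simp

lemma pu_amap1: "y \<in>. N ==> amap M T (%x. pu x y)"
proof (rule amapI)
 assume h: "y \<in>. N"
 fix x x' assume x: "x \<in>. M" "x' \<in>. M"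
 then show "pu (x \<oplus>\<^sub>M x') y = pu x y \<oplus>\<^sub>T pu x' y"
  unfolding pu_cl using h by (intro F.F_rel3[OF cl_amap T_grp _ _ _ cl_rel[OF tensor_rels1]]) auto
qed simp

lemma pu_amap2: "x \<in>. M ==> amap N T (%y. pu x y)"
proof (rule amapI)
 assume h: "x \<in>. M"
 fix y y' assume x: "y \<in>. N" "y' \<in>. N"
 then show "pu x (y \<oplus>\<^sub>N y') = pu x y \<oplus>\<^sub>T pu x y'"
  unfolding pu_cl using h by (intro F.F_rel3[OF cl_amap T_grp _ _ _ cl_rel[OF tensor_rels2]]) auto
qed simp

lemma pu_bal: "[|x \<in>. M; y \<in>. N; al \<in>. K|] ==> pu (x \<bullet>\<^sub>M al) y = pu x (lscale K N al y)"
 unfolding pu_cl by (rule F.F_rel2[OF cl_amap T_grp _ _ cl_rel[OF tensor_rels3]]) (auto simp: M.scale_closed)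

lemma pu_balanced: "balanced K M N T pu"
 by (simp add: balanced_def pu_amap1 pu_amap2 pu_bal)

lemma am_pu1: "amap X M f ==> y \<in>. N ==> amap X T (%x. pu (f x) y)" by (rule amc[OF _ pu_amap1])
lemma am_pu2: "amap X N f ==> x \<in>. M ==> amap X T (%y. pu x (f y))" by (rule amc[OF _ pu_amap2])
lemma am_plus: "[|amap X T f; amap X T h|] ==> amap X T (%x. f x \<oplus>\<^sub>T h x)" by (rule amap_plus[OF T_grp])
lemma pu_sg1: "[|x \<in>. M; y \<in>. N|] ==> pu (sg M i x) y = sg T i (pu x y)"
 using amap_sg[OF pu_amap1 M.M.ag T_grp] .
lemma pu_sg2: "[|x \<in>. M; y \<in>. N|] ==> pu x (sg N i y) = sg T i (pu x y)"
 using amap_sg[OF pu_amap2 N.M.ag T_grp] .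

lemma T_induct [consumes 1, case_names pu add]:
 assumes "z \<in>. T" "!!i j x y. [|x \<in> hpart M i; y \<in> hpart N j|] ==> Q (pu x y)"
  "!!z w. [|z \<in>. T; w \<in>. T; Q z; Q w|] ==> Q (z \<oplus>\<^sub>T w)"
 shows "Q z"
proof -
 interpret T: abelian_group T by (rule T_grp)
 have p: "Q (pu x y)" if "x \<in>. M" "y \<in>. N" for x y
  using that(1)
 proof (induction rule: M.MG.homog_induct)
  case (homog i x)
  then have x: "x \<in>. M" by (rule M.MG.hpc)
  show ?case using that(2)
  proof (induction rule: N.MG.homog_induct)
   case (homog j y) then show ?case using assms(2) \<open>x \<in> hpart M i\<close> by blast
  next
   case (add y y') then show ?case using assms(3) x by (simp add: ama[OF pu_amap2])
  qed
 next
  case (add x x') then show ?case using assms(3) that(2) by (simp add: ama[OF pu_amap1])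
 qed
 obtain t where t: "t \<in>. FP" "z = Qt.cl t" using assms(1) by (auto simp: T_surj)
 note cc = amapc[OF cl_amap]
 have "Q (Qt.cl t) \<and> Q (\<ominus>\<^sub>T Qt.cl t)" using t(1)
 proof (induction rule: F.F_induct)
  case zero
  have "pu \<zero>\<^sub>M \<zero>\<^sub>N = \<zero>\<^sub>T" using amap_zero[OF pu_amap1 M.M.ag T_grp] by simp
  then show ?case using p[of "\<zero>\<^sub>M" "\<zero>\<^sub>N"] by (simp add: F.F_amap_zero[OF cl_amap T_grp] T.neg_zero)
 next
  case (diff s t)
  note c = cc[OF diff(1)] cc[OF diff(2)]
  have "Q (Qt.cl s \<oplus>\<^sub>T \<ominus>\<^sub>T Qt.cl t)" "Q (Qt.cl t \<oplus>\<^sub>T \<ominus>\<^sub>T Qt.cl s)" using diff(3,4) c by (auto intro!: assms(3))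
  then show ?case using diff(1,2) c by (simp add: F.F_amap_diff[OF cl_amap T_grp] T.minus_eq T.minus_add T.a_comm)
 next
  case (of b)
  then obtain x y where b: "b = (x, y)" "x \<in>. M" "y \<in>. N" by auto
  have "\<ominus>\<^sub>T pu x y = pu (\<ominus>\<^sub>M x) y" using amap_neg[OF pu_amap1 M.M.ag T_grp] b by simp
  then show ?case using b p[of x y] p[of "\<ominus>\<^sub>M x" y] by (simp add: pu_cl)
 qed
 then show ?thesis using t by simp
qed

lemma T_ext:
 assumes "amap T P f" "amap T P h" "!!i j x y. [|x \<in> hpart M i; y \<in> hpart N j|] ==> f (pu x y) = h (pu x y)" "z \<in>. T"
 shows "f z = h z"
 using assms(4) by (induction rule: T_induct) (auto simp: assms(3) ama[OF assms(1)] ama[OF assms(2)])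

lemma balanced_kill:
 assumes "balanced K M N P f" "abelian_group P" "amap FP P h"
  "!!x y. [|x \<in>. M; y \<in>. N|] ==> h (fof (x, y)) = f x y" "r \<in> tensor_null K M N"
 shows "h r = \<zero>\<^sub>P"
proof (rule F.gen_kill[OF assms(3,2) tensor_rels_sub _ assms(5)[unfolded tensor_null_def]])
 interpret P: abelian_group P by fact
 have b1: "amap N P (f x)" if "x \<in>. M" for x using assms(1) that unfolding balanced_def by blast
 have b2: "amap M P (%x. f x y)" if "y \<in>. N" for y using assms(1) that unfolding balanced_def by blast
 have b3: "f (x \<bullet>\<^sub>M al) y = f x (lscale K N al y)" if "x \<in>. M" "y \<in>. N" "al \<in>. K" for x y al
  using assms(1) that unfolding balanced_def by blast
 have fc: "f x y \<in>. P" if "x \<in>. M" "y \<in>. N" for x y using amapc[OF b1] that by blast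
 note d = F.F_amap_diff[OF assms(3,2)]
 fix r assume "r \<in> tensor_rels K M N"
 then show "h r = \<zero>\<^sub>P"
 proof (cases rule: tensor_rels_cases)
  case (1 x x' y)
  then have "h r = h (fof (x \<oplus>\<^sub>M x', y)) \<ominus>\<^sub>P h (fof (x, y)) \<ominus>\<^sub>P h (fof (x', y))"
   by (simp add: d F.F_diff_closed)
  then show ?thesis using 1 fc P.minus3_zero by (simp add: assms(4) ama[OF b2])
 next
  case (2 x y y')
  then have "h r = h (fof (x, y \<oplus>\<^sub>N y')) \<ominus>\<^sub>P h (fof (x, y)) \<ominus>\<^sub>P h (fof (x, y'))"
   by (simp add: d F.F_diff_closed)
  then show ?thesis using 2 fc P.minus3_zero by (simp add: assms(4) ama[OF b1])
 next
  case (3 x al y)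
  then have "h r = h (fof (x \<bullet>\<^sub>M al, y)) \<ominus>\<^sub>P h (fof (x, lscale K N al y))"
   by (simp add: d M.scale_closed)
  then show ?thesis using 3 fc by (simp add: assms(4) b3 M.scale_closed P.minus_eq P.r_neg)
 qed
qed

lemma lift_ex:
 assumes "balanced K M N P f" "abelian_group P"
 obtains h where "amap T P h" "!!x y. [|x \<in>. M; y \<in>. N|] ==> h (pu x y) = f x y"
proof -
 have fc: "f x y \<in>. P" if "x \<in>. M" "y \<in>. N" for x y
  using assms(1) that unfolding balanced_def by (auto simp: amap_def)
 obtain h where h: "amap FP P h" "!!b. b \<in> carrier M \<times> carrier N ==> h (fof b) = case_prod f b"
  by (rule F.F_lift[OF assms(2), of "case_prod f"]) (use fc in auto)
 have h2: "h (fof (x, y)) = f x y" if "x \<in>. M" "y \<in>. N" for x y using h(2)[of "(x, y)"] that by simp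
 obtain h' where h': "amap (squot FP (tensor_null K M N)) P h'" "!!x. x \<in>. FP ==> h' (Qt.cl x) = h x"
  by (rule Qt.factor[OF assms(2) h(1) balanced_kill[OF assms h(1) h2]]) blast+
 show ?thesis
 proof (rule that)
  show "amap T P h'" using h'(1) by (simp only: QtT)
  show "h' (pu x y) = f x y" if "x \<in>. M" "y \<in>. N" for x y
   unfolding pu_cl using h'(2)[of "fof (x, y)"] h2[OF that] that by simp
 qed
qed

lemma T_full_ext:
 assumes "amap T P f" "amap T P h" "!!x y. [|x \<in>. M; y \<in>. N|] ==> f (pu x y) = h (pu x y)" "z \<in>. T"
 shows "f z = h z"
 by (rule T_ext[OF assms(1,2) _ assms(4)]) (rule assms(3)[OF M.MG.hpc N.MG.hpc])

text \<open>Existence comes from the quotient, uniqueness from additivity and extensionality, so the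
  description operator in \<open>tensor_lift\<close> picks the expected map.\<close>

lemma tensor_lift_facts:
 assumes "balanced K M N P f" "abelian_group P"
 shows lift_amap: "amap T P (tensor_lift K M N P f)"
  and lift_pu: "!!x y. [|x \<in>. M; y \<in>. N|] ==> tensor_lift K M N P f (pu x y) = f x y"
proof -
 let ?P = "%h. h \<in> hom (add_monoid T) (add_monoid P) \<inter> extensional (carrier T) \<and>
       (\<forall>x \<in> carrier M. \<forall>y \<in> carrier N. h (pu x y) = f x y)"
 obtain h where h: "amap T P h" "!!x y. [|x \<in>. M; y \<in>. N|] ==> h (pu x y) = f x y"
  by (rule lift_ex[OF assms]) blast
 have Tc: "x \<oplus>\<^sub>T y \<in>. T" if "x \<in>. T" "y \<in>. T" for x y
  using T_grp that by (simp add: abelian_group.axioms abelian_monoid.a_closed)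
 have am: "amap T P k" if "k \<in> hom (add_monoid T) (add_monoid P)" for k
  using that by (auto simp: hom_def amap_def)
 have "?P (restrict h (carrier T))"
  using h Tc by (auto simp: hom_def amap_def)
 moreover have "k = restrict h (carrier T)" if k: "?P k" for k
 proof (rule extensionalityI[of _ "carrier T"])
  show "k \<in> extensional (carrier T)" using k by blast
  fix z assume z: "z \<in>. T"
  have "k z = h z"
   by (rule T_full_ext[OF _ h(1) _ z, of k]) (use k am h(2) in auto)
  then show "k z = restrict h (carrier T) z" using z by simp
 qed simp
 ultimately have "?P (THE h. ?P h)" by (rule theI)
 then have "?P (tensor_lift K M N P f)" unfolding tensor_lift_def .
 then show "amap T P (tensor_lift K M N P f)"
  "!!x y. [|x \<in>. M; y \<in>. N|] ==> tensor_lift K M N P f (pu x y) = f x y"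
  using am by auto
qed

lemma FP_scale: "u \<bullet>\<^sub>FP al = frag_extend (%(x, y). fof (x, y \<bullet>\<^sub>N al)) u"
 by (simp add: free_pairs_def)

lemma FP_scale_amap: "al \<in>. K ==> amap FP FP (%u. u \<bullet>\<^sub>FP al)"
 unfolding FP_scale by (rule F.F_extend_amap[OF F.fragg_axioms]) (auto simp: N.scale_closed)

text \<open>Scaling preserves the null group because (x, y) |-> x \<otimes> y al is a balanced map
  into T. By \<open>balanced_kill\<close> the class of a scaled null element is zero, which is
  membership in the null group.\<close>

lemma cl_scale_T: assumes "al \<in>. K" "u \<in>. FP" shows "Qt.cl u \<bullet>\<^sub>T al = Qt.cl (u \<bullet>\<^sub>FP al)"
 unfolding QtT[symmetric]
proof (rule Qt.cl_scale[OF FP_scale_amap[OF assms(1)] _ assms(2)])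
 fix x assume x: "x \<in> tensor_null K M N"
 have c: "x \<in>. FP" using x additive_subgroup_closed(1)[OF null_sub] by blast
 have "balanced K M N T (%x y. pu x (y \<bullet>\<^sub>N al))"
  unfolding balanced_def using assms(1)
  by (auto intro!: am_pu1 am_pu2 N.am_scale1 amap_id simp: N.scale_closed pu_bal N.lscale_scale)
 then have "Qt.cl (x \<bullet>\<^sub>FP al) = \<zero>\<^sub>T"
  by (rule balanced_kill[OF _ T_grp amc[OF FP_scale_amap[OF assms(1)] cl_amap] _ x]) (auto simp: FP_scale pu_cl)
 then show "x \<bullet>\<^sub>FP al \<in> tensor_null K M N"
  using Qt.cl_zero_iff[OF amapc[OF FP_scale_amap[OF assms(1)] c]] by (simp add: QtT)
qed

lemma T_scale_amap: assumes "al \<in>. K" shows "amap T T (%z. z \<bullet>\<^sub>T al)"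
proof (rule amapI)
 fix z assume "z \<in>. T"
 then show "z \<bullet>\<^sub>T al \<in>. T"
  using assms cl_scale_T amapc[OF FP_scale_amap] amapc[OF cl_amap] by (auto simp: T_surj)
next
 fix z w assume "z \<in>. T" "w \<in>. T"
 then obtain u v where u: "u \<in>. FP" "v \<in>. FP" "z = Qt.cl u" "w = Qt.cl v" by (auto simp: T_surj)
 have c: "u \<oplus>\<^sub>FP v \<in>. FP" using u abelian_monoid.a_closed[OF abelian_group.axioms(1)[OF F.F_group]] by blast
 note sc = amapc[OF FP_scale_amap[OF assms]]
 have "(z \<oplus>\<^sub>T w) \<bullet>\<^sub>T al = Qt.cl ((u \<oplus>\<^sub>FP v) \<bullet>\<^sub>FP al)"
  unfolding u(3,4) ama[OF cl_amap u(1,2), symmetric] by (rule cl_scale_T[OF assms c])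
 also have "... = Qt.cl (u \<bullet>\<^sub>FP al) \<oplus>\<^sub>T Qt.cl (v \<bullet>\<^sub>FP al)"
  by (simp only: ama[OF FP_scale_amap[OF assms] u(1,2)] ama[OF cl_amap sc[OF u(1)] sc[OF u(2)]])
 also have "... = z \<bullet>\<^sub>T al \<oplus>\<^sub>T w \<bullet>\<^sub>T al"
  unfolding u(3,4) by (simp only: cl_scale_T[OF assms u(1)] cl_scale_T[OF assms u(2)])
 finally show "(z \<oplus>\<^sub>T w) \<bullet>\<^sub>T al = z \<bullet>\<^sub>T al \<oplus>\<^sub>T w \<bullet>\<^sub>T al" .
qed

lemma pu_scale: "[|x \<in>. M; y \<in>. N; al \<in>. K|] ==> pu x y \<bullet>\<^sub>T al = pu x (y \<bullet>\<^sub>N al)"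
 unfolding pu_cl by (subst cl_scale_T) (auto simp: FP_scale)

lemma FP_hpart: "u \<in> hpart FP i \<longleftrightarrow> Poly_Mapping.keys u <= (\<Union>j. hpart M j \<times> hpart N (i - j))"
 by (simp add: free_pairs_def)

lemma T_hpart: "hpart T i = Qt.cl ` hpart FP i"
 using Qt.Q_simps(6) by (simp add: QtT)

lemma FP_hpart_sub: "hpart FP i <= carrier FP"
proof
 fix u assume "u \<in> hpart FP i"
 then have "Poly_Mapping.keys u <= (\<Union>j. hpart M j \<times> hpart N (i - j))" by (simp only: FP_hpart)
 also have "... <= carrier M \<times> carrier N" using M.MG.hpc N.MG.hpc by blast
 finally show "u \<in>. FP" by (simp only: F.F_carr_iff)
qed

lemma T_hp_sub: "additive_subgroup (hpart T i) T"
proof (rule additive_subgroupI'[OF T_grp])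
 show "hpart T i <= carrier T" using FP_hpart_sub amapc[OF cl_amap] by (auto simp: T_hpart)
 show "\<zero>\<^sub>T \<in> hpart T i" unfolding T_hpart F.F_amap_zero[OF cl_amap T_grp, symmetric] by (rule imageI) (simp add: FP_hpart)
next
 fix x y assume "x \<in> hpart T i" "y \<in> hpart T i"
 then obtain s t where s: "s \<in> hpart FP i" "t \<in> hpart FP i" "x = Qt.cl s" "y = Qt.cl t" by (auto simp: T_hpart)
 then have c: "s \<in>. FP" "t \<in>. FP" using FP_hpart_sub by auto
 have "x \<oplus>\<^sub>T y = Qt.cl (s + t)" using ama[OF cl_amap c] s by (simp add: F.F_plus)
 moreover have "s + t \<in> hpart FP i" using s(1,2) keys_add[of s t] unfolding FP_hpart by blast
 ultimately show "x \<oplus>\<^sub>T y \<in> hpart T i" by (simp add: T_hpart)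
next
 fix x assume "x \<in> hpart T i"
 then obtain s where s: "s \<in> hpart FP i" "x = Qt.cl s" by (auto simp: T_hpart)
 then have c: "s \<in>. FP" using FP_hpart_sub by auto
 have "\<ominus>\<^sub>T x = Qt.cl (- s)" using amap_neg[OF cl_amap F.F_group T_grp c] s c by (simp add: F.F_neg)
 moreover have "- s \<in> hpart FP i" using s(1) by (simp add: FP_hpart)
 ultimately show "\<ominus>\<^sub>T x \<in> hpart T i" by (simp add: T_hpart)
qed

lemmas T_hp_closed = additive_subgroup_closed[OF T_hp_sub]

lemma pu_hp: "[|x \<in> hpart M i; y \<in> hpart N j|] ==> pu x y \<in> hpart T (i + j)"
 unfolding T_hpart pu_cl
 by (rule imageI, subst FP_hpart) (auto intro!: bexI[of _ i] exI[of _ i] simp: add.assoc[symmetric])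

lemma T_hinduct [consumes 1, case_names pu add]:
 assumes "z \<in> hpart T k" "!!i j x y. [|x \<in> hpart M i; y \<in> hpart N j|] ==> Q (i + j) (pu x y)"
  "!!k z w. [|z \<in> hpart T k; w \<in> hpart T k; Q k z; Q k w|] ==> Q k (z \<oplus>\<^sub>T w)"
 shows "Q k z"
proof -
 interpret T: abelian_group T by (rule T_grp)
 obtain t where t: "t \<in> hpart FP k" "z = Qt.cl t" using assms(1) by (auto simp: T_hpart)
 have t': "Poly_Mapping.keys t <= (\<Union>j. hpart M j \<times> hpart N (k - j))" using t(1) by (simp only: FP_hpart)
 note cc = amapc[OF cl_amap]
 have z: "Q k (\<zero>\<^sub>T)"
  using assms(2)[of "\<zero>\<^sub>M" k "\<zero>\<^sub>N" 0] amap_zero[OF pu_amap1 M.M.ag T_grp] by simp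
 have "Q k (Qt.cl t) \<and> Q k (\<ominus>\<^sub>T Qt.cl t)" using t'
 proof (induction rule: keys_induct)
  case zero then show ?case using z by (simp add: F.F_amap_zero[OF cl_amap T_grp] T.neg_zero)
 next
  case (diff s t)
  have h: "s \<in> hpart FP k" "t \<in> hpart FP k" using diff(1,2) by (simp_all only: FP_hpart)
  then have c: "s \<in>. FP" "t \<in>. FP" using FP_hpart_sub by auto
  have m: "Qt.cl s \<in> hpart T k" "Qt.cl t \<in> hpart T k" using h by (auto simp: T_hpart)
  then have n: "\<ominus>\<^sub>T Qt.cl s \<in> hpart T k" "\<ominus>\<^sub>T Qt.cl t \<in> hpart T k"
   using additive_subgroup_neg[OF T_hp_sub T_grp] by auto
  have "Q k (Qt.cl s \<oplus>\<^sub>T \<ominus>\<^sub>T Qt.cl t)" "Q k (Qt.cl t \<oplus>\<^sub>T \<ominus>\<^sub>T Qt.cl s)"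
   using diff(3,4) m n by (auto intro!: assms(3))
  then show ?case using c cc[OF c(1)] cc[OF c(2)] by (simp add: F.F_amap_diff[OF cl_amap T_grp] T.minus_eq T.minus_add T.a_comm)
 next
  case (of b)
  then obtain x y j where b: "b = (x, y)" "x \<in> hpart M j" "y \<in> hpart N (k - j)" by blast
  have "\<ominus>\<^sub>T pu x y = pu (\<ominus>\<^sub>M x) y"
   using amap_neg[OF pu_amap1 M.M.ag T_grp M.MG.hpc[OF b(2)], of y] N.MG.hpc[OF b(3)] by simp
  moreover have "j + (k - j) = k" by (cases j; cases k) simp_all
  ultimately show ?case using b assms(2)[OF b(2,3)] assms(2)[OF M.MG.hp_neg[OF b(2)] b(3)] by (simp add: pu_cl)
 qed
 then show ?thesis using t by simp
qed

end

section \<open>The tensor square of a superalgebra\<close>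

locale talg = kalg K A e
 for K :: "('k, 'm) graded_ring_scheme" and A :: "('b, 'k, 'o) smodule_scheme" and e :: "'k => 'b"
begin

sublocale tens K A A ..

text \<open>The product of a \<otimes> b and c \<otimes> d. The sum over the components of c is
  collapsed by \<open>tw\<close>, so that only b is split by parity.\<close>

definition mu where "mu a b c d = pu (a \<otimes>\<^sub>A c) (hcomp A 0 b \<otimes>\<^sub>A d) \<oplus>\<^sub>T pu (a \<otimes>\<^sub>A MG.tw 1 c) (hcomp A 1 b \<otimes>\<^sub>A d)"

definition wp where "wp p r = (\<Sum>j\<in>{0, 1}. \<Sum>k\<in>{0, 1::bit}.
   fof (sg A (j * k) (fst p \<otimes>\<^sub>A hcomp A k (fst r)), hcomp A j (snd p) \<otimes>\<^sub>A snd r))"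

lemma FP_mult: "u \<otimes>\<^sub>FP v = frag_extend (%p. frag_extend (wp p) v) u"
 by (simp add: free_pairs_def wp_def[abs_def] case_prod_beta')

lemma wp_alt: "wp (a, b) (c, d) =
  fof (a \<otimes>\<^sub>A hcomp A 0 c, hcomp A 0 b \<otimes>\<^sub>A d) + fof (a \<otimes>\<^sub>A hcomp A 1 c, hcomp A 0 b \<otimes>\<^sub>A d)
 + (fof (a \<otimes>\<^sub>A hcomp A 0 c, hcomp A 1 b \<otimes>\<^sub>A d) + fof (\<ominus>\<^sub>A (a \<otimes>\<^sub>A hcomp A 1 c), hcomp A 1 b \<otimes>\<^sub>A d))"
 by (simp add: wp_def)

lemma wp_closed: "[|p \<in> carrier A \<times> carrier A; r \<in> carrier A \<times> carrier A|] ==> wp p r \<in>. FP"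
 by (cases p; cases r) (auto simp: wp_alt intro!: F.F_add_closed)

lemma cl_wp: assumes "a \<in>. A" "b \<in>. A" "c \<in>. A" "d \<in>. A"
 shows "Qt.cl (wp (a, b) (c, d)) = mu a b c d"
proof -
 note pl = ama[OF cl_amap, unfolded F.F_plus]
 interpret T: abelian_group T by (rule T_grp)
 have 1: "pu (a \<otimes>\<^sub>A hcomp A 0 c) y \<oplus>\<^sub>T pu (a \<otimes>\<^sub>A hcomp A 1 c) y = pu (a \<otimes>\<^sub>A c) y" if "y \<in>. A" for y
  using that assms by (simp add: ama[OF pu_amap1, symmetric] R.r_distr[symmetric] MG.hc_sum)
 have 2: "pu (a \<otimes>\<^sub>A hcomp A 0 c) y \<oplus>\<^sub>T pu (\<ominus>\<^sub>A (a \<otimes>\<^sub>A hcomp A 1 c)) y = pu (a \<otimes>\<^sub>A MG.tw 1 c) y" if "y \<in>. A" for y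
  using that assms by (simp add: ama[OF pu_amap1, symmetric] MG.tw_def R.r_distr R.r_minus)
 have "Qt.cl (wp (a, b) (c, d)) = pu (a \<otimes>\<^sub>A hcomp A 0 c) (hcomp A 0 b \<otimes>\<^sub>A d) \<oplus>\<^sub>T pu (a \<otimes>\<^sub>A hcomp A 1 c) (hcomp A 0 b \<otimes>\<^sub>A d)
  \<oplus>\<^sub>T (pu (a \<otimes>\<^sub>A hcomp A 0 c) (hcomp A 1 b \<otimes>\<^sub>A d) \<oplus>\<^sub>T pu (\<ominus>\<^sub>A (a \<otimes>\<^sub>A hcomp A 1 c)) (hcomp A 1 b \<otimes>\<^sub>A d))"
  using assms by (simp add: wp_alt pl F.F_add_closed pu_cl)
 then show ?thesis using assms by (simp add: 1 2 mu_def)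
qed

lemma FP_amapR: "v \<in>. FP ==> amap FP FP (%u. u \<otimes>\<^sub>FP v)"
 unfolding FP_mult
 by (rule F.F_extend_amap[OF F.fragg_axioms], rule amapc[OF F.F_extend_amap[OF F.fragg_axioms]])
   (auto intro: wp_closed)

lemma FP_amapL: assumes "u \<in>. FP" shows "amap FP FP (%v. u \<otimes>\<^sub>FP v)"
proof (rule amapI)
 fix x assume "x \<in>. FP" then show "u \<otimes>\<^sub>FP x \<in>. FP" using amapc[OF FP_amapR assms] by simp
next
 fix x y
 show "u \<otimes>\<^sub>FP (x \<oplus>\<^sub>FP y) = u \<otimes>\<^sub>FP x \<oplus>\<^sub>FP u \<otimes>\<^sub>FP y"
  by (simp add: FP_mult F.F_plus frag_extend_add frag_extend_plus_fun)
qed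

lemma cl_FP_of: "[|a \<in>. A; b \<in>. A; c \<in>. A; d \<in>. A|]
  ==> Qt.cl (fof (a, b) \<otimes>\<^sub>FP fof (c, d)) = mu a b c d"
 by (simp add: FP_mult cl_wp)

lemma mu_homog: assumes "a \<in>. A" "b \<in> hpart A j" "c \<in> hpart A k" "d \<in>. A"
 shows "mu a b c d = sg T (j * k) (pu (a \<otimes>\<^sub>A c) (b \<otimes>\<^sub>A d))"
proof -
 interpret T: abelian_group T by (rule T_grp)
 have c: "b \<in>. A" "c \<in>. A" using assms by (auto intro: MG.hpc)
 have z: "pu x \<zero>\<^sub>A = \<zero>\<^sub>T" if "x \<in>. A" for x using amap_zero[OF pu_amap2[OF that] M.ag T_grp] .
 show ?thesis using assms c
  by (cases j) (simp_all add: mu_def MG.hc_homog z MG.tw_homog[of c k] sg_mult2 pu_sg1)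
qed

lemma mu_amap: 
 "[|b \<in>. A; c \<in>. A; d \<in>. A|] ==> amap A T (%a. mu a b c d)"
 "[|a \<in>. A; c \<in>. A; d \<in>. A|] ==> amap A T (%b. mu a b c d)"
 "[|a \<in>. A; b \<in>. A; d \<in>. A|] ==> amap A T (%c. mu a b c d)"
 "[|a \<in>. A; b \<in>. A; c \<in>. A|] ==> amap A T (%d. mu a b c d)"
 unfolding mu_def by (auto intro!: am_plus am_pu1 am_pu2 am_mult1 am_mult2 am_intros)

lemma am_mu:
 "[|amap X A f; b \<in>. A; c \<in>. A; d \<in>. A|] ==> amap X T (%x. mu (f x) b c d)"
 "[|amap X A f; a \<in>. A; c \<in>. A; d \<in>. A|] ==> amap X T (%x. mu a (f x) c d)"
 "[|amap X A f; a \<in>. A; b \<in>. A; d \<in>. A|] ==> amap X T (%x. mu a b (f x) d)"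
 "[|amap X A f; a \<in>. A; b \<in>. A; c \<in>. A|] ==> amap X T (%x. mu a b c (f x))"
 by (rule amc[OF _ mu_amap(1)] amc[OF _ mu_amap(2)] amc[OF _ mu_amap(3)] amc[OF _ mu_amap(4)]; assumption)+

text \<open>With i, j, k the parities of al, b, c: moving the scalar past c costs (-1)^(ik), exactly
  the change of the sign (-1)^(jk) when b takes up the scalar.\<close>

lemma mu_bal1: assumes abcd: "a \<in>. A" "b \<in>. A" "c \<in>. A" "d \<in>. A" and "al \<in>. K"
 shows "mu (a \<bullet>\<^sub>A al) b c d = mu a (lscale K A al b) c d"
proof (rule KG.amap_eqI[where x=al and N=T and f="%al. mu (a \<bullet>\<^sub>A al) b c d"])
 fix i al assume al: "al \<in> hpart K i"
 note [simp] = KG.hpc[OF al]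
 show "mu (a \<bullet>\<^sub>A al) b c d = mu a (lscale K A al b) c d"
 proof (rule MG.amap_eqI[where x=b and N=T and f="%b. mu (a \<bullet>\<^sub>A al) b c d"])
  fix j b assume b: "b \<in> hpart A j"
  note [simp] = MG.hpc[OF b]
  show "mu (a \<bullet>\<^sub>A al) b c d = mu a (lscale K A al b) c d"
  proof (rule MG.amap_eqI[where x=c and N=T and f="%c. mu (a \<bullet>\<^sub>A al) b c d"])
   fix k c assume c: "c \<in> hpart A k"
   note [simp] = MG.hpc[OF c]
   have "mu (a \<bullet>\<^sub>A al) b c d = sg T (j * k) (pu ((a \<bullet>\<^sub>A al) \<otimes>\<^sub>A c) (b \<otimes>\<^sub>A d))"
    using abcd by (intro mu_homog b c) (auto simp: scale_closed)
   also have "(a \<bullet>\<^sub>A al) \<otimes>\<^sub>A c = sg A (i * k) ((a \<otimes>\<^sub>A c) \<bullet>\<^sub>A al)"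
    using abcd by (simp add: scale_mult_l lscale_homog2[OF al c] sg_mult2 scale_closed scale_mult_r)
   also have "sg T (j * k) (pu (sg A (i * k) ((a \<otimes>\<^sub>A c) \<bullet>\<^sub>A al)) (b \<otimes>\<^sub>A d))
     = sg T (j * k + i * k) (pu (a \<otimes>\<^sub>A c) (lscale K A al b \<otimes>\<^sub>A d))"
    using abcd by (simp add: pu_sg1 scale_closed abelian_group.sg_sg[OF T_grp] pu_bal lscale_mult_l)
   also have "... = mu a (lscale K A al b) c d"
    using abcd mu_homog[OF abcd(1) lscale_hp[OF al b] c abcd(4)] by (simp add: distrib_right add.commute)
   finally show "mu (a \<bullet>\<^sub>A al) b c d = mu a (lscale K A al b) c d" .
  qed (use abcd in \<open>auto intro!: am_mu am_intros simp: scale_closed\<close>)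
 qed (use abcd in \<open>auto intro!: am_mu am_intros simp: scale_closed\<close>)
qed (use assms in \<open>auto intro!: am_mu am_intros simp: scale_closed\<close>)

text \<open>Here the scalar has to pass b on its way to d. This sign compensates the change of the
  parity of the third factor.\<close>

lemma mu_bal2: assumes abcd: "a \<in>. A" "b \<in>. A" "c \<in>. A" "d \<in>. A" and "al \<in>. K"
 shows "mu a b (c \<bullet>\<^sub>A al) d = mu a b c (lscale K A al d)"
proof (rule KG.amap_eqI[where x=al and N=T and f="%al. mu a b (c \<bullet>\<^sub>A al) d"])
 fix i al assume al: "al \<in> hpart K i"
 note [simp] = KG.hpc[OF al]
 show "mu a b (c \<bullet>\<^sub>A al) d = mu a b c (lscale K A al d)"
 proof (rule MG.amap_eqI[where x=b and N=T and f="%b. mu a b (c \<bullet>\<^sub>A al) d"])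
  fix j b assume b: "b \<in> hpart A j"
  note [simp] = MG.hpc[OF b]
  show "mu a b (c \<bullet>\<^sub>A al) d = mu a b c (lscale K A al d)"
  proof (rule MG.amap_eqI[where x=c and N=T and f="%c. mu a b (c \<bullet>\<^sub>A al) d"])
   fix k c assume c: "c \<in> hpart A k"
   note [simp] = MG.hpc[OF c]
   have l: "lscale K A al (b \<otimes>\<^sub>A d) = sg A (i * j) (b \<otimes>\<^sub>A lscale K A al d)"
    using abcd by (simp add: lscale_mult_l[symmetric] lscale_homog2[OF al b] sg_mult1 scale_closed scale_mult_l)
   have "mu a b (c \<bullet>\<^sub>A al) d = sg T (j * (k + i)) (pu (a \<otimes>\<^sub>A (c \<bullet>\<^sub>A al)) (b \<otimes>\<^sub>A d))"
    using abcd by (intro mu_homog b scale_parity[OF c al])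
   also have "pu (a \<otimes>\<^sub>A (c \<bullet>\<^sub>A al)) (b \<otimes>\<^sub>A d) = sg T (i * j) (pu (a \<otimes>\<^sub>A c) (b \<otimes>\<^sub>A lscale K A al d))"
    using abcd by (simp add: scale_mult_r pu_bal l pu_sg2)
   also have "sg T (j * (k + i)) (sg T (i * j) (pu (a \<otimes>\<^sub>A c) (b \<otimes>\<^sub>A lscale K A al d))) = mu a b c (lscale K A al d)"
    using abcd mu_homog[OF abcd(1) b c, of "lscale K A al d"]
    by (simp add: abelian_group.sg_sg[OF T_grp] bit_ac)
   finally show "mu a b (c \<bullet>\<^sub>A al) d = mu a b c (lscale K A al d)" .
  qed (use abcd in \<open>auto intro!: am_mu am_intros simp: scale_closed\<close>)
 qed (use abcd in \<open>auto intro!: am_mu am_intros simp: scale_closed\<close>)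
qed (use assms in \<open>auto intro!: am_mu am_intros simp: scale_closed\<close>)

text \<open>For a fixed pair as one factor the product is balanced in the other pair, hence kills
  the null group; additivity then extends this from pairs to all of v.\<close>

lemma absorb: assumes u: "u \<in> tensor_null K A A" and v: "v \<in>. FP"
 shows "u \<otimes>\<^sub>FP v \<in> tensor_null K A A" "v \<otimes>\<^sub>FP u \<in> tensor_null K A A"
proof -
 have uc: "u \<in>. FP" using u additive_subgroup_closed(1)[OF null_sub] by blast
 have "Qt.cl (u \<otimes>\<^sub>FP v) = \<zero>\<^sub>T"
 proof (rule F.F_ext[OF amc[OF FP_amapL[OF uc] cl_amap] amap_const0[OF T_grp] T_grp _ v])
  fix r assume r: "r \<in> carrier A \<times> carrier A"
  then obtain c d where cd: "r = (c, d)" "c \<in>. A" "d \<in>. A" by auto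
  have fr: "fof (c, d) \<in>. FP" using cd by simp
  have "balanced K A A T (%a b. mu a b c d)"
   unfolding balanced_def using cd by (auto simp: mu_bal1 intro!: am_mu amap_id)
  then show "Qt.cl (u \<otimes>\<^sub>FP fof r) = \<zero>\<^sub>T" unfolding cd(1)
   by (rule balanced_kill[OF _ T_grp amc[OF FP_amapR[OF fr] cl_amap] _ u]) (simp add: cl_FP_of cd)
 qed
 then show "u \<otimes>\<^sub>FP v \<in> tensor_null K A A"
  using Qt.cl_zero_iff[OF amapc[OF FP_amapL[OF uc] v]] by (simp add: QtT)
 have "Qt.cl (v \<otimes>\<^sub>FP u) = \<zero>\<^sub>T"
 proof (rule F.F_ext[OF amc[OF FP_amapR[OF uc] cl_amap] amap_const0[OF T_grp] T_grp _ v])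
  fix r assume r: "r \<in> carrier A \<times> carrier A"
  then obtain a b where ab: "r = (a, b)" "a \<in>. A" "b \<in>. A" by auto
  have fr: "fof (a, b) \<in>. FP" using ab by simp
  have "balanced K A A T (%c d. mu a b c d)"
   unfolding balanced_def using ab by (auto simp: mu_bal2 intro!: am_mu amap_id)
  then show "Qt.cl (fof r \<otimes>\<^sub>FP u) = \<zero>\<^sub>T" unfolding ab(1)
   by (rule balanced_kill[OF _ T_grp amc[OF FP_amapL[OF fr] cl_amap] _ u]) (simp add: cl_FP_of ab)
 qed
 then show "v \<otimes>\<^sub>FP u \<in> tensor_null K A A"
  using Qt.cl_zero_iff[OF amapc[OF FP_amapL[OF v] uc]] by (simp add: QtT)
qed

lemma cl_T_mult: "[|u \<in>. FP; v \<in>. FP|] ==> Qt.cl u \<otimes>\<^sub>T Qt.cl v = Qt.cl (u \<otimes>\<^sub>FP v)"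
 unfolding QtT[symmetric]
 by (rule Qt.cl_mult[symmetric]) (auto intro: FP_amapL FP_amapR absorb)

lemma pu_mult: "[|a \<in>. A; b \<in>. A; c \<in>. A; d \<in>. A|] ==> pu a b \<otimes>\<^sub>T pu c d = mu a b c d"
 unfolding pu_cl by (subst cl_T_mult) (auto simp: cl_FP_of)

lemma pu_mult_homog: "[|a \<in>. A; b \<in> hpart A j; c \<in> hpart A k; d \<in>. A|]
  ==> pu a b \<otimes>\<^sub>T pu c d = sg T (j * k) (pu (a \<otimes>\<^sub>A c) (b \<otimes>\<^sub>A d))"
 by (simp add: pu_mult mu_homog MG.hpc)

lemma T_amap: assumes z: "z \<in>. T" shows T_amapL: "amap T T (%w. z \<otimes>\<^sub>T w)" and T_amapR: "amap T T (%w. w \<otimes>\<^sub>T z)"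
proof -
 obtain u where u: "u \<in>. FP" "z = Qt.cl u" using z by (auto simp: T_surj)
 note cl1 = amapc[OF FP_amapL[OF u(1)]] and cl2 = amapc[OF FP_amapR[OF u(1)]] and cc = amapc[OF cl_amap]
 show "amap T T (%w. z \<otimes>\<^sub>T w)"
 proof (rule amapI)
  fix x assume "x \<in>. T" then obtain s where "s \<in>. FP" "x = Qt.cl s" by (auto simp: T_surj)
  then show "z \<otimes>\<^sub>T x \<in>. T" using u by (simp add: cl_T_mult cl1 cc)
 next
  fix x y assume "x \<in>. T" "y \<in>. T"
  then obtain s t where s: "s \<in>. FP" "t \<in>. FP" "x = Qt.cl s" "y = Qt.cl t" by (auto simp: T_surj)
  have c: "s \<oplus>\<^sub>FP t \<in>. FP" using s abelian_monoid.a_closed[OF abelian_group.axioms(1)[OF F.F_group]] by blast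
  have "z \<otimes>\<^sub>T (x \<oplus>\<^sub>T y) = Qt.cl (u \<otimes>\<^sub>FP (s \<oplus>\<^sub>FP t))"
   by (simp only: u(2) s(3,4) ama[OF cl_amap s(1,2), symmetric] cl_T_mult[OF u(1) c])
  also have "... = Qt.cl (u \<otimes>\<^sub>FP s) \<oplus>\<^sub>T Qt.cl (u \<otimes>\<^sub>FP t)"
   by (simp only: ama[OF FP_amapL[OF u(1)] s(1,2)] ama[OF cl_amap cl1[OF s(1)] cl1[OF s(2)]])
  finally show "z \<otimes>\<^sub>T (x \<oplus>\<^sub>T y) = z \<otimes>\<^sub>T x \<oplus>\<^sub>T z \<otimes>\<^sub>T y"
   by (simp only: u(2) s(3,4) cl_T_mult[OF u(1) s(1)] cl_T_mult[OF u(1) s(2)])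
 qed
 show "amap T T (%w. w \<otimes>\<^sub>T z)"
 proof (rule amapI)
  fix x assume "x \<in>. T" then obtain s where "s \<in>. FP" "x = Qt.cl s" by (auto simp: T_surj)
  then show "x \<otimes>\<^sub>T z \<in>. T" using u by (simp add: cl_T_mult cl2 cc)
 next
  fix x y assume "x \<in>. T" "y \<in>. T"
  then obtain s t where s: "s \<in>. FP" "t \<in>. FP" "x = Qt.cl s" "y = Qt.cl t" by (auto simp: T_surj)
  have c: "s \<oplus>\<^sub>FP t \<in>. FP" using s abelian_monoid.a_closed[OF abelian_group.axioms(1)[OF F.F_group]] by blast
  have "(x \<oplus>\<^sub>T y) \<otimes>\<^sub>T z = Qt.cl ((s \<oplus>\<^sub>FP t) \<otimes>\<^sub>FP u)"
   by (simp only: u(2) s(3,4) ama[OF cl_amap s(1,2), symmetric] cl_T_mult[OF c u(1)])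
  also have "... = Qt.cl (s \<otimes>\<^sub>FP u) \<oplus>\<^sub>T Qt.cl (t \<otimes>\<^sub>FP u)"
   by (simp only: ama[OF FP_amapR[OF u(1)] s(1,2)] ama[OF cl_amap cl2[OF s(1)] cl2[OF s(2)]])
  finally show "(x \<oplus>\<^sub>T y) \<otimes>\<^sub>T z = x \<otimes>\<^sub>T z \<oplus>\<^sub>T y \<otimes>\<^sub>T z"
   by (simp only: u(2) s(3,4) cl_T_mult[OF s(1) u(1)] cl_T_mult[OF s(2) u(1)])
 qed
qed

lemma T_one: "\<one>\<^sub>T = pu \<one>\<^sub>A \<one>\<^sub>A"
 using Qt.Q_simps(3) by (simp add: QtT pu_cl) (simp add: free_pairs_def)

lemma T_sg_mult1: "[|x \<in>. T; y \<in>. T|] ==> sg T i x \<otimes>\<^sub>T y = sg T i (x \<otimes>\<^sub>T y)"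
 using amap_sg[OF T_amapR T_grp T_grp] by blast
lemma T_sg_mult2: "[|x \<in>. T; y \<in>. T|] ==> x \<otimes>\<^sub>T sg T i y = sg T i (x \<otimes>\<^sub>T y)"
 using amap_sg[OF T_amapL T_grp T_grp] by blast

lemma T_ring: "ring T"
proof (rule ringI[OF T_grp])
 interpret T: abelian_group T by (rule T_grp)
 note clm = amapc[OF T_amapL]
 show "Group.monoid T"
 proof (rule monoidI)
  fix x y z assume x: "x \<in>. T" and y: "y \<in>. T" and z: "z \<in>. T"
  show "x \<otimes>\<^sub>T y \<otimes>\<^sub>T z = x \<otimes>\<^sub>T (y \<otimes>\<^sub>T z)" using x
  proof (induction rule: T_induct)
   case (pu i j a b)
   note ca = MG.hpc[OF pu(1)] MG.hpc[OF pu(2)]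
   note ab = pu_closed[OF ca]
   from y show ?case
   proof (induction rule: T_induct)
    case (pu k l c d)
    note b = \<open>b \<in> hpart A j\<close>
    note ca = ca MG.hpc[OF pu(1)] MG.hpc[OF pu(2)]
    note cd = pu_closed[OF ca(3,4)]
    from z show ?case
    proof (induction rule: T_induct)
     case (pu m n f h)
     note c = \<open>c \<in> hpart A k\<close> and d = \<open>d \<in> hpart A l\<close>
     note ca = ca MG.hpc[OF pu(1)] MG.hpc[OF pu(2)]
     note fh = pu_closed[OF ca(5,6)]
     have "pure K A A a b \<otimes>\<^sub>T pure K A A c d \<otimes>\<^sub>T pure K A A f h
       = sg T (j * k) (sg T ((j + l) * m) (pure K A A (a \<otimes>\<^sub>A c \<otimes>\<^sub>A f) (b \<otimes>\<^sub>A d \<otimes>\<^sub>A h)))"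
      using ca fh by (simp add: pu_mult_homog[OF ca(1) b c ca(4)] T_sg_mult1
        pu_mult_homog[OF R.m_closed[OF ca(1,3)] mult_hp[OF b d] pu(1) ca(6)])
     also have "... = sg T (l * m) (sg T (j * (k + m)) (pure K A A (a \<otimes>\<^sub>A (c \<otimes>\<^sub>A f)) (b \<otimes>\<^sub>A (d \<otimes>\<^sub>A h))))"
      using ca by (simp add: T.sg_sg R.m_assoc bit_ac)
     also have "... = pure K A A a b \<otimes>\<^sub>T (pure K A A c d \<otimes>\<^sub>T pure K A A f h)"
      using ca ab by (simp add: pu_mult_homog[OF ca(3) d pu(1) ca(6)] T_sg_mult2
        pu_mult_homog[OF ca(1) b mult_hp[OF c pu(1)] R.m_closed[OF ca(4,6)]])
     finally show ?case .
    next
     case (add z w)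
     then show ?case using ab cd clm by (simp add: ama[OF T_amapL])
    qed
   next
    case (add y w)
    then show ?case using ab z clm by (simp add: ama[OF T_amapL] ama[OF T_amapR])
   qed
  next
   case (add x w)
   then show ?case using y z clm by (simp add: ama[OF T_amapR])
  qed
 next
  fix x assume x: "x \<in>. T"
  have o: "\<one>\<^sub>T \<in>. T" by (simp add: T_one)
  show "\<one>\<^sub>T \<otimes>\<^sub>T x = x"
   by (rule T_ext[OF T_amapL[OF o] amap_id _ x]) (simp add: T_one pu_mult_homog[OF _ one_hp] MG.hpc)
  show "x \<otimes>\<^sub>T \<one>\<^sub>T = x"
   by (rule T_ext[OF T_amapR[OF o] amap_id _ x]) (simp add: T_one pu_mult_homog[OF _ _ one_hp] MG.hpc)
 qed (simp_all add: T_one clm)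
 fix x y z assume "x \<in>. T" "y \<in>. T" "z \<in>. T"
 then show "(x \<oplus>\<^sub>T y) \<otimes>\<^sub>T z = x \<otimes>\<^sub>T z \<oplus>\<^sub>T y \<otimes>\<^sub>T z" "z \<otimes>\<^sub>T (x \<oplus>\<^sub>T y) = z \<otimes>\<^sub>T x \<oplus>\<^sub>T z \<otimes>\<^sub>T y"
  by (simp_all add: ama[OF T_amapL] ama[OF T_amapR])
qed

lemma T_mult_hp: assumes "z \<in> hpart T i" "w \<in> hpart T j" shows "z \<otimes>\<^sub>T w \<in> hpart T (i + j)"
 using assms(1)
proof (induction rule: T_hinduct)
 case (pu i i' a b)
 note pu1 = pu
 note ca = MG.hpc[OF pu(1)] MG.hpc[OF pu(2)]
 from assms(2) show ?case
 proof (induction rule: T_hinduct)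
  case (pu k l c d)
  have "pure K A A (a \<otimes>\<^sub>A c) (b \<otimes>\<^sub>A d) \<in> hpart T ((i + k) + (i' + l))"
   using pu_hp[OF mult_hp[OF pu1(1) pu(1)] mult_hp[OF pu1(2) pu(2)]] .
  then show ?case using additive_subgroup_neg[OF T_hp_sub T_grp]
   by (simp add: pu_mult_homog[OF ca(1) pu1(2) pu(1) MG.hpc[OF pu(2)]] sg_def add.assoc add.left_commute add.commute)
 next
  case (add k z w)
  then show ?case using T_hp_closed ca by (simp add: ama[OF T_amapL])
 qed
next
 case (add k z w')
 then show ?case using T_hp_closed assms(2) by (simp add: ama[OF T_amapR])
qed

lemma T_scale: assumes "al \<in>. K" "z \<in>. T" shows "z \<bullet>\<^sub>T al = z \<otimes>\<^sub>T pu \<one>\<^sub>A (e al)"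
 by (rule T_ext[OF T_scale_amap T_amapR _ assms(2)])
   (use assms in \<open>simp_all add: pu_scale pu_mult_homog[OF _ _ one_hp] MG.hpc scale_e\<close>)

lemma eT_hom: "(%al. pu \<one>\<^sub>A (e al)) \<in> ring_hom K T"
proof (rule ring_hom_memI)
 fix al ga assume a: "al \<in>. K" "ga \<in>. K"
 show "pu \<one>\<^sub>A (e (al \<oplus>\<^sub>K ga)) = pu \<one>\<^sub>A (e al) \<oplus>\<^sub>T pu \<one>\<^sub>A (e ga)"
  using a by (simp add: e_simps ama[OF pu_amap2])
 have "mu \<one>\<^sub>A b \<one>\<^sub>A d = pu \<one>\<^sub>A (b \<otimes>\<^sub>A d)" if "b \<in>. A" "d \<in>. A" for b d
  by (rule MG.amap_eqI[where x=b and N=T and f="%b. mu \<one>\<^sub>A b \<one>\<^sub>A d"])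
    (use that in \<open>auto intro!: am_mu am_pu2 am_mult1 amap_id simp: mu_homog[OF _ _ one_hp]\<close>)
 then show "pu \<one>\<^sub>A (e (al \<otimes>\<^sub>K ga)) = pu \<one>\<^sub>A (e al) \<otimes>\<^sub>T pu \<one>\<^sub>A (e ga)"
  using a by (simp add: pu_mult e_simps)
qed (simp_all add: T_one e_simps)

end

section \<open>Convolution along a comultiplication\<close>

text \<open>Homogeneous right linear maps of parity d as a predicate on bare functions. Unlike
  elements of \<open>sHom\<close> they need not be extensional, so shifted maps y |-> f (X y) and
  pointwise sums are covered directly.\<close>

definition lin where
 "lin K M N d f \<longleftrightarrow> amap M N f \<and> (\<forall>x \<in> carrier M. \<forall>al \<in> carrier K. f (x \<bullet>\<^sub>M al) = f x \<bullet>\<^sub>N al) \<and>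
   (\<forall>j. \<forall>x \<in> hpart M j. f x \<in> hpart N (d + j))"

lemma linD:
 assumes "lin K M N d f"
 shows lin_amap: "amap M N f" and lin_scale: "[|x \<in>. M; al \<in>. K|] ==> f (x \<bullet>\<^sub>M al) = f x \<bullet>\<^sub>N al"
  and lin_hp: "x \<in> hpart M j ==> f x \<in> hpart N (d + j)"
  and linc: "x \<in>. M ==> f x \<in>. N"
  and lin_add: "[|x \<in>. M; y \<in>. M|] ==> f (x \<oplus>\<^sub>M y) = f x \<oplus>\<^sub>N f y"
 using assms by (auto simp: lin_def ama intro: amapc)

lemma lin_comp: "[|lin K M N d f; lin K N P d' h|] ==> lin K M P (d + d') (%x. h (f x))"
 unfolding lin_def by (auto intro: amc simp: amapc) (metis add.assoc add.commute)

lemma lin_id: "lin K M M 0 (%x. x)"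
 by (simp add: lin_def amap_id)

lemma lin_plus: assumes "supermodule K N" "lin K M N d f" "lin K M N d h"
 shows "lin K M N d (%x. f x \<oplus>\<^sub>N h x)"
proof -
 interpret N: supermodule K N by fact
 show ?thesis using assms(2,3)
  by (auto simp: lin_def N.scale_add_left amapc intro!: amap_plus N.M.ag N.MG.hp_add)
qed

lemma lin_sg: assumes "supermodule K N" "lin K M N d f"
 shows "lin K M N d (%x. sg N i (f x))"
proof -
 interpret N: supermodule K N by fact
 show ?thesis using assms(2)
  by (auto simp: lin_def N.scale_sg1 amapc intro!: N.MG.am_sg N.MG.hp_sg)
qed

lemma lin_zero: assumes "supermodule K N" shows "lin K M N d (%x. \<zero>\<^sub>N)"
proof -
 interpret N: supermodule K N by fact
 show ?thesis by (auto simp: lin_def intro!: amap_const0 N.M.ag)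
qed

text \<open>An even scalar commutes with all of K, so scaling the values by it keeps right
  linearity.\<close>

lemma lin_even_scale: assumes "supermodule K N" "lin K M N d f" "c \<in> hpart K 0"
 shows "lin K M N d (%x. f x \<bullet>\<^sub>N c)"
proof -
 interpret N: supermodule K N by fact
 have c: "c \<in>. K" using assms(3) by (rule N.KG.hpc)
 have cc: "al \<otimes>\<^sub>K c = c \<otimes>\<^sub>K al" if "al \<in>. K" for al using that
 proof (induction rule: N.KG.homog_induct)
  case (homog i a) then show ?case using N.supercomm[OF homog assms(3)] by simp
 next
  case (add a b) then show ?case using c by (simp add: N.l_distr N.r_distr)
 qed
 have h: "f x \<bullet>\<^sub>N c \<in> hpart N (d + j)" if "x \<in> hpart M j" for x j
  using N.scale_parity[OF lin_hp[OF assms(2) that] assms(3)] by simp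
 show ?thesis unfolding lin_def
  using linD[OF assms(2)] c h by (auto intro!: N.am_scale1 simp: N.scale_mult[symmetric] cc)
qed

text \<open>On y of parity j the scalar acts from the left with (-1)^(ij) before f and with
  (-1)^(i(d+j)) after f; the quotient of the two is the sign.\<close>

lemma lin_lscale:
 assumes "supermodule K M" "supermodule K N" "lin K M N d f" "al \<in> hpart K i" "x \<in>. M"
 shows "f (lscale K M al x) = sg N (i * d) (lscale K N al (f x))"
proof -
 interpret M: supermodule K M by fact
 interpret N: supermodule K N by fact
 note a = M.KG.hpc[OF assms(4)]
 note fam = lin_amap[OF assms(3)]
 show ?thesis
 proof (rule M.MG.amap_eqI[OF amc[OF M.lscale_amap1[OF a] fam] N.MG.am_sg[OF amc[OF fam N.lscale_amap1[OF a]]] _ assms(5)])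
  fix j y assume y: "y \<in> hpart M j"
  note yc = M.MG.hpc[OF y]
  note fc = linc[OF assms(3) yc]
  have "f (lscale K M al y) = sg N (i * j) (f y \<bullet>\<^sub>N al)"
   using yc a by (simp add: M.lscale_homog2[OF assms(4) y] amap_sg[OF fam M.M.ag N.M.ag]
     M.scale_closed lin_scale[OF assms(3)])
  also have "... = sg N (i * d) (lscale K N al (f y))"
   using fc a by (simp add: N.lscale_homog2[OF assms(4) lin_hp[OF assms(3) y]] N.M.sg_sg N.scale_closed distrib_left)
  finally show "f (lscale K M al y) = sg N (i * d) (lscale K N al (f y))" .
 qed
qed

definition bil where
 "bil K M N P B \<longleftrightarrow> balanced K M N P B \<and>
   (\<forall>x \<in> carrier M. \<forall>y \<in> carrier N. \<forall>al \<in> carrier K. B x (y \<bullet>\<^sub>N al) = B x y \<bullet>\<^sub>P al) \<and>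
   (\<forall>i j. \<forall>x \<in> hpart M i. \<forall>y \<in> hpart N j. B x y \<in> hpart P (i + j))"

lemma bilD:
 assumes "bil K M N P B"
 shows bil_amap2: "x \<in>. M ==> amap N P (B x)" and bil_amap1: "y \<in>. N ==> amap M P (%x. B x y)"
  and bil_bal: "[|x \<in>. M; y \<in>. N; al \<in>. K|] ==> B (x \<bullet>\<^sub>M al) y = B x (lscale K N al y)"
  and bil_scale: "[|x \<in>. M; y \<in>. N; al \<in>. K|] ==> B x (y \<bullet>\<^sub>N al) = B x y \<bullet>\<^sub>P al"
  and bil_hp: "[|x \<in> hpart M i; y \<in> hpart N j|] ==> B x y \<in> hpart P (i + j)"
  and bil_closed: "[|x \<in>. M; y \<in>. N|] ==> B x y \<in>. P"
 using assms unfolding bil_def balanced_def by (auto intro: amapc)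

section \<open>The comultiplication of a presented algebra\<close>

locale walg_t = walg K M A q G
 for K :: "('k, 'm) graded_ring_scheme" and M :: "('a, 'k, 'n) smodule_scheme"
  and A :: "('b, 'k, 'o) smodule_scheme"
  and q :: "('a list \<times> 'k \<Rightarrow>\<^sub>0 int) => 'b" and G :: "('a list \<times> 'k \<Rightarrow>\<^sub>0 int) set" +
 assumes kal: "kalg K A \<eta>"
begin

sublocale AT: talg K A \<eta>
 by (rule talg.intro[OF kal])

definition prim where "prim X = AT.pu (gen X) \<one>\<^sub>A \<oplus>\<^sub>AT.T AT.pu \<one>\<^sub>A (gen X)"

lemma prim_amap: "amap M AT.T prim"
 unfolding prim_def by (intro AT.am_plus AT.am_pu1 AT.am_pu2 gen_amap A.one_closed)

lemma prim_closed [simp]: "X \<in>. M ==> prim X \<in>. AT.T"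
 by (rule amapc[OF prim_amap])

lemma gen_scale': "[|X \<in>. M; al \<in>. K|] ==> gen (X \<bullet>\<^sub>M al) = gen X \<bullet>\<^sub>A al"
 by (simp add: gen_scale scale_\<eta>)

lemma lscale_one_A: "al \<in>. K ==> lscale K A al \<one>\<^sub>A = \<eta> al"
 by (simp add: AT.lscale_e[symmetric])

lemma one_scale_A: "al \<in>. K ==> \<one>\<^sub>A \<bullet>\<^sub>A al = \<eta> al"
 by (simp add: scale_\<eta>)

lemma prim_whom: "whom K M AT.T prim (%al. AT.pu \<one>\<^sub>A (\<eta> al))"
proof (intro whom.intro whom_axioms.intro smx AT.T_ring AT.eT_hom prim_amap)
 fix Y al assume Y: "Y \<in>. M" and a: "al \<in>. K"
 have "prim Y \<otimes>\<^sub>AT.T AT.pu \<one>\<^sub>A (\<eta> al) = prim Y \<bullet>\<^sub>AT.T al" using Y a by (simp add: AT.T_scale)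
 also have "... = AT.pu (gen Y) (\<one>\<^sub>A \<bullet>\<^sub>A al) \<oplus>\<^sub>AT.T AT.pu \<one>\<^sub>A (gen Y \<bullet>\<^sub>A al)"
  using Y a by (simp add: prim_def ama[OF AT.T_scale_amap] AT.pu_scale)
 also have "... = prim (Y \<bullet>\<^sub>M al)" using Y a by (simp add: prim_def gen_scale' AT.pu_bal lscale_one_A one_scale_A)
 finally show "prim (Y \<bullet>\<^sub>M al) = prim Y \<otimes>\<^sub>AT.T AT.pu \<one>\<^sub>A (\<eta> al)" by simp
 show "AT.pu \<one>\<^sub>A (\<eta> al) \<otimes>\<^sub>AT.T prim Y = prim (lscale K M al Y)"
 proof (rule KG.amap_eqI[where x=al and N=AT.T and f="%al. AT.pu \<one>\<^sub>A (\<eta> al) \<otimes>\<^sub>AT.T prim Y"])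
  show "amap K AT.T (%al. AT.pu \<one>\<^sub>A (\<eta> al) \<otimes>\<^sub>AT.T prim Y)"
   by (rule amc[OF ring_hom_amap[OF AT.eT_hom] AT.T_amapR[OF prim_closed[OF Y]]])
  show "amap K AT.T (%al. prim (lscale K M al Y))" by (rule amc[OF lscale_amap2[OF Y] prim_amap])
  fix i c assume c: "c \<in> hpart K i"
  note [simp] = KG.hpc[OF c]
  show "AT.pu \<one>\<^sub>A (\<eta> c) \<otimes>\<^sub>AT.T prim Y = prim (lscale K M c Y)"
  proof (rule MG.amap_eqI[where x=Y and N=AT.T and f="%Y. AT.pu \<one>\<^sub>A (\<eta> c) \<otimes>\<^sub>AT.T prim Y"])
   show "amap M AT.T (%Y. AT.pu \<one>\<^sub>A (\<eta> c) \<otimes>\<^sub>AT.T prim Y)" by (rule amc[OF prim_amap AT.T_amapL]) simp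
   show "amap M AT.T (%Y. prim (lscale K M c Y))" by (rule amc[OF lscale_amap1 prim_amap]) simp
   fix p X assume X: "X \<in> hpart M p"
   note [simp] = MG.hpc[OF X]
   have 1: "AT.pu \<one>\<^sub>A (\<eta> c) \<otimes>\<^sub>AT.T AT.pu (gen X) \<one>\<^sub>A = AT.pu (gen (lscale K M c X)) \<one>\<^sub>A"
    using AT.pu_mult_homog[OF A.one_closed \<eta>_hp[OF c] gen_hp[OF X] A.one_closed]
    by (simp add: lscale_homog2[OF c X] amap_sg[OF gen_amap M.ag A.ag] scale_closed
      gen_scale' AT.pu_sg1 AT.scale_closed AT.pu_bal lscale_one_A)
   have 2: "AT.pu \<one>\<^sub>A (\<eta> c) \<otimes>\<^sub>AT.T AT.pu \<one>\<^sub>A (gen X) = AT.pu \<one>\<^sub>A (gen (lscale K M c X))"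
    using AT.pu_mult_homog[OF A.one_closed \<eta>_hp[OF c] AT.one_hp gen_closed[of X]] by (simp add: \<eta>_gen)
   show "AT.pu \<one>\<^sub>A (\<eta> c) \<otimes>\<^sub>AT.T prim X = prim (lscale K M c X)"
    by (simp add: prim_def ama[OF AT.T_amapL] 1 2)
  qed (rule Y)
 qed (rule a)
qed

text \<open>The mixed terms in the last bracket are supersymmetric in v and w. They drop out of
  supercommutators, and for odd v = w they cancel each other.\<close>

lemma prim_mult: assumes "v \<in> hpart M i" "w \<in> hpart M j"
 shows "prim v \<otimes>\<^sub>AT.T prim w = (AT.pu (gen v \<otimes>\<^sub>A gen w) \<one>\<^sub>A \<oplus>\<^sub>AT.T AT.pu \<one>\<^sub>A (gen v \<otimes>\<^sub>A gen w))
   \<oplus>\<^sub>AT.T (AT.pu (gen v) (gen w) \<oplus>\<^sub>AT.T sg AT.T (i * j) (AT.pu (gen w) (gen v)))"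
proof -
 interpret T: ring AT.T by (rule AT.T_ring)
 note c = MG.hpc[OF assms(1)] MG.hpc[OF assms(2)]
 note g = gen_hp[OF assms(1)] gen_hp[OF assms(2)]
 have 1: "AT.pu (gen v) \<one>\<^sub>A \<otimes>\<^sub>AT.T AT.pu (gen w) \<one>\<^sub>A = AT.pu (gen v \<otimes>\<^sub>A gen w) \<one>\<^sub>A"
  using AT.pu_mult_homog[OF _ AT.one_hp g(2)] c by simp
 have 2: "AT.pu (gen v) \<one>\<^sub>A \<otimes>\<^sub>AT.T AT.pu \<one>\<^sub>A (gen w) = AT.pu (gen v) (gen w)"
  using AT.pu_mult_homog[OF _ AT.one_hp AT.one_hp] c by simp
 have 3: "AT.pu \<one>\<^sub>A (gen v) \<otimes>\<^sub>AT.T AT.pu (gen w) \<one>\<^sub>A = sg AT.T (i * j) (AT.pu (gen w) (gen v))"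
  using AT.pu_mult_homog[OF _ g(1) g(2)] c by simp
 have 4: "AT.pu \<one>\<^sub>A (gen v) \<otimes>\<^sub>AT.T AT.pu \<one>\<^sub>A (gen w) = AT.pu \<one>\<^sub>A (gen v \<otimes>\<^sub>A gen w)"
  using AT.pu_mult_homog[OF _ g(1) AT.one_hp] c by simp
 show ?thesis unfolding prim_def using c
  by (simp add: T.l_distr T.r_distr 1 2 3 4 T.a_ac)
qed

definition is_comult where
 "is_comult D \<longleftrightarrow> D \<in> superalg_hom K A AT.T \<and> (\<forall>X \<in> carrier M. D (gen X) = prim X)"

lemma superalg_homD:
 assumes "D \<in> superalg_hom K A P"
 shows "D \<in> ring_hom A P" "D \<in> extensional (carrier A)" "[|x \<in>. A; al \<in>. K|] ==> D (x \<bullet>\<^sub>A al) = D x \<bullet>\<^sub>P al"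
  "x \<in> hpart A i ==> D x \<in> hpart P i"
 using assms unfolding superalg_hom_def by blast+

lemma superalg_hom_unique:
 assumes "D \<in> superalg_hom K A P" "D' \<in> superalg_hom K A P" "!!X. X \<in>. M ==> D (gen X) = D' (gen X)"
 shows "D = D'"
proof (rule extensionalityI[OF superalg_homD(2)[OF assms(1)] superalg_homD(2)[OF assms(2)]])
 fix x assume "x \<in>. A"
 then show "D x = D' x"
 proof (induction rule: A_induct)
  case (\<eta> i al)
  note a = KG.hpc[OF \<eta>]
  have "D (\<one>\<^sub>A \<bullet>\<^sub>A al) = D' (\<one>\<^sub>A \<bullet>\<^sub>A al)"
   using a ring_hom_one[OF superalg_homD(1)[OF assms(1)]] ring_hom_one[OF superalg_homD(1)[OF assms(2)]]
   by (simp add: superalg_homD(3)[OF assms(1)] superalg_homD(3)[OF assms(2)])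
  then show ?case by (simp only: one_scale_A[OF a])
 next
  case (gen i X x)
  note X = MG.hpc[OF gen(1)]
  show ?case using X gen(2,3) assms(3)
   by (simp add: ring_hom_mult[OF superalg_homD(1)[OF assms(1)]] ring_hom_mult[OF superalg_homD(1)[OF assms(2)]])
 next
  case (add x y)
  then show ?case by (simp add: ring_hom_add[OF superalg_homD(1)[OF assms(1)]] ring_hom_add[OF superalg_homD(1)[OF assms(2)]])
 qed
qed

text \<open>Extensionality forces the restriction.\<close>

lemma superalg_hom_restrict:
 assumes "h \<in> ring_hom A P" "!!x al. [|x \<in>. A; al \<in>. K|] ==> h (x \<bullet>\<^sub>A al) = h x \<bullet>\<^sub>P al"
  "!!x i. x \<in> hpart A i ==> h x \<in> hpart P i"
 shows "restrict h (carrier A) \<in> superalg_hom K A P"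
 unfolding superalg_hom_def using assms A_hp_closed(1) AT.scale_closed
 by (auto simp: ring_hom_def)

lemma comult_ex:
 assumes G: "!!h r. [|h \<in> ring_hom FW AT.T; !!X. X \<in>. M ==> h (fof ([X], \<one>\<^sub>K)) = prim X; r \<in> G|] ==> h r = \<zero>\<^sub>AT.T"
 shows "\<exists>!D. is_comult D"
proof (rule ex_ex1I)
 interpret w: whom K M AT.T prim "%al. AT.pu \<one>\<^sub>A (\<eta> al)" by (rule prim_whom)
 obtain h where h: "h \<in> ring_hom A AT.T" "!!X. X \<in>. M ==> h (gen X) = prim X"
  "!!al. al \<in>. K ==> h (\<eta> al) = AT.pu \<one>\<^sub>A (\<eta> al)"
 proof (rule universal[OF prim_whom])
  fix h r assume h: "h \<in> ring_hom FW AT.T"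
   "!!w. w \<in> WB ==> h (fof w) = wev AT.T prim (%al. AT.pu \<one>\<^sub>A (\<eta> al)) w" "r \<in> G"
  have "h (fof ([X], \<one>\<^sub>K)) = prim X" if "X \<in>. M" for X
   using h(2)[of "([X], \<one>\<^sub>K)"] that w.e_simps(3) by (simp add: w.wev_Cons w.wev_Nil)
  then show "h r = \<zero>\<^sub>AT.T" by (rule G[OF h(1) _ h(3)])
 qed blast
 have "h x \<in> hpart AT.T i" if "x \<in> hpart A i" for x i
  using that
 proof (induction rule: A_hinduct)
  case (\<eta> i al) then show ?case using AT.pu_hp[OF AT.one_hp \<eta>_hp[OF \<eta>]] by (simp add: h KG.hpc)
 next
  case (gen i j X x)
  have "prim X \<in> hpart AT.T i" unfolding prim_def
   using AT.pu_hp[OF gen_hp[OF gen(1)] AT.one_hp] AT.pu_hp[OF AT.one_hp gen_hp[OF gen(1)]] AT.T_hp_closed by simp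
  then show ?case using AT.T_mult_hp gen ring_hom_mult[OF h(1)] by (simp add: h(2) MG.hpc A_hp_closed)
 next
  case (add j x y) then show ?case using ring_hom_add[OF h(1)] by (simp add: A_hp_closed AT.T_hp_closed)
 qed
 moreover have "h (x \<bullet>\<^sub>A al) = h x \<bullet>\<^sub>AT.T al" if "x \<in>. A" "al \<in>. K" for x al
  using that ring_hom_mult[OF h(1)] ring_hom_closed[OF h(1)] by (simp add: scale_\<eta> h(3) AT.T_scale)
 ultimately have "restrict h (carrier A) \<in> superalg_hom K A AT.T" by (intro superalg_hom_restrict h(1))
 then have "is_comult (restrict h (carrier A))" unfolding is_comult_def using h(2) by simp
 then show "\<exists>D. is_comult D" by blast
 show "D = D'" if "is_comult D" "is_comult D'" for D D'
  using that unfolding is_comult_def by (intro superalg_hom_unique[of D _ D']) auto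
qed

end

section \<open>Convolution of maps along the comultiplication\<close>

locale coalg = walg_t +
 fixes D
 assumes com: "is_comult D"
begin

lemma D_amap: "amap A AT.T D" and D_gen: "[|X \<in>. M; x \<in>. A|] ==> D (gen X \<otimes>\<^sub>A x) = prim X \<otimes>\<^sub>AT.T D x"
 and D_\<eta>: "al \<in>. K ==> D (\<eta> al) = AT.pu \<one>\<^sub>A (\<eta> al)"
 and D_scale: "[|x \<in>. A; al \<in>. K|] ==> D (x \<bullet>\<^sub>A al) = D x \<bullet>\<^sub>AT.T al"
 and D_hp: "x \<in> hpart A i ==> D x \<in> hpart AT.T i"
proof -
 have D: "D \<in> superalg_hom K A AT.T" "!!X. X \<in>. M ==> D (gen X) = prim X" using com unfolding is_comult_def by auto
 note h = superalg_homD[OF D(1)]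
 show "amap A AT.T D" by (rule ring_hom_amap[OF h(1)])
 show "D (gen X \<otimes>\<^sub>A x) = prim X \<otimes>\<^sub>AT.T D x" if "X \<in>. M" "x \<in>. A"
  using that D(2) ring_hom_mult[OF h(1)] by simp
 show s: "D (x \<bullet>\<^sub>A al) = D x \<bullet>\<^sub>AT.T al" if "x \<in>. A" "al \<in>. K" for x al using h(3)[OF that] .
 show "D (\<eta> al) = AT.pu \<one>\<^sub>A (\<eta> al)" if "al \<in>. K"
  using s[OF A.one_closed that] that ring_hom_one[OF h(1)] by (simp add: one_scale_A AT.T_one AT.pu_scale)
 show "D x \<in> hpart AT.T i" if "x \<in> hpart A i" using h(4)[OF that] .
qed

lemma D_closed [simp]: "x \<in>. A ==> D x \<in>. AT.T"
 by (rule amapc[OF D_amap])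

text \<open>This is B \<circ> (f \<otimes> h) \<circ> D. The parity d of h is an explicit argument,
  since the sign for h passing v is realised by \<open>tw d\<close> on the first tensor
  factor.\<close>

definition conv where
 "conv P B f h d x = tensor_lift K A A P (%v w. B (f (AT.MG.tw d v)) (h w)) (D x)"

abbreviation LX where "LX X x \<equiv> gen X \<otimes>\<^sub>A x"

lemma LX_lin: "X \<in> hpart M p ==> lin K A A p (%x. LX X x)"
 unfolding lin_def using A_hp_mult[OF gen_hp] MG.hpc
 by (auto intro!: ring_amapL A.ring_axioms simp: AT.scale_mult_r)

lemma LX_comp: "[|lin K A N d f; X \<in> hpart M p|] ==> lin K A N (d + p) (%x. f (LX X x))"
 using lin_comp[OF LX_lin] by (metis add.commute)

context
 fixes B1 B2 P B
 assumes B1: "supermodule K B1" and B2: "supermodule K B2" and P: "supermodule K P" and B: "bil K B1 B2 P B"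
begin

interpretation B1: supermodule K B1 by (rule B1)
interpretation B2: supermodule K B2 by (rule B2)
interpretation P: supermodule K P by (rule P)

text \<open>For a scalar of parity i, moving it past h on the right gives (-1)^(d i), the same sign
  that \<open>tw d\<close> puts on it when it stands on the left.\<close>

lemma conv_balanced: assumes f: "lin K A B1 df f" and h: "lin K A B2 d h"
 shows "balanced K A A P (%v w. B (f (AT.MG.tw d v)) (h w))"
 unfolding balanced_def
proof (intro conjI ballI)
 fix v assume v: "v \<in>. A"
 show "amap A P (%w. B (f (AT.MG.tw d v)) (h w))"
  by (rule amc[OF lin_amap[OF h] bil_amap2[OF B linc[OF f AT.MG.tw_closed[OF v]]]])
next
 fix w assume w: "w \<in>. A"
 show "amap A P (%v. B (f (AT.MG.tw d v)) (h w))"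
  by (rule amc[OF amc[OF AT.MG.tw_amap lin_amap[OF f]] bil_amap1[OF B linc[OF h w]]])
next
 fix v w al assume v: "v \<in>. A" and w: "w \<in>. A" and a: "al \<in>. K"
 note fc = linc[OF f AT.MG.tw_closed[OF v]] and hc = linc[OF h w]
 have e: "f (AT.MG.tw d (v \<bullet>\<^sub>A al)) = f (AT.MG.tw d v) \<bullet>\<^sub>B1 KG.tw d al" if "al \<in>. K" for al
  using v that by (simp add: AT.tw_scale lin_scale[OF f])
 show "B (f (AT.MG.tw d (v \<bullet>\<^sub>A al))) (h w) = B (f (AT.MG.tw d v)) (h (lscale K A al w))"
 proof (rule KG.amap_eqI[where x=al and N=P and f="%al. B (f (AT.MG.tw d (v \<bullet>\<^sub>A al))) (h w)"])
  show "amap K P (%al. B (f (AT.MG.tw d (v \<bullet>\<^sub>A al))) (h w))"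
   by (rule amc[OF amc[OF AT.MG.am_tw[OF AT.scale_amap2[OF v]] lin_amap[OF f]] bil_amap1[OF B hc]])
  show "amap K P (%al. B (f (AT.MG.tw d v)) (h (lscale K A al w)))"
   by (rule amc[OF amc[OF AT.lscale_amap2[OF w] lin_amap[OF h]] bil_amap2[OF B fc]])
  fix i c assume c: "c \<in> hpart K i"
  note cc = KG.hpc[OF c]
  have "B (f (AT.MG.tw d (v \<bullet>\<^sub>A c))) (h w) = sg P (d * i) (B (f (AT.MG.tw d v)) (lscale K B2 c (h w)))"
   using fc hc cc
   by (simp add: e KG.tw_homog[OF c] B1.scale_sg2 amap_sg[OF bil_amap1[OF B hc] B1.M.ag P.M.ag]
     B1.scale_closed bil_bal[OF B])
  also have "... = B (f (AT.MG.tw d v)) (h (lscale K A c w))"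
   using fc hc cc by (simp add: lin_lscale[OF AT.smx B2 h c w] mult.commute
     amap_sg[OF bil_amap2[OF B fc] B2.M.ag P.M.ag])
  finally show "B (f (AT.MG.tw d (v \<bullet>\<^sub>A c))) (h w) = B (f (AT.MG.tw d v)) (h (lscale K A c w))" .
 qed (rule a)
qed

lemmas conv_lift_amap = AT.lift_amap[OF conv_balanced P.M.ag]
 and conv_lift_pu = AT.lift_pu[OF conv_balanced P.M.ag]

lemma conv_amap: assumes f: "lin K A B1 df f" and h: "lin K A B2 d h" shows "amap A P (conv P B f h d)"
 unfolding conv_def[abs_def] by (rule amc[OF D_amap conv_lift_amap[OF f h]])

lemma conv_\<eta>: assumes f: "lin K A B1 df f" and h: "lin K A B2 d h" and a: "al \<in>. K"
 shows "conv P B f h d (\<eta> al) = B (f \<one>\<^sub>A) (h \<one>\<^sub>A) \<bullet>\<^sub>P al"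
proof -
 have "conv P B f h d (\<eta> al) = B (f \<one>\<^sub>A) (h (\<one>\<^sub>A \<bullet>\<^sub>A al))"
  using a AT.MG.tw_homog[OF AT.one_hp] by (simp add: conv_def D_\<eta> conv_lift_pu[OF f h] one_scale_A)
 then show ?thesis using a lin_scale[OF h] bil_scale[OF B] linc[OF f] linc[OF h] by simp
qed

text \<open>As X is primitive and D multiplicative, D (X x) is the sum of (X \<otimes> 1) D x and (1
  \<otimes> X) D x. In the first term h has to pass X, which costs (-1)^(dp); in the second X is
  absorbed into h, whose parity becomes d + p. With \<open>conv_\<eta>\<close> this recursion drives
  the inductions over words.\<close>

lemma conv_gen: assumes f: "lin K A B1 df f" and h: "lin K A B2 d h" and X: "X \<in> hpart M p" and x: "x \<in>. A"
 shows "conv P B f h d (LX X x) = sg P (d * p) (conv P B (%x. f (LX X x)) h d x) \<oplus>\<^sub>P conv P B f (%x. h (LX X x)) (d + p) x"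
proof -
 note Xc = MG.hpc[OF X] and fX = LX_comp[OF f X] and hX = LX_comp[OF h X]
 let ?L = "tensor_lift K A A P (%v w. B (f (AT.MG.tw d v)) (h w))"
 let ?L1 = "tensor_lift K A A P (%v w. B (f (LX X (AT.MG.tw d v))) (h w))"
 let ?L2 = "tensor_lift K A A P (%v w. B (f (AT.MG.tw (d + p) v)) (h (LX X w)))"
 note Lp = conv_lift_pu[OF f h] and L1p = conv_lift_pu[OF fX h] and L2p = conv_lift_pu[OF f hX]
 note La = conv_lift_amap[OF f h] and L1a = conv_lift_amap[OF fX h] and L2a = conv_lift_amap[OF f hX]
 have g1: "AT.pu (gen X) \<one>\<^sub>A \<in>. AT.T" "AT.pu \<one>\<^sub>A (gen X) \<in>. AT.T" using Xc by simp_all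
 have 1: "?L (AT.pu (gen X) \<one>\<^sub>A \<otimes>\<^sub>AT.T z) = sg P (d * p) (?L1 z)" if "z \<in>. AT.T" for z
 proof (rule AT.T_ext[OF amc[OF AT.T_amapL[OF g1(1)] La] P.MG.am_sg[OF L1a] _ that])
  fix i j v w assume v: "v \<in> hpart A i" and w: "w \<in> hpart A j"
  note c = A_hp_closed(1)[OF v] A_hp_closed(1)[OF w]
  have "AT.MG.tw d (gen X \<otimes>\<^sub>A v) = sg A (d * p) (gen X \<otimes>\<^sub>A AT.MG.tw d v)"
   using Xc c by (simp add: AT.MG.tw_homog[OF A_hp_mult[OF gen_hp[OF X] v]] AT.MG.tw_homog[OF v] AT.sg_mult2 A.sg_sg distrib_left)
  then show "?L (AT.pu (gen X) \<one>\<^sub>A \<otimes>\<^sub>AT.T AT.pu v w) = sg P (d * p) (?L1 (AT.pu v w))"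
   using Xc c by (simp add: AT.pu_mult_homog[OF gen_closed[OF Xc] AT.one_hp v c(2)] Lp L1p
     amap_sg[OF lin_amap[OF f] A.ag B1.M.ag]
     amap_sg[OF bil_amap1[OF B linc[OF h c(2)]] B1.M.ag P.M.ag] linc[OF f])
 qed
 have 2: "?L (AT.pu \<one>\<^sub>A (gen X) \<otimes>\<^sub>AT.T z) = ?L2 z" if "z \<in>. AT.T" for z
 proof (rule AT.T_ext[OF amc[OF AT.T_amapL[OF g1(2)] La] L2a _ that])
  fix i j v w assume v: "v \<in> hpart A i" and w: "w \<in> hpart A j"
  note c = A_hp_closed(1)[OF v] A_hp_closed(1)[OF w]
  have fh: "f v \<in>. B1" "h (gen X \<otimes>\<^sub>A w) \<in>. B2" using c Xc linc[OF f] linc[OF h] by auto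
  have s: "B (f (sg A k v)) (h (gen X \<otimes>\<^sub>A w)) = sg P k (B (f v) (h (gen X \<otimes>\<^sub>A w)))" for k
   using c fh by (simp add: amap_sg[OF lin_amap[OF f] A.ag B1.M.ag]
     amap_sg[OF bil_amap1[OF B fh(2)] B1.M.ag P.M.ag])
  have "?L (AT.pu \<one>\<^sub>A (gen X) \<otimes>\<^sub>AT.T AT.pu v w) = ?L (sg AT.T (p * i) (AT.pu v (gen X \<otimes>\<^sub>A w)))"
   using c by (simp add: AT.pu_mult_homog[OF A.one_closed gen_hp[OF X] v c(2)])
  also have "... = sg P (p * i) (B (f (AT.MG.tw d v)) (h (gen X \<otimes>\<^sub>A w)))"
   using c Xc by (simp add: amap_sg[OF La AT.T_grp P.M.ag] Lp)
  also have "... = ?L2 (AT.pu v w)"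
   using c fh by (simp add: L2p AT.MG.tw_homog[OF v] s P.M.sg_sg bil_closed[OF B] distrib_right add.commute)
  finally show "?L (AT.pu \<one>\<^sub>A (gen X) \<otimes>\<^sub>AT.T AT.pu v w) = ?L2 (AT.pu v w)" .
 qed
 have "D (LX X x) = AT.pu (gen X) \<one>\<^sub>A \<otimes>\<^sub>AT.T D x \<oplus>\<^sub>AT.T AT.pu \<one>\<^sub>A (gen X) \<otimes>\<^sub>AT.T D x"
  using Xc x g1 by (simp add: D_gen prim_def ama[OF AT.T_amapR])
 moreover have "AT.pu (gen X) \<one>\<^sub>A \<otimes>\<^sub>AT.T D x \<in>. AT.T" "AT.pu \<one>\<^sub>A (gen X) \<otimes>\<^sub>AT.T D x \<in>. AT.T"
  using g1 x amapc[OF AT.T_amapL] by auto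
 ultimately show ?thesis using x by (simp add: conv_def ama[OF La] 1 2)
qed

lemma conv_lin: assumes f: "lin K A B1 df f" and h: "lin K A B2 d h" shows "lin K A P (df + d) (conv P B f h d)"
 unfolding lin_def
proof (intro conjI allI ballI)
 show "amap A P (conv P B f h d)" by (rule conv_amap[OF f h])
 fix x al assume x: "x \<in>. A" and a: "al \<in>. K"
 let ?L = "tensor_lift K A A P (%v w. B (f (AT.MG.tw d v)) (h w))"
 have "?L (z \<bullet>\<^sub>AT.T al) = ?L z \<bullet>\<^sub>P al" if "z \<in>. AT.T" for z
 proof (rule AT.T_ext[OF amc[OF AT.T_scale_amap[OF a] conv_lift_amap[OF f h]] P.am_scale1[OF conv_lift_amap[OF f h] a] _ that])
  fix i j v w assume v: "v \<in> hpart A i" and w: "w \<in> hpart A j"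
  note c = A_hp_closed(1)[OF v] A_hp_closed(1)[OF w]
  show "?L (AT.pu v w \<bullet>\<^sub>AT.T al) = ?L (AT.pu v w) \<bullet>\<^sub>P al"
   using c a by (simp add: AT.pu_scale conv_lift_pu[OF f h] AT.scale_closed lin_scale[OF h] bil_scale[OF B] linc[OF f] linc[OF h])
 qed
 then show "conv P B f h d (x \<bullet>\<^sub>A al) = conv P B f h d x \<bullet>\<^sub>P al"
  using x a by (simp add: conv_def D_scale)
next
 fix j x assume x: "x \<in> hpart A j"
 let ?L = "tensor_lift K A A P (%v w. B (f (AT.MG.tw d v)) (h w))"
 have "?L z \<in> hpart P (df + d + k)" if "z \<in> hpart AT.T k" for z k using that
 proof (induction rule: AT.T_hinduct)
  case (pu i j v w)
  note c = A_hp_closed(1)[OF pu(1)] A_hp_closed(1)[OF pu(2)]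
  have "B (f (AT.MG.tw d v)) (h w) \<in> hpart P ((df + i) + (d + j))"
   by (rule bil_hp[OF B lin_hp[OF f AT.MG.tw_hp[OF pu(1)]] lin_hp[OF h pu(2)]])
  then show ?case using c by (simp add: conv_lift_pu[OF f h] add.assoc add.left_commute)
 next
  case (add k z w) then show ?case using AT.T_hp_closed by (simp add: ama[OF conv_lift_amap[OF f h]] P.MG.hp_add)
 qed
 then show "conv P B f h d x \<in> hpart P (df + d + j)" using D_hp[OF x] by (simp add: conv_def)
qed

end

end

section \<open>The grading of a tensor product\<close>

context tens begin

text \<open>The point is that the two parts of T meet in zero. Projections onto them are constructed
  as balanced maps from the projections of the factors.\<close>

lemma T_supermodule: "supermodule K T"
proof -
 interpret T: abelian_group T by (rule T_grp)
 \<comment> \<open>The two summands belong to the two ways of writing the parity i as a sum, 0 + i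
   and 1 + (i + 1).\<close>
 define pr where "pr i = tensor_lift K M N T (%v w. pu (hcomp M 0 v) (hcomp N i w) \<oplus>\<^sub>T pu (hcomp M 1 v) (hcomp N (i + 1) w))" for i
 \<comment> \<open>Moving a scalar of parity d across the tensor sign shifts the components on both
   sides by d; an odd scalar thus exchanges the two summands of \<open>pr\<close>.\<close>
 have 2: "pu (hcomp M (j + d) (v \<bullet>\<^sub>M al)) (hcomp N k w) = pu (hcomp M j v) (hcomp N (k + d) (lscale K N al w))"
  if "v \<in>. M" "w \<in>. N" "al \<in> hpart K d" for d j k v w al
 proof -
  note a = M.KG.hpc[OF that(3)]
  have e: "hcomp M (j + d) (v \<bullet>\<^sub>M al) = hcomp M j v \<bullet>\<^sub>M al"
  proof (rule M.MG.amap_eqI[where x=v and N=M and f="%v. hcomp M (j + d) (v \<bullet>\<^sub>M al)"])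
   fix i x assume x: "x \<in> hpart M i"
   show "hcomp M (j + d) (x \<bullet>\<^sub>M al) = hcomp M j x \<bullet>\<^sub>M al"
    unfolding M.MG.hc_homog[OF M.scale_parity[OF x that(3)]] M.MG.hc_homog[OF x] using a by simp
  qed (use a that in \<open>auto intro!: M.am_intros\<close>)
  have e2: "hcomp N (k + d) (lscale K N al w) = lscale K N al (hcomp N k w)"
  proof (rule N.MG.amap_eqI[where x=w and N=N and f="%w. hcomp N (k + d) (lscale K N al w)"])
   fix i x assume x: "x \<in> hpart N i"
   show "hcomp N (k + d) (lscale K N al x) = lscale K N al (hcomp N k x)"
    unfolding N.MG.hc_homog[OF N.lscale_hp[OF that(3) x]] N.MG.hc_homog[OF x]
    using amap_zero[OF N.lscale_amap1[OF a] N.M.ag N.M.ag] by (simp add: add.commute)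
  qed (use a that in \<open>auto intro!: N.am_intros\<close>)
  show ?thesis using that a by (simp add: e e2 pu_bal)
 qed
 have bal: "balanced K M N T (%v w. pu (hcomp M 0 v) (hcomp N i w) \<oplus>\<^sub>T pu (hcomp M 1 v) (hcomp N (i + 1) w))" (is "balanced K M N T ?b") for i
  unfolding balanced_def
 proof (intro conjI ballI)
  fix v w al assume v: "v \<in>. M" and w: "w \<in>. N" and a: "al \<in>. K"
  show "?b (v \<bullet>\<^sub>M al) w = ?b v (lscale K N al w)"
  proof (rule M.KG.amap_eqI[where x=al and N=T and f="%al. ?b (v \<bullet>\<^sub>M al) w"])
   fix k c assume c: "c \<in> hpart K k"
   note cc = M.KG.hpc[OF c]
   show "?b (v \<bullet>\<^sub>M c) w = ?b v (lscale K N c w)"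
   proof (cases "k = 0")
    case True then show ?thesis using 2[OF v w, of c 0 0 i] 2[OF v w, of c 0 1 "i + 1"] c v w by simp
   next
    case False then have c1: "c \<in> hpart K 1" using c by simp
    have "pu (hcomp M 0 (v \<bullet>\<^sub>M c)) (hcomp N i w) = pu (hcomp M 1 v) (hcomp N (i + 1) (lscale K N c w))"
     using 2[OF v w c1, of 1 i] by simp
    moreover have "pu (hcomp M 1 (v \<bullet>\<^sub>M c)) (hcomp N (i + 1) w) = pu (hcomp M 0 v) (hcomp N i (lscale K N c w))"
     using 2[OF v w c1, of 0 "i + 1"] by (simp add: add.assoc)
    ultimately show ?thesis using v w cc by (simp add: T.a_comm)
   qed
  qed (use v w a in \<open>auto intro!: am_plus am_pu1 am_pu2 M.am_intros N.am_intros\<close>)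
 qed (auto intro!: am_plus am_pu1 am_pu2 M.am_intros N.am_intros)
 note pra = lift_amap[OF bal T_grp, folded pr_def] and prp = lift_pu[OF bal T_grp, folded pr_def]
 have pz: "pu \<zero>\<^sub>M y = \<zero>\<^sub>T" if "y \<in>. N" for y using amap_zero[OF pu_amap1[OF that] M.M.ag T_grp] .
 have pz2: "pu y \<zero>\<^sub>N = \<zero>\<^sub>T" if "y \<in>. M" for y using amap_zero[OF pu_amap2[OF that] N.M.ag T_grp] .
 have pr: "pr i z = (if i = k then z else \<zero>\<^sub>T)" if "z \<in> hpart T k" for i k z using that
 proof (induction rule: T_hinduct)
  case (pu j l x y)
  note c = M.MG.hpc[OF pu(1)] N.MG.hpc[OF pu(2)]
  show ?case using c by (cases i; cases j; cases l) (simp_all add: prp M.MG.hc_homog[OF pu(1)] N.MG.hc_homog[OF pu(2)] pz pz2)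
 next
  case (add k z w) then show ?case using T_hp_closed by (simp add: ama[OF pra])
 qed
 have dec: "\<exists>y\<in>hpart T 0. \<exists>u\<in>hpart T 1. z = y \<oplus>\<^sub>T u" if "z \<in>. T" for z using that
 proof (induction rule: T_induct)
  case (pu i j x y)
  note h = pu_hp[OF pu] and c = pu_closed[OF M.MG.hpc[OF pu(1)] N.MG.hpc[OF pu(2)]]
  show ?case
  proof (cases "i + j = 0")
   case True then show ?thesis using h c T_hp_closed(3)[of 1] by (intro bexI[of _ "pure K M N x y"] bexI[of _ "\<zero>\<^sub>T"]) auto
  next
   case False then have "i + j = 1" by simp
   then show ?thesis using h c T_hp_closed(3)[of 0] by (intro bexI[of _ "\<zero>\<^sub>T"] bexI[of _ "pure K M N x y"]) auto
  qed
 next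
  case (add z w)
  then obtain a b c d where "a \<in> hpart T 0" "b \<in> hpart T 1" "z = a \<oplus>\<^sub>T b" "c \<in> hpart T 0" "d \<in> hpart T 1" "w = c \<oplus>\<^sub>T d"
   by blast
  then show ?case
   by (intro bexI[of _ "a \<oplus>\<^sub>T c"] bexI[of _ "b \<oplus>\<^sub>T d"]) (auto simp: T_hp_closed T.add4)
 qed
 have gr: "is_graded T" unfolding is_graded_def
 proof (intro conjI allI)
  show "hpart T 0 \<inter> hpart T 1 = {\<zero>\<^sub>T}" using pr[of _ 0 1] pr[of _ 1 1] T_hp_closed(3) by auto
  show "hpart T 0 <+>\<^sub>T hpart T 1 = carrier T" using dec T_hp_closed(1) by (fastforce simp: set_add_def')
 qed (rule T_hp_sub)
 show ?thesis
 proof (unfold_locales)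
  fix x al assume x: "x \<in>. T" and a: "al \<in>. K"
  show "x \<bullet>\<^sub>T al \<in>. T" by (rule amapc[OF T_scale_amap[OF a] x])
  fix ga assume c: "ga \<in>. K"
  note s = amapc[OF T_scale_amap]
  show "x \<bullet>\<^sub>T (al \<oplus>\<^sub>K ga) = x \<bullet>\<^sub>T al \<oplus>\<^sub>T x \<bullet>\<^sub>T ga"
   by (rule T_ext[OF T_scale_amap am_plus[OF T_scale_amap T_scale_amap] _ x])
    (use a c in \<open>simp_all add: pu_scale M.MG.hpc N.MG.hpc N.scale_add_right ama[OF pu_amap2] N.scale_closed\<close>)
  show "x \<bullet>\<^sub>T (al \<otimes>\<^sub>K ga) = x \<bullet>\<^sub>T al \<bullet>\<^sub>T ga"
   by (rule T_ext[OF T_scale_amap amc[OF T_scale_amap T_scale_amap] _ x])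
    (use a c in \<open>simp_all add: pu_scale M.MG.hpc N.MG.hpc N.scale_mult N.scale_closed\<close>)
 next
  fix x y al assume "x \<in>. T" "y \<in>. T" and a: "al \<in>. K"
  then show "(x \<oplus>\<^sub>T y) \<bullet>\<^sub>T al = x \<bullet>\<^sub>T al \<oplus>\<^sub>T y \<bullet>\<^sub>T al" by (simp add: ama[OF T_scale_amap])
 next
  fix x assume x: "x \<in>. T"
  show "x \<bullet>\<^sub>T \<one>\<^sub>K = x"
   by (rule T_ext[OF T_scale_amap amap_id _ x]) (simp_all add: pu_scale M.MG.hpc N.MG.hpc N.scale_one)
 next
  fix x i al j assume x: "x \<in> hpart T i" and a: "al \<in> hpart K j"
  note ac = M.KG.hpc[OF a]
  from x show "x \<bullet>\<^sub>T al \<in> hpart T (i + j)"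
  proof (induction rule: T_hinduct)
   case (pu k l x y)
   then show ?case using pu_hp[OF pu(1) N.scale_parity[OF pu(2) a]] ac
    by (simp add: pu_scale M.MG.hpc N.MG.hpc add.assoc)
  next
   case (add k z w) then show ?case using T_hp_closed ac by (simp add: ama[OF T_scale_amap])
  qed
 qed (auto simp: T.a_ac T.l_neg gr)
qed

lemma pu_bil: "bil K M N T pu"
 by (simp add: bil_def pu_balanced pu_scale pu_hp)

lemma tensor_lift_cong:
 assumes "!!x y. [|x \<in>. M; y \<in>. N|] ==> f x y = f' x y"
 shows "tensor_lift K M N P f = tensor_lift K M N P f'"
 unfolding tensor_lift_def using assms by simp

end

section \<open>Linearity of convolution and the operators \<open>PH\<close>\<close>

context coalg begin

lemma conv_cong:
 assumes "!!y. y \<in>. A ==> f y = f' y" "!!y. y \<in>. A ==> h y = h' y"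
 shows "conv P B f h d x = conv P B f' h' d x"
proof -
 have "tensor_lift K A A P (%v w. B (f (AT.MG.tw d v)) (h w)) = tensor_lift K A A P (%v w. B (f' (AT.MG.tw d v)) (h' w))"
  by (rule AT.tensor_lift_cong) (simp only: assms AT.MG.tw_closed)
 then show ?thesis unfolding conv_def by (rule fun_cong)
qed

context
 fixes B1 B2 P B
 assumes B1: "supermodule K B1" and B2: "supermodule K B2" and P: "supermodule K P" and B: "bil K B1 B2 P B"
begin

interpretation B1: supermodule K B1 by (rule B1)
interpretation B2: supermodule K B2 by (rule B2)
interpretation P: supermodule K P by (rule P)

lemmas cx = conv_lift_amap[OF B1 B2 P B] conv_lift_pu[OF B1 B2 P B]

lemma conv_closed: assumes f: "lin K A B1 df f" and h: "lin K A B2 d h" and x: "x \<in>. A"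
 shows "conv P B f h d x \<in>. P"
 by (rule amapc[OF conv_amap[OF B1 B2 P B f h] x])

text \<open>A convolution may be evaluated through any additive H on the tensor square that has the
  right values on pure tensors. The linearity rules that follow differ only in the choice of
  H.\<close>

lemma conv_ext:
 assumes "lin K A B1 df f" "lin K A B2 d h" "amap AT.T P H" "x \<in>. A"
  "!!v w. [|v \<in>. A; w \<in>. A|] ==> B (f (AT.MG.tw d v)) (h w) = H (AT.pu v w)"
 shows "conv P B f h d x = H (D x)"
 unfolding conv_def
 by (rule AT.T_full_ext[OF cx(1)[OF assms(1,2)] assms(3) _ D_closed[OF assms(4)]])
   (simp add: cx(2)[OF assms(1,2)] assms(5))

lemma conv_plus1: assumes "lin K A B1 df f" "lin K A B1 df f'" and h: "lin K A B2 d h" and x: "x \<in>. A"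
 shows "conv P B (%y. f y \<oplus>\<^sub>B1 f' y) h d x = conv P B f h d x \<oplus>\<^sub>P conv P B f' h d x"
 unfolding conv_def[of _ _ f] conv_def[of _ _ f']
 by (rule conv_ext[OF lin_plus[OF B1 assms(1,2)] h amap_plus[OF P.M.ag cx(1)[OF assms(1) h] cx(1)[OF assms(2) h]] x])
   (simp add: cx(2)[OF assms(1) h] cx(2)[OF assms(2) h] ama[OF bil_amap1[OF B]] linD[OF assms(1)] linD[OF assms(2)] linD[OF h])

lemma conv_plus2: assumes f: "lin K A B1 df f" and "lin K A B2 d h" "lin K A B2 d h'" and x: "x \<in>. A"
 shows "conv P B f (%y. h y \<oplus>\<^sub>B2 h' y) d x = conv P B f h d x \<oplus>\<^sub>P conv P B f h' d x"
 unfolding conv_def[of _ _ _ h] conv_def[of _ _ _ h']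
 by (rule conv_ext[OF f lin_plus[OF B2 assms(2,3)] amap_plus[OF P.M.ag cx(1)[OF f assms(2)] cx(1)[OF f assms(3)]] x])
   (simp add: cx(2)[OF f assms(2)] cx(2)[OF f assms(3)] ama[OF bil_amap2[OF B]] linD[OF assms(2)] linD[OF assms(3)] linD[OF f])

lemma conv_sg1: assumes f: "lin K A B1 df f" and h: "lin K A B2 d h" and x: "x \<in>. A"
 shows "conv P B (%y. sg B1 i (f y)) h d x = sg P i (conv P B f h d x)"
 unfolding conv_def[of _ _ f]
 by (rule conv_ext[OF lin_sg[OF B1 f] h P.MG.am_sg[OF cx(1)[OF f h]] x])
   (simp add: cx(2)[OF f h] amap_sg[OF bil_amap1[OF B] B1.M.ag P.M.ag] linD[OF f] linD[OF h])

lemma conv_sg2: assumes f: "lin K A B1 df f" and h: "lin K A B2 d h" and x: "x \<in>. A"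
 shows "conv P B f (%y. sg B2 i (h y)) d x = sg P i (conv P B f h d x)"
 unfolding conv_def[of _ _ f h]
 by (rule conv_ext[OF f lin_sg[OF B2 h] P.MG.am_sg[OF cx(1)[OF f h]] x])
   (simp add: cx(2)[OF f h] amap_sg[OF bil_amap2[OF B] B2.M.ag P.M.ag] linD[OF f] linD[OF h])

lemma conv_scale2: assumes f: "lin K A B1 df f" and h: "lin K A B2 d h" and c: "c \<in> hpart K 0" and x: "x \<in>. A"
 shows "conv P B f (%y. h y \<bullet>\<^sub>B2 c) d x = conv P B f h d x \<bullet>\<^sub>P c"
 unfolding conv_def[of _ _ f h] using KG.hpc[OF c]
 by (intro conv_ext[OF f lin_even_scale[OF B2 h c] P.am_scale1[OF cx(1)[OF f h]] x])
   (simp_all add: cx(2)[OF f h] bil_scale[OF B] linD[OF f] linD[OF h])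

lemma conv_scale1: assumes f: "lin K A B1 df f" and h: "lin K A B2 d h" and c: "c \<in> hpart K 0" and x: "x \<in>. A"
 shows "conv P B (%y. f y \<bullet>\<^sub>B1 c) h d x = conv P B f h d x \<bullet>\<^sub>P c"
 unfolding conv_def[of _ _ f h] using KG.hpc[OF c]
 by (intro conv_ext[OF lin_even_scale[OF B1 f c] h P.am_scale1[OF cx(1)[OF f h]] x])
   (simp_all add: cx(2)[OF f h] bil_bal[OF B] bil_scale[OF B] linD[OF f] linD[OF h] B2.lscale_homog[OF c])

end

abbreviation gm where "gm s Y \<equiv> s \<otimes>\<^sub>A gen Y"
definition PH where "PH \<psi> d = conv A gm (%x. x) \<psi> d"

lemma gm_bil: "bil K A M A gm"
 unfolding bil_def balanced_def using A_hp_mult[OF _ gen_hp]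
 by (auto intro!: AT.am_mult1 AT.am_mult2 gen_amap amap_id simp: AT.scale_mult_l AT.scale_mult_r gen_scale'
   AT.lscale_e[symmetric] \<eta>_gen)

lemmas gmx = AT.smx smx AT.smx gm_bil

lemma PH_lin: "lin K A M d \<psi> ==> lin K A A d (PH \<psi> d)"
 unfolding PH_def using conv_lin[OF gmx lin_id] by simp

lemma PH_\<eta>: assumes "lin K A M d \<psi>" "al \<in>. K" shows "PH \<psi> d (\<eta> al) = LX (\<psi> \<one>\<^sub>A) (\<eta> al)"
 unfolding PH_def using conv_\<eta>[OF gmx lin_id assms] assms linc[OF assms(1)] by (simp add: scale_\<eta>)

lemma gm_LX: assumes f: "lin K A A df f" and h: "lin K A M d h" and X: "X \<in> hpart M p" and x: "x \<in>. A"
 shows "conv A gm (%y. LX X (f y)) h d x = LX X (conv A gm f h d x)"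
 unfolding conv_def[of _ _ f]
 by (rule conv_ext[OF gmx lin_comp[OF f LX_lin[OF X]] h AT.am_mult2[OF cx(1)[OF gmx f h]] x])
   (use MG.hpc[OF X] in \<open>simp_all add: cx(2)[OF gmx f h] linD[OF f] linD[OF h] A.m_assoc\<close>)

lemma PH_gen: assumes h: "lin K A M d \<psi>" and X: "X \<in> hpart M p" and x: "x \<in>. A"
 shows "PH \<psi> d (LX X x) = sg A (d * p) (LX X (PH \<psi> d x)) \<oplus>\<^sub>A PH (%y. \<psi> (LX X y)) (d + p) x"
 unfolding PH_def using conv_gen[OF gmx lin_id h X x] gm_LX[OF lin_id h X x] by simp

text \<open>\<open>PH \<chi>\<close> acts on a convolution through either of its two maps. The
  induction must generalise f, h and \<chi> with their parities: by \<open>conv_gen\<close> and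
  \<open>PH_gen\<close> a letter shifts each of the three in turn, and the hypothesis is used once
  for each shift.\<close>

lemma PH_derivation:
 assumes B1: "supermodule K B1" and B2: "supermodule K B2" and P: "supermodule K P" and B: "bil K B1 B2 P B"
  and "x \<in>. A" "lin K A B1 df f" "lin K A B2 d h" "lin K A M c \<chi>"
 shows "conv P B f h d (PH \<chi> c x) = sg P (d * c) (conv P B (%y. f (PH \<chi> c y)) h d x) \<oplus>\<^sub>P conv P B f (%y. h (PH \<chi> c y)) (d + c) x"
 using assms(5-)
proof (induction x arbitrary: df f d h c \<chi> rule: A_induct)
 case (\<eta> i al)
 note f = \<eta>(2) and h = \<eta>(3) and k = \<eta>(4)
 interpret P: supermodule K P by fact
 have a: "al \<in>. K" using \<eta> by (auto intro: KG.hpc)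
 have Y: "\<chi> \<one>\<^sub>A \<in> hpart M c" using lin_hp[OF k AT.one_hp] by simp
 note Yc = MG.hpc[OF Y]
 have P1: "PH \<chi> c \<one>\<^sub>A = gen (\<chi> \<one>\<^sub>A)"
  using PH_\<eta>[OF k one_closed] Yc ring_hom_one[OF \<eta>_hom] by simp
 note fP = lin_comp[OF PH_lin[OF k] f] and hP = lin_comp[OF PH_lin[OF k] h]
 show ?case
  using a Yc by (simp add: PH_\<eta>[OF k a] conv_gen[OF B1 B2 P B f h Y] conv_\<eta>[OF B1 B2 P B LX_comp[OF f Y] h]
    conv_\<eta>[OF B1 B2 P B f LX_comp[OF h Y]] conv_\<eta>[OF B1 B2 P B fP h] conv_\<eta>[OF B1 B2 P B f hP[unfolded add.commute[of c d]]] P1)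
next
 case (gen p X x)
 note X = gen(1) and x = gen(2) and IH = gen(3) and f = gen(4) and h = gen(5) and k = gen(6)
 interpret B1: supermodule K B1 by fact
 interpret B2: supermodule K B2 by fact
 interpret P: supermodule K P by fact
 note bb = B1 B2 P B
 note Xc = MG.hpc[OF X]
 note fX = LX_comp[OF f X] and hX = LX_comp[OF h X] and kX = LX_comp[OF k X]
 note Pk = PH_lin[OF k] and PkX = PH_lin[OF kX]
 note fP = lin_comp[OF Pk f] and hP = lin_comp[OF Pk h] and fXP = lin_comp[OF Pk fX] and hXP = lin_comp[OF Pk hX]
  and fPX = lin_comp[OF PkX f] and hPX = lin_comp[OF PkX h]
 have PHx: "PH \<chi> c x \<in>. A" "PH (%y. \<chi> (LX X y)) (c + p) x \<in>. A"
  using linc[OF Pk x] linc[OF PkX x] .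
 have fe: "f (PH \<chi> c (LX X y)) = sg B1 (c * p) (f (LX X (PH \<chi> c y))) \<oplus>\<^sub>B1 f (PH (%y. \<chi> (LX X y)) (c + p) y)" if "y \<in>. A" for y
  using that Xc linc[OF Pk that] linc[OF PkX that]
  by (simp add: PH_gen[OF k X that] lin_add[OF f] amap_sg[OF lin_amap[OF f] A.ag B1.M.ag])
 have he: "h (PH \<chi> c (LX X y)) = sg B2 (c * p) (h (LX X (PH \<chi> c y))) \<oplus>\<^sub>B2 h (PH (%y. \<chi> (LX X y)) (c + p) y)" if "y \<in>. A" for y
  using that Xc linc[OF Pk that] linc[OF PkX that]
  by (simp add: PH_gen[OF k X that] lin_add[OF h] amap_sg[OF lin_amap[OF h] A.ag B2.M.ag])
 \<comment> \<open>The predicate \<open>lin\<close> carries the parity as an index, so sums of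
   parities are brought to one form before the facts fit together.\<close>
 have ac: "c + p + df = c + (df + p)" "c + p + d = d + c + p" "c + d + p = d + c + p" "c + (d + p) = d + c + p" "c + d = d + c"
   "d + (c + p) = d + c + p" "d + p + c = d + c + p" by (simp_all only: ac_simps)
 note hP' = hP[unfolded ac] and hXP' = hXP[unfolded ac] and hPX' = hPX[unfolded ac] and fPX' = fPX[unfolded ac]
 have R1: "conv P B (%y. f (PH \<chi> c (LX X y))) h d x = sg P (c * p) (conv P B (%y. f (LX X (PH \<chi> c y))) h d x)
   \<oplus>\<^sub>P conv P B (%y. f (PH (%y. \<chi> (LX X y)) (c + p) y)) h d x"
  by (rule trans[OF conv_cong[OF fe refl]]) (assumption, simp only: conv_plus1[OF bb lin_sg[OF B1 fXP] fPX' h x] conv_sg1[OF bb fXP h x])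
 have R2: "conv P B f (%y. h (PH \<chi> c (LX X y))) (d + c + p) x = sg P (c * p) (conv P B f (%y. h (LX X (PH \<chi> c y))) (d + c + p) x)
   \<oplus>\<^sub>P conv P B f (%y. h (PH (%y. \<chi> (LX X y)) (c + p) y)) (d + c + p) x"
  by (rule trans[OF conv_cong[OF refl he]]) (assumption, simp only: conv_plus2[OF bb f lin_sg[OF B2 hXP'] hPX' x] conv_sg2[OF bb f hXP' x])
 note cc = conv_closed[OF bb fXP h x] conv_closed[OF bb fPX' h x] conv_closed[OF bb f hXP' x] conv_closed[OF bb f hPX' x]
  conv_closed[OF bb fX hP' x] conv_closed[OF bb fP hX x]
 have L: "conv P B f h d (PH \<chi> c (LX X x)) = sg P (c * p) (conv P B f h d (LX X (PH \<chi> c x))) \<oplus>\<^sub>P conv P B f h d (PH (%y. \<chi> (LX X y)) (c + p) x)"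
  using PHx Xc by (simp add: PH_gen[OF k X x] ama[OF conv_amap[OF bb f h]]
    amap_sg[OF conv_amap[OF bb f h] A.ag P.M.ag])
 show ?case
  unfolding L conv_gen[OF bb f h X PHx(1)] IH[OF fX h k] IH[OF f hX k] IH[OF f h kX]
   conv_gen[OF bb fP h X x] conv_gen[OF bb f hP' X x] R1 R2 ac
  using cc by (cases d; cases c; cases p) (simp_all add: P.M.a_ac P.M.minus_add)
next
 case (add x y)
 interpret P: supermodule K P by fact
 note Pk = PH_lin[OF add(7)]
 note fP = lin_comp[OF Pk add(5)] and hP = lin_comp[OF Pk add(6), unfolded add.commute[of c d]]
 note am = conv_amap[OF B1 B2 P B add(5,6)] conv_amap[OF B1 B2 P B fP add(6)] conv_amap[OF B1 B2 P B add(5) hP]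
 show ?case using add(1,2) linc[OF Pk add(1)] linc[OF Pk add(2)] am[THEN amapc, OF add(1)] am[THEN amapc, OF add(2)]
  by (simp add: lin_add[OF Pk] am[THEN ama] add(3)[OF add(5,6,7)] add(4)[OF add(5,6,7)] P.M.sg_add P.M.add4)
qed

text \<open>The comultiplication is itself a convolution, of the identity with itself along the pure
  tensor map. Applied to it, \<open>PH_derivation\<close> becomes a statement about D.\<close>

lemma D_conv: "x \<in>. A ==> conv AT.T AT.pu (%x. x) (%x. x) 0 x = D x"
 by (rule conv_ext[OF AT.smx AT.smx AT.T_supermodule AT.pu_bil lin_id lin_id amap_id]) auto

lemma D_PH: assumes "lin K A M c \<chi>" "x \<in>. A"
 shows "D (PH \<chi> c x) = conv AT.T AT.pu (PH \<chi> c) (%x. x) 0 x \<oplus>\<^sub>AT.T conv AT.T AT.pu (%x. x) (PH \<chi> c) c x"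
 using PH_derivation[OF AT.smx AT.smx AT.T_supermodule AT.pu_bil assms(2) lin_id lin_id assms(1)]
  D_conv linc[OF PH_lin[OF assms(1)] assms(2)] by simp

end

section \<open>The relations of S(g) and U(g)\<close>

context walg begin

lemma letter_hom: "[|whom K M P f e; !!w. w \<in> WB ==> h (fof w) = wev P f e w; X \<in>. M|]
  ==> h (fof ([X], \<one>\<^sub>K)) = f X"
 by (simp add: whom.wev_Cons whom.wev_Nil whom.e_simps(3) whom.f_closed monoid.r_one ring.is_monoid whom.axioms(2))

lemma inter_half:
 assumes "[(2::nat)] \<cdot>\<^sub>K \<one>\<^sub>K \<in> Units K \<or> (carrier K = hpart K 0 \<and> carrier M = hpart M 0)"
  and G: "!!h r. [|h \<in> ring_hom FW A; !!X. X \<in>. M ==> h (fof ([X], \<one>\<^sub>K)) = gen (MG.tw 1 X); r \<in> G|] ==> h r = \<zero>\<^sub>A"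
 shows "walg_t K M A q G"
proof -
 have "x = \<zero>\<^sub>A" if x: "x \<in> hpart A 0" "x \<in> hpart A 1" for x
 proof (cases "[(2::nat)] \<cdot>\<^sub>K \<one>\<^sub>K \<in> Units K")
  case True
  show ?thesis by (rule inter_theta[OF True _ x]) (rule G, assumption, rule letter_hom[OF theta_whom], assumption+)
 next
  case False then show ?thesis using inter_even assms(1) x by blast
 qed
 then show ?thesis by (intro walg_t.intro walg_axioms walg_t_axioms.intro kalgI)
qed

lemma gen_tw: "X \<in> hpart M i ==> gen (MG.tw 1 X) = sg A i (gen X)"
 by (simp add: MG.tw_homog amap_sg[OF gen_amap M.ag A.ag] MG.hpc)

end

locale symw = walg K M A q "supermodule.Gsym K M" for K M A q
begin

lemma S_rel: assumes "v \<in> hpart M i" "w \<in> hpart M j" shows "gen v \<otimes>\<^sub>A gen w = sg A (i * j) (gen w \<otimes>\<^sub>A gen v)"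
proof -
 note c = MG.hpc[OF assms(1)] MG.hpc[OF assms(2)]
 have "fof ([v], \<one>\<^sub>K) \<otimes>\<^sub>FW fof ([w], \<one>\<^sub>K)
   \<ominus>\<^sub>FW sg FW (i * j) (fof ([w], \<one>\<^sub>K) \<otimes>\<^sub>FW fof ([v], \<one>\<^sub>K)) \<in> Gsym"
  unfolding Gsym_def using assms by blast
 from q_G[OF this] have "gen v \<otimes>\<^sub>A gen w \<ominus>\<^sub>A sg A (i * j) (gen w \<otimes>\<^sub>A gen v) = \<zero>\<^sub>A"
  unfolding hom_comm[OF A.ring_axioms q_hom c] gen_def .
 then show ?thesis using A.minus_zero_eq c by simp
qed

lemma S_odd: assumes "u \<in> hpart M 1" shows "gen u \<otimes>\<^sub>A gen u = \<zero>\<^sub>A"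
proof -
 have "fof ([u], \<one>\<^sub>K) \<otimes>\<^sub>FW fof ([u], \<one>\<^sub>K) \<in> Gsym"
  unfolding Gsym_def using assms by blast
 from q_G[OF this] show ?thesis unfolding gen_def q_mult[OF FW_letter FW_letter, OF MG.hpc[OF assms] MG.hpc[OF assms]] .
qed

lemma S_kill:
 assumes P: "ring P" and h: "h \<in> ring_hom FW P" and f: "!!X. X \<in>. M ==> h (fof ([X], \<one>\<^sub>K)) = f X"
  and r1: "!!v w i j. [|v \<in> hpart M i; w \<in> hpart M j|] ==> f v \<otimes>\<^sub>P f w = sg P (i * j) (f w \<otimes>\<^sub>P f v)"
  and r2: "!!u. u \<in> hpart M 1 ==> f u \<otimes>\<^sub>P f u = \<zero>\<^sub>P" and r: "r \<in> Gsym"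
 shows "h r = \<zero>\<^sub>P"
proof -
 interpret P: ring P by fact
 have fc: "f X \<in>. P" if "X \<in>. M" for X using f[OF that] ring_hom_closed[OF h FW_letter[OF that]] by simp
 from r show ?thesis unfolding Gsym_def
 proof (elim UnE CollectE exE conjE)
  fix v w i j assume v: "v \<in> hpart M i" and w: "w \<in> hpart M j"
   and r: "r = fof ([v], \<one>\<^sub>K) \<otimes>\<^sub>FW fof ([w], \<one>\<^sub>K) \<ominus>\<^sub>FW sg FW (i * j) (fof ([w], \<one>\<^sub>K) \<otimes>\<^sub>FW fof ([v], \<one>\<^sub>K))"
  note c = MG.hpc[OF v] MG.hpc[OF w]
  have "h r = f v \<otimes>\<^sub>P f w \<ominus>\<^sub>P sg P (i * j) (f w \<otimes>\<^sub>P f v)" unfolding r hom_comm[OF P h c] f[OF c(1)] f[OF c(2)] ..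
  also have "... = \<zero>\<^sub>P" unfolding r1[OF v w] using fc c by (simp add: P.minus_eq P.r_neg)
  finally show ?thesis .
 next
  fix u assume u: "u \<in> hpart M 1" and r: "r = fof ([u], \<one>\<^sub>K) \<otimes>\<^sub>FW fof ([u], \<one>\<^sub>K)"
  note c = MG.hpc[OF u]
  show ?thesis unfolding r ring_hom_mult[OF h FW_letter[OF c] FW_letter[OF c]] f[OF c] by (rule r2[OF u])
 qed
qed

lemma S_walg_t:
 assumes "[(2::nat)] \<cdot>\<^sub>K \<one>\<^sub>K \<in> Units K \<or> (carrier K = hpart K 0 \<and> carrier M = hpart M 0)"
 shows "walg_t K M A q Gsym"
proof (rule inter_half[OF assms])
 fix h r assume h: "h \<in> ring_hom FW A" "!!X. X \<in>. M ==> h (fof ([X], \<one>\<^sub>K)) = gen (MG.tw 1 X)" and r: "r \<in> Gsym"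
 show "h r = \<zero>\<^sub>A"
 proof (rule S_kill[OF A.ring_axioms h _ _ r])
  fix v w i j assume v: "v \<in> hpart M i" and w: "w \<in> hpart M j"
  show "gen (MG.tw 1 v) \<otimes>\<^sub>A gen (MG.tw 1 w) = sg A (i * j) (gen (MG.tw 1 w) \<otimes>\<^sub>A gen (MG.tw 1 v))"
   unfolding gen_tw[OF v] gen_tw[OF w] using S_rel[OF v w] MG.hpc[OF v] MG.hpc[OF w]
   by (cases i; cases j) (simp_all add: A.l_minus A.r_minus)
 next
  fix u assume u: "u \<in> hpart M 1"
  show "gen (MG.tw 1 u) \<otimes>\<^sub>A gen (MG.tw 1 u) = \<zero>\<^sub>A"
   unfolding gen_tw[OF u] using S_odd[OF u] MG.hpc[OF u] by (simp add: A.l_minus A.r_minus)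
 qed
qed

end

context walg_t begin

text \<open>Applied with c = 0 for S(g) and with c = [v, w] for U(g).\<close>

lemma prim_rel: assumes v: "v \<in> hpart M i" and w: "w \<in> hpart M j" and c: "c \<in>. M"
  and r: "gen v \<otimes>\<^sub>A gen w = sg A (i * j) (gen w \<otimes>\<^sub>A gen v) \<oplus>\<^sub>A gen c"
 shows "prim v \<otimes>\<^sub>AT.T prim w = sg AT.T (i * j) (prim w \<otimes>\<^sub>AT.T prim v) \<oplus>\<^sub>AT.T prim c"
proof -
 interpret T: ring AT.T by (rule AT.T_ring)
 note vc = MG.hpc[OF v] and wc = MG.hpc[OF w]
 show ?thesis unfolding prim_mult[OF v w] prim_mult[OF w v] r prim_def[of c] using vc wc c
  by (cases i; cases j) (simp_all add: ama[OF AT.pu_amap1] ama[OF AT.pu_amap2]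
    amap_neg[OF AT.pu_amap1 A.ag AT.T_grp] amap_neg[OF AT.pu_amap2 A.ag AT.T_grp]
    T.minus_add T.a_ac)
qed

end

section \<open>The counit of S(g) and the projection onto g\<close>

context supermodule begin

text \<open>The square-zero extension of K by M. Products of two letters vanish there, so the
  relations of S(g) hold, and one morphism from S(g) yields both the counit and the projection onto
  g.\<close>

definition sqz where "sqz = \<lparr>carrier = carrier K \<times> carrier M,
  monoid.mult = (%p r. (fst p \<otimes>\<^sub>K fst r, snd p \<bullet>\<^sub>M fst r \<oplus>\<^sub>M lscale K M (fst p) (snd r))),
  one = (\<one>\<^sub>K, \<zero>\<^sub>M), ring.zero = (\<zero>\<^sub>K, \<zero>\<^sub>M), add = (%p r. (fst p \<oplus>\<^sub>K fst r, snd p \<oplus>\<^sub>M snd r))\<rparr>"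

lemma lscale_zero1: "al \<in>. K ==> lscale K M al \<zero>\<^sub>M = \<zero>\<^sub>M"
 by (rule amap_zero[OF lscale_amap1 M.ag M.ag])

lemma lscale_zero2: "x \<in>. M ==> lscale K M \<zero>\<^sub>K x = \<zero>\<^sub>M"
 by (rule amap_zero[OF lscale_amap2 ag M.ag])

lemma sqz_ring: "ring sqz"
proof (rule ringI)
 show "abelian_group sqz"
 proof (rule abelian_groupI)
  fix x assume "x \<in>. sqz"
  then show "\<exists>y\<in>carrier sqz. y \<oplus>\<^sub>sqz x = \<zero>\<^sub>sqz"
   by (intro bexI[of _ "(\<ominus>\<^sub>K fst x, \<ominus>\<^sub>M snd x)"]) (auto simp: sqz_def l_neg M.l_neg)
 qed (auto simp: sqz_def a_ac M.a_ac)
 show "Group.monoid sqz"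
  by (rule monoidI) (auto simp: sqz_def scale_closed m_assoc scale_add_left ama[OF lscale_amap1] lscale_scale
    lscale_mult scale_mult M.a_assoc scale_one lscale_zero1)
qed (auto simp: sqz_def scale_closed l_distr r_distr scale_add_left scale_add_right ama[OF lscale_amap1]
   ama[OF lscale_amap2] M.a_ac)

lemma sqz_whom: "whom K M sqz (%X. (\<zero>\<^sub>K, X)) (%al. (al, \<zero>\<^sub>M))"
 by (intro whom.intro whom_axioms.intro smx sqz_ring)
   (auto simp: sqz_def ring_hom_def amap_def lscale_zero1 lscale_zero2 scale_closed)

end

context symw begin

definition hsq where "hsq = (SOME h. h \<in> ring_hom A sqz \<and> (\<forall>X \<in> carrier M. h (gen X) = (\<zero>\<^sub>K, X)) \<and> (\<forall>al \<in> carrier K. h (\<eta> al) = (al, \<zero>\<^sub>M)))"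

lemma hsq: "hsq \<in> ring_hom A sqz" "X \<in>. M ==> hsq (gen X) = (\<zero>\<^sub>K, X)" "al \<in>. K ==> hsq (\<eta> al) = (al, \<zero>\<^sub>M)"
proof -
 obtain h where "h \<in> ring_hom A sqz" "!!X. X \<in>. M ==> h (gen X) = (\<zero>\<^sub>K, X)" "!!al. al \<in>. K ==> h (\<eta> al) = (al, \<zero>\<^sub>M)"
 proof (rule universal[OF sqz_whom])
  fix h r assume h: "h \<in> ring_hom FW sqz"
   "!!w. w \<in> WB ==> h (fof w) = wev sqz (%X. (\<zero>\<^sub>K, X)) (%al. (al, \<zero>\<^sub>M)) w" "r \<in> Gsym"
  have z: "(\<zero>\<^sub>K, v) \<otimes>\<^sub>sqz (\<zero>\<^sub>K, w) = \<zero>\<^sub>sqz" if "v \<in>. M" "w \<in>. M" for v w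
   using that by (simp add: sqz_def lscale_zero2)
  show "h r = \<zero>\<^sub>sqz"
  proof (rule S_kill[OF sqz_ring h(1) letter_hom[OF sqz_whom h(2)] _ _ h(3)])
   show "(\<zero>\<^sub>K, v) \<otimes>\<^sub>sqz (\<zero>\<^sub>K, w) = sg sqz (i * j) ((\<zero>\<^sub>K, w) \<otimes>\<^sub>sqz (\<zero>\<^sub>K, v))"
    if "v \<in> hpart M i" "w \<in> hpart M j" for v w i j
    using z MG.hpc[OF that(1)] MG.hpc[OF that(2)] abelian_group.sg_zero[OF ring.is_abelian_group[OF sqz_ring]] by simp
  qed (auto intro: z)
 qed blast
 then have "\<exists>h. h \<in> ring_hom A sqz \<and> (\<forall>X \<in> carrier M. h (gen X) = (\<zero>\<^sub>K, X)) \<and> (\<forall>al \<in> carrier K. h (\<eta> al) = (al, \<zero>\<^sub>M))"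
  by (intro exI[of _ h]) simp
 then have "hsq \<in> ring_hom A sqz \<and> (\<forall>X \<in> carrier M. hsq (gen X) = (\<zero>\<^sub>K, X)) \<and> (\<forall>al \<in> carrier K. hsq (\<eta> al) = (al, \<zero>\<^sub>M))"
  unfolding hsq_def by (rule someI_ex)
 then show "hsq \<in> ring_hom A sqz" "X \<in>. M ==> hsq (gen X) = (\<zero>\<^sub>K, X)" "al \<in>. K ==> hsq (\<eta> al) = (al, \<zero>\<^sub>M)"
  by blast+
qed

text \<open>The components of that morphism: \<open>ep\<close> is the counit, \<open>xx\<close> the
  projection x onto words of length one, and \<open>const a\<close> the map \<epsilon>(.) a.\<close>

definition ep where "ep y = fst (hsq y)"
definition xx where "xx y = snd (hsq y)"
definition const where "const a y = a \<bullet>\<^sub>M ep y"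

lemma hsq_closed: "y \<in>. A ==> hsq y \<in> carrier K \<times> carrier M"
 using ring_hom_closed[OF hsq(1)] by (simp add: sqz_def)

lemma ep_closed [simp]: "y \<in>. A ==> ep y \<in>. K" and xx_closed [simp]: "y \<in>. A ==> xx y \<in>. M"
 using hsq_closed[of y] by (auto simp: ep_def xx_def)

lemma ep_amap: "amap A K ep" and xx_amap: "amap A M xx"
 by (auto intro!: amapI simp del: xx_def ep_def) (simp_all add: ep_def xx_def ring_hom_add[OF hsq(1)] sqz_def)

lemma ep_simps: "al \<in>. K ==> ep (\<eta> al) = al" "[|X \<in>. M; y \<in>. A|] ==> ep (gen X \<otimes>\<^sub>A y) = \<zero>\<^sub>K"
 "[|y \<in>. A; al \<in>. K|] ==> ep (y \<bullet>\<^sub>A al) = ep y \<otimes>\<^sub>K al"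
 using hsq_closed[of y] by (auto simp: ep_def hsq(2,3) ring_hom_mult[OF hsq(1)] scale_\<eta> sqz_def)

lemma xx_simps: "al \<in>. K ==> xx (\<eta> al) = \<zero>\<^sub>M" "[|X \<in>. M; y \<in>. A|] ==> xx (gen X \<otimes>\<^sub>A y) = const X y"
 "[|y \<in>. A; al \<in>. K|] ==> xx (y \<bullet>\<^sub>A al) = xx y \<bullet>\<^sub>M al"
 using hsq_closed[of y] by (auto simp: const_def ep_def xx_def hsq(2,3) ring_hom_mult[OF hsq(1)] scale_\<eta> sqz_def lscale_zero1 lscale_zero2 scale_closed)

lemma ep_hp: "y \<in> hpart A j ==> ep y \<in> hpart K j"
proof (induction rule: A_hinduct)
 case (\<eta> i al) then show ?case by (simp add: ep_simps KG.hpc)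
next
 case (gen i j X x) then show ?case by (simp add: ep_simps MG.hpc A_hp_closed)
next
 case (add j x y) then show ?case by (simp add: ama[OF ep_amap] A_hp_closed KG.hp_add)
qed

lemma xx_hp: "y \<in> hpart A j ==> xx y \<in> hpart M j"
proof (induction rule: A_hinduct)
 case (\<eta> i al) then show ?case by (simp add: xx_simps KG.hpc)
next
 case (gen i j X x) then show ?case using scale_parity[OF gen(1) ep_hp[OF gen(2)]]
  by (simp add: xx_simps MG.hpc A_hp_closed const_def)
next
 case (add j x y) then show ?case by (simp add: ama[OF xx_amap] A_hp_closed MG.hp_add)
qed

lemma xx_lin: "lin K A M 0 xx"
 by (simp add: lin_def xx_amap xx_simps xx_hp)

lemma const_lin: assumes "a \<in> hpart M p" shows "lin K A M p (const a)"
 unfolding lin_def const_def using MG.hpc[OF assms] scale_parity[OF assms ep_hp]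
 by (auto intro: amc[OF ep_amap scale_amap2] simp: ep_simps scale_mult)

end

section \<open>S(g) and U(g) with their comultiplications\<close>

locale envw = lie_superalgebra K g + walg K g A q "lie_superalgebra.Genv K g" for K g A q
begin

lemma U_rel: assumes "v \<in> hpart g i" "w \<in> hpart g j"
 shows "gen v \<otimes>\<^sub>A gen w = sg A (i * j) (gen w \<otimes>\<^sub>A gen v) \<oplus>\<^sub>A gen (bracket g v w)"
proof -
 note c = MG.hpc[OF assms(1)] MG.hpc[OF assms(2)]
 have "fof ([v], \<one>\<^sub>K) \<otimes>\<^sub>FW fof ([w], \<one>\<^sub>K)
   \<ominus>\<^sub>FW sg FW (i * j) (fof ([w], \<one>\<^sub>K) \<otimes>\<^sub>FW fof ([v], \<one>\<^sub>K)) \<ominus>\<^sub>FW fof ([bracket g v w], \<one>\<^sub>K) \<in> Genv"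
  unfolding Genv_def using assms by blast
 from q_G[OF this] have "gen v \<otimes>\<^sub>A gen w \<ominus>\<^sub>A sg A (i * j) (gen w \<otimes>\<^sub>A gen v) \<ominus>\<^sub>A gen (bracket g v w) = \<zero>\<^sub>A"
  unfolding hom_comm_br[OF A.ring_axioms q_hom c] gen_def .
 then have "gen v \<otimes>\<^sub>A gen w \<ominus>\<^sub>A (sg A (i * j) (gen w \<otimes>\<^sub>A gen v) \<oplus>\<^sub>A gen (bracket g v w)) = \<zero>\<^sub>A"
  using c br_closed[OF c] by (simp add: A.minus_eq A.minus_add A.a_assoc)
 then show ?thesis using A.minus_zero_eq c br_closed[OF c] by simp
qed

lemma U_kill:
 assumes P: "ring P" and h: "h \<in> ring_hom FW P" and f: "!!X. X \<in>. g ==> h (fof ([X], \<one>\<^sub>K)) = f X"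
  and r1: "!!v w i j. [|v \<in> hpart g i; w \<in> hpart g j|] ==> f v \<otimes>\<^sub>P f w = sg P (i * j) (f w \<otimes>\<^sub>P f v) \<oplus>\<^sub>P f (bracket g v w)"
  and r: "r \<in> Genv"
 shows "h r = \<zero>\<^sub>P"
proof -
 interpret P: ring P by fact
 have fc: "f X \<in>. P" if "X \<in>. g" for X using f[OF that] ring_hom_closed[OF h FW_letter[OF that]] by simp
 from r obtain v w i j where v: "v \<in> hpart g i" and w: "w \<in> hpart g j"
   and r: "r = fof ([v], \<one>\<^sub>K) \<otimes>\<^sub>FW fof ([w], \<one>\<^sub>K) \<ominus>\<^sub>FW sg FW (i * j) (fof ([w], \<one>\<^sub>K) \<otimes>\<^sub>FW fof ([v], \<one>\<^sub>K))
     \<ominus>\<^sub>FW fof ([bracket g v w], \<one>\<^sub>K)" unfolding Genv_def by blast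
 note c = MG.hpc[OF v] MG.hpc[OF w]
 have "h r = f v \<otimes>\<^sub>P f w \<ominus>\<^sub>P sg P (i * j) (f w \<otimes>\<^sub>P f v) \<ominus>\<^sub>P f (bracket g v w)"
  unfolding r hom_comm_br[OF P h c] f[OF c(1)] f[OF c(2)] f[OF br_closed[OF c]] ..
 also have "... = \<zero>\<^sub>P" unfolding r1[OF v w] by (rule P.minus3_zero) (use fc c br_closed[OF c] in auto)
 finally show ?thesis .
qed

lemma U_walg_t:
 assumes "[(2::nat)] \<cdot>\<^sub>K \<one>\<^sub>K \<in> Units K \<or> (carrier K = hpart K 0 \<and> carrier g = hpart g 0)"
 shows "walg_t K g A q Genv"
proof (rule inter_half[OF assms])
 fix h r assume h: "h \<in> ring_hom FW A" "!!X. X \<in>. g ==> h (fof ([X], \<one>\<^sub>K)) = gen (MG.tw 1 X)" and r: "r \<in> Genv"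
 show "h r = \<zero>\<^sub>A"
 proof (rule U_kill[OF A.ring_axioms h _ r])
  fix v w i j assume v: "v \<in> hpart g i" and w: "w \<in> hpart g j"
  show "gen (MG.tw 1 v) \<otimes>\<^sub>A gen (MG.tw 1 w) = sg A (i * j) (gen (MG.tw 1 w) \<otimes>\<^sub>A gen (MG.tw 1 v)) \<oplus>\<^sub>A gen (MG.tw 1 (bracket g v w))"
   unfolding gen_tw[OF v] gen_tw[OF w] gen_tw[OF br_parity[OF v w]]
   using U_rel[OF v w] MG.hpc[OF v] MG.hpc[OF w] br_closed[OF MG.hpc[OF v] MG.hpc[OF w]]
   by (cases i; cases j) (simp_all add: A.l_minus A.r_minus A.minus_add)
 qed
qed

end

locale hl = lie_superalgebra K g
 for K :: "('k, 'm) graded_ring_scheme" and g :: "('g, 'k, 'n) lie_super_scheme" (structure) +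
 assumes half: "[(2::nat)] \<cdot>\<^sub>K \<one>\<^sub>K \<in> Units K \<or> (carrier K = hpart K 0 \<and> carrier g = hpart g 0)"
begin

abbreviation qS where "qS \<equiv> (%t. sym_ideal K g +>\<^sub>(tensor_alg K g) tcl t)"
abbreviation qU where "qU \<equiv> (%t. env_ideal K g +>\<^sub>(tensor_alg K g) tcl t)"

lemma symw: "symw K g (Sym K g) qS"
 by (intro symw.intro Sym_walg)

lemma envw: "envw K g (Env K g) qU"
 by (intro envw.intro Env_walg lie_superalgebra_axioms)

lemma S_coalg: "coalg K g (Sym K g) qS Gsym (sym_comult K g)"
proof -
 interpret w: walg_t K g "Sym K g" qS Gsym by (rule symw.S_walg_t[OF symw half])
 interpret s: symw K g "Sym K g" qS by (rule symw)
 interpret T: ring w.AT.T by (rule w.AT.T_ring)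
 have g: "sgen K g = w.gen" by (rule ext) (simp add: sgen_def w.gen_def tgen_def)
 have rel: "w.prim v \<otimes>\<^sub>w.AT.T w.prim w' = sg w.AT.T (i * j) (w.prim w' \<otimes>\<^sub>w.AT.T w.prim v)"
  if v: "v \<in> hpart g i" and w: "w' \<in> hpart g j" for v w' i j
 proof -
  have z: "w.gen \<zero> = \<zero>\<^sub>(Sym K g)" "w.prim \<zero> = \<zero>\<^sub>w.AT.T"
   using amap_zero[OF w.gen_amap M.ag w.A.ag] amap_zero[OF w.prim_amap M.ag w.AT.T_grp] .
  show ?thesis
   using w.prim_rel[OF v w M.zero_closed] s.S_rel[OF v w] MG.hpc[OF v] MG.hpc[OF w] by (simp add: z)
 qed
 have "\<exists>!D. w.is_comult D"
 proof (rule w.comult_ex)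
  fix h r assume h: "h \<in> ring_hom FW w.AT.T" "!!X. X \<in>. g ==> h (fof ([X], \<one>\<^sub>K)) = w.prim X" "r \<in> Gsym"
  show "h r = \<zero>\<^sub>w.AT.T"
  proof (rule s.S_kill[OF w.AT.T_ring h(1,2) rel _ h(3)])
   fix u assume u: "u \<in> hpart g 1"
   note uc = MG.hpc[OF u]
   have z: "w.AT.pu \<zero>\<^sub>(Sym K g) \<one>\<^sub>(Sym K g) = \<zero>\<^sub>w.AT.T" "w.AT.pu \<one>\<^sub>(Sym K g) \<zero>\<^sub>(Sym K g) = \<zero>\<^sub>w.AT.T"
    using amap_zero[OF w.AT.pu_amap1 w.A.ag w.AT.T_grp] amap_zero[OF w.AT.pu_amap2 w.A.ag w.AT.T_grp] by auto
   show "w.prim u \<otimes>\<^sub>w.AT.T w.prim u = \<zero>\<^sub>w.AT.T"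
    using uc by (simp add: w.prim_mult[OF u u] s.S_odd[OF u] z T.r_neg)
  qed
 qed
 then have "w.is_comult (THE D. w.is_comult D)" by (rule theI')
 then have "w.is_comult (sym_comult K g)" unfolding sym_comult_def w.is_comult_def Let_def w.prim_def g .
 then show ?thesis by (intro coalg.intro coalg_axioms.intro w.walg_t_axioms)
qed

lemma U_coalg: "coalg K g (Env K g) qU Genv (env_comult K g)"
proof -
 interpret w: walg_t K g "Env K g" qU Genv by (rule envw.U_walg_t[OF envw half])
 interpret s: envw K g "Env K g" qU by (rule envw)
 interpret T: ring w.AT.T by (rule w.AT.T_ring)
 have g: "ugen K g = w.gen" by (rule ext) (simp add: ugen_def w.gen_def tgen_def)
 have "\<exists>!D. w.is_comult D"
 proof (rule w.comult_ex)
  fix h r assume h: "h \<in> ring_hom FW w.AT.T" "!!X. X \<in>. g ==> h (fof ([X], \<one>\<^sub>K)) = w.prim X" "r \<in> Genv"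
  show "h r = \<zero>\<^sub>w.AT.T"
  proof (rule s.U_kill[OF w.AT.T_ring h(1,2) _ h(3)])
   fix v w' i j assume v: "v \<in> hpart g i" and w: "w' \<in> hpart g j"
   show "w.prim v \<otimes>\<^sub>w.AT.T w.prim w' = sg w.AT.T (i * j) (w.prim w' \<otimes>\<^sub>w.AT.T w.prim v) \<oplus>\<^sub>w.AT.T w.prim (bracket g v w')"
    by (rule w.prim_rel[OF v w br_closed[OF MG.hpc[OF v] MG.hpc[OF w]] s.U_rel[OF v w]])
  qed
 qed
 then have "w.is_comult (THE D. w.is_comult D)" by (rule theI')
 \<comment> \<open>\<open>env_comult\<close> lists the two summands of a primitive element in the
   other order than \<open>prim\<close>.\<close>
 moreover have "w.is_comult D \<longleftrightarrow> D \<in> superalg_hom K (Env K g) w.AT.T \<and>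
   (\<forall>a \<in> carrier g. D (ugen K g a) = w.AT.pu \<one>\<^sub>(Env K g) (ugen K g a) \<oplus>\<^sub>w.AT.T w.AT.pu (ugen K g a) \<one>\<^sub>(Env K g))" for D
  unfolding w.is_comult_def w.prim_def g using T.a_comm by auto
 ultimately have "w.is_comult (env_comult K g)" unfolding env_comult_def Let_def by simp
 then show ?thesis by (intro coalg.intro coalg_axioms.intro w.walg_t_axioms)
qed

sublocale SC: coalg K g "Sym K g" qS Gsym "sym_comult K g"
 by (rule S_coalg)

sublocale SW: symw K g "Sym K g" qS
 by (rule symw)

sublocale UC: coalg K g "Env K g" qU Genv "env_comult K g"
 by (rule U_coalg)

lemma sgen_gen: "sgen K g = SC.gen"
 by (rule ext) (simp add: sgen_def SC.gen_def tgen_def)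

lemma ugen_gen: "ugen K g = UC.gen"
 by (rule ext) (simp add: ugen_def UC.gen_def tgen_def)

lemma U_rel: "[|v \<in> hpart g i; w \<in> hpart g j|] ==> UC.gen v \<otimes>\<^sub>(Env K g) UC.gen w
  = sg (Env K g) (i * j) (UC.gen w \<otimes>\<^sub>(Env K g) UC.gen v) \<oplus>\<^sub>(Env K g) UC.gen (bracket g v w)"
 by (rule envw.U_rel[OF envw])

lemmas U_kill = envw.U_kill[OF envw]

end

section \<open>Brackets of maps from the symmetric algebra to the Lie superalgebra\<close>

lemma (in abelian_group) add_cancel3:
 "[|a \<in>. G; b \<in>. G; c \<in>. G|] ==> a \<oplus> (b \<oplus> (\<ominus> a \<oplus> c)) = b \<oplus> c"
 by (subst a_lcomm) (simp_all add: r_neg2)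

context hl begin

abbreviation S where "S \<equiv> Sym K g"
abbreviation U where "U \<equiv> Env K g"
abbreviation LX where "LX \<equiv> SC.LX"
abbreviation br where "br f h d \<equiv> SC.conv g (bracket g) f h d"
abbreviation L where "L d f \<equiv> lin K S g d f"

lemma br_amap1: "Y \<in>. g ==> amap g g (%X. bracket g X Y)" and br_amap2: "X \<in>. g ==> amap g g (bracket g X)"
 by (auto intro!: amapI br_closed br_add_left br_add_right)

lemma br_bil: "bil K g g g (bracket g)"
 by (auto simp: bil_def balanced_def br_amap1 br_amap2 br_scale_middle br_scale_right br_parity)

lemmas bx = smx smx smx br_bil
lemmas br_\<eta> = SC.conv_\<eta>[OF bx] and br_gen = SC.conv_gen[OF bx] and br_lin = SC.conv_lin[OF bx]
 and br_cl = SC.conv_closed[OF bx] and br_am = SC.conv_amap[OF bx]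

lemma br_sg1: "[|X \<in>. g; Y \<in>. g|] ==> bracket g (sg g i X) Y = sg g i (bracket g X Y)"
 and br_sg2: "[|X \<in>. g; Y \<in>. g|] ==> bracket g X (sg g i Y) = sg g i (bracket g X Y)"
 using amap_sg[OF br_amap1 M.ag M.ag] amap_sg[OF br_amap2 M.ag M.ag] by auto

lemma br_zero1: "[|L d h; x \<in>. S|] ==> br (%y. \<zero>) h d x = \<zero>"
 by (rule SC.conv_ext[OF bx lin_zero[OF smx] _ amap_const0[OF M.ag]])
   (auto simp: amap_zero[OF br_amap1 M.ag M.ag] linc)

lemma br_zero2: "[|L df f; x \<in>. S|] ==> br f (%y. \<zero>) d x = \<zero>"
 by (rule SC.conv_ext[OF bx _ lin_zero[OF smx] amap_const0[OF M.ag]])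
   (auto simp: amap_zero[OF br_amap2 M.ag M.ag] linc)

lemma one_ep: "SW.ep \<one>\<^sub>S = \<one>\<^sub>K"
 using SW.ep_simps(1)[OF one_closed] by (simp add: ring_hom_one[OF SC.\<eta>_hom])

lemma const_one: "X \<in>. g ==> SW.const X \<one>\<^sub>S = X"
 by (simp add: SW.const_def one_ep scale_one)

lemma const_LX: "[|X \<in>. g; Y \<in>. g; y \<in>. S|] ==> SW.const X (LX Y y) = \<zero>"
 by (simp add: SW.const_def SW.ep_simps)

lemma \<eta>_scale: "al \<in>. K ==> SC.\<eta> al = \<one>\<^sub>S \<bullet>\<^sub>S al"
 by (simp add: SC.one_scale_A)

text \<open>The counit law: with a constant map in the first slot only the term 1 \<otimes> y of the
  comultiplication contributes.\<close>

lemma br_const: assumes "y \<in>. S" "X \<in> hpart g p" "L d f" shows "br (SW.const X) f d y = bracket g X (f y)"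
 using assms
proof (induction y arbitrary: f d rule: SC.A_induct)
 case (\<eta> i al)
 note a = KG.hpc[OF \<eta>(1)] and X = MG.hpc[OF \<eta>(2)]
 show ?case unfolding br_\<eta>[OF SW.const_lin[OF \<eta>(2)] \<eta>(3) a]
  using a X linc[OF \<eta>(3) SC.A.one_closed] by (simp add: const_one \<eta>_scale lin_scale[OF \<eta>(3)] br_scale_right)
next
 case (gen q Y y)
 note X = MG.hpc[OF gen(4)] and Y = MG.hpc[OF gen(1)] and fY = SC.LX_comp[OF gen(5) gen(1)]
 have "br (%x. SW.const X (LX Y x)) f d y = br (%x. \<zero>) f d y"
  by (rule SC.conv_cong) (simp_all add: const_LX X Y)
 then show ?case
  using br_gen[OF SW.const_lin[OF gen(4)] gen(5) gen(1,2)] gen(3)[OF gen(4) fY] br_zero1[OF gen(5,2)]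
   br_closed[OF X linc[OF fY gen(2)]] by simp
next
 case (add x y)
 show ?case using add(1,2) MG.hpc[OF add(5)] linc[OF add(6)]
  by (simp add: ama[OF br_am[OF SW.const_lin[OF add(5)] add(6)]] add(3)[OF add(5,6)] add(4)[OF add(5,6)] lin_add[OF add(6)] br_add_right)
qed

lemma br_in1: assumes h: "L dh h" and k: "L dk k" and f: "L d f" and X: "X \<in> hpart g p" and x: "x \<in>. S"
 shows "br (%y. br h k dk (LX X y)) f d x = sg g (dk * p) (br (br (%y. h (LX X y)) k dk) f d x) \<oplus> br (br h (%y. k (LX X y)) (dk + p)) f d x"
proof -
 have e: "dh + p + dk = dh + dk + p" "dh + (dk + p) = dh + dk + p" by (simp_all only: ac_simps)
 note l1 = br_lin[OF SC.LX_comp[OF h X] k, unfolded e] and l2 = br_lin[OF h SC.LX_comp[OF k X], unfolded e]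
 show ?thesis
  by (rule trans[OF SC.conv_cong[OF br_gen[OF h k X] refl]])
    (assumption, simp only: SC.conv_plus1[OF bx lin_sg[OF smx l1] l2 f x] SC.conv_sg1[OF bx l1 f x])
qed

lemma br_in2: assumes h: "L dh h" and k: "L dk k" and f: "L df f" and X: "X \<in> hpart g p" and x: "x \<in>. S" and d: "d = dh + dk + p"
 shows "br f (%y. br h k dk (LX X y)) d x = sg g (dk * p) (br f (br (%y. h (LX X y)) k dk) d x) \<oplus> br f (br h (%y. k (LX X y)) (dk + p)) d x"
proof -
 have e: "dh + p + dk = d" "dh + (dk + p) = d" unfolding d by (simp_all only: ac_simps)
 note l1 = br_lin[OF SC.LX_comp[OF h X] k, unfolded e] and l2 = br_lin[OF h SC.LX_comp[OF k X], unfolded e]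
 show ?thesis
  by (rule trans[OF SC.conv_cong[OF refl br_gen[OF h k X]]])
    (assumption, simp only: SC.conv_plus2[OF bx f lin_sg[OF smx l1] l2 x] SC.conv_sg2[OF bx f l1 x])
qed

text \<open>Antisymmetry of the bracket combined with cocommutativity. The latter is visible in
  \<open>conv_gen\<close>, which sends a letter to either map in the same way up to sign.\<close>

lemma br_antisym_conv: assumes "x \<in>. S" "L df f" "L d h" shows "br f h d x = \<ominus> sg g (df * d) (br h f df x)"
 using assms
proof (induction x arbitrary: df f d h rule: SC.A_induct)
 case (\<eta> i al)
 note a = KG.hpc[OF \<eta>(1)]
 have h: "f \<one>\<^sub>S \<in> hpart g df" "h \<one>\<^sub>S \<in> hpart g d"
  using lin_hp[OF \<eta>(2) SC.AT.one_hp] lin_hp[OF \<eta>(3) SC.AT.one_hp] by simp_all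
 note c = br_closed[OF MG.hpc[OF h(2)] MG.hpc[OF h(1)]]
 show ?case unfolding br_\<eta>[OF \<eta>(2,3) a] br_\<eta>[OF \<eta>(3,2) a] br_antisym[OF h]
  using a c by (simp add: scale_neg1 scale_sg1)
next
 case (gen p X x)
 note f = gen(4) and h = gen(5) and fX = SC.LX_comp[OF f gen(1)] and hX = SC.LX_comp[OF h gen(1)]
 note c = br_cl[OF h fX gen(2)] br_cl[OF hX f gen(2)]
 show ?case unfolding br_gen[OF f h gen(1,2)] br_gen[OF h f gen(1,2)] gen(3)[OF fX h] gen(3)[OF f hX]
  using c by (cases df; cases d; cases p) (simp_all add: M.minus_add M.a_ac)
next
 case (add x y)
 show ?case using add(1,2) br_cl[OF add(6,5)]
  by (simp add: ama[OF br_am[OF add(5,6)]] ama[OF br_am[OF add(6,5)]] add(3)[OF add(5,6)] add(4)[OF add(5,6)] M.sg_add M.minus_add)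
qed

text \<open>The Jacobi identity combined with coassociativity and cocommutativity. At 1 it is the
  Jacobi identity in g; a letter X is distributed over f, h and k, giving three instances of the
  hypothesis.\<close>

lemma br_jacobi_conv: assumes "x \<in>. S" "L df f" "L dh h" "L dk k"
 shows "br f (br h k dk) (dh + dk) x = br (br f h dh) k dk x \<oplus> sg g (df * dh) (br h (br f k dk) (df + dk) x)"
 using assms
proof (induction x arbitrary: df f dh h dk k rule: SC.A_induct)
 case (\<eta> i al)
 note a = KG.hpc[OF \<eta>(1)] and f = \<eta>(2) and h = \<eta>(3) and k = \<eta>(4)
 have p: "f \<one>\<^sub>S \<in> hpart g df" "h \<one>\<^sub>S \<in> hpart g dh" "k \<one>\<^sub>S \<in> hpart g dk"
  using lin_hp[OF f SC.AT.one_hp] lin_hp[OF h SC.AT.one_hp] lin_hp[OF k SC.AT.one_hp] by simp_all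
 note c = p[THEN MG.hpc]
 have o: "br f h d \<one>\<^sub>S = bracket g (f \<one>\<^sub>S) (h \<one>\<^sub>S)" if "L df f" "L d h" for df f d h
  using br_\<eta>[OF that one_closed] br_closed[OF linc[OF that(1)] linc[OF that(2)]]
  by (simp add: ring_hom_one[OF SC.\<eta>_hom] scale_one)
 have "bracket g (f \<one>\<^sub>S) (bracket g (h \<one>\<^sub>S) (k \<one>\<^sub>S)) = bracket g (bracket g (f \<one>\<^sub>S) (h \<one>\<^sub>S)) (k \<one>\<^sub>S)
   \<oplus> sg g (df * dh) (bracket g (h \<one>\<^sub>S) (bracket g (f \<one>\<^sub>S) (k \<one>\<^sub>S)))"
  using jacobi[OF p(1,2) c(3)] c by (simp add: br_closed M.minus_eq M.a_assoc M.l_neg)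
 then show ?case using a c
  by (simp add: br_\<eta>[OF f br_lin[OF h k] a] br_\<eta>[OF br_lin[OF f h] k a] br_\<eta>[OF h br_lin[OF f k] a]
    o[OF h k] o[OF f h] o[OF f k] scale_add_left br_closed scale_sg1)
next
 case (gen p X x)
 note X = gen(1) and x = gen(2) and IH = gen(3) and f = gen(4) and h = gen(5) and k = gen(6)
 note fX = SC.LX_comp[OF f X] and hX = SC.LX_comp[OF h X] and kX = SC.LX_comp[OF k X]
 have e: "dh + p + dk = dh + dk + p" "dh + (dk + p) = dh + dk + p" "df + p + dk = df + dk + p" "df + (dk + p) = df + dk + p"
  by (simp_all only: ac_simps)
 note I = IH[OF fX h k, unfolded e] IH[OF f hX k, unfolded e] IH[OF f h kX, unfolded e]
 note c = br_cl[OF br_lin[OF fX h] k x] br_cl[OF br_lin[OF f hX] k x] br_cl[OF br_lin[OF f h] kX x]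
  br_cl[OF h br_lin[OF fX k] x] br_cl[OF hX br_lin[OF f k] x] br_cl[OF h br_lin[OF f kX] x]
 show ?case
  unfolding br_gen[OF f br_lin[OF h k] X x] br_in2[OF h k f X x refl] br_gen[OF br_lin[OF f h] k X x] br_in1[OF f h k X x]
   br_gen[OF h br_lin[OF f k] X x] br_in2[OF f k h X x refl] I
  using c[unfolded e] by (cases df; cases dh; cases dk; cases p) (simp_all add: M.minus_add M.a_ac)
next
 case (add x y)
 note f = add(5) and h = add(6) and k = add(7)
 note am = br_am[OF f br_lin[OF h k]] br_am[OF br_lin[OF f h] k] br_am[OF h br_lin[OF f k]]
 show ?case using add(1,2) am[THEN amapc, OF add(1)] am[THEN amapc, OF add(2)]
  by (simp add: am[THEN ama] add(3)[OF f h k] add(4)[OF f h k] M.sg_add M.add4)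
qed

section \<open>The derivation {x, .}\<close>

abbreviation AD where "AD f d \<equiv> br SW.xx f d"

lemma AD_lin: "L d f ==> L d (AD f d)"
 using br_lin[OF SW.xx_lin] by simp

lemma AD_br: assumes "L df f" "L d h" "x \<in>. S"
 shows "AD (br f h d) (df + d) x = br (AD f df) h d x \<oplus> br f (AD h d) d x"
 using br_jacobi_conv[OF assms(3) SW.xx_lin assms(1,2)] by simp

lemma AD_\<eta>: "[|L d f; al \<in>. K|] ==> AD f d (SC.\<eta> al) = \<zero>"
 using SW.xx_simps(1)[OF one_closed] amap_zero[OF br_amap1 M.ag M.ag]
 by (simp add: br_\<eta>[OF SW.xx_lin] ring_hom_one[OF SC.\<eta>_hom] linc)

lemma AD_gen: assumes f: "L d f" and X: "X \<in> hpart g p" and x: "x \<in>. S"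
 shows "AD f d (LX X x) = sg g (d * p) (bracket g X (f x)) \<oplus> AD (%y. f (LX X y)) (d + p) x"
proof -
 have "br (%y. SW.xx (LX X y)) f d x = br (SW.const X) f d x"
  by (rule SC.conv_cong) (simp_all add: SW.xx_simps MG.hpc[OF X])
 then show ?thesis unfolding br_gen[OF SW.xx_lin f X x] by (simp only: br_const[OF x X f])
qed

text \<open>The operator multiplies by a value of \<chi>, so its values have no part of length
  zero.\<close>

lemma ep_PH: assumes "x \<in>. S" "L c \<chi>" shows "SW.ep (SC.PH \<chi> c x) = \<zero>\<^sub>K"
 using assms
proof (induction x arbitrary: \<chi> c rule: SC.A_induct)
 case (\<eta> i al)
 then show ?case using linc[OF \<eta>(2) SC.A.one_closed] by (simp add: SC.PH_\<eta> KG.hpc SW.ep_simps)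
next
 case (gen p X x)
 note k = gen(4) and kX = SC.LX_comp[OF gen(4,1)] and X = MG.hpc[OF gen(1)]
 note c = linc[OF SC.PH_lin[OF k] gen(2)] linc[OF SC.PH_lin[OF kX] gen(2)]
 show ?case using c X gen(3)[OF kX]
  by (simp add: SC.PH_gen[OF k gen(1,2)] ama[OF SW.ep_amap] amap_sg[OF SW.ep_amap SC.A.ag ag] SW.ep_simps)
next
 case (add x y)
 then show ?case using linc[OF SC.PH_lin[OF add(5)]] by (simp add: lin_add[OF SC.PH_lin[OF add(5)]] ama[OF SW.ep_amap])
qed

lemma const_PH: "[|x \<in>. S; L c \<chi>; a \<in>. g|] ==> SW.const a (SC.PH \<chi> c x) = \<zero>"
 by (simp add: SW.const_def ep_PH)

text \<open>The linear part of v \<chi>(w) is \<epsilon>(v) \<chi>(w); by the counit law these add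
  up to \<chi> x.\<close>

lemma xx_PH: assumes "x \<in>. S" "L c \<chi>" shows "SW.xx (SC.PH \<chi> c x) = \<chi> x"
 using assms
proof (induction x arbitrary: \<chi> c rule: SC.A_induct)
 case (\<eta> i al)
 note a = KG.hpc[OF \<eta>(1)]
 have "SW.xx (SC.PH \<chi> c (SC.\<eta> al)) = \<chi> \<one>\<^sub>S \<bullet> al" using a linc[OF \<eta>(2) SC.A.one_closed]
  by (simp add: SC.PH_\<eta>[OF \<eta>(2)] SW.xx_simps SW.const_def SW.ep_simps)
 moreover have "\<chi> (SC.\<eta> al) = \<chi> \<one>\<^sub>S \<bullet> al" using a by (simp add: \<eta>_scale lin_scale[OF \<eta>(2)])
 ultimately show ?case by simp
next
 case (gen p X x)
 note k = gen(4) and kX = SC.LX_comp[OF gen(4,1)] and X = MG.hpc[OF gen(1)]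
 note c = linc[OF SC.PH_lin[OF k] gen(2)] linc[OF SC.PH_lin[OF kX] gen(2)]
 show ?case using c X gen(3)[OF kX] linc[OF kX gen(2)]
  by (simp add: SC.PH_gen[OF k gen(1,2)] ama[OF SW.xx_amap] amap_sg[OF SW.xx_amap SC.A.ag M.ag]
    SW.xx_simps const_PH[OF gen(2) k X])
next
 case (add x y)
 then show ?case using linc[OF SC.PH_lin[OF add(5)]] by (simp add: lin_add[OF SC.PH_lin[OF add(5)]] ama[OF SW.xx_amap] lin_add[OF add(5)])
qed

text \<open>Composing the projection x with \<open>PH \<chi>\<close> gives \<chi> by
  \<open>xx_PH\<close>. The derivation rule therefore splits off the bracket {\<chi>, f}, the source
  of all brackets in the commutator.\<close>

lemma AD_PH: assumes f: "L d f" and k: "L c \<chi>" and x: "x \<in>. S"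
 shows "AD f d (SC.PH \<chi> c x) = sg g (d * c) (br \<chi> f d x) \<oplus> AD (%y. f (SC.PH \<chi> c y)) (d + c) x"
proof -
 have "br (%y. SW.xx (SC.PH \<chi> c y)) f d x = br \<chi> f d x"
  by (rule SC.conv_cong) (simp_all add: xx_PH k)
 then show ?thesis using SC.PH_derivation[OF bx x SW.xx_lin f k] by simp
qed

text \<open>Supersymmetry of the part of a product of two such operators that is not seen by either coefficient.\<close>

lemma PH_normal: assumes "x \<in>. S" "L d \<psi>" "L c \<chi>"
 shows "SC.conv S SC.gm (SC.PH \<chi> c) \<psi> d x = sg S (c * d) (SC.conv S SC.gm (SC.PH \<psi> d) \<chi> c x)"
 using assms
proof (induction x arbitrary: d \<psi> c \<chi> rule: SC.A_induct)
 case (\<eta> i al)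
 note a = KG.hpc[OF \<eta>(1)]
 have h: "\<psi> \<one>\<^sub>S \<in> hpart g d" "\<chi> \<one>\<^sub>S \<in> hpart g c"
  using lin_hp[OF \<eta>(2) SC.AT.one_hp] lin_hp[OF \<eta>(3) SC.AT.one_hp] by simp_all
 note hc = h[THEN MG.hpc]
 have o: "SC.PH \<psi> d \<one>\<^sub>S = SC.gen (\<psi> \<one>\<^sub>S)" if "L d \<psi>" for \<psi> d
  using SC.PH_\<eta>[OF that one_closed] linc[OF that SC.A.one_closed] by (simp add: ring_hom_one[OF SC.\<eta>_hom])
 show ?case using a hc SW.S_rel[OF h(2,1)]
  by (simp add: SC.conv_\<eta>[OF SC.gmx SC.PH_lin[OF \<eta>(3)] \<eta>(2)] SC.conv_\<eta>[OF SC.gmx SC.PH_lin[OF \<eta>(2)] \<eta>(3)] o[OF \<eta>(2)] o[OF \<eta>(3)] SC.AT.scale_sg1)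
next
 case (gen p X x)
 note X = gen(1) and x = gen(2) and IH = gen(3) and f = gen(4) and h = gen(5)
 note fX = SC.LX_comp[OF f X] and hX = SC.LX_comp[OF h X]
 have e: "SC.conv S SC.gm (%y. SC.PH \<chi> c (LX X y)) \<psi> d x = sg S (c * p) (LX X (SC.conv S SC.gm (SC.PH \<chi> c) \<psi> d x))
   \<oplus>\<^sub>S SC.conv S SC.gm (SC.PH (%y. \<chi> (LX X y)) (c + p)) \<psi> d x" if f: "L d \<psi>" and h: "L c \<chi>" for d \<psi> c \<chi>
 proof -
  have l: "lin K S S (c + p) (%y. LX X (SC.PH \<chi> c y))" by (rule lin_comp[OF SC.PH_lin[OF h] SC.LX_lin[OF X]])
  show ?thesis
   by (rule trans[OF SC.conv_cong[OF SC.PH_gen[OF h X] refl]])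
     (assumption, simp only: SC.conv_plus1[OF SC.gmx lin_sg[OF SC.AT.smx l] SC.PH_lin[OF SC.LX_comp[OF h X]] f x] SC.conv_sg1[OF SC.gmx l f x]
       SC.gm_LX[OF SC.PH_lin[OF h] f X x])
 qed
 note c = SC.conv_closed[OF SC.gmx SC.PH_lin[OF f] h x] SC.conv_closed[OF SC.gmx SC.PH_lin[OF fX] h x] SC.conv_closed[OF SC.gmx SC.PH_lin[OF f] hX x]
 note Xc = MG.hpc[OF X]
 show ?case unfolding SC.conv_gen[OF SC.gmx SC.PH_lin[OF h] f X x] SC.conv_gen[OF SC.gmx SC.PH_lin[OF f] h X x] e[OF f h] e[OF h f]
   IH[OF f h] IH[OF fX h] IH[OF f hX]
  using c Xc by (cases d; cases c; cases p) (simp_all add: SC.A.minus_add SC.A.a_ac SC.A.r_minus)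
next
 case (add x y)
 note am = SC.conv_amap[OF SC.gmx SC.PH_lin[OF add(6)] add(5)] SC.conv_amap[OF SC.gmx SC.PH_lin[OF add(5)] add(6)]
 show ?case using add(1,2) am[THEN amapc, OF add(1)] am[THEN amapc, OF add(2)]
  by (simp add: am[THEN ama] add(3)[OF add(5,6)] add(4)[OF add(5,6)] SC.A.sg_add)
qed

section \<open>Commutators of the operators\<close>

lemma PH_plus: "[|L d f; L d h; x \<in>. S|] ==> SC.PH (%y. f y \<oplus> h y) d x = SC.PH f d x \<oplus>\<^sub>S SC.PH h d x"
 unfolding SC.PH_def by (rule SC.conv_plus2[OF SC.gmx lin_id])

lemma PH_sg: "[|L d f; x \<in>. S|] ==> SC.PH (%y. sg g i (f y)) d x = sg S i (SC.PH f d x)"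
 unfolding SC.PH_def by (rule SC.conv_sg2[OF SC.gmx lin_id])

lemma PH_scale: "[|L d f; c \<in> hpart K 0; x \<in>. S|] ==> SC.PH (%y. f y \<bullet> c) d x = SC.PH f d x \<bullet>\<^sub>S c"
 unfolding SC.PH_def by (rule SC.conv_scale2[OF SC.gmx lin_id])

lemma PH_PH: "[|x \<in>. S; L d \<psi>; L c \<chi>|] ==> SC.PH \<psi> d (SC.PH \<chi> c x)
  = sg S (d * c) (SC.conv S SC.gm (SC.PH \<chi> c) \<psi> d x) \<oplus>\<^sub>S SC.PH (%y. \<psi> (SC.PH \<chi> c y)) (d + c) x"
 using SC.PH_derivation[OF SC.gmx _ lin_id] by (simp only: SC.PH_def[symmetric])

text \<open>Each product of two operators is a normally ordered part plus an operator of the form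
  \<open>PH\<close>. The normally ordered parts cancel by \<open>PH_normal\<close>, so operators of
  this form are closed under supercommutators.\<close>

lemma PH_commutator: assumes x: "x \<in>. S" and f: "L d \<psi>" and h: "L c \<chi>"
 shows "SC.PH \<psi> d (SC.PH \<chi> c x) = sg S (d * c) (SC.PH \<chi> c (SC.PH \<psi> d x)) \<oplus>\<^sub>S
   SC.PH (%y. \<psi> (SC.PH \<chi> c y) \<ominus> sg g (d * c) (\<chi> (SC.PH \<psi> d y))) (d + c) x"
proof -
 have fh: "L (d + c) (%y. \<psi> (SC.PH \<chi> c y))" using lin_comp[OF SC.PH_lin[OF h] f] by (simp add: add.commute)
 have hf: "L (d + c) (%y. \<chi> (SC.PH \<psi> d y))" using lin_comp[OF SC.PH_lin[OF f] h] .
 note s = lin_sg[OF smx hf, of "d * c"]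
 have "L (d + c) (%y. \<ominus> sg g (d * c) (\<chi> (SC.PH \<psi> d y)))" using lin_sg[OF smx s, of 1] by simp
 then have 1: "SC.PH (%y. \<psi> (SC.PH \<chi> c y) \<ominus> sg g (d * c) (\<chi> (SC.PH \<psi> d y))) (d + c) x
   = SC.PH (%y. \<psi> (SC.PH \<chi> c y)) (d + c) x \<oplus>\<^sub>S SC.PH (%y. \<ominus> sg g (d * c) (\<chi> (SC.PH \<psi> d y))) (d + c) x"
  unfolding a_minus_def by (rule PH_plus[OF fh _ x])
 have 2: "SC.PH (%y. \<ominus> sg g (d * c) (\<chi> (SC.PH \<psi> d y))) (d + c) x = \<ominus>\<^sub>S sg S (d * c) (SC.PH (%y. \<chi> (SC.PH \<psi> d y)) (d + c) x)"
  using PH_sg[OF s x, of 1] PH_sg[OF hf x, of "d * c"] by simp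
 have 3: "SC.PH \<psi> d (SC.PH \<chi> c x) = sg S (d * c) (SC.conv S SC.gm (SC.PH \<chi> c) \<psi> d x) \<oplus>\<^sub>S SC.PH (%y. \<psi> (SC.PH \<chi> c y)) (d + c) x"
  by (rule PH_PH[OF x f h])
 have 4: "SC.PH \<chi> c (SC.PH \<psi> d x) = sg S (c * d) (SC.conv S SC.gm (SC.PH \<psi> d) \<chi> c x) \<oplus>\<^sub>S SC.PH (%y. \<chi> (SC.PH \<psi> d y)) (d + c) x"
  using PH_PH[OF x h f] by (simp add: add.commute)
 note c = SC.conv_closed[OF SC.gmx SC.PH_lin[OF f] h x] linc[OF SC.PH_lin[OF fh] x] linc[OF SC.PH_lin[OF hf] x]
 show ?thesis unfolding 1 2 3 4 PH_normal[OF x f h]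
  using c by (cases d; cases c) (simp_all add: SC.A.minus_add SC.A.a_ac SC.A.add_cancel3)
qed

primrec psi where
 "psi a p 0 = SW.const a"
| "psi a p (Suc n) = AD (psi a p n) p"

lemma psi_lin: "a \<in> hpart g p ==> L p (psi a p n)"
 by (induction n) (auto intro: SW.const_lin AD_lin)

text \<open>The counterpart of the monomial s^i t^j: i applications of {x, .} sit on a and j on
  b.\<close>

definition E where "E a pa b pb i j = br (psi a pa i) (psi b pb j) pb"

lemma E_lin: "[|a \<in> hpart g pa; b \<in> hpart g pb|] ==> L (pa + pb) (E a pa b pb i j)"
 unfolding E_def by (intro br_lin psi_lin)

lemma AD_E: assumes "a \<in> hpart g pa" "b \<in> hpart g pb" "x \<in>. S"
 shows "AD (E a pa b pb i j) (pa + pb) x = E a pa b pb (Suc i) j x \<oplus> E a pa b pb i (Suc j) x"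
 unfolding E_def using AD_br[OF psi_lin[OF assms(1)] psi_lin[OF assms(2)] assms(3)] by simp

lemma E_00: assumes "a \<in> hpart g pa" "b \<in> hpart g pb" "x \<in>. S"
 shows "E a pa b pb 0 0 x = SW.const (bracket g a b) x"
 using MG.hpc[OF assms(1)] MG.hpc[OF assms(2)] assms(3)
 by (simp add: E_def br_const[OF assms(3,1) SW.const_lin[OF assms(2)]] SW.const_def br_scale_right)

lemma psi_PH_0: "[|x \<in>. S; L c \<chi>; a \<in>. g|] ==> psi a p 0 (SC.PH \<chi> c x) = \<zero>"
 by (simp add: const_PH)

text \<open>In both cases below the sign of the transposition of \<open>a\<close> and \<open>b\<close> has been absorbed.\<close>

lemma psi_PH_Suc1: assumes a: "a \<in> hpart g pa" and b: "b \<in> hpart g pb" and x: "x \<in>. S"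
 shows "psi a pa (Suc m) (SC.PH (psi b pb k) pb x) = \<ominus> E a pa b pb m k x \<oplus> AD (%y. psi a pa m (SC.PH (psi b pb k) pb y)) (pa + pb) x"
proof -
 note la = psi_lin[OF a, of m] and lb = psi_lin[OF b, of k]
 have "sg g (pa * pb) (br (psi b pb k) (psi a pa m) pa x) = \<ominus> E a pa b pb m k x"
  using br_antisym_conv[OF x lb la] br_cl[OF la lb x] by (simp add: E_def M.sg_neg M.sg_sg mult.commute)
 then show ?thesis using AD_PH[OF la lb x] by simp
qed

lemma psi_PH_Suc2: assumes a: "a \<in> hpart g pa" and b: "b \<in> hpart g pb" and x: "x \<in>. S"
 shows "psi b pb (Suc m) (SC.PH (psi a pa k) pa x) = sg g (pa * pb) (E a pa b pb k m x) \<oplus> AD (%y. psi b pb m (SC.PH (psi a pa k) pa y)) (pa + pb) x"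
 using AD_PH[OF psi_lin[OF b, of m] psi_lin[OF a, of k] x] by (simp add: E_def mult.commute add.commute)

end

section \<open>Bernoulli numbers\<close>

abbreviation bern :: "nat => rat" where "bern n \<equiv> fps_nth (fps_X / (fps_exp 1 - 1)) n"

lemma bern_fps: "fps_X / (fps_exp 1 - 1) * (fps_exp 1 - 1) = (fps_X :: rat fps)"
proof -
 have n0: "fps_exp 1 - 1 \<noteq> (0 :: rat fps)"
 proof
  assume "fps_exp 1 - 1 = (0 :: rat fps)"
  then have "fps_nth (fps_exp 1 - 1 :: rat fps) 1 = 0" by simp
  then show False by simp
 qed
 have "subdegree (fps_exp 1 - 1 :: rat fps) = 1"
  by (rule subdegreeI) auto
 then have "(fps_exp 1 - 1) dvd (fps_X :: rat fps)" using n0 by (subst fps_dvd_iff) auto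
 then show ?thesis by (rule dvd_div_mult_self)
qed

text \<open>The series \<phi>(w t) for \<phi>(t) = t / (e^t - 1), given by its coefficients so that
  w = 0 is no exception.\<close>

definition bserie :: "rat => rat fps" where "bserie w = Abs_fps (%n. bern n * w ^ n)"

lemma bserie_eq: "bserie w * (fps_exp w - 1) = fps_const w * fps_X"
proof (rule fps_ext)
 fix n
 have "fps_nth (bserie w * (fps_exp w - 1)) n = (\<Sum>i=0..n. w ^ n * (bern i * fps_nth (fps_exp 1 - 1) (n - i)))"
  unfolding fps_mult_nth bserie_def
  by (intro sum.cong refl) (auto simp: power_add[symmetric])
 also have "... = w ^ n * fps_nth (fps_X / (fps_exp 1 - 1) * (fps_exp 1 - 1)) n"
  unfolding fps_mult_nth sum_distrib_left ..
 finally show "fps_nth (bserie w * (fps_exp w - 1)) n = fps_nth (fps_const w * fps_X) n"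
  unfolding bern_fps by (cases "n = 1") auto
qed

text \<open>With \<open>\<phi>(t) = t / (e\<^sup>t - 1)\<close>: \<open>-u (\<phi>((u+1)t) - \<phi>(ut)) \<phi>(t) - (\<phi>((u+1)t) - \<phi>(t)) \<phi>(ut) = u t \<phi>((u+1)t)\<close>.\<close>

lemma bserie_functional:
 assumes "u \<noteq> 0" "u + 1 \<noteq> 0"
 shows "- (fps_const u * (bserie (u + 1) - bserie u) * bserie 1) - (bserie (u + 1) - bserie 1) * bserie u
  = fps_const u * fps_X * bserie (u + 1)"
proof -
 define a b c where "a = fps_exp u - (1 :: rat fps)" and "b = fps_exp 1 - (1 :: rat fps)" and "c = fps_exp (u + 1) - (1 :: rat fps)"
 have c: "c = a * b + a + b" unfolding a_def b_def c_def fps_exp_add_mult by (simp add: algebra_simps)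
 define A B C where "A = bserie u" and "B = bserie 1" and "C = bserie (u + 1)"
 have A: "A * a = fps_const u * fps_X" and B: "B * b = fps_X" and C: "C * c = fps_const u * fps_X + fps_X"
  unfolding A_def B_def C_def a_def b_def c_def bserie_eq by (simp_all flip: fps_const_add add: algebra_simps)
 have nz: "fps_exp w - 1 \<noteq> (0 :: rat fps)" if "w \<noteq> 0" for w
 proof
  assume "fps_exp w - 1 = (0 :: rat fps)"
  then have "fps_nth (fps_exp w - 1 :: rat fps) 1 = 0" by simp
  then show False using that by simp
 qed
 \<comment> \<open>After multiplication by all three denominators the series occur only in the
   products A a, B b and C c, which are multiples of t; what remains is a polynomial identity in a,
   b and t.\<close>
 have "(- (fps_const u * (C - A) * B) - (C - B) * A) * (a * b * c) =
   - (fps_const u * ((C * c) * a * (B * b) - (A * a) * (B * b) * c)) - ((C * c) * (A * a) * b - (B * b) * (A * a) * c)"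
  by (simp add: algebra_simps)
 also have "... = fps_const u * fps_X * (C * c) * (a * b)"
  unfolding A B C by (simp add: c algebra_simps)
 finally have "(- (fps_const u * (C - A) * B) - (C - B) * A) * (a * b * c) = (fps_const u * fps_X * C) * (a * b * c)"
  by (simp add: algebra_simps)
 moreover have "a * b * c \<noteq> 0" using nz assms unfolding a_def b_def c_def by simp
 ultimately show ?thesis unfolding A_def B_def C_def by simp
qed

section \<open>The functional equation as an identity of polynomials in u\<close>

definition upoly :: "rat poly" where "upoly = [:1, 1:]"

text \<open>The polynomial of the commutator contribution of \<psi>_m for a and \<psi>_k for b.
  Raising m multiplies by u + 1 and adds u^m + u^k, which are the brackets split off in
  \<open>psi_PH_Suc1\<close> and \<open>psi_PH_Suc2\<close>.\<close>

fun Ppoly :: "nat => nat => rat poly" where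
 "Ppoly 0 k = 0"
| "Ppoly (Suc m) k = (monom 1 m + monom 1 k) + upoly * Ppoly m k"

text \<open>Solves the recursion in closed form. The factor u on both sides avoids the exponent k -
  1.\<close>

lemma Ppoly_eval: "u * poly (Ppoly m k) u = u * ((u + 1) ^ m - u ^ m) + ((u + 1) ^ m - 1) * u ^ k"
proof (induction m)
 case (Suc m)
 have "u * poly (Ppoly (Suc m) k) u = u * (u ^ m + u ^ k) + (u + 1) * (u * poly (Ppoly m k) u)"
  by (simp add: upoly_def poly_monom algebra_simps)
 then show ?case unfolding Suc by (simp add: algebra_simps)
qed simp

text \<open>The coefficient of t^(n+1) in the functional equation, divided by u, at every rational u
  other than 0 and -1. Infinitely many points make it an identity of polynomials, which can then be
  evaluated on brackets instead of powers of u.\<close>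

lemma bern_poly: "(\<Sum>m\<le>Suc n. smult (- (bern m * bern (Suc n - m))) (Ppoly m (Suc n - m))) = smult (bern n) (upoly ^ n)" (is "?L = ?R")
proof -
 have "poly (?L - ?R) u = 0" if u: "u \<noteq> 0" "u + 1 \<noteq> 0" for u
 proof -
  have "fps_nth (- (fps_const u * (bserie (u + 1) - bserie u) * bserie 1) - (bserie (u + 1) - bserie 1) * bserie u) (Suc n)
    = fps_nth (fps_const u * fps_X * bserie (u + 1)) (Suc n)"
   unfolding bserie_functional[OF u] ..
  note a = this
  have e: "- (\<Sum>m\<le>Suc n. u * ((bern m * (u + 1) ^ m - bern m * u ^ m) * bern (Suc n - m)) + (bern m * (u + 1) ^ m - bern m) * (bern (Suc n - m) * u ^ (Suc n - m)))
    = u * (bern n * (u + 1) ^ n)"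
  proof -
   have 1: "fps_nth (fps_const u * fps_X * bserie (u + 1)) (Suc n) = u * (bern n * (u + 1) ^ n)"
    unfolding mult.assoc fps_mult_left_const_nth by (simp add: bserie_def)
   have 2: "fps_nth (fps_const u * (bserie (u + 1) - bserie u) * bserie 1) (Suc n)
    = (\<Sum>m\<le>Suc n. u * ((bern m * (u + 1) ^ m - bern m * u ^ m) * bern (Suc n - m)))"
    unfolding mult.assoc fps_mult_left_const_nth unfolding fps_mult_nth sum_distrib_left atLeast0AtMost by (simp add: bserie_def del: sum.atMost_Suc)
   have 3: "fps_nth ((bserie (u + 1) - bserie 1) * bserie u) (Suc n)
    = (\<Sum>m\<le>Suc n. (bern m * (u + 1) ^ m - bern m) * (bern (Suc n - m) * u ^ (Suc n - m)))"
    unfolding fps_mult_nth atLeast0AtMost by (simp add: bserie_def del: sum.atMost_Suc)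
   show ?thesis using a unfolding 1 fps_sub_nth fps_neg_nth 2 3 sum.distrib by linarith
  qed
  have "u * poly ?L u = (\<Sum>m\<le>Suc n. - (bern m * bern (Suc n - m)) * (u * poly (Ppoly m (Suc n - m)) u))"
   unfolding poly_sum sum_distrib_left by (intro sum.cong refl) (simp add: algebra_simps)
  also have "... = - (\<Sum>m\<le>Suc n. u * ((bern m * (u + 1) ^ m - bern m * u ^ m) * bern (Suc n - m)) + (bern m * (u + 1) ^ m - bern m) * (bern (Suc n - m) * u ^ (Suc n - m)))"
   unfolding Ppoly_eval sum_negf[symmetric] by (intro sum.cong refl) (simp add: algebra_simps)
  also have "... = u * poly ?R u" unfolding e by (simp add: upoly_def add.commute)
  finally show ?thesis using u by simp
 qed
 then have "UNIV - {0, - 1} <= {u. poly (?L - ?R) u = 0}" by (auto simp: add_eq_0_iff2)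
 moreover have "infinite (UNIV - {0, - 1 :: rat})" by (simp add: infinite_UNIV_char_0)
 ultimately have "?L - ?R = 0" using poly_roots_finite finite_subset by blast
 then show ?thesis by simp
qed

lemma bern_0: "bern 0 = 1"
proof -
 have "fps_nth (fps_X / (fps_exp 1 - 1) * (fps_exp 1 - 1)) 1 = (1 :: rat)" unfolding bern_fps by simp
 then show ?thesis by (simp add: fps_mult_nth)
qed

text \<open>Controls denominators: the n-th coefficient exists as soon as 2, ..., n + 1 are
  invertible.\<close>

lemma bern_rec: assumes "n > 0" shows "bern n = - (\<Sum>k<n. bern k * (1 / of_nat (fact (Suc n - k))))"
proof -
 have "fps_nth (fps_X / (fps_exp 1 - 1) * (fps_exp 1 - 1)) (Suc n) = (0 :: rat)" unfolding bern_fps using assms by simp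
 then have "(\<Sum>k\<le>Suc n. bern k * fps_nth (fps_exp 1 - 1) (Suc n - k)) = 0" by (simp add: fps_mult_nth atLeast0AtMost)
 then have "(\<Sum>k\<le>n. bern k * fps_nth (fps_exp 1 - 1) (Suc n - k)) = 0" by simp
 then have "(\<Sum>k<n. bern k * fps_nth (fps_exp 1 - 1) (Suc n - k)) + bern n = 0"
  by (simp add: lessThan_Suc_atMost[symmetric])
 moreover have "(\<Sum>k<n. bern k * fps_nth (fps_exp 1 - 1) (Suc n - k)) = (\<Sum>k<n. bern k * (1 / of_nat (fact (Suc n - k))))"
  by (intro sum.cong refl) auto
 ultimately have "(\<Sum>k<n. bern k * (1 / of_nat (fact (Suc n - k)))) + bern n = 0" by (simp only:)
 from minus_unique[OF this] show ?thesis by (rule sym)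
qed

section \<open>Rational numbers in the base ring\<close>

context superring begin

abbreviation ii :: "int => 'k" where "ii z \<equiv> [z] \<cdot> \<one>"

lemma ii_closed [simp]: "ii z \<in>. K" by simp

lemma ii_add: "ii (y + z) = ii y \<oplus> ii z"
 using add.int_pow_mult[of "\<one>" y z] by (simp add: add_pow_def)

lemma ii_mult: "ii (y * z) = ii y \<otimes> ii z"
proof -
 have "ii y \<otimes> ii z = [y] \<cdot> (\<one> \<otimes> ii z)" by (rule add_pow_ldistr_int) simp_all
 also have "... = [y] \<cdot> ii z" by simp
 also have "... = ii (z * y)" using add.int_pow_pow[of "\<one>" y z] by (simp add: add_pow_def mult.commute)
 finally show ?thesis by (simp add: mult.commute)
qed

lemma ii_comm: "ii y \<otimes> ii z = ii z \<otimes> ii y"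
 by (simp add: ii_mult[symmetric] mult.commute)

lemma ii_1: "ii 1 = \<one>" using add.int_pow_1[of "\<one>"] by (simp add: add_pow_def)
lemma ii_0: "ii 0 = \<zero>" by (simp add: add_pow_def)

lemma ii_nat: "ii (int n) = [n] \<cdot> \<one>"
 by (simp add: add_pow_def int_pow_int)

lemma ii_even: "ii z \<in> hpart K 0"
proof -
 have n: "[n] \<cdot> \<one> \<in> hpart K 0" for n :: nat
  by (induction n) (simp_all add: one_even KG.hp_add)
 show ?thesis
 proof (cases z)
  case (nonneg n) then show ?thesis using n by (simp add: ii_nat)
 next
  case (neg n)
  have "ii (- int (Suc n)) \<oplus> ii (int (Suc n)) = \<zero>" by (simp only: ii_add[symmetric]) (simp add: ii_0)
  then have "ii (- int (Suc n)) = \<ominus> ii (int (Suc n))" by (intro minus_equality[symmetric]) auto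
  then show ?thesis using KG.hp_neg[OF n[of "Suc n"]] neg by (simp only: ii_nat)
 qed
qed

text \<open>Some representation of x, not necessarily in lowest terms, has a denominator that
  becomes a unit. In this form closure under sums and products is immediate.\<close>

definition good :: "rat => bool" where
 "good x \<longleftrightarrow> (\<exists>a b. b > 0 \<and> ii b \<in> Units K \<and> x = of_int a / of_int b)"

text \<open>\<open>rat_in\<close> uses the reduced fraction. Its denominator divides b, and a
  divisor of a unit is a unit here because the images of integers commute.\<close>

lemma rat_in_char: assumes "b > 0" "ii b \<in> Units K" "x = of_int a / of_int b"
 shows "rat_in K x \<in>. K" "rat_in K x \<otimes> ii b = ii a"
proof -
 obtain p s where ps: "quotient_of x = (p, s)" by (cases "quotient_of x")
 have s: "s > 0" "coprime p s" "x = of_int p / of_int s"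
  using quotient_of_denom_pos[OF ps] quotient_of_coprime[OF ps] quotient_of_div[OF ps] by auto
 have e: "p * b = a * s"
 proof -
  have "of_int p / of_int s = (of_int a / of_int b :: rat)" using s(3) assms(3) by simp
  then have "of_int p * of_int b = (of_int a * of_int s :: rat)" using s(1) assms(1) by (simp add: field_simps)
  then show ?thesis by (simp flip: of_int_mult)
 qed
 then have "s dvd p * b" by simp
 then have "s dvd b" using s(2) by (simp add: coprime_dvd_mult_right_iff coprime_commute)
 then obtain t where t: "b = s * t" by auto
 have at: "a = p * t" using e s(1) by (auto simp: t)
 have bst: "ii b = ii s \<otimes> ii t" by (simp add: t ii_mult)
 note ib = Units_inv_closed[OF assms(2)] Units_r_inv[OF assms(2)] Units_l_inv[OF assms(2)]
 have "ii s \<otimes> (ii t \<otimes> inv ii b) = \<one>" using ib bst by (simp add: m_assoc[symmetric])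
 moreover have "(inv ii b \<otimes> ii t) \<otimes> ii s = \<one>" using ib bst by (simp add: m_assoc ii_comm[of t s])
 ultimately have "ii s \<in> Units K" using ib(1) inv_unique[of "inv ii b \<otimes> ii t" "ii s" "ii t \<otimes> inv ii b"]
  unfolding Units_def by (auto intro!: bexI[of _ "ii t \<otimes> inv ii b"])
 note iS = Units_inv_closed[OF this] Units_l_inv[OF this]
 show "rat_in K x \<in>. K" unfolding rat_in_def ps using iS by simp
 have "rat_in K x \<otimes> ii b = ii p \<otimes> ((inv ii s \<otimes> ii s) \<otimes> ii t)"
  unfolding rat_in_def ps bst using iS(1) by (simp add: m_assoc)
 also have "... = ii a" using iS by (simp add: at ii_mult)
 finally show "rat_in K x \<otimes> ii b = ii a" .
qed

lemma good_closed: "good x ==> rat_in K x \<in>. K"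
 unfolding good_def using rat_in_char by blast

lemma unit_cancel: "[|x \<otimes> c = y \<otimes> c; c \<in> Units K; x \<in>. K; y \<in>. K|] ==> x = y"
 by (metis Units_closed Units_inv_closed Units_r_inv m_assoc r_one)

text \<open>From x b = a with a and b images of integers, hence even, the even component of x solves
  the same equation; b is a unit, so this component is x.\<close>

lemma good_even: assumes "good x" shows "rat_in K x \<in> hpart K 0"
proof -
 obtain a b where ab: "b > 0" "ii b \<in> Units K" "x = of_int a / of_int b" using assms unfolding good_def by blast
 note c = rat_in_char[OF ab]
 obtain y z where yz: "y \<in> hpart K 0" "z \<in> hpart K 1" "rat_in K x = y \<oplus> z" using KG.decomp[OF c(1), of 0] by auto
 note yzc = KG.hpc[OF yz(1)] KG.hpc[OF yz(2)]
 have p: "y \<otimes> ii b \<in> hpart K 0" "z \<otimes> ii b \<in> hpart K 1"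
  using mult_parity[OF yz(1) ii_even[of b]] mult_parity[OF yz(2) ii_even[of b]] by auto
 have "ii a = y \<otimes> ii b \<oplus> z \<otimes> ii b" using c(2) yzc by (simp add: yz(3) l_distr)
 then have "y \<otimes> ii b = ii a" using KG.hc_eq[of "y \<otimes> ii b" 0 "z \<otimes> ii b"] p KG.hc_homog[OF ii_even[of a], of 0] by simp
 then have "y = rat_in K x" using unit_cancel[OF _ ab(2) yzc(1) c(1)] c(2) by simp
 then show ?thesis using yz(1) by simp
qed

lemma good_frac: "[|b > 0; ii b \<in> Units K|] ==> good (of_int a / of_int b)"
 unfolding good_def by blast

lemma good_int: "good (of_int a)"
 using good_frac[of 1 a] by (simp add: ii_1 Units_one_closed)

lemma rat_in_int: "rat_in K (of_int a) = ii a"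
 using rat_in_char[of 1 "of_int a" a] by (simp add: ii_1 Units_one_closed)

lemma good_add: assumes "good x" "good y" shows "good (x + y)" "rat_in K (x + y) = rat_in K x \<oplus> rat_in K y"
proof -
 obtain a b where ab: "b > 0" "ii b \<in> Units K" "x = of_int a / of_int b" using assms(1) unfolding good_def by blast
 obtain c d where cd: "d > 0" "ii d \<in> Units K" "y = of_int c / of_int d" using assms(2) unfolding good_def by blast
 have bd: "b * d > 0" "ii (b * d) \<in> Units K" using ab(1,2) cd(1,2) by (simp_all only: ii_mult Units_m_closed mult_pos_pos)
 have "x + y = of_int (a * d + c * b) / of_int (b * d)"
  unfolding ab(3) cd(3) using ab(1) cd(1) by (simp add: add_frac_eq)
 note bd = bd this
 show "good (x + y)" unfolding good_def using bd by blast
 note r1 = rat_in_char[OF ab] and r2 = rat_in_char[OF cd] and r3 = rat_in_char[OF bd]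
 have "(rat_in K x \<oplus> rat_in K y) \<otimes> ii (b * d) = (rat_in K x \<otimes> ii b) \<otimes> ii d \<oplus> (rat_in K y \<otimes> ii d) \<otimes> ii b"
  using r1(1) r2(1) by (simp add: ii_mult l_distr m_assoc ii_comm[of d b])
 also have "... = ii (a * d + c * b)" by (simp add: r1(2) r2(2) ii_mult ii_add)
 finally have e: "(rat_in K x \<oplus> rat_in K y) \<otimes> ii (b * d) = \<dots>" .
 show "rat_in K (x + y) = rat_in K x \<oplus> rat_in K y"
  by (rule unit_cancel[OF _ bd(2) r3(1)]) (simp_all only: r3(2) e r1(1) r2(1) a_closed m_closed)
qed

lemma good_mult: assumes "good x" "good y" shows "good (x * y)" "rat_in K (x * y) = rat_in K x \<otimes> rat_in K y"
proof -
 obtain a b where ab: "b > 0" "ii b \<in> Units K" "x = of_int a / of_int b" using assms(1) unfolding good_def by blast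
 obtain c d where cd: "d > 0" "ii d \<in> Units K" "y = of_int c / of_int d" using assms(2) unfolding good_def by blast
 have bd: "b * d > 0" "ii (b * d) \<in> Units K" "x * y = of_int (a * c) / of_int (b * d)"
  using ab(1,2) cd(1,2) by (simp_all only: ii_mult Units_m_closed mult_pos_pos ab(3) cd(3) of_int_mult times_divide_times_eq)
 show "good (x * y)" unfolding good_def using bd by blast
 note r1 = rat_in_char[OF ab] and r2 = rat_in_char[OF cd] and r3 = rat_in_char[OF bd]
 have ev: "rat_in K y \<otimes> ii b = ii b \<otimes> rat_in K y"
  using supercomm[OF good_even[OF assms(2)] ii_even[of b]] by simp
 have "(rat_in K x \<otimes> rat_in K y) \<otimes> ii (b * d) = rat_in K x \<otimes> (rat_in K y \<otimes> ii b) \<otimes> ii d"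
  using r1(1) r2(1) by (simp add: ii_mult m_assoc)
 also have "... = (rat_in K x \<otimes> ii b) \<otimes> (rat_in K y \<otimes> ii d)" using r1(1) r2(1) unfolding ev by (simp add: m_assoc)
 also have "... = ii (a * c)" by (simp add: r1(2) r2(2) ii_mult)
 finally have e: "(rat_in K x \<otimes> rat_in K y) \<otimes> ii (b * d) = \<dots>" .
 show "rat_in K (x * y) = rat_in K x \<otimes> rat_in K y"
  by (rule unit_cancel[OF _ bd(2) r3(1)]) (simp_all only: r3(2) e r1(1) r2(1) a_closed m_closed)
qed

lemma good_neg: "good x ==> good (- x)"
 using good_mult(1)[OF good_int[of "- 1"]] by simp

lemma good_sum: "[|finite I; !!i. i \<in> I ==> good (f i)|] ==> good (sum f I)"
 by (induction I rule: finite_induct) (use good_int[of 0] in \<open>auto intro: good_add\<close>)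

lemma fact_unit: assumes "!!m. [|2 \<le> m; m \<le> n|] ==> [(m::nat)] \<cdot> \<one> \<in> Units K"
 shows "ii (int (fact n)) \<in> Units K"
 using assms
proof (induction n)
 case 0 then show ?case by (simp add: ii_1 Units_one_closed)
next
 case (Suc n)
 have "ii (int (Suc n)) \<in> Units K"
 proof (cases "n = 0")
  case True then show ?thesis by (simp add: ii_1 Units_one_closed)
 next
  case False then show ?thesis unfolding ii_nat by (intro Suc(2)) simp_all
 qed
 then show ?case using Suc by (simp only: fact_Suc of_nat_mult of_nat_fact of_nat_id ii_mult Units_m_closed)
qed

lemma bern_good: assumes "!!m. [|2 \<le> m; m \<le> Suc n|] ==> [(m::nat)] \<cdot> \<one> \<in> Units K"
 shows "good (bern n)"
 using assms
proof (induction n rule: less_induct)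
 case (less n)
 show ?case
 proof (cases "n = 0")
  case True then show ?thesis using good_int[of 1] bern_0 by simp
 next
  case False
  have "good (bern k * (1 / of_nat (fact (Suc n - k))))" if "k < n" for k
  proof -
   have "ii (int (fact (Suc n - k))) \<in> Units K" by (rule fact_unit) (use less.prems that in auto)
   then have "good (of_int 1 / of_int (int (fact (Suc n - k))))" by (intro good_frac) auto
   moreover have "good (bern k)" by (rule less.IH) (use less.prems that in auto)
   ultimately show ?thesis using good_mult(1)[of "bern k" "of_int 1 / of_int (int (fact (Suc n - k)))"] by (simp only: of_int_of_nat_eq of_int_1)
  qed
  then show ?thesis using False by (simp only: bern_rec[OF False[unfolded neq0_conv]]) (auto intro!: good_neg good_sum simp del: of_nat_fact)
 qed
qed

end

section \<open>Homogeneous components of the operators\<close>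

context hl begin

text \<open>Single words of length n with a scalar at the end. They take the place of the degree n
  part of S(g) without setting up a length grading.\<close>

fun Wd :: "nat => ('g, 'k) tens set set" where
 "Wd 0 = SC.\<eta> ` carrier K"
| "Wd (Suc n) = {LX X y | X y p. X \<in> hpart g p \<and> y \<in> Wd n}"

lemma Wd_closed: "y \<in> Wd n ==> y \<in>. S"
 by (induction n arbitrary: y) (auto simp: MG.hpc)

lemma Wd_gen: "[|X \<in> hpart g p; y \<in> Wd n|] ==> LX X y \<in> Wd (Suc n)"
 by auto

lemma Wd_induct [consumes 1, case_names \<eta> gen]:
 assumes "y \<in> Wd n" "!!al. al \<in>. K ==> Q 0 (SC.\<eta> al)"
  "!!n X p y. [|X \<in> hpart g p; y \<in> Wd n; y \<in>. S; Q n y|] ==> Q (Suc n) (LX X y)"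
 shows "Q n y"
 using assms(1) by (induction n arbitrary: y) (auto intro!: assms(2,3) dest: Wd_closed)

lemma word_induct [consumes 1, case_names word add]:
 assumes "x \<in>. S" "!!n y. y \<in> Wd n ==> P y"
  "!!x y. [|x \<in>. S; y \<in>. S; P x; P y|] ==> P (x \<oplus>\<^sub>S y)"
 shows "P x"
proof -
 let ?F = "foldr LX" and ?H = "%l. \<forall>X \<in> set l. \<exists>p. X \<in> hpart g p"
 have c: "?H l ==> y \<in>. S ==> ?F l y \<in>. S" for l y by (induction l) (auto simp: MG.hpc)
 \<comment> \<open>The claim is strengthened by an arbitrary word l in front:
   \<open>SC.A_induct\<close> removes letters from the left, but sums appear to the right of the
   letters already removed.\<close>
 have "\<forall>l. ?H l --> P (?F l x)" using assms(1)
 proof (induction rule: SC.A_induct)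
  case (\<eta> i al)
  have "?H l ==> ?F l (SC.\<eta> al) \<in> Wd (length l)" for l using KG.hpc[OF \<eta>] by (induction l) auto
  then show ?case using assms(2) by blast
 next
  case (gen i X x)
  have "P (?F (l @ [X]) x)" if "?H l" for l using gen(1) that by (intro gen(3)[rule_format]) auto
  then show ?case by simp
 next
  case (add x y)
  have "?H l ==> ?F l (x \<oplus>\<^sub>S y) = ?F l x \<oplus>\<^sub>S ?F l y" for l
   by (induction l) (auto simp: MG.hpc c add(1,2) SC.A.r_distr)
  then show ?case using assms(3)[OF c[OF _ add(1)] c[OF _ add(2)]] add(3,4) by simp
 qed
 from this[rule_format, of "[]"] show ?thesis by simp
qed

lemma word_eqI: assumes "amap S P f" "amap S P h" "x \<in>. S" "!!n y. y \<in> Wd n ==> f y = h y" shows "f x = h x"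
 using assms(3) by (induction rule: word_induct) (simp_all add: assms(4) ama[OF assms(1)] ama[OF assms(2)])

text \<open>The degree is an integer so that removing a letter can lower it below zero; a map of
  negative degree vanishes on all words.\<close>

definition dg where "dg i f \<longleftrightarrow> (\<forall>k. \<forall>y \<in> Wd k. int k \<noteq> i --> f y = \<zero>)"

lemma dg_LX: "[|dg i f; X \<in> hpart g p|] ==> dg (i - 1) (%y. f (LX X y))"
 unfolding dg_def
proof (intro allI ballI impI)
 fix k y assume "\<forall>k. \<forall>y\<in>Wd k. int k \<noteq> i --> f y = \<zero>" "X \<in> hpart g p" "y \<in> Wd k" "int k \<noteq> i - 1"
 then show "f (LX X y) = \<zero>" using Wd_gen[of X p y k] by fastforce
qed

lemma dg_const: assumes "a \<in>. g" shows "dg 0 (SW.const a)"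
proof -
 have "int n \<noteq> 0 --> SW.const a y = \<zero>" if "y \<in> Wd n" for n y
  using that assms by (induction rule: Wd_induct) (auto simp: const_LX MG.hpc)
 then show ?thesis unfolding dg_def by blast
qed

lemma dg_xx: "dg 1 SW.xx"
proof -
 have "int n \<noteq> 1 --> SW.xx y = \<zero>" if "y \<in> Wd n" for n y
  using that
 proof (induction rule: Wd_induct)
  case (\<eta> al) then show ?case by (simp add: SW.xx_simps)
 next
  case (gen n X p y)
  then show ?case using dg_const[OF MG.hpc[OF gen(1)]] by (auto simp: SW.xx_simps MG.hpc dg_def)
 qed
 then show ?thesis unfolding dg_def by blast
qed

lemma one_Wd: "\<one>\<^sub>S \<in> Wd 0" by (auto simp: ring_hom_one[OF SC.\<eta>_hom, symmetric])

lemma dg_one: "[|dg i f; i \<noteq> 0|] ==> f \<one>\<^sub>S = \<zero>"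
 using one_Wd unfolding dg_def by fastforce

lemma br_0: "X \<in>. g ==> bracket g X \<zero> = \<zero>" "X \<in>. g ==> bracket g \<zero> X = \<zero>"
 using amap_zero[OF br_amap1 M.ag M.ag] amap_zero[OF br_amap2 M.ag M.ag] by auto

text \<open>The comultiplication preserves total length: by \<open>conv_gen\<close> each letter goes
  to one of the two maps and lowers its degree by one.\<close>

lemma dg_br: assumes "L df f" "L d h" "dg i f" "dg j h" shows "dg (i + j) (br f h d)"
proof -
 have "int n \<noteq> i + j ==> br f h d y = \<zero>" if "y \<in> Wd n" for n y
  using that assms
 proof (induction arbitrary: f h df d i j rule: Wd_induct)
  case (\<eta> al)
  then show ?case using dg_one[OF \<eta>(5)] dg_one[OF \<eta>(6)] linc[OF \<eta>(3) SC.A.one_closed] linc[OF \<eta>(4) SC.A.one_closed]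
   by (cases "i = 0") (auto simp: br_\<eta>[OF \<eta>(3,4)] br_0)
 next
  case (gen n X p y)
  note f = gen(6) and h = gen(7)
  have 1: "br (%x. f (LX X x)) h d y = \<zero>"
   by (rule gen(4)[OF _ SC.LX_comp[OF f gen(1)] h dg_LX[OF gen(8,1)] gen(9)]) (use gen(5) in auto)
  have 2: "br f (%x. h (LX X x)) (d + p) y = \<zero>"
   by (rule gen(4)[OF _ f SC.LX_comp[OF h gen(1)] gen(8) dg_LX[OF gen(9,1)]]) (use gen(5) in auto)
  show ?case by (simp add: br_gen[OF f h gen(1,3)] 1 2)
 qed
 then show ?thesis unfolding dg_def by blast
qed

lemma dg_psi: "a \<in> hpart g p ==> dg (int n) (psi a p n)"
proof (induction n)
 case 0 then show ?case using dg_const MG.hpc by simp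
next
 case (Suc n) then show ?case using dg_br[OF SW.xx_lin psi_lin dg_xx Suc(1)] by (simp add: add.commute)
qed

lemma psi_van: "[|a \<in> hpart g p; y \<in> Wd k; k \<noteq> n|] ==> psi a p n y = \<zero>"
 using dg_psi[of a p n] unfolding dg_def by auto

text \<open>A map \<chi> of degree i consumes i letters and returns one, so words of length k go to
  combinations of words of length k + 1 - i. This is expressed by additive test maps f that vanish
  on words of that length.\<close>

lemma PH_van: assumes "y \<in> Wd k" "L c \<chi>" "dg i \<chi>" "amap S g f" "!!w z. [|int w = int k + 1 - i; z \<in> Wd w|] ==> f z = \<zero>"
 shows "f (SC.PH \<chi> c y) = \<zero>"
 using assms
proof (induction arbitrary: \<chi> c i f rule: Wd_induct)
 case (\<eta> al)
 note z = amap_zero[OF \<eta>(4) SC.A.ag M.ag]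
 have o: "\<chi> \<one>\<^sub>S \<in> hpart g c" using lin_hp[OF \<eta>(2) SC.AT.one_hp] by simp
 show ?case
 proof (cases "i = 0")
  case True
  have "LX (\<chi> \<one>\<^sub>S) (SC.\<eta> al) \<in> Wd 1" using Wd_gen[OF o, of "SC.\<eta> al" 0] \<eta>(1) by simp
  then show ?thesis using \<eta>(5)[of 1] True by (simp add: SC.PH_\<eta>[OF \<eta>(2,1)])
 next
  case False
  then show ?thesis using \<eta>(1) dg_one[OF \<eta>(3)] z amap_zero[OF SC.gen_amap M.ag SC.A.ag] by (simp add: SC.PH_\<eta>[OF \<eta>(2,1)])
 qed
next
 case (gen n X p y)
 note k = gen(5) and kX = SC.LX_comp[OF gen(5,1)] and X = MG.hpc[OF gen(1)]
 note c = linc[OF SC.PH_lin[OF k] gen(3)] linc[OF SC.PH_lin[OF kX] gen(3)]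
 have 1: "f (LX X (SC.PH \<chi> c y)) = \<zero>"
 proof (rule gen(4)[OF k gen(6) amc[OF lin_amap[OF SC.LX_lin[OF gen(1)]] gen(7)]])
  fix w z assume "int w = int n + 1 - i" "z \<in> Wd w"
  then show "f (LX X z) = \<zero>" using gen(8)[of "Suc w" "LX X z"] Wd_gen[OF gen(1)] by (simp del: Wd.simps)
 qed
 have 2: "f (SC.PH (%y. \<chi> (LX X y)) (c + p) y) = \<zero>"
  by (rule gen(4)[OF kX dg_LX[OF gen(6,1)] gen(7)]) (rule gen(8), auto)
 show ?case using c X by (simp add: SC.PH_gen[OF k gen(1,3)] ama[OF gen(7)] amap_sg[OF gen(7) SC.A.ag M.ag] 1 2)
qed

text \<open>Only words of length at most k occur in the comultiplication of a word of length
  k.\<close>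

lemma PH_local: assumes "y \<in> Wd k" "L c \<chi>" "L c \<chi>'" "!!j z. [|j \<le> k; z \<in> Wd j|] ==> \<chi> z = \<chi>' z"
 shows "SC.PH \<chi> c y = SC.PH \<chi>' c y"
 using assms
proof (induction arbitrary: \<chi> \<chi>' c rule: Wd_induct)
 case (\<eta> al)
 then show ?case using \<eta>(4)[OF le_refl one_Wd] by (simp add: SC.PH_\<eta>)
next
 case (gen n X p y)
 have 1: "SC.PH \<chi> c y = SC.PH \<chi>' c y" by (rule gen(4)[OF gen(5,6)]) (rule gen(7), auto)
 have 2: "SC.PH (%y. \<chi> (LX X y)) (c + p) y = SC.PH (%y. \<chi>' (LX X y)) (c + p) y"
  by (rule gen(4)[OF SC.LX_comp[OF gen(5,1)] SC.LX_comp[OF gen(6,1)]]) (rule gen(7)[OF _ Wd_gen[OF gen(1)]], rule Suc_le_mono[THEN iffD2], assumption, assumption)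
 show ?case by (simp add: SC.PH_gen[OF gen(5) gen(1,3)] SC.PH_gen[OF gen(6) gen(1,3)] 1 2)
qed

section \<open>Series in the maps \<open>psi\<close>\<close>

primrec psm where
 "psm a p cs 0 = (%y. \<zero>)"
| "psm a p cs (Suc n) = (%y. psm a p cs n y \<oplus> psi a p n y \<bullet> cs n)"

text \<open>The infinite sum of the \<open>psi n\<close> with coefficients \<open>cs n\<close>. It
  is finite at each argument, and the least index beyond which all terms vanish marks where to
  stop.\<close>

definition phs where "phs a p cs y = psm a p cs (LEAST M. \<forall>n\<ge>M. psi a p n y = \<zero>) y"

definition ev where "ev cs \<longleftrightarrow> (\<forall>n. cs n \<in> hpart K 0)"

lemma evD: "ev cs ==> cs n \<in> hpart K 0" "ev cs ==> cs n \<in>. K"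
 unfolding ev_def using KG.hpc by blast+

lemma psm_lin: "[|a \<in> hpart g p; ev cs|] ==> L p (psm a p cs n)"
 by (induction n) (auto intro!: lin_zero lin_plus lin_even_scale smx psi_lin simp: evD)

lemma psm_stable: assumes "a \<in> hpart g p" "ev cs" "y \<in>. S" "!!n. n \<ge> M ==> psi a p n y = \<zero>" "M \<le> M'"
 shows "psm a p cs M' y = psm a p cs M y"
 using assms(5) by (induction rule: dec_induct) (simp_all add: assms(4) evD[OF assms(2)] linc[OF psm_lin[OF assms(1,2)] assms(3)])

lemma phs_eq: assumes "a \<in> hpart g p" "ev cs" "y \<in>. S" "!!n. n \<ge> M ==> psi a p n y = \<zero>"
 shows "phs a p cs y = psm a p cs M y"
proof -
 let ?P = "%M. \<forall>n\<ge>M. psi a p n y = \<zero>"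
 have M: "?P M" using assms(4) by blast
 show ?thesis unfolding phs_def using LeastI[of ?P, OF M] Least_le[of ?P, OF M]
  by (intro psm_stable[symmetric] assms(1-3)) blast+
qed

lemma psi_bound: assumes "a \<in> hpart g p" "y \<in>. S" shows "\<exists>M. \<forall>n\<ge>M. psi a p n y = \<zero>"
 using assms(2)
proof (induction rule: word_induct)
 case (word n y) then show ?case by (intro exI[of _ "Suc n"]) (auto intro!: psi_van[OF assms(1)] simp del: Wd.simps)
next
 case (add x y)
 then obtain M M' where "\<forall>n\<ge>M. psi a p n x = \<zero>" "\<forall>n\<ge>M'. psi a p n y = \<zero>" by blast
 then show ?case by (intro exI[of _ "max M M'"]) (auto simp: lin_add[OF psi_lin[OF assms(1)] add(1,2)])
qed

text \<open>The stopping index depends on the argument. Additivity is checked at a bound valid for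
  both summands, which is then valid for their sum.\<close>

lemma phs_lin: assumes a: "a \<in> hpart g p" and cs: "ev cs" shows "L p (phs a p cs)"
proof -
 note pl = psm_lin[OF a cs]
 have ex: "\<exists>M. (\<forall>n\<ge>M. psi a p n y = \<zero>) \<and> (\<forall>n\<ge>M. psi a p n y' = \<zero>)" if yy: "y \<in>. S" "y' \<in>. S" for y y'
 proof -
  obtain M M' where "\<forall>n\<ge>M. psi a p n y = \<zero>" "\<forall>n\<ge>M'. psi a p n y' = \<zero>" using psi_bound[OF a yy(1)] psi_bound[OF a yy(2)] by blast
  then show ?thesis by (intro exI[of _ "max M M'"]) auto
 qed
 have e: "\<exists>M. phs a p cs y = psm a p cs M y" for y unfolding phs_def by blast
 show ?thesis unfolding lin_def
 proof (intro conjI amapI ballI allI)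
  fix x assume "x \<in>. S" then show "phs a p cs x \<in>. g" using e[of x] linc[OF pl] by fastforce
 next
  fix x j assume "x \<in> hpart S j" then show "phs a p cs x \<in> hpart g (p + j)" using e[of x] lin_hp[OF pl] by fastforce
 next
  fix x y assume xy: "x \<in>. S" "y \<in>. S"
  obtain M where M: "\<forall>n\<ge>M. psi a p n x = \<zero>" "\<forall>n\<ge>M. psi a p n y = \<zero>" using ex[OF xy] by blast
  have "\<forall>n\<ge>M. psi a p n (x \<oplus>\<^sub>S y) = \<zero>" using M xy by (simp add: lin_add[OF psi_lin[OF a]])
  then show "phs a p cs (x \<oplus>\<^sub>S y) = phs a p cs x \<oplus> phs a p cs y"
   using phs_eq[OF a cs, of _ M] M xy lin_add[OF pl xy] by simp
 next
  fix x al assume xa: "x \<in>. S" "al \<in>. K"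
  obtain M where M: "\<forall>n\<ge>M. psi a p n x = \<zero>" using ex[OF xa(1) xa(1)] by blast
  have "\<forall>n\<ge>M. psi a p n (x \<bullet>\<^sub>S al) = \<zero>" using M xa by (simp add: lin_scale[OF psi_lin[OF a]])
  then show "phs a p cs (x \<bullet>\<^sub>S al) = phs a p cs x \<bullet> al"
   using phs_eq[OF a cs, of _ M] M xa lin_scale[OF pl xa] SC.AT.scale_closed[OF xa] by simp
 qed
qed

lemma phs_Wd: assumes a: "a \<in> hpart g p" and cs: "ev cs" and y: "y \<in> Wd k"
 shows "phs a p cs y = psi a p k y \<bullet> cs k" "j > k ==> psm a p cs j y = psi a p k y \<bullet> cs k"
proof -
 note yc = Wd_closed[OF y] and v = psi_van[OF a y]
 note c = linc[OF psi_lin[OF a] yc]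
 have lo: "psm a p cs m y = \<zero>" if "m \<le> k" for m
  using that by (induction m) (simp_all add: v evD[OF cs])
 have e: "psm a p cs (Suc k) y = psi a p k y \<bullet> cs k" using c by (simp add: lo scale_closed evD[OF cs])
 have s: "psi a p n y = \<zero>" if "n \<ge> Suc k" for n using that by (intro v) auto
 show "phs a p cs y = psi a p k y \<bullet> cs k" by (rule trans[OF phs_eq[OF a cs yc s] e])
 show "psm a p cs j y = psi a p k y \<bullet> cs k" if "j > k"
  by (rule trans[OF psm_stable[OF a cs yc s Suc_leI[OF that]] e])
qed

text \<open>On words of length \<open>n\<close> only the terms of total degree \<open>n + 1\<close> survive.\<close>

lemma phs_PH: assumes a: "a \<in> hpart g pa" and b: "b \<in> hpart g pb" and cs: "ev cs" and y: "y \<in> Wd n"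
 shows "phs a pa cs (SC.PH (phs b pb cs) pb y) = (\<Oplus>j\<in>{..Suc n}. psi a pa (Suc n - j) (SC.PH (psi b pb j) pb y) \<bullet> (cs j \<otimes>\<^sub>K cs (Suc n - j)))"
proof -
 note yc = Wd_closed[OF y] and la = phs_lin[OF a cs] and c = evD[OF cs]
 \<comment> \<open>The sum up to j = n + 1 includes every pair of indices of sum n + 1, as in
   \<open>bern_poly\<close>; on words of length at most n it agrees with the full series.\<close>
 have 1: "SC.PH (phs b pb cs) pb y = SC.PH (psm b pb cs (Suc (Suc n))) pb y"
  by (rule PH_local[OF y phs_lin[OF b cs] psm_lin[OF b cs]]) (simp only: phs_Wd[OF b cs] less_Suc_eq_le le_SucI)
 have t: "phs a pa cs (SC.PH (psi b pb j) pb y) \<bullet> cs j = psi a pa (Suc n - j) (SC.PH (psi b pb j) pb y) \<bullet> (cs j \<otimes>\<^sub>K cs (Suc n - j))"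
  if j: "j < Suc (Suc n)" for j
 proof -
  let ?m = "Suc n - j"
  note z = linc[OF SC.PH_lin[OF psi_lin[OF b]] yc]
  have lm: "L pa (%x. psi a pa ?m x \<bullet> cs ?m)" by (rule lin_even_scale[OF smx psi_lin[OF a] c(1)])
  \<comment> \<open>The difference is written with \<open>sg g 1\<close>, the form for which the
    linearity rules are available.\<close>
  have "phs a pa cs (SC.PH (psi b pb j) pb y) \<oplus> sg g 1 (psi a pa ?m (SC.PH (psi b pb j) pb y) \<bullet> cs ?m) = \<zero>"
  proof (rule PH_van[OF y psi_lin[OF b] dg_psi[OF b]])
   show "amap S g (%x. phs a pa cs x \<oplus> sg g 1 (psi a pa ?m x \<bullet> cs ?m))"
    by (rule lin_amap[OF lin_plus[OF smx la lin_sg[OF smx lm]]])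
   fix w z assume w: "int w = int n + 1 - int j" and z: "z \<in> Wd w"
   have "w = ?m" using w j by linarith
   then show "phs a pa cs z \<oplus> sg g 1 (psi a pa ?m z \<bullet> cs ?m) = \<zero>"
    using z linc[OF lm Wd_closed[OF z]] by (simp add: phs_Wd[OF a cs z] M.r_neg)
  qed
  then have 1: "phs a pa cs (SC.PH (psi b pb j) pb y) = psi a pa ?m (SC.PH (psi b pb j) pb y) \<bullet> cs ?m"
   by (intro M.minus_zero_eq[OF _ linc[OF la z] linc[OF lm z]]) (simp only: sg_1 a_minus_def)
  have 2: "cs ?m \<otimes>\<^sub>K cs j = cs j \<otimes>\<^sub>K cs ?m" using supercomm[OF c(1) c(1)] by simp
  show ?thesis unfolding 1 2[symmetric] by (rule scale_mult[OF linc[OF psi_lin[OF a] z] c(2) c(2), symmetric])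
 qed
 have s: "phs a pa cs (SC.PH (psm b pb cs m) pb y) = (\<Oplus>j\<in>{..<m}. phs a pa cs (SC.PH (psi b pb j) pb y) \<bullet> cs j)" for m
 proof (induction m)
  case 0
  have "SC.PH (%y. \<zero>) pb y = SC.PH (%y. \<zero> \<bullet> \<zero>\<^sub>K) pb y" by simp
  also have "... = \<zero>\<^sub>S" using PH_scale[OF lin_zero[OF smx, of S pb] KG.hp_zero yc] linc[OF SC.PH_lin[OF lin_zero[OF smx]] yc] by simp
  finally show ?case using amap_zero[OF lin_amap[OF la] SC.A.ag M.ag] by simp
 next
  case (Suc m)
  note ls = lin_even_scale[OF smx psi_lin[OF b] c(1), of m m]
  note z = linc[OF SC.PH_lin[OF psi_lin[OF b]] yc] linc[OF SC.PH_lin[OF psm_lin[OF b cs]] yc]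
  have "SC.PH (psm b pb cs (Suc m)) pb y = SC.PH (psm b pb cs m) pb y \<oplus>\<^sub>S SC.PH (psi b pb m) pb y \<bullet>\<^sub>S cs m"
   using PH_plus[OF psm_lin[OF b cs] ls yc] PH_scale[OF psi_lin[OF b] c(1) yc] by simp
  then have "phs a pa cs (SC.PH (psm b pb cs (Suc m)) pb y) = phs a pa cs (SC.PH (psm b pb cs m) pb y) \<oplus> phs a pa cs (SC.PH (psi b pb m) pb y) \<bullet> cs m"
   using z c(2) by (simp add: lin_add[OF la] lin_scale[OF la] SC.AT.scale_closed)
  then show ?case unfolding Suc
   using linc[OF la z(1)] c(2) by (simp add: lessThan_Suc M.finsum_insert Pi_def scale_closed M.a_comm)
 qed
 show ?thesis unfolding 1 s[of "Suc (Suc n)"]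
  by (rule M.finsum_cong')
    (auto simp only: t lessThan_Suc_atMost lessThan_iff atMost_iff less_Suc_eq_le Pi_def intro!: scale_closed linc[OF psi_lin[OF a]] linc[OF SC.PH_lin[OF psi_lin[OF b]]] yc c m_closed)
qed

end

lemma amap_finsum:
 assumes "amap M N h" "abelian_group M" "abelian_group N" "finite I" "!!i. i \<in> I ==> f i \<in>. M"
 shows "h (\<Oplus>\<^sub>M i\<in>I. f i) = (\<Oplus>\<^sub>N i\<in>I. h (f i))"
proof -
 interpret M: abelian_group M by fact
 interpret N: abelian_group N by fact
 show ?thesis using assms(4,5)
 proof (induction rule: finite_induct)
  case empty then show ?case using amap_zero[OF assms(1-3)] by simp
 next
  case (insert i I)
  then have "(\<Oplus>\<^sub>M i\<in>I. f i) \<in>. M" by (intro M.finsum_closed) auto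
  then show ?case using insert by (simp add: M.finsum_insert N.finsum_insert amapc[OF assms(1)] ama[OF assms(1)] Pi_def)
 qed
qed

lemma lin_cong: assumes "supermodule K M" "lin K M N d f" "!!x. x \<in>. M ==> h x = f x" shows "lin K M N d h"
proof -
 interpret M: supermodule K M by fact
 show ?thesis using linD[OF assms(2)] assms(3) unfolding lin_def
  by (auto intro!: amapI simp: M.scale_closed M.MG.hpc)
qed

lemma lin_finsum: assumes "supermodule K M" "supermodule K N" "finite I" "!!i. i \<in> I ==> lin K M N d (f i)"
 shows "lin K M N d (%y. \<Oplus>\<^sub>N i\<in>I. f i y)"
proof -
 interpret M: supermodule K M by fact
 interpret N: supermodule K N by fact
 show ?thesis using assms(3,4)
 proof (induction rule: finite_induct)
  case empty then show ?case using lin_zero[OF assms(2)] by simp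
 next
  case (insert i I)
  show ?case by (rule lin_cong[OF assms(1) lin_plus[OF assms(2) insert(4)[of i] insert(3)]])
    (use insert(1,2) in \<open>auto simp: insert.prems intro!: N.M.finsum_insert linc[OF insert.prems]\<close>)
 qed
qed

section \<open>Polynomials in u acting on brackets\<close>

lemma upoly_coeff: "coeff (upoly * w) i = coeff w i + (case i of 0 => 0 | Suc j => coeff w j)"
 unfolding upoly_def by (simp add: coeff_pCons split: nat.split)

text \<open>Thus \<open>TE (m + k - 1)\<close> sees every coefficient of \<open>Ppoly m k\<close>,
  which is the degree condition of \<open>AD_TE\<close>.\<close>

lemma Ppoly_deg: "i \<ge> m + k ==> coeff (Ppoly m k) i = 0"
proof (induction m arbitrary: i)
 case (Suc m)
 then show ?case by (auto simp: upoly_coeff split: nat.split)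
qed simp

lemma upoly_deg: "i > n ==> coeff (upoly ^ n) i = 0"
 by (induction n arbitrary: i) (auto simp: upoly_coeff split: nat.split)

lemma bern_poly': "(\<Sum>j\<le>Suc n. smult (- (bern j * bern (Suc n - j))) (Ppoly (Suc n - j) j)) = smult (bern n) (upoly ^ n)"
 unfolding bern_poly[symmetric]
 by (rule sum.reindex_bij_witness[of _ "%j. Suc n - j" "%j. Suc n - j"]) (auto simp: mult.commute)

context superring begin

definition gp where "gp w \<longleftrightarrow> (\<forall>i. good (coeff w i))"

lemma good_1: "good 1" using good_int[of 1] by simp
lemma good_0: "good 0" using good_int[of 0] by simp

lemma gp_0: "gp 0" and gp_1: "gp 1" and gp_monom: "gp (monom 1 m)"
 by (simp_all add: gp_def good_0 good_1 coeff_monom)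
lemma gp_add: "[|gp v; gp w|] ==> gp (v + w)" by (simp add: gp_def good_add)
lemma gp_smult: "[|good c; gp w|] ==> gp (smult c w)" by (simp add: gp_def good_mult)
lemma gp_upoly: "gp w ==> gp (upoly * w)"
 by (auto simp: gp_def upoly_coeff good_0 intro!: good_add split: nat.split)
lemma gp_Ppoly: "gp (Ppoly m k)"
 by (induction m) (auto intro: gp_0 gp_monom gp_add gp_upoly)
lemma gp_power: "gp (upoly ^ n)"
 by (induction n) (auto intro: gp_1 gp_upoly)
lemma gp_sum: "[|finite I; !!i. i \<in> I ==> gp (f i)|] ==> gp (sum f I)"
 by (induction I rule: finite_induct) (auto intro: gp_0 gp_add)

lemma rat_0: "rat_in K 0 = \<zero>\<^sub>K" and rat_1: "rat_in K 1 = \<one>\<^sub>K"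
 using rat_in_int[of 0] rat_in_int[of 1] by (simp_all add: ii_0 ii_1)

lemma rat_neg: "good x ==> rat_in K (- x) = \<ominus>\<^sub>K rat_in K x"
 using good_add(2)[of "- x" x] good_neg[of x] good_closed[of x] good_closed[of "- x"] minus_equality[of "rat_in K (- x)" "rat_in K x"] by (simp add: rat_0)

end

context hl begin

lemma br_finsum: assumes f: "L df f" and h: "!!i. i \<in> I ==> L d (h i)" and I: "finite I" and y: "y \<in>. S"
 shows "br f (%x. \<Oplus>i\<in>I. h i x) d y = (\<Oplus>i\<in>I. br f (h i) d y)"
 using I h
proof (induction rule: finite_induct)
 case empty then show ?case using br_zero2[OF f y] by simp
next
 case (insert i I)
 have l: "L d (%x. \<Oplus>i\<in>I. h i x)" by (rule lin_finsum[OF SC.AT.smx smx insert(1)]) (use insert(4) in auto)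
 have "br f (%x. \<Oplus>i\<in>insert i I. h i x) d y = br f (%x. h i x \<oplus> (\<Oplus>i\<in>I. h i x)) d y"
  by (rule SC.conv_cong[OF refl]) (use insert(1,2) linc[OF insert(4)] in \<open>auto intro!: M.finsum_insert\<close>)
 also have "... = br f (h i) d y \<oplus> (\<Oplus>i\<in>I. br f (h i) d y)"
  using SC.conv_plus2[OF bx f insert(4)[of i] l y] insert by simp
 also have "... = (\<Oplus>i\<in>insert i I. br f (h i) d y)"
  using insert(1,2) br_cl[OF f insert(4) y] by (intro M.finsum_insert[symmetric]) auto
 finally show ?case .
qed

context
 fixes a b pa pb
 assumes a: "a \<in> hpart g pa" and b: "b \<in> hpart g pb"
begin

text \<open>Substitutes \<open>E i (n - i)\<close> for u^i, that is, evaluates the homogenisation of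
  w to total degree n on brackets.\<close>

definition TE where "TE n w y = (\<Oplus>i\<in>{..n}. E a pa b pb i (n - i) y \<bullet> rat_in K (coeff w i))"

lemma gpD: "gp w ==> rat_in K (coeff w i) \<in> hpart K 0" "gp w ==> rat_in K (coeff w i) \<in>. K"
 unfolding gp_def using good_even good_closed by blast+

lemma E_cl: "y \<in>. S ==> E a pa b pb i j y \<in>. g"
 by (rule linc[OF E_lin[OF a b]])

lemma TE_term: "gp w ==> L (pa + pb) (%y. E a pa b pb i j y \<bullet> rat_in K (coeff w k))"
 by (rule lin_even_scale[OF smx E_lin[OF a b] gpD(1)])

lemma TE_lin: "gp w ==> L (pa + pb) (TE n w)"
 unfolding TE_def[abs_def] by (rule lin_finsum[OF SC.AT.smx smx]) (auto intro: TE_term)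

lemma TE_0: "y \<in>. S ==> TE n 0 y = \<zero>"
 unfolding TE_def by (simp add: rat_0 E_cl M.finsum_zero)

lemma TE_add: assumes "gp v" "gp w" "y \<in>. S" shows "TE n (v + w) y = TE n v y \<oplus> TE n w y"
proof -
 have "E a pa b pb i (n - i) y \<bullet> rat_in K (coeff (v + w) i) = E a pa b pb i (n - i) y \<bullet> rat_in K (coeff v i) \<oplus> E a pa b pb i (n - i) y \<bullet> rat_in K (coeff w i)" for i
  using assms(1,2) gpD(2)[OF assms(1)] gpD(2)[OF assms(2)] by (simp add: gp_def good_add(2) scale_add_right E_cl[OF assms(3)])
 then show ?thesis unfolding TE_def
  using linc[OF TE_term[OF assms(1)] assms(3)] linc[OF TE_term[OF assms(2)] assms(3)] by (simp add: M.finsum_addf)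
qed

lemma TE_smult: assumes "gp w" "good c" "y \<in>. S" shows "TE n (smult c w) y = TE n w y \<bullet> rat_in K c"
proof -
 have "E a pa b pb i (n - i) y \<bullet> rat_in K (coeff (smult c w) i) = E a pa b pb i (n - i) y \<bullet> rat_in K (coeff w i) \<bullet> rat_in K c" for i
  using assms(1,2) gpD(2)[OF assms(1)] good_closed[OF assms(2)] good_mult(2)[of "coeff w i" c]
  by (simp add: gp_def scale_mult[symmetric] E_cl[OF assms(3)] mult.commute)
 then show ?thesis unfolding TE_def
  using linc[OF TE_term[OF assms(1)] assms(3)]
  by (simp add: amap_finsum[OF scale_amap1[OF good_closed[OF assms(2)]] M.ag M.ag])
qed

lemma TE_sum: assumes "finite I" "!!i. i \<in> I ==> gp (f i)" "y \<in>. S" shows "TE n (sum f I) y = (\<Oplus>i\<in>I. TE n (f i) y)"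
 using assms(1,2)
proof (induction rule: finite_induct)
 case empty then show ?case using TE_0[OF assms(3)] by simp
next
 case (insert i I)
 then show ?case using linc[OF TE_lin assms(3)] by (simp add: TE_add gp_sum assms(3) M.finsum_insert Pi_def)
qed

lemma TE_monom: assumes "y \<in>. S" "m \<le> n" shows "TE n (monom 1 m) y = E a pa b pb m (n - m) y"
proof -
 have "TE n (monom 1 m) y = (\<Oplus>i\<in>{..n}. if i = m then E a pa b pb i (n - i) y else \<zero>)"
  unfolding TE_def using E_cl[OF assms(1)] by (intro M.finsum_cong') (auto simp: rat_0 rat_1 scale_one coeff_monom)
 also have "... = E a pa b pb m (n - m) y" using assms E_cl[OF assms(1)] M.finsum_singleton[of m "{..n}" "%i. E a pa b pb i (n - i) y"] by (simp add: Pi_def eq_commute[of m])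
 finally show ?thesis .
qed

text \<open>By \<open>AD_E\<close>, {x, .} raises either index. Raising the first multiplies by u,
  raising the second keeps the power of u; together this is u + 1. \<open>TE n\<close> does not see
  the coefficient of u^(n+1), but \<open>TE (Suc n)\<close> does, whence the assumption on
  it.\<close>

lemma AD_TE: assumes w: "gp w" and z: "coeff w (Suc n) = 0" and y: "y \<in>. S"
 shows "AD (TE n w) (pa + pb) y = TE (Suc n) (upoly * w) y"
proof -
 let ?r = "%i. rat_in K (coeff w i)" and ?E = "E a pa b pb"
 let ?c = "%i. case i of 0 => 0 | Suc j => coeff w j"
 note e = E_cl[OF y] and r = gpD[OF w]
 have ec: "?E i j y \<bullet> ?r k \<in>. g" for i j k using e r by (intro scale_closed)
 have t: "AD (%x. ?E i (n - i) x \<bullet> ?r i) (pa + pb) y = ?E (Suc i) (n - i) y \<bullet> ?r i \<oplus> ?E i (Suc n - i) y \<bullet> ?r i" if "i \<in> {..n}" for i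
  using that e r SC.conv_scale2[OF bx SW.xx_lin E_lin[OF a b] r(1) y, of i "n - i" i]
  by (simp add: AD_E[OF a b y] scale_add_left Suc_diff_le)
 have 1: "AD (TE n w) (pa + pb) y = (\<Oplus>i\<in>{..n}. ?E (Suc i) (n - i) y \<bullet> ?r i) \<oplus> (\<Oplus>i\<in>{..n}. ?E i (Suc n - i) y \<bullet> ?r i)"
 proof -
  have "AD (TE n w) (pa + pb) y = (\<Oplus>i\<in>{..n}. AD (%x. ?E i (n - i) x \<bullet> ?r i) (pa + pb) y)"
   unfolding TE_def[abs_def] by (rule br_finsum[OF SW.xx_lin _ _ y]) (auto intro: TE_term[OF w])
  also have "... = (\<Oplus>i\<in>{..n}. ?E (Suc i) (n - i) y \<bullet> ?r i \<oplus> ?E i (Suc n - i) y \<bullet> ?r i)"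
   by (rule M.finsum_cong'[OF refl _ t]) (auto intro!: M.a_closed ec)
  also have "... = (\<Oplus>i\<in>{..n}. ?E (Suc i) (n - i) y \<bullet> ?r i) \<oplus> (\<Oplus>i\<in>{..n}. ?E i (Suc n - i) y \<bullet> ?r i)"
   by (rule M.finsum_addf) (auto intro!: ec)
  finally show ?thesis .
 qed
 have gc: "good (?c i)" for i using w by (auto simp: gp_def good_0 split: nat.split)
 have cc: "?E i j y \<bullet> rat_in K (?c k) \<in>. g" for i j k using e good_closed[OF gc] by (intro scale_closed)
 have "TE (Suc n) (upoly * w) y = (\<Oplus>i\<in>{..Suc n}. ?E i (Suc n - i) y \<bullet> ?r i \<oplus> ?E i (Suc n - i) y \<bullet> rat_in K (?c i))"
  unfolding TE_def upoly_coeff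
 proof (rule M.finsum_cong'[OF refl])
  fix i
  show "?E i (Suc n - i) y \<bullet> rat_in K (coeff w i + ?c i) = ?E i (Suc n - i) y \<bullet> ?r i \<oplus> ?E i (Suc n - i) y \<bullet> rat_in K (?c i)"
   unfolding good_add(2)[OF w[unfolded gp_def, rule_format] gc] by (rule scale_add_right[OF e r(2) good_closed[OF gc]])
 qed (auto intro!: ec cc M.a_closed)
 also have "... = (\<Oplus>i\<in>{..Suc n}. ?E i (Suc n - i) y \<bullet> ?r i) \<oplus> (\<Oplus>i\<in>{..Suc n}. ?E i (Suc n - i) y \<bullet> rat_in K (?c i))"
  by (rule M.finsum_addf) (auto intro!: ec cc)
 also have "(\<Oplus>i\<in>{..Suc n}. ?E i (Suc n - i) y \<bullet> ?r i) = ?E (Suc n) 0 y \<bullet> ?r (Suc n) \<oplus> (\<Oplus>i\<in>{..n}. ?E i (Suc n - i) y \<bullet> ?r i)"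
  using M.finsum_Suc[of "%i. ?E i (Suc n - i) y \<bullet> ?r i" n] by (simp add: Pi_def ec)
 also have "(\<Oplus>i\<in>{..Suc n}. ?E i (Suc n - i) y \<bullet> rat_in K (?c i)) = (\<Oplus>i\<in>{..n}. ?E (Suc i) (n - i) y \<bullet> ?r i) \<oplus> ?E 0 (Suc n) y \<bullet> \<zero>\<^sub>K"
  using M.finsum_Suc2[of "%i. ?E i (Suc n - i) y \<bullet> rat_in K (?c i)" n] cc by (simp add: Pi_def rat_0)
 finally show ?thesis unfolding 1 z rat_0 using e ec by (simp add: M.a_comm)
qed

text \<open>At n = 0 the bracket of the two constant maps is the constant map of [a, b]; each
  further {x, .} contributes a factor u + 1.\<close>

lemma psi_TE: "y \<in>. S ==> psi (bracket g a b) (pa + pb) n y = TE n (upoly ^ n) y"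
proof (induction n arbitrary: y)
 case 0
 have "TE 0 (monom 1 0) y = E a pa b pb 0 0 y" using TE_monom[OF 0, of 0 0] by simp
 then show ?case by (simp add: E_00[OF a b 0])
next
 case (Suc n)
 have "psi (bracket g a b) (pa + pb) (Suc n) y = AD (TE n (upoly ^ n)) (pa + pb) y"
  by (simp, rule SC.conv_cong[OF refl Suc.IH])
 then show ?case using AD_TE[OF gp_power upoly_deg[of n "Suc n"] Suc(2)] by simp
qed

text \<open>In the step from m to m + 1 the two brackets split off by \<open>psi_PH_Suc1\<close> and
  \<open>psi_PH_Suc2\<close> give -(u^m + u^k), and {x, .} of the previous expression gives the
  factor u + 1. This is the recursion of \<open>Ppoly\<close>, up to the overall sign.\<close>

lemma D_TE: assumes "y \<in>. S"
 shows "psi a pa m (SC.PH (psi b pb k) pb y) \<ominus> sg g (pa * pb) (psi b pb m (SC.PH (psi a pa k) pa y)) = \<ominus> TE (m + k - 1) (Ppoly m k) y"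
 using assms
proof (induction m arbitrary: y)
 case 0
 then show ?case using psi_PH_0[OF 0 psi_lin[OF b] MG.hpc[OF a]] psi_PH_0[OF 0 psi_lin[OF a] MG.hpc[OF b]]
  by (simp add: TE_0 a_minus_def M.neg_zero)
next
 case (Suc m)
 note y = Suc(2)
 let ?P = "%y. psi a pa m (SC.PH (psi b pb k) pb y)" and ?Q = "%y. psi b pb m (SC.PH (psi a pa k) pa y)" and ?p = "pa + pb"
 let ?T = "TE (m + k - 1) (Ppoly m k)"
 have lP: "L ?p ?P" using lin_comp[OF SC.PH_lin[OF psi_lin[OF b]] psi_lin[OF a]] by (simp add: add.commute)
 have lQ: "L ?p ?Q" by (rule lin_comp[OF SC.PH_lin[OF psi_lin[OF a]] psi_lin[OF b]])
 note lsQ = lin_sg[OF smx lQ, of "pa * pb + 1"]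
 have ADT: "AD ?T ?p y = TE (m + k) (upoly * Ppoly m k) y"
 \<comment> \<open>For m = 0 the index m + k - 1 may be truncated at zero; there the polynomial is
   zero.\<close>
 proof (cases m)
  case 0
  have "AD ?T ?p y = AD (%y. \<zero>) ?p y" by (rule SC.conv_cong[OF refl]) (simp add: 0 TE_0)
  then show ?thesis using br_zero2[OF SW.xx_lin y] by (simp add: 0 TE_0[OF y])
 next
  case (Suc m')
  have "coeff (Ppoly m k) (Suc (m + k - 1)) = 0" by (rule Ppoly_deg) simp
  from AD_TE[OF gp_Ppoly this y] show ?thesis by (simp only: Suc add_Suc diff_Suc_1)
 qed
 have n: "\<ominus> sg g (pa * pb) x = sg g (pa * pb + 1) x" if "x \<in>. g" for x using M.sg_sg[OF that, of 1 "pa * pb"] by (simp add: add.commute)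
 have 1: "AD ?P ?p y \<oplus> sg g (pa * pb + 1) (AD ?Q ?p y) = \<ominus> AD ?T ?p y"
 proof -
  have "AD ?P ?p y \<oplus> sg g (pa * pb + 1) (AD ?Q ?p y) = AD (%y. ?P y \<oplus> sg g (pa * pb + 1) (?Q y)) ?p y"
   by (simp only: SC.conv_plus2[OF bx SW.xx_lin lP lsQ y] SC.conv_sg2[OF bx SW.xx_lin lQ y])
  also have "... = AD (%y. sg g 1 (?T y)) ?p y"
   by (rule SC.conv_cong[OF refl]) (simp only: Suc.IH[symmetric] n[symmetric] linc[OF lQ] a_minus_def sg_1)
  also have "... = \<ominus> AD ?T ?p y" using SC.conv_sg2[OF bx SW.xx_lin TE_lin[OF gp_Ppoly] y, where i=1] by (simp only: sg_1)
  finally show ?thesis .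
 qed
 have 2: "TE (m + k) (Ppoly (Suc m) k) y = (E a pa b pb m k y \<oplus> E a pa b pb k m y) \<oplus> AD ?T ?p y"
  unfolding ADT by (simp add: TE_add gp_add gp_monom gp_upoly gp_Ppoly TE_monom y)
 note c = E_cl[OF y] linc[OF AD_lin[OF lP] y] linc[OF AD_lin[OF lQ] y] linc[OF AD_lin[OF TE_lin[OF gp_Ppoly]] y]
 have "psi a pa (Suc m) (SC.PH (psi b pb k) pb y) \<ominus> sg g (pa * pb) (psi b pb (Suc m) (SC.PH (psi a pa k) pa y))
   = (\<ominus> E a pa b pb m k y \<oplus> AD ?P ?p y) \<oplus> (\<ominus> E a pa b pb k m y \<oplus> sg g (pa * pb + 1) (AD ?Q ?p y))"
  unfolding psi_PH_Suc1[OF a b y] psi_PH_Suc2[OF a b y] using c(1,3)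
  by (simp add: a_minus_def n[symmetric] M.sg_add M.sg_sg M.minus_add)
 also have "... = (\<ominus> E a pa b pb m k y \<oplus> \<ominus> E a pa b pb k m y) \<oplus> (AD ?P ?p y \<oplus> sg g (pa * pb + 1) (AD ?Q ?p y))"
  using c by (intro M.add4) simp_all
 also have "... = \<ominus> TE (m + k) (Ppoly (Suc m) k) y" unfolding 1 2 using c by (simp add: M.minus_add)
 finally show ?case by simp
qed

end

text \<open>The upper central series of g: nilpotency of order n says that \<open>Wn n\<close> is
  everything, and each bracket descends by one step.\<close>

definition Wn where "Wn t = {x \<in> carrier g. \<forall>Xs \<in> lists (carrier g). length Xs = t --> ad_list g Xs x = \<zero>}"

lemma ad_amap: "Xs \<in> lists (carrier g) ==> amap g g (ad_list g Xs)"
proof (induction Xs)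
 case Nil then show ?case by (simp add: ad_list_def amap_id id_def)
next
 case (Cons X Xs)
 then have "amap g g (%x. bracket g X (ad_list g Xs x))" by (intro amc[OF _ br_amap2]) auto
 then show ?case by (simp add: ad_list_def comp_def)
qed

lemma ad_scale: "[|Xs \<in> lists (carrier g); x \<in>. g; al \<in>. K|] ==> ad_list g Xs (x \<bullet> al) = ad_list g Xs x \<bullet> al"
proof (induction Xs)
 case Nil then show ?case by (simp add: ad_list_def)
next
 case (Cons X Xs)
 then show ?case using amapc[OF ad_amap, of Xs x] by (simp add: ad_list_def br_scale_right)
qed

lemma Wn_add: "[|x \<in> Wn t; y \<in> Wn t|] ==> x \<oplus> y \<in> Wn t" by (simp add: Wn_def ama[OF ad_amap])
lemma Wn_sg: "x \<in> Wn t ==> sg g i x \<in> Wn t"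
 by (simp add: Wn_def amap_sg[OF ad_amap M.ag M.ag])
lemma Wn_scale: "[|x \<in> Wn t; al \<in>. K|] ==> x \<bullet> al \<in> Wn t" by (simp add: Wn_def ad_scale scale_closed)
lemma Wn_0: "x \<in> Wn 0 ==> x = \<zero>" by (auto simp: Wn_def ad_list_def)
lemma Wn_zero: "\<zero> \<in> Wn t" by (simp add: Wn_def amap_zero[OF ad_amap M.ag M.ag])
lemma Wn_br: assumes "X \<in>. g" "x \<in> Wn t" shows "bracket g X x \<in> Wn (t - 1)"
proof (cases t)
 case 0 then show ?thesis using Wn_0[of x] assms Wn_zero[of 0] by (simp add: br_0)
next
 case (Suc s)
 have "ad_list g Xs (bracket g X x) = \<zero>" if "Xs \<in> lists (carrier g)" "length Xs = s" for Xs
 proof -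
  have "Xs @ [X] \<in> lists (carrier g)" "length (Xs @ [X]) = t" using that assms Suc by auto
  then have "ad_list g (Xs @ [X]) x = \<zero>" using assms(2) unfolding Wn_def by blast
  then show ?thesis by (simp add: ad_list_def)
 qed
 then show ?thesis using assms Suc by (simp add: Wn_def br_closed)
qed

lemma Wn_AD: assumes "L d f" "!!y. y \<in>. S ==> f y \<in> Wn t" "y \<in>. S" shows "AD f d y \<in> Wn (t - 1)"
 using assms(3,1,2)
proof (induction y arbitrary: f d rule: SC.A_induct)
 case (\<eta> i al) then show ?case by (simp add: AD_\<eta> KG.hpc Wn_zero)
next
 case (gen p X x)
 note X = MG.hpc[OF gen(1)]
 have "AD (%y. f (LX X y)) (d + p) x \<in> Wn (t - 1)" by (rule gen(3)[OF SC.LX_comp[OF gen(4,1)] gen(5)]) (simp add: X)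
 then show ?case unfolding AD_gen[OF gen(4,1,2)] by (intro Wn_add Wn_sg Wn_br[OF X] gen(5,2))
next
 case (add x y)
 then show ?case using lin_add[OF AD_lin[OF add(5)] add(1,2)] Wn_add by simp
qed

lemma Wn_psi: assumes b: "b \<in> hpart g p" and W: "b \<in> Wn t" and y: "y \<in>. S" shows "psi b p j y \<in> Wn (t - j)"
 using y
proof (induction j arbitrary: y)
 case 0 then show ?case using Wn_scale[OF W] by (simp add: SW.const_def)
next
 case (Suc j)
 then show ?case using Wn_AD[OF psi_lin[OF b] Suc(1) Suc(2)] by simp
qed

text \<open>The map \<open>psi a p i\<close> brackets i times with x and once with a, hence descends
  i + 1 steps. For the step, {{x, f}, h} is rewritten as {x, {f, h}} - {f, {x, h}} by
  \<open>AD_br\<close>.\<close>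

lemma Wn_br_psi: assumes a: "a \<in> hpart g p"
 shows "[|L d h; !!y. y \<in>. S ==> h y \<in> Wn t; y \<in>. S|] ==> br (psi a p i) h d y \<in> Wn (t - Suc i)"
proof (induction i arbitrary: h t y)
 case 0 then show ?case using Wn_br[OF MG.hpc[OF a] 0(2)] by (simp add: br_const[OF 0(3) a 0(1)])
next
 case (Suc i)
 note h = Suc(2) and y = Suc(4)
 have 1: "AD (br (psi a p i) h d) (p + d) y \<in> Wn (t - Suc i - 1)"
  by (rule Wn_AD[OF br_lin[OF psi_lin[OF a] h] Suc.IH[OF h Suc(3)] y])
 have 2: "br (psi a p i) (AD h d) d y \<in> Wn (t - 1 - Suc i)"
  by (rule Suc.IH[OF AD_lin[OF h] Wn_AD[OF h Suc(3)] y])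
 note c = br_cl[OF psi_lin[OF a, of "Suc i"] h y] br_cl[OF psi_lin[OF a] AD_lin[OF h] y, of i]
 have "br (psi a p (Suc i)) h d y = AD (br (psi a p i) h d) (p + d) y \<oplus> sg g 1 (br (psi a p i) (AD h d) d y)"
  using AD_br[OF psi_lin[OF a] h y, of i] c by (simp add: M.a_assoc M.r_neg)
 then show ?case using 1 2 by (simp only: diff_diff_left add.commute[of 1] add_Suc_right add_0_right One_nat_def plus_1_eq_Suc add_Suc) (simp add: Wn_add Wn_sg del: sg_1)
qed

text \<open>The element b is hit by j brackets inside \<psi>_j and by i + 1 more from
  \<psi>_i.\<close>

lemma E_nil: assumes "lie_nilpotent g n" "a \<in> hpart g pa" "b \<in> hpart g pb" "y \<in>. S" "Suc (i + j) \<ge> n"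
 shows "E a pa b pb i j y = \<zero>"
proof -
 have "b \<in> Wn n" using assms(1) MG.hpc[OF assms(3)] by (auto simp: Wn_def lie_nilpotent_def)
 then have "E a pa b pb i j y \<in> Wn (n - j - Suc i)" unfolding E_def
  by (intro Wn_br_psi[OF assms(2) psi_lin[OF assms(3)]] Wn_psi[OF assms(3)] assms(4))
 then show ?thesis using assms(5) Wn_0 by simp
qed

end

section \<open>The representation of g on S(g)\<close>

locale hln = hl K g for K :: "('k, 'm) graded_ring_scheme" and g :: "('g, 'k, 'n) lie_super_scheme" (structure) +
 fixes N :: enat
 assumes nil: "(N = \<infinity> \<and> (\<forall>m::nat. m > 0 --> [m] \<cdot>\<^sub>K \<one>\<^sub>K \<in> Units K)) \<or>
     (\<exists>n::nat. n \<ge> 2 \<and> N = enat n \<and> lie_nilpotent g n \<and> (\<forall>m \<in> {2..n}. [m] \<cdot>\<^sub>K \<one>\<^sub>K \<in> Units K))"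
begin

definition cs1 where "cs1 n = (if N \<le> enat n then \<zero>\<^sub>K else rat_in K (bern n))"

lemma bern_goodN: assumes "enat n < N" shows "good (bern n)"
proof (rule bern_good)
 fix m assume m: "2 \<le> m" "m \<le> Suc n"
 show "[(m::nat)] \<cdot>\<^sub>K \<one>\<^sub>K \<in> Units K" using nil
 proof
  assume "\<exists>n::nat. n \<ge> 2 \<and> N = enat n \<and> lie_nilpotent g n \<and> (\<forall>m \<in> {2..n}. [m] \<cdot>\<^sub>K \<one>\<^sub>K \<in> Units K)"
  then obtain k where "N = enat k" "\<forall>m \<in> {2..k}. [m] \<cdot>\<^sub>K \<one>\<^sub>K \<in> Units K" by blast
  then show ?thesis using m assms by simp
 qed (use m in simp)
qed

lemma ev_cs1: "ev cs1"
 by (auto simp: ev_def cs1_def not_le bern_goodN good_even)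

text \<open>N is at least 2, so the constant term is not truncated. Its value 1 makes the leading
  part of the operator of a the multiplication by a.\<close>

lemma cs1_0: "cs1 0 = \<one>\<^sub>K"
 using nil by (auto simp: cs1_def bern_0 rat_1 enat_0_iff zero_enat_def[symmetric])

text \<open>Checked on words of length n. There the left side becomes a sum of terms
  \<open>TE n\<close> of \<open>Ppoly\<close>, the right side is \<open>TE n\<close> of (u + 1)^n,
  and the polynomial identity of the Bernoulli numbers equates them.\<close>

lemma phs_bracket:
 assumes a: "a \<in> hpart g pa" and b: "b \<in> hpart g pb" and x: "x \<in>. S"
 shows "phs a pa cs1 (SC.PH (phs b pb cs1) pb x) \<ominus> sg g (pa * pb) (phs b pb cs1 (SC.PH (phs a pa cs1) pa x)) = phs (bracket g a b) (pa + pb) cs1 x"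
proof -
 note la = phs_lin[OF a ev_cs1] and lb = phs_lin[OF b ev_cs1] and lab = phs_lin[OF br_parity[OF a b] ev_cs1] and c = evD[OF ev_cs1]
 let ?A = "%x. phs a pa cs1 (SC.PH (phs b pb cs1) pb x)" and ?B = "%x. phs b pb cs1 (SC.PH (phs a pa cs1) pa x)"
 have n: "\<ominus> sg g (pa * pb) x = sg g (pa * pb + 1) x" if "x \<in>. g" for x using M.sg_sg[OF that, of 1 "pa * pb"] by (simp add: add.commute)
 have lA: "L (pa + pb) ?A" using lin_comp[OF SC.PH_lin[OF lb] la] by (simp add: add.commute)
 note lB = lin_comp[OF SC.PH_lin[OF la] lb]
 have "?A x \<oplus> sg g (pa * pb + 1) (?B x) = phs (bracket g a b) (pa + pb) cs1 x"
 proof (rule word_eqI[OF lin_amap[OF lin_plus[OF smx lA lin_sg[OF smx lB]]] lin_amap[OF lab] x])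
  fix n y assume y: "y \<in> Wd n"
  note yc = Wd_closed[OF y]
  let ?P = "%j. psi a pa (Suc n - j) (SC.PH (psi b pb j) pb y)" and ?Q = "%j. psi b pb (Suc n - j) (SC.PH (psi a pa j) pa y)"
  let ?c = "%j. cs1 j \<otimes>\<^sub>K cs1 (Suc n - j)" and ?p = "pa * pb + 1"
  have Pc: "?P j \<in>. g" and Qc: "?Q j \<in>. g" for j
   by (rule linc[OF psi_lin[OF a] linc[OF SC.PH_lin[OF psi_lin[OF b]] yc]], rule linc[OF psi_lin[OF b] linc[OF SC.PH_lin[OF psi_lin[OF a]] yc]])
  have cc: "?c j \<in>. K" for j using c(2) by simp
  have Tc: "TE a b pa pb n (Ppoly i j) y \<in>. g" for i j by (rule linc[OF TE_lin[OF a b gp_Ppoly] yc])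
  have "?A y \<oplus> sg g ?p (?B y) = (\<Oplus>j\<in>{..Suc n}. ?P j \<bullet> ?c j) \<oplus> (\<Oplus>j\<in>{..Suc n}. sg g ?p (?Q j \<bullet> ?c j))"
   unfolding phs_PH[OF a b ev_cs1 y] phs_PH[OF b a ev_cs1 y] using scale_closed[OF Qc cc]
   by (subst amap_finsum[OF M.amap_sgm M.ag M.ag]) (simp_all only: finite_atMost)
  also have "... = (\<Oplus>j\<in>{..Suc n}. ?P j \<bullet> ?c j \<oplus> sg g ?p (?Q j \<bullet> ?c j))"
   by (rule M.finsum_addf[symmetric]) (use scale_closed[OF Qc cc] scale_closed[OF Pc cc] in \<open>simp_all only: Pi_def M.sg_closed, auto\<close>)
  also have "... = (\<Oplus>j\<in>{..Suc n}. (\<ominus> TE a b pa pb n (Ppoly (Suc n - j) j) y) \<bullet> ?c j)"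
  proof (rule M.finsum_cong'[OF refl])
   fix j assume j: "j \<in> {..Suc n}"
   have "Suc n - j + j - 1 = n" using j by simp
   then have "?P j \<oplus> sg g ?p (?Q j) = \<ominus> TE a b pa pb n (Ppoly (Suc n - j) j) y"
    using D_TE[OF a b yc, of "Suc n - j" j] by (simp only: a_minus_def n[OF Qc])
   then show "?P j \<bullet> ?c j \<oplus> sg g ?p (?Q j \<bullet> ?c j) = (\<ominus> TE a b pa pb n (Ppoly (Suc n - j) j) y) \<bullet> ?c j"
    using scale_add_left[OF Pc M.sg_closed[OF Qc] cc, of j ?p j j] scale_sg1[OF Qc cc, of ?p j j] by simp
  qed (use Tc cc in \<open>auto intro!: scale_closed\<close>)
  also have "... = TE a b pa pb n (upoly ^ n) y \<bullet> cs1 n"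
  \<comment> \<open>The identity involves coefficients up to index n + 1. If n + 1 < N they all
    exist in K; otherwise each bracket of total degree n already vanishes by nilpotency, and both
    sides are zero.\<close>
  proof (cases "enat (Suc n) < N")
   case True
   then have lt: "enat j < N" if "j \<le> Suc n" for j using that by (meson enat_ord_simps(1) le_less_trans)
   have ci: "cs1 j = rat_in K (bern j)" "good (bern j)" if "j \<le> Suc n" for j using lt[OF that] bern_goodN by (auto simp: cs1_def)
   have "(\<Oplus>j\<in>{..Suc n}. (\<ominus> TE a b pa pb n (Ppoly (Suc n - j) j) y) \<bullet> ?c j)
    = (\<Oplus>j\<in>{..Suc n}. TE a b pa pb n (smult (- (bern j * bern (Suc n - j))) (Ppoly (Suc n - j) j)) y)"
   proof (rule M.finsum_cong'[OF refl])
    fix j assume "j \<in> {..Suc n}"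
    then have j: "j \<le> Suc n" by simp
    note cj = ci[OF j] ci[of "Suc n - j", OF diff_le_self]
    have g: "good (bern j * bern (Suc n - j))" using cj good_mult(1) by blast
    show "(\<ominus> TE a b pa pb n (Ppoly (Suc n - j) j) y) \<bullet> ?c j = TE a b pa pb n (smult (- (bern j * bern (Suc n - j))) (Ppoly (Suc n - j) j)) y"
     unfolding TE_smult[OF a b gp_Ppoly good_neg[OF g] yc] rat_neg[OF g] good_mult(2)[OF cj(2,4)] cj(1,3)[symmetric]
     using scale_neg1[OF Tc cc] scale_sg2[OF Tc cc, of _ _ 1] by simp
   next
    have "gp (smult (- (bern j * bern (Suc n - j))) (Ppoly (Suc n - j) j))" if "j \<le> Suc n" for j
     using ci[OF that] ci[of "Suc n - j", OF diff_le_self] by (intro gp_smult good_neg good_mult(1) gp_Ppoly) auto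
    then show "(%j. TE a b pa pb n (smult (- (bern j * bern (Suc n - j))) (Ppoly (Suc n - j) j)) y) \<in> {..Suc n} \<rightarrow> carrier g"
     using linc[OF TE_lin[OF a b] yc] by (simp only: Pi_def atMost_iff mem_Collect_eq) blast
   qed
   also have "... = TE a b pa pb n (smult (bern n) (upoly ^ n)) y"
    unfolding bern_poly'[symmetric]
   proof (rule TE_sum[OF a b _ _ yc, symmetric])
    fix j assume "j \<in> {..Suc n}"
    then have j: "j \<le> Suc n" by simp
    show "gp (smult (- (bern j * bern (Suc n - j))) (Ppoly (Suc n - j) j))"
     using ci[OF j] ci[of "Suc n - j", OF diff_le_self] by (intro gp_smult good_neg good_mult(1) gp_Ppoly) auto
   qed simp
   also have "... = TE a b pa pb n (upoly ^ n) y \<bullet> cs1 n"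
    using ci[of n] by (simp add: TE_smult[OF a b gp_power _ yc])
   finally show ?thesis .
  next
   case False
   then obtain k where k: "N = enat k" "lie_nilpotent g k" "k \<le> Suc n" using nil by (auto simp: not_less)
   have z: "TE a b pa pb n w y = \<zero>" if "gp w" for w
   proof -
    have "TE a b pa pb n w y = (\<Oplus>i\<in>{..n}. \<zero>)" unfolding TE_def[OF a b]
     by (rule M.finsum_cong') (use k(3) gpD(2)[OF a b that] in \<open>auto simp: E_nil[OF k(2) a b yc]\<close>)
    then show ?thesis by (simp add: M.finsum_zero)
   qed
   show ?thesis using cc c(2) by (simp add: z gp_Ppoly gp_power M.neg_zero M.finsum_zero)
  qed
  also have "... = phs (bracket g a b) (pa + pb) cs1 y" by (simp only: phs_Wd(1)[OF br_parity[OF a b] ev_cs1 y] psi_TE[OF a b yc])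
  finally show "?A y \<oplus> sg g ?p (?B y) = phs (bracket g a b) (pa + pb) cs1 y" .
 qed
 then show ?thesis by (simp only: a_minus_def n[OF linc[OF lB x]])
qed

lemma PH_rep: assumes a: "a \<in> hpart g pa" and b: "b \<in> hpart g pb" and x: "x \<in>. S"
 shows "SC.PH (phs a pa cs1) pa (SC.PH (phs b pb cs1) pb x)
  = sg S (pa * pb) (SC.PH (phs b pb cs1) pb (SC.PH (phs a pa cs1) pa x)) \<oplus>\<^sub>S SC.PH (phs (bracket g a b) (pa + pb) cs1) (pa + pb) x"
proof -
 have "SC.PH (%y. phs a pa cs1 (SC.PH (phs b pb cs1) pb y) \<ominus> sg g (pa * pb) (phs b pb cs1 (SC.PH (phs a pa cs1) pa y))) (pa + pb) x
   = SC.PH (phs (bracket g a b) (pa + pb) cs1) (pa + pb) x"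
  unfolding SC.PH_def by (rule SC.conv_cong[OF refl]) (rule phs_bracket[OF a b, unfolded SC.PH_def])
 then show ?thesis using PH_commutator[OF x phs_lin[OF a ev_cs1] phs_lin[OF b ev_cs1]] by simp
qed

end

section \<open>The permutation formula\<close>

text \<open>The exponent of the Koszul sign of an arrangement of indices, computed from the left:
  the leading index passes the smaller ones behind it. This form suits the recursion of
  \<open>psi\<close>, which produces the outermost bracket first.\<close>

fun kl :: "(nat => bit) => nat list => bit" where
 "kl P [] = 0"
| "kl P (i # l) = P i * sum_list (map P (filter (%j. j < i) l)) + kl P l"

lemma filter_sum_nth: "sum_list (map P (filter Q l)) = (\<Sum>j\<in>{j. j < length l \<and> Q (l ! j)}. P (l ! j) :: bit)"
proof -
 have "sum_list (map P (filter Q l)) = sum_list (map (%j. if Q j then P j else 0) l)" by (rule sum_list_map_filter')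
 also have "... = (\<Sum>j\<in>{0..<length l}. if Q (l ! j) then P (l ! j) else 0)" unfolding sum_list_sum_nth by (intro sum.cong) auto
 also have "... = (\<Sum>j\<in>{j \<in> {0..<length l}. Q (l ! j)}. P (l ! j))" by (rule sum.inter_filter[symmetric]) simp
 finally show ?thesis by simp
qed

lemma kl_pairs: "kl P l = (\<Sum>(i, j)\<in>{(i, j). i < j \<and> j < length l \<and> l ! j < l ! i}. P (l ! i) * P (l ! j))"
proof (induction l)
 case (Cons x l)
 let ?T = "%l. {(i, j). i < j \<and> j < length l \<and> l ! j < l ! i}"
 let ?A = "{j. j < length l \<and> l ! j < x}"
 have fin: "finite (?T l)" by (rule finite_subset[of _ "{..<length l} \<times> {..<length l}"]) auto
 have e: "?T (x # l) = (%j. (0, Suc j)) ` ?A \<union> (%(i, j). (Suc i, Suc j)) ` ?T l" (is "?L = ?R")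
 proof (intro Set.set_eqI iffI)
  fix p assume "p \<in> ?L"
  then obtain i j where p: "p = (i, j)" "i < j" "j < Suc (length l)" "(x # l) ! j < (x # l) ! i" by auto
  then obtain j' where "j = Suc j'" by (cases j) auto
  then show "p \<in> ?R" using p by (cases i) auto
 qed auto
 have "(\<Sum>(i, j)\<in>?T (x # l). P ((x # l) ! i) * P ((x # l) ! j)) = (\<Sum>j\<in>?A. P x * P (l ! j)) + (\<Sum>(i, j)\<in>?T l. P (l ! i) * P (l ! j))"
  unfolding e using fin
  by (subst sum.union_disjoint) (auto simp: sum.reindex inj_on_def case_prod_beta' intro!: finite_imageI)
 then show ?case by (simp add: Cons filter_sum_nth sum_distrib_left)
qed simp

lemma kl_koszul: assumes "s permutes {..<length ps}" shows "koszul ps s = kl (%i. ps ! i) (map s [0..<length ps])"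
 unfolding koszul_def kl_pairs by (rule sum.cong) auto

text \<open>Permutations are replaced by lists of distinct indices, on which one can recurse on the
  first entry.\<close>

lemma permutes_lists:
 shows "inj_on (%s. map s [0..<n]) {s. s permutes {..<n}}" "(%s. map s [0..<n]) ` {s. s permutes {..<n}} = permutations_of_set {..<n}"
proof -
 show "inj_on (%s. map s [0..<n]) {s. s permutes {..<n}}"
 proof (rule inj_onI, rule ext)
  fix s t i assume "s \<in> {s. s permutes {..<n}}" "t \<in> {s. s permutes {..<n}}" "map s [0..<n] = map t [0..<n]"
  then show "s i = t i" by (cases "i < n") (auto simp: permutes_not_in)
 qed
 show "(%s. map s [0..<n]) ` {s. s permutes {..<n}} = permutations_of_set {..<n}" (is "?L = ?R")
 proof (intro Set.set_eqI iffI)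
  fix l assume "l \<in> ?L"
  then obtain s where s: "s permutes {..<n}" "l = map s [0..<n]" by blast
  have "set l = {..<n}" using permutes_image[OF s(1)] s(2) by (simp add: atLeast0LessThan)
  moreover have "distinct l" using s permutes_inj_on[OF s(1)] by (simp add: distinct_map)
  ultimately show "l \<in> ?R" by blast
 next
  fix l assume "l \<in> ?R"
  then have l: "set l = {..<n}" "distinct l" by (auto dest: permutations_of_setD)
  have n: "length l = n" using distinct_card[OF l(2)] l(1) by simp
  define s where "s i = (if i < n then l ! i else i)" for i
  have "bij_betw ((!) l) {..<n} {..<n}" by (rule bij_betw_nth[OF l(2)]) (simp_all only: l n)
  moreover have "bij_betw s {..<n} {..<n} = bij_betw ((!) l) {..<n} {..<n}" by (rule bij_betw_cong) (simp add: s_def)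
  ultimately have "bij_betw s {..<n} {..<n}" by simp
  then have "s permutes {..<n}" by (rule bij_imp_permutes) (simp add: s_def)
  moreover have "l = map s [0..<n]" by (rule nth_equalityI) (simp_all add: n s_def)
  ultimately show "l \<in> ?L" by blast
 qed
qed

section \<open>Values of \<open>psi\<close> on products of letters\<close>

context hl begin

abbreviation wd where "wd l \<equiv> foldr (\<otimes>\<^sub>S) (map SC.gen l) \<one>\<^sub>S"

lemma wd_closed: "set l <= carrier g ==> wd l \<in>. S" by (induction l) auto

text \<open>Unrolls \<open>AD_gen\<close>: x picks one letter and f receives the others. The sign
  comes from moving that letter to the front, past f and past the letters before it; sortedness
  identifies these with the smaller indices.\<close>

lemma AD_wd:
 assumes "L d f" "sorted l" "distinct l" "!!i. i \<in> set l ==> X i \<in> hpart g (P i)"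
 shows "AD f d (wd (map X l)) = (\<Oplus>i\<in>set l. sg g (d * P i + P i * (\<Sum>j\<in>{j \<in> set l. j < i}. P j)) (bracket g (X i) (f (wd (map X (remove1 i l))))))"
 using assms
proof (induction l arbitrary: f d)
 case Nil then show ?case using AD_\<eta>[OF Nil(1) one_closed] by (simp add: ring_hom_one[OF SC.\<eta>_hom])
next
 case (Cons k l)
 have X: "X k \<in> hpart g (P k)" and Xl: "!!i. i \<in> set l ==> X i \<in> hpart g (P i)" using Cons(5) by auto
 have k: "k < i" if "i \<in> set l" for i using Cons(3,4) that by (auto simp: le_less)
 have kl: "k \<notin> set l" using Cons(4) by simp
 have w: "wd (map X l) \<in>. S" by (rule wd_closed) (use MG.hpc[OF Xl] in auto)
 have wr: "wd (map X (remove1 i l)) \<in>. S" for i by (rule wd_closed) (auto intro!: MG.hpc[OF Xl] dest!: subsetD[OF set_remove1_subset])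
 let ?s = "%l i. d * P i + P i * (\<Sum>j\<in>{j \<in> set l. j < i}. P j)"
 let ?t = "%l i. sg g (?s l i) (bracket g (X i) (f (wd (map X (remove1 i l)))))"
 have tc: "?t (k # l) i \<in>. g" if "i \<in> set (k # l)" for i
  using that MG.hpc[OF Cons(5)] w wr MG.hpc[OF X] by (intro M.sg_closed br_closed linc[OF Cons(2)]) auto
 have "AD f d (wd (map X (k # l))) = sg g (d * P k) (bracket g (X k) (f (wd (map X l)))) \<oplus> AD (%y. f (LX (X k) y)) (d + P k) (wd (map X l))"
  using AD_gen[OF Cons(2) X w] by simp
 also have "AD (%y. f (LX (X k) y)) (d + P k) (wd (map X l)) = (\<Oplus>i\<in>set l. sg g ((d + P k) * P i + P i * (\<Sum>j\<in>{j \<in> set l. j < i}. P j)) (bracket g (X i) (f (LX (X k) (wd (map X (remove1 i l)))))))"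
  by (rule Cons(1)[OF SC.LX_comp[OF Cons(2) X] _ _ Xl]) (use Cons(3,4) in auto)
 also have "... = (\<Oplus>i\<in>set l. ?t (k # l) i)"
 proof (rule M.finsum_cong'[OF refl])
  show "(%i. ?t (k # l) i) \<in> set l \<rightarrow> carrier g" using tc by auto
  fix i assume i: "i \<in> set l"
  have "{j \<in> set (k # l). j < i} = insert k {j \<in> set l. j < i}" using k[OF i] by auto
  then have "(\<Sum>j\<in>{j \<in> set (k # l). j < i}. P j) = P k + (\<Sum>j\<in>{j \<in> set l. j < i}. P j)" using kl by simp
  then have "?s (k # l) i = (d + P k) * P i + P i * (\<Sum>j\<in>{j \<in> set l. j < i}. P j)" by (simp only: distrib_left distrib_right ac_simps)
  moreover have "remove1 i (k # l) = k # remove1 i l" using i kl by auto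
  ultimately show "sg g ((d + P k) * P i + P i * (\<Sum>j\<in>{j \<in> set l. j < i}. P j)) (bracket g (X i) (f (LX (X k) (wd (map X (remove1 i l)))))) = ?t (k # l) i"
   by (simp only: list.map foldr.simps comp_apply)
 qed
 also have "sg g (d * P k) (bracket g (X k) (f (wd (map X l)))) = ?t (k # l) k"
 proof -
  have "{j \<in> set (k # l). j < k} = {}" using k by fastforce
  then show ?thesis by (simp only: sum.empty mult_zero_right add_0_right remove1.simps if_True simp_thms)
 qed
 also have "?t (k # l) k \<oplus> (\<Oplus>i\<in>set l. ?t (k # l) i) = (\<Oplus>i\<in>insert k (set l). ?t (k # l) i)"
  by (rule M.finsum_insert[symmetric, OF finite_set kl]) (intro funcsetI tc, simp)+
 also have "... = (\<Oplus>i\<in>set (k # l). ?t (k # l) i)" by (simp only: list.set)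
 finally show ?case .
qed

text \<open>Stated for any finite index set A, because the step removes the index of the outermost
  letter, which can be any element of A.\<close>

lemma psi_wd:
 assumes a: "a \<in> hpart g p" and "finite A" "!!i. i \<in> A ==> X i \<in> hpart g (P i)"
 shows "psi a p (card A) (wd (map X (sorted_list_of_set A)))
  = sg g (p * (\<Sum>i\<in>A. P i)) (\<Oplus>l\<in>permutations_of_set A. sg g (kl P l) (ad_list g (map X l) a))"
 using assms(2,3)
proof (induction "card A" arbitrary: A)
 case 0
 then show ?case using MG.hpc[OF a] by (simp add: const_one ad_list_def M.finsum_insert[of "{}", simplified])
next
 case (Suc n)
 note fin = Suc(3) and X = Suc(4) and ac = MG.hpc[OF a]
 have ne: "A \<noteq> {}" using Suc(2) by auto
 have adc: "ad_list g (map X l) a \<in>. g" if "set l <= A" for l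
  by (rule amapc[OF ad_amap ac]) (auto intro!: MG.hpc[OF X] subsetD[OF that])
 let ?t = "%l. sg g (kl P l) (ad_list g (map X l) a)" and ?q = "p * (\<Sum>i\<in>A. P i)"
 have tc: "?t l \<in>. g" if "set l <= A" for l using adc[OF that] by simp
 have "psi a p (card A) (wd (map X (sorted_list_of_set A))) = AD (psi a p n) p (wd (map X (sorted_list_of_set A)))"
  by (simp add: Suc(2)[symmetric])
 also have "... = (\<Oplus>i\<in>A. sg g (p * P i + P i * (\<Sum>j\<in>{j \<in> A. j < i}. P j)) (bracket g (X i) (psi a p n (wd (map X (sorted_list_of_set (A - {i})))))))"
  using AD_wd[OF psi_lin[OF a] sorted_sorted_list_of_set distinct_sorted_list_of_set, of A X P n] X fin
  by (simp add: sorted_list_of_set_remove)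
 also have "... = (\<Oplus>i\<in>A. \<Oplus>l\<in>permutations_of_set (A - {i}). sg g ?q (?t (i # l)))"
 proof (rule M.finsum_cong'[OF refl])
  show "(%i. \<Oplus>l\<in>permutations_of_set (A - {i}). sg g ?q (?t (i # l))) \<in> A \<rightarrow> carrier g"
   by (intro funcsetI M.finsum_closed M.sg_closed adc) (auto dest: permutations_of_setD)
  fix i assume i: "i \<in> A"
  let ?s = "p * P i + P i * (\<Sum>j\<in>{j \<in> A. j < i}. P j)" and ?r = "p * (\<Sum>i\<in>A - {i}. P i)"
  have IH: "psi a p n (wd (map X (sorted_list_of_set (A - {i})))) = sg g ?r (\<Oplus>l\<in>permutations_of_set (A - {i}). ?t l)"
  proof -
   have cn: "n = card (A - {i})" using Suc(2) i fin by simp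
   show ?thesis unfolding cn by (rule Suc(1)[OF cn]) (use fin X in auto)
  qed
  have am: "amap g g (%x. sg g ?s (bracket g (X i) (sg g ?r x)))"
   by (intro amc[OF amc[OF M.amap_sgm br_amap2] M.amap_sgm] MG.hpc[OF X[OF i]])
  have "sg g ?s (bracket g (X i) (psi a p n (wd (map X (sorted_list_of_set (A - {i})))))) = (\<Oplus>l\<in>permutations_of_set (A - {i}). sg g ?s (bracket g (X i) (sg g ?r (?t l))))"
   unfolding IH by (rule amap_finsum[OF am M.ag M.ag]) (auto intro!: tc dest: permutations_of_setD)
  also have "... = (\<Oplus>l\<in>permutations_of_set (A - {i}). sg g ?q (?t (i # l)))"
  proof (rule M.finsum_cong'[OF refl])
   show "(%l. sg g ?q (?t (i # l))) \<in> permutations_of_set (A - {i}) \<rightarrow> carrier g"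
    using i by (intro funcsetI M.sg_closed adc) (auto dest: permutations_of_setD)
   fix l assume "l \<in> permutations_of_set (A - {i})"
   then have l: "set l = A - {i}" "distinct l" by (auto dest: permutations_of_setD)
   have "{j \<in> A. j < i} = set (filter (%j. j < i) l)" using l(1) by auto
   then have f: "(\<Sum>j\<in>{j \<in> A. j < i}. P j) = sum_list (map P (filter (%j. j < i) l))" using l(2) by (simp add: sum_list_distinct_conv_sum_set)
   have c: "ad_list g (map X l) a \<in>. g" by (rule adc) (use l in auto)
   have b: "bracket g (X i) (ad_list g (map X l) a) = ad_list g (map X (i # l)) a" by (simp add: ad_list_def)
   have s: "?s + (?r + kl P l) = ?q + kl P (i # l)" unfolding f kl.simps sum.remove[OF fin i] by (simp only: distrib_left ac_simps)
   have c': "ad_list g (map X (i # l)) a \<in>. g" by (rule adc) (use l i in auto)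
   show "sg g ?s (bracket g (X i) (sg g ?r (?t l))) = sg g ?q (?t (i # l))"
    by (simp only: M.sg_sg[OF c] br_sg2[OF MG.hpc[OF X[OF i]] c] b M.sg_sg[OF c'] s)
  qed
  finally show "sg g ?s (bracket g (X i) (psi a p n (wd (map X (sorted_list_of_set (A - {i})))))) = (\<Oplus>l\<in>permutations_of_set (A - {i}). sg g ?q (?t (i # l)))" .
 qed
 also have "... = (\<Oplus>i\<in>A. \<Oplus>l\<in>(#) i ` permutations_of_set (A - {i}). sg g ?q (?t l))"
 proof (rule M.finsum_cong'[OF refl])
  show "(%i. \<Oplus>l\<in>(#) i ` permutations_of_set (A - {i}). sg g ?q (?t l)) \<in> A \<rightarrow> carrier g"
   by (intro funcsetI M.finsum_closed M.sg_closed adc) (auto dest: permutations_of_setD)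
  fix i assume "i \<in> A"
  then show "(\<Oplus>l\<in>permutations_of_set (A - {i}). sg g ?q (?t (i # l))) = (\<Oplus>l\<in>(#) i ` permutations_of_set (A - {i}). sg g ?q (?t l))"
   by (intro M.finsum_reindex[symmetric] funcsetI M.sg_closed adc) (auto dest: permutations_of_setD simp: inj_on_def)
 qed
 also have "... = (\<Oplus>l\<in>(\<Union>i\<in>A. (#) i ` permutations_of_set (A - {i})). sg g ?q (?t l))"
  by (rule M.add.finprod_UN_disjoint[symmetric, folded finsum_def, OF fin])
    (simp, force simp: pairwise_def disjnt_def, intro M.sg_closed adc, auto dest: permutations_of_setD)
 also have "(\<Union>i\<in>A. (#) i ` permutations_of_set (A - {i})) = permutations_of_set A" using permutations_of_set_nonempty[OF ne] by simp
 also have "(\<Oplus>l\<in>permutations_of_set A. sg g ?q (?t l)) = sg g ?q (\<Oplus>l\<in>permutations_of_set A. ?t l)"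
  by (rule amap_finsum[OF M.amap_sgm M.ag M.ag, symmetric]) (auto intro!: tc dest: permutations_of_setD)
 finally show ?case .
qed

lemma psi_perm:
 assumes a: "a \<in> hpart g p" and "list_all2 (%p X. X \<in> hpart g p) ps Xs"
 shows "psi a p (length Xs) (wd Xs) = sg g (p * sum_list ps) (\<Oplus>s\<in>{s. s permutes {..<length Xs}}. sg g (koszul ps s) (ad_list g (permute_list s Xs) a))"
proof -
 let ?n = "length Xs"
 have n: "length ps = ?n" using assms(2) by (simp add: list_all2_lengthD)
 have X: "Xs ! i \<in> hpart g (ps ! i)" if "i < ?n" for i using list_all2_nthD2[OF assms(2) that] .
 have m: "map ((!) Xs) (sorted_list_of_set {..<?n}) = Xs"
  by (simp add: map_nth lessThan_atLeast0)
 have sl: "(\<Sum>i\<in>{..<?n}. ps ! i) = sum_list ps" by (simp add: sum_list_sum_nth n lessThan_atLeast0)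
 have ac: "ad_list g (map ((!) Xs) l) a \<in>. g" if "set l <= {..<?n}" for l
  by (rule amapc[OF ad_amap MG.hpc[OF a]]) (auto intro!: MG.hpc[OF X] dest!: subsetD[OF that])
 have pl: "s i < ?n" if "s permutes {..<?n}" "i < ?n" for s i using permutes_in_image[OF that(1), of i] that(2) by simp
 let ?t = "%l. sg g (kl ((!) ps) l) (ad_list g (map ((!) Xs) l) a)"
 have "psi a p ?n (wd Xs) = sg g (p * sum_list ps) (\<Oplus>l\<in>permutations_of_set {..<?n}. ?t l)"
  using psi_wd[OF a finite_lessThan, of ?n "(!) Xs" "(!) ps"] X unfolding m sl by simp
 also have "(\<Oplus>l\<in>permutations_of_set {..<?n}. ?t l) = (\<Oplus>s\<in>{s. s permutes {..<?n}}. ?t (map s [0..<?n]))"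
  unfolding permutes_lists(2)[symmetric]
  by (rule M.finsum_reindex[OF _ permutes_lists(1)]) (auto intro!: M.sg_closed ac simp: pl)
 also have "... = (\<Oplus>s\<in>{s. s permutes {..<?n}}. sg g (koszul ps s) (ad_list g (permute_list s Xs) a))"
 proof (rule M.finsum_cong'[OF refl])
  have e: "?t (map s [0..<?n]) = sg g (koszul ps s) (ad_list g (permute_list s Xs) a)" if "s permutes {..<?n}" for s
   using kl_koszul[of s ps] that by (simp add: n permute_list_def comp_def)
  show "?t (map s [0..<?n]) = sg g (koszul ps s) (ad_list g (permute_list s Xs) a)" if "s \<in> {s. s permutes {..<?n}}" for s using e that by blast
  have "?t (map s [0..<?n]) \<in>. g" if "s permutes {..<?n}" for s
   using that by (intro M.sg_closed ac) (auto simp: pl)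
  then show "(%s. sg g (koszul ps s) (ad_list g (permute_list s Xs) a)) \<in> {s. s permutes {..<?n}} \<rightarrow> carrier g" by (auto simp only: e Pi_def mem_Collect_eq)
 qed
 finally show ?thesis .
qed

lemma wd_Wd: "list_all2 (%p X. X \<in> hpart g p) ps Xs ==> wd Xs \<in> Wd (length Xs)"
 by (induction rule: list_all2_induct) (auto simp: one_Wd simp del: Wd.simps intro: Wd_gen)

lemma Wd_wd: "y \<in> Wd n ==> \<exists>ps Xs al. list_all2 (%p X. X \<in> hpart g p) ps Xs \<and> al \<in>. K \<and> y = wd Xs \<bullet>\<^sub>S al"
proof (induction rule: Wd_induct)
 case (\<eta> al) then show ?case by (intro exI[of _ "[]"] exI[of _ al]) (simp add: \<eta>_scale)
next
 case (gen n X p y)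
 then obtain ps Xs al where y: "list_all2 (%p X. X \<in> hpart g p) ps Xs" "al \<in>. K" "y = wd Xs \<bullet>\<^sub>S al" by blast
 then have "LX X y = wd (X # Xs) \<bullet>\<^sub>S al"
  using lin_scale[OF SC.LX_lin[OF gen(1)] Wd_closed[OF wd_Wd[OF y(1)]] y(2)] by simp
 moreover have "list_all2 (%p X. X \<in> hpart g p) (p # ps) (X # Xs)" using y gen(1) by simp
 ultimately show ?case using y(2) by blast
qed

section \<open>Identification of \<open>phi\<close> and \<open>Phi\<close> with series\<close>

definition phs2 where "phs2 a cs y = phs (hcomp g 0 a) 0 cs y \<oplus> phs (hcomp g 1 a) 1 cs y"

text \<open>The series satisfies the defining formula of \<open>phi\<close> by
  \<open>psi_perm\<close>. The formula fixes the values on all words with scalars, so the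
  description has no other solution.\<close>

lemma phi_phs:
 assumes a: "a \<in>. g" and cs: "ev (phi_coeff K N c)"
 shows "phi K g N c a = restrict (phs2 a (phi_coeff K N c)) (carrier S)"
proof -
 let ?cs = "phi_coeff K N c"
 let ?F = "%ps Xs. (\<Oplus>i\<in>{0, 1}. sg g (i * sum_list ps) ((\<Oplus>s\<in>{s. s permutes {..<length Xs}}. sg g (koszul ps s) (ad_list g (permute_list s Xs) (hcomp g i a))) \<bullet> ?cs (length Xs)))"
 let ?Q = "%f. f \<in>. (sHom K S g) \<and> (\<forall>ps Xs. list_all2 (%p X. X \<in> hpart g p) ps Xs --> f (wd Xs) = ?F ps Xs)"
 note l = phs_lin[OF MG.hc_in[OF a] cs]
 have am: "amap S g (phs2 a ?cs)" unfolding phs2_def[abs_def] by (rule amap_plus[OF M.ag lin_amap[OF l] lin_amap[OF l]])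
 have sc: "phs2 a ?cs (y \<bullet>\<^sub>S al) = phs2 a ?cs y \<bullet> al" if "y \<in>. S" "al \<in>. K" for y al
  using that linc[OF l that(1)] by (simp add: phs2_def lin_scale[OF l that] scale_add_left)
 have 1: "phs2 a ?cs (wd Xs) = ?F ps Xs" if X: "list_all2 (%p X. X \<in> hpart g p) ps Xs" for ps Xs
 proof -
  let ?r = "%i. \<Oplus>s\<in>{s. s permutes {..<length Xs}}. sg g (koszul ps s) (ad_list g (permute_list s Xs) (hcomp g i a))"
  have rc: "?r i \<in>. g" for i
  proof (rule M.finsum_closed)
   have "set Xs <= carrier g" using X MG.hpc by (induction rule: list_all2_induct) auto
   then have "permute_list s Xs \<in> lists (carrier g)" if "s permutes {..<length Xs}" for s using that by auto
   then show "(%s. sg g (koszul ps s) (ad_list g (permute_list s Xs) (hcomp g i a))) \<in> {s. s permutes {..<length Xs}} \<rightarrow> carrier g"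
    using amapc[OF ad_amap] MG.hc_closed[OF a] by (auto intro!: M.sg_closed)
  qed
  have "phs (hcomp g i a) i ?cs (wd Xs) = sg g (i * sum_list ps) (?r i \<bullet> ?cs (length Xs))" for i
   using rc evD(2)[OF cs] by (simp add: phs_Wd(1)[OF MG.hc_in[OF a] cs wd_Wd[OF X]] psi_perm[OF MG.hc_in[OF a] X] scale_sg1)
  then show ?thesis using rc evD(2)[OF cs] by (simp add: phs2_def M.finsum_bit scale_closed del: mult_zero_left mult_1)
 qed
 have wS: "wd Xs \<in>. S" if "list_all2 (%p X. X \<in> hpart g p) ps Xs" for ps Xs by (rule Wd_closed[OF wd_Wd[OF that]])
 have ex: "?Q (restrict (phs2 a ?cs) (carrier S))"
  using am sc 1 wS by (auto simp: sHom_def amap_def SC.AT.scale_closed)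
 have un: "f = restrict (phs2 a ?cs) (carrier S)" if f: "?Q f" for f
 proof (rule extensionalityI)
  have fH: "f \<in> carrier S \<rightarrow>\<^sub>E carrier g" "!!x y. [|x \<in>. S; y \<in>. S|] ==> f (x \<oplus>\<^sub>S y) = f x \<oplus> f y"
   "!!x al. [|x \<in>. S; al \<in>. K|] ==> f (x \<bullet>\<^sub>S al) = f x \<bullet> al" using f by (auto simp: sHom_def)
  show "f \<in> extensional (carrier S)" using fH(1) by (simp add: PiE_def)
  have fam: "amap S g f" using fH by (auto simp: amap_def)
  fix x assume x: "x \<in>. S"
  have "f x = phs2 a ?cs x"
  proof (rule word_eqI[OF fam am x])
   fix n y assume "y \<in> Wd n"
   then obtain ps Xs al where y: "list_all2 (%p X. X \<in> hpart g p) ps Xs" "al \<in>. K" "y = wd Xs \<bullet>\<^sub>S al" using Wd_wd by blast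
   show "f y = phs2 a ?cs y" unfolding y(3) fH(3)[OF wS[OF y(1)] y(2)] sc[OF wS[OF y(1)] y(2)] 1[OF y(1)] using f y(1) by simp
  qed
  then show "f x = restrict (phs2 a ?cs) (carrier S) x" using x by simp
 qed simp
 show ?thesis unfolding phi_def Let_def sgen_gen by (rule the_equality[where P="?Q"], rule ex, rule un)
qed

end

lemma balanced_plus:
 assumes "abelian_group P" "balanced K M N P f" "balanced K M N P h"
 shows "balanced K M N P (%x y. f x y \<oplus>\<^sub>P h x y)"
 using assms unfolding balanced_def by (auto intro!: amap_plus)

lemma (in tens) lift_plus:
 assumes P: "abelian_group P" and f: "balanced K M N P f" and h: "balanced K M N P h" and z: "z \<in>. T"
 shows "tensor_lift K M N P (%x y. f x y \<oplus>\<^sub>P h x y) z = tensor_lift K M N P f z \<oplus>\<^sub>P tensor_lift K M N P h z"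
 by (rule T_full_ext[OF lift_amap[OF balanced_plus[OF P f h] P] amap_plus[OF P lift_amap[OF f P] lift_amap[OF h P]] _ z])
   (simp add: lift_pu[OF balanced_plus[OF P f h] P] lift_pu[OF f P] lift_pu[OF h P])

lemma sHom_carrier:
 "f \<in>. (sHom K A B) \<longleftrightarrow> f \<in> carrier A \<rightarrow>\<^sub>E carrier B \<and>
   (\<forall>x \<in> carrier A. \<forall>y \<in> carrier A. f (x \<oplus>\<^sub>A y) = f x \<oplus>\<^sub>B f y) \<and>
   (\<forall>x \<in> carrier A. \<forall>al \<in> carrier K. f (x \<bullet>\<^sub>A al) = f x \<bullet>\<^sub>B al)"
 by (simp add: sHom_def)

lemma sHom_add: "F \<oplus>\<^sub>(sHom K A B) H = (\<lambda>x \<in> carrier A. F x \<oplus>\<^sub>B H x)"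
 by (simp add: sHom_def)

lemma sHom_hpart: "f \<in> hpart (sHom K A B) i \<longleftrightarrow> f \<in>. (sHom K A B) \<and> (\<forall>j. f ` hpart A j <= hpart B (i + j))"
 by (simp add: sHom_def)

lemma lin_sHom: assumes "supermodule K A" "lin K A B i f" shows "restrict f (carrier A) \<in> hpart (sHom K A B) i"
proof -
 interpret A: supermodule K A by fact
 show ?thesis unfolding sHom_hpart sHom_carrier using linD[OF assms(2)] A.MG.hpc by (auto simp: A.scale_closed)
qed

lemma sHom_lin: assumes "f \<in> hpart (sHom K A B) i" shows "lin K A B i f"
 using assms unfolding sHom_hpart sHom_carrier lin_def amap_def by (auto simp: image_subset_iff)

text \<open>No grading of \<open>sHom\<close> is needed: the components are determined pointwise on homogeneous elements.\<close>

lemma hcomp_sHom: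
 assumes A: "supermodule K A" and B: "supermodule K B" and G: "lin K A B 0 G0" "lin K A B 1 G1"
  and e: "G \<in> extensional (carrier A)" "!!v. v \<in>. A ==> G v = G0 v \<oplus>\<^sub>B G1 v"
 shows "hcomp (sHom K A B) i G = restrict (if i = 0 then G0 else G1) (carrier A)"
proof -
 interpret A: supermodule K A by fact
 interpret B: supermodule K B by fact
 define H where "H = (%i::bit. if i = 0 then G0 else G1)"
 have l: "lin K A B i (H i)" for i using G by (cases i) (auto simp: H_def)
 have Gi: "G v = H i v \<oplus>\<^sub>B H (i + 1) v" if "v \<in>. A" for i v
  using e(2)[OF that] linc[OF G(1) that] linc[OF G(2) that] by (cases i) (simp_all add: H_def B.M.a_comm)
 have G': "G = restrict (H i) (carrier A) \<oplus>\<^sub>(sHom K A B) restrict (H (i + 1)) (carrier A)" for i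
  unfolding sHom_add by (rule extensionalityI[OF e(1), of "\<lambda>x \<in> carrier A. restrict (H i) (carrier A) x \<oplus>\<^sub>B restrict (H (i + 1)) (carrier A) x"]) (simp_all add: Gi[of _ i])
 show ?thesis unfolding hcomp_def H_def[symmetric]
 proof (rule the_equality)
  show "restrict (if i = 0 then G0 else G1) (carrier A) \<in> hpart (sHom K A B) i \<and> (\<exists>z\<in>hpart (sHom K A B) (i + 1). G = restrict (if i = 0 then G0 else G1) (carrier A) \<oplus>\<^sub>(sHom K A B) z)"
   using lin_sHom[OF A l[of i]] lin_sHom[OF A l[of "i + 1"]] G'[of i] unfolding H_def by blast
  fix y assume "y \<in> hpart (sHom K A B) i \<and> (\<exists>z\<in>hpart (sHom K A B) (i + 1). G = y \<oplus>\<^sub>(sHom K A B) z)"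
  then obtain z where y: "y \<in> hpart (sHom K A B) i" and z: "z \<in> hpart (sHom K A B) (i + 1)" and Gy: "G = y \<oplus>\<^sub>(sHom K A B) z" by blast
  note ly = sHom_lin[OF y] and lz = sHom_lin[OF z]
  have "y = restrict (H i) (carrier A)"
  proof (rule extensionalityI[of _ "carrier A"])
   show "y \<in> extensional (carrier A)" using y unfolding sHom_hpart sHom_carrier by (simp add: PiE_def)
   fix x assume x: "x \<in>. A"
   have "y x = H i x"
   proof (rule A.MG.amap_eqI[OF lin_amap[OF ly] lin_amap[OF l] _ x])
    fix j v assume v: "v \<in> hpart A j"
    note vc = A.MG.hpc[OF v]
    have "y v \<oplus>\<^sub>B z v = H i v \<oplus>\<^sub>B H (i + 1) v" using Gi[OF vc, of i] vc unfolding Gy sHom_add by simp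
    moreover have "z v \<in> hpart B ((i + j) + 1)" "H (i + 1) v \<in> hpart B ((i + j) + 1)" using lin_hp[OF lz v] lin_hp[OF l v, of "i + 1"] by (simp_all only: ac_simps)
    ultimately show "y v = H i v" using B.MG.hc_eq[OF lin_hp[OF ly v]] B.MG.hc_eq[OF lin_hp[OF l v, of i]] by metis
   qed
   then show "y x = restrict (H i) (carrier A) x" using x by simp
  qed simp
  then show "y = restrict (if i = 0 then G0 else G1) (carrier A)" unfolding H_def .
 qed
qed

context coalg begin

context
 fixes B F F0 F1 H H0 H1
 assumes B: "supermodule K B" and F: "lin K A B 0 F0" "lin K A B 1 F1" and H: "lin K A B 0 H0" "lin K A B 1 H1"
  and Fe: "!!v. v \<in>. A ==> F v = F0 v \<oplus>\<^sub>B F1 v"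
  and He: "H \<in> extensional (carrier A)" "!!v. v \<in>. A ==> H v = H0 v \<oplus>\<^sub>B H1 v"
begin

interpretation B: supermodule K B by (rule B)
interpretation tB: tens K B B ..
interpretation TB: supermodule K "tensor K B B" by (rule tB.T_supermodule)

text \<open>Reduces \<open>tensor_map\<close> of inhomogeneous maps to convolutions. Its definition
  splits v and H by parity, and the sign depends on the component of H and of v only; regrouped, it
  is the \<open>tw\<close> in \<open>conv\<close>.\<close>

lemma tensor_map_conv: assumes x: "x \<in>. A"
 shows "tensor_map K A A B B F H (D x) =
   (conv (tensor K B B) (pure K B B) F0 H0 0 x \<oplus>\<^sub>(tensor K B B) conv (tensor K B B) (pure K B B) F1 H0 0 x) \<oplus>\<^sub>(tensor K B B)
   (conv (tensor K B B) (pure K B B) F0 H1 1 x \<oplus>\<^sub>(tensor K B B) conv (tensor K B B) (pure K B B) F1 H1 1 x)"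
proof -
 note bx = B B tB.T_supermodule tB.pu_bil
 note b = conv_balanced[OF bx]
 let ?b = "%f h d v w. tB.pu (f (AT.MG.tw d v)) (h w)"
 have "tensor_map K A A B B F H = tensor_lift K A A (tensor K B B) (%v w. (?b F0 H0 0 v w \<oplus>\<^sub>(tensor K B B) ?b F1 H0 0 v w) \<oplus>\<^sub>(tensor K B B) (?b F0 H1 1 v w \<oplus>\<^sub>(tensor K B B) ?b F1 H1 1 v w))"
  unfolding tensor_map_def
 proof (rule AT.tensor_lift_cong)
  fix v w assume v: "v \<in>. A" and w: "w \<in>. A"
  note h = hcomp_sHom[OF AT.smx B H He]
  note [simp] = AT.MG.hc_closed[OF v] v w
  have v01: "hcomp A 0 v \<oplus>\<^sub>A hcomp A 1 v = v" by (rule AT.MG.hc_sum[OF v])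
  have t1: "f (AT.MG.tw 1 v) = f (hcomp A 0 v) \<oplus>\<^sub>B sg B 1 (f (hcomp A 1 v))" if "lin K A B i f" for f i
   unfolding AT.MG.tw_def using amap_sg[OF lin_amap[OF that] A.ag B.M.ag, of "hcomp A 1 v" 1]
   by (simp add: lin_add[OF that])
  have t0: "f v = f (hcomp A 0 v) \<oplus>\<^sub>B f (hcomp A 1 v)" if "lin K A B i f" for f i
   using lin_add[OF that, of "hcomp A 0 v" "hcomp A 1 v"] by (simp add: v01)
  have fc: "F0 (hcomp A i v) \<in>. B" "F1 (hcomp A i v) \<in>. B" "H0 w \<in>. B" "H1 w \<in>. B" for i
   by (simp_all add: linc[OF F(1)] linc[OF F(2)] linc[OF H(1)] linc[OF H(2)])
  note pa = ama[OF tB.pu_amap1]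
  have Tn: "tB.pu (\<ominus>\<^sub>B a) c = \<ominus>\<^sub>(tensor K B B) tB.pu a c" if "a \<in>. B" "c \<in>. B" for a c
   using tB.pu_sg1[OF that, of 1] by simp
  show "(\<Oplus>\<^sub>(tensor K B B) i\<in>{0, 1}. \<Oplus>\<^sub>(tensor K B B) j\<in>{0, 1}. sg (tensor K B B) (i * j) (tB.pu (F (hcomp A j v)) (hcomp (sHom K A B) i H w)))
   = (?b F0 H0 0 v w \<oplus>\<^sub>(tensor K B B) ?b F1 H0 0 v w) \<oplus>\<^sub>(tensor K B B) (?b F0 H1 1 v w \<oplus>\<^sub>(tensor K B B) ?b F1 H1 1 v w)"
   using fc by (simp add: h Fe TB.M.finsum_bit t1[OF F(1)] t1[OF F(2)] t0[OF F(1)] t0[OF F(2)] pa Tn TB.M.a_ac TB.M.minus_add)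
 qed
 then show ?thesis unfolding conv_def using x
  by (simp add: AT.lift_plus[OF TB.M.ag] balanced_plus[OF TB.M.ag] b[OF F(1) H(1)] b[OF F(1) H(2)] b[OF F(2) H(1)] b[OF F(2) H(2)])
qed

end

lemma mult_balanced: "balanced K A A A (%x y. x \<otimes>\<^sub>A y)"
 unfolding balanced_def
 by (auto intro!: AT.am_mult1 AT.am_mult2 amap_id simp: scale_\<eta> A.m_assoc AT.lscale_e)

lemma mult_conv: assumes f: "lin K A A df f" and h: "lin K A A d h" and x: "x \<in>. A"
 shows "tensor_lift K A A A (%x y. x \<otimes>\<^sub>A y) (conv AT.T AT.pu f h d x) = conv A (%x y. x \<otimes>\<^sub>A y) f h d x"
proof -
 note px = AT.smx AT.smx AT.T_supermodule AT.pu_bil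
 have mb: "bil K A A A (%x y. x \<otimes>\<^sub>A y)" unfolding bil_def using mult_balanced A_hp_mult by (auto simp: AT.scale_mult_r)
 show ?thesis unfolding conv_def[of AT.T]
  by (rule conv_ext[OF AT.smx AT.smx AT.smx mb f h amc[OF cx(1)[OF px f h] AT.lift_amap[OF mult_balanced A.ag]] x, symmetric])
    (simp add: cx(2)[OF px f h] AT.lift_pu[OF mult_balanced A.ag] linc[OF f] linc[OF h])
qed

end

context hl begin

definition PHS where "PHS a cs x = SC.PH (phs (hcomp g 0 a) 0 cs) 0 x \<oplus>\<^sub>S SC.PH (phs (hcomp g 1 a) 1 cs) 1 x"

lemma Phi_PHS:
 assumes a: "a \<in>. g" and cs: "ev (phi_coeff K N c)"
 shows "Phi K g N c a = restrict (PHS a (phi_coeff K N c)) (carrier S)"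
proof -
 let ?cs = "phi_coeff K N c"
 let ?l = "%i. phs (hcomp g i a) i ?cs"
 let ?G = "compose (carrier S) (sgen K g) (phi K g N c a)"
 note l = phs_lin[OF MG.hc_in[OF a] cs]
 have lg: "lin K S S i (%y. SC.gen (?l i y))" for i
 proof -
  have "lin K g S 0 SC.gen" unfolding lin_def using SC.gen_amap SC.gen_scale' SC.gen_hp by auto
  from lin_comp[OF l this] show ?thesis by simp
 qed
 interpret tS: tens K S S ..
 interpret TS: supermodule K "tensor K S S" by (rule SC.AT.T_supermodule)
 note sm = SC.AT.smx
 note px = sm sm SC.AT.T_supermodule SC.AT.pu_bil
 note l0 = lin_zero[OF sm]
 have pz: "SC.conv (tensor K S S) (pure K S S) (%x. \<zero>\<^sub>S) h d x = \<zero>\<^sub>(tensor K S S)" if "lin K S S d h" "x \<in>. S" for h d x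
  by (rule SC.conv_ext[OF px l0 that(1) amap_const0[OF TS.M.ag] that(2)])
    (auto simp: amap_zero[OF SC.AT.pu_amap1 SC.A.ag TS.M.ag] linc[OF that(1)])
 have tm: "tensor_map K S S S S (\<lambda>x \<in> carrier S. x) ?G (sym_comult K g x) = SC.conv (tensor K S S) (pure K S S) (%x. x) (%y. SC.gen (?l 0 y)) 0 x \<oplus>\<^sub>(tensor K S S) SC.conv (tensor K S S) (pure K S S) (%x. x) (%y. SC.gen (?l 1 y)) 1 x"
  if x: "x \<in>. S" for x
 proof -
  note c = SC.conv_closed[OF px lin_id lg x]
  show ?thesis
   by (subst SC.tensor_map_conv[OF sm lin_id l0 lg lg _ _ _ x])
     (use c in \<open>simp_all add: pz[OF lg x] compose_def phi_phs[OF a cs] phs2_def sgen_gen ama[OF SC.gen_amap] linc[OF l]\<close>)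
 qed
 have gmc: "SC.conv S (%x y. x \<otimes>\<^sub>S y) (%x. x) (%y. SC.gen (?l i y)) i x = SC.PH (?l i) i x" for i x
  unfolding SC.PH_def SC.conv_def ..
 show ?thesis
 proof (rule extensionalityI)
  show "Phi K g N c a \<in> extensional (carrier S)" by (simp add: Phi_def compose_def Let_def)
  fix x assume x: "x \<in>. S"
  have "Phi K g N c a x = tensor_lift K S S S (%x y. x \<otimes>\<^sub>S y) (tensor_map K S S S S (\<lambda>x \<in> carrier S. x) ?G (sym_comult K g x))"
   using x by (simp add: Phi_def compose_def Let_def)
  also have "... = SC.PH (?l 0) 0 x \<oplus>\<^sub>S SC.PH (?l 1) 1 x"
   unfolding tm[OF x] ama[OF SC.AT.lift_amap[OF SC.mult_balanced SC.A.ag] SC.conv_closed[OF px lin_id lg x] SC.conv_closed[OF px lin_id lg x]]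
    SC.mult_conv[OF lin_id lg x] gmc ..
  finally show "Phi K g N c a x = restrict (PHS a ?cs) (carrier S) x" using x by (simp add: PHS_def)
 qed simp
qed

end

section \<open>The length filtration\<close>

context walg begin

text \<open>Lengths are bounded strictly, so that \<open>fl 0\<close> is zero and inductions on the
  filtration can start there.\<close>

definition lw where "lw n t \<longleftrightarrow> t \<in>. FW \<and> (\<forall>p \<in> Poly_Mapping.keys t. length (fst p) < n)"
definition fl where "fl n = q ` {t. lw n t}"
definition part where "part n t = frag_extend (%p. if length (fst p) = n then fof p else 0) t"
text \<open>Combinations whose part of each length n can be rewritten in A by words shorter than n:
  the kernel of the map from words to the associated graded algebra of A. For A = U(g) it is an
  ideal containing the relations of S(g), hence contains all that vanishes in S(g). This replaces
  the Poincare-Birkhoff-Witt argument with a basis.\<close>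

definition Hf where "Hf = {t \<in> carrier FW. \<forall>n. q (part n t) \<in> fl n}"

lemma lw_diff: "[|lw n s; lw n t|] ==> lw n (s - t)"
 unfolding lw_def using keys_diff[of s t] by (auto intro: W.F_diff_closed)

lemma lw_0: "lw n 0" by (simp add: lw_def W.F_carr_iff)

lemma lw_mono: "[|lw n t; n \<le> m|] ==> lw m t"
 unfolding lw_def by fastforce

lemma lw_ex: assumes "t \<in>. FW" shows "\<exists>n. lw n t"
 using assms
proof (induction rule: W.F_induct)
 case zero then show ?case using lw_0 by blast
next
 case (diff x y)
 then obtain n m where "lw n x" "lw m y" by blast
 then have "lw (max n m) x" "lw (max n m) y" by (auto elim: lw_mono)
 from lw_diff[OF this] show ?case by blast
next
 case (of b) then show ?case by (intro exI[of _ "Suc (length (fst b))"]) (simp add: lw_def)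
qed

lemma fl_closed: "x \<in> fl n ==> x \<in>. A"
 unfolding fl_def lw_def using amapc[OF q_amap] by auto

lemma fl_zero: "\<zero>\<^sub>A \<in> fl n"
 unfolding fl_def using lw_0[of n] q_zero[symmetric] by blast

lemma fl_diff: assumes "x \<in> fl n" "y \<in> fl n" shows "x \<ominus>\<^sub>A y \<in> fl n"
proof -
 obtain s t where s: "lw n s" "lw n t" "x = q s" "y = q t" using assms unfolding fl_def by blast
 then have "x \<ominus>\<^sub>A y = q (s - t)" by (simp add: q_diff lw_def)
 then show ?thesis using lw_diff[OF s(1,2)] unfolding fl_def by blast
qed

lemma fl_neg: "x \<in> fl n ==> \<ominus>\<^sub>A x \<in> fl n"
 using fl_diff[OF fl_zero, of x n] fl_closed by (simp add: a_minus_def)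

lemma fl_add: "[|x \<in> fl n; y \<in> fl n|] ==> x \<oplus>\<^sub>A y \<in> fl n"
 using fl_diff[OF _ fl_neg, of x n y] fl_closed by (simp add: a_minus_def)

lemma fl_sg: "x \<in> fl n ==> sg A i x \<in> fl n" by (cases i) (auto intro: fl_neg)

lemma fl_mono: "[|x \<in> fl n; n \<le> m|] ==> x \<in> fl m"
 unfolding fl_def using lw_mono by blast

lemma fl_ex: "x \<in>. A ==> \<exists>n. x \<in> fl n"
 unfolding fl_def using q_surj lw_ex by fastforce

lemma fl_00: assumes "x \<in> fl 0" shows "x = \<zero>\<^sub>A"
proof -
 obtain t where t: "lw 0 t" "x = q t" using assms unfolding fl_def by blast
 have "Poly_Mapping.keys t = {}" using t(1) unfolding lw_def by blast
 then have "t = 0" by (simp only: keys_eq_empty)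
 then show ?thesis using t q_zero by simp
qed

lemma fl_of: "[|u \<in> LM; al \<in>. K; length u < n|] ==> q (fof (u, al)) \<in> fl n"
 unfolding fl_def by (rule imageI) (simp add: lw_def)

lemma lw_induct [consumes 1, case_names zero diff of]:
 assumes "lw n t" "P 0" "!!x y. [|lw n x; lw n y; P x; P y|] ==> P (x - y)"
  "!!u al. [|u \<in> LM; al \<in>. K; length u < n|] ==> P (fof (u, al))"
 shows "P t"
proof -
 let ?B = "{p \<in> WB. length (fst p) < n}"
 have lwB: "lw n t \<longleftrightarrow> Poly_Mapping.keys t <= ?B" for t unfolding lw_def W.F_carr_iff by auto
 have "Poly_Mapping.keys t <= ?B" using assms(1) lwB by blast
 then show ?thesis
 proof (induction rule: keys_induct)
  case zero show ?case by (rule assms(2))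
 next
  case (diff x y) then show ?case using assms(3) lwB by blast
 next
  case (of a) then show ?case using assms(4)[of "fst a" "snd a"] by (cases a) simp
 qed
qed

lemma fl_gen: assumes "X \<in>. M" "x \<in> fl n" shows "gen X \<otimes>\<^sub>A x \<in> fl (Suc n)"
proof -
 obtain t where t: "lw n t" "x = q t" using assms unfolding fl_def by blast
 have "gen X \<otimes>\<^sub>A q t \<in> fl (Suc n)" using t(1)
 proof (induction rule: lw_induct)
  case zero then show ?case using assms(1) fl_zero by (simp add: q_zero)
 next
  case (diff x y)
  then have c: "q x \<in>. A" "q y \<in>. A" using amapc[OF q_amap] by (auto simp: lw_def)
  then show ?case using diff assms(1) fl_diff[OF diff(3,4)] by (simp add: q_diff lw_def a_minus_def A.r_distr A.r_minus)
 next
  case (of u al) then show ?case using fl_of[of "X # u" al "Suc n"] assms(1) by (simp add: q_Cons)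
 qed
 then show ?thesis by (simp add: t)
qed

lemma fl_induct [consumes 1, case_names zero add \<eta> gen]:
 assumes "x \<in> fl n" "!!n. Q n \<zero>\<^sub>A" "!!n x y. [|x \<in> fl n; y \<in> fl n; Q n x; Q n y|] ==> Q n (x \<oplus>\<^sub>A y)"
  "!!n al. al \<in>. K ==> Q (Suc n) (\<eta> al)"
  "!!n X p x. [|X \<in> hpart M p; x \<in> fl n; Q n x|] ==> Q (Suc n) (gen X \<otimes>\<^sub>A x)"
 shows "Q n x"
proof -
 have w: "Q n (q (fof (u, al)))" if "u \<in> LM" "al \<in>. K" "length u < n" for u al n
  using that
 proof (induction u arbitrary: n rule: list.induct)
  case Nil then show ?case using assms(4)[OF that(2)] by (cases n) (auto simp: \<eta>_def)
 next
  case (Cons X u)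
  then obtain m where m: "n = Suc m" "length u < m" by (cases n) auto
  have s: "set (X # u) <= carrier M" using Cons.prems(1) by (simp only: lists_eq_set mem_Collect_eq)
  have X: "X \<in>. M" and u: "u \<in> LM" using s by (simp_all add: lists_eq_set)
  let ?y = "q (fof (u, al))"
  have y: "?y \<in> fl m" "Q m ?y" "?y \<in>. A" using fl_of[OF u that(2) m(2)] Cons(1)[OF u that(2) m(2)] u that(2) by auto
  have "gen X \<otimes>\<^sub>A ?y = gen (hcomp M 0 X) \<otimes>\<^sub>A ?y \<oplus>\<^sub>A gen (hcomp M 1 X) \<otimes>\<^sub>A ?y"
   using X y(3) ama[OF gen_amap, of "hcomp M 0 X" "hcomp M 1 X"] MG.hc_sum[OF X] by (simp add: A.l_distr[symmetric])
  then show ?case unfolding m(1) q_Cons[OF X u that(2)]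
   using assms(3)[OF fl_gen[OF MG.hc_closed[OF X] y(1)] fl_gen[OF MG.hc_closed[OF X] y(1)] assms(5)[OF MG.hc_in[OF X] y(1,2)] assms(5)[OF MG.hc_in[OF X] y(1,2)]] by simp
 qed
 obtain t where t: "lw n t" "x = q t" using assms(1) unfolding fl_def by blast
 have "Q n (q t) \<and> Q n (\<ominus>\<^sub>A q t)" using t(1)
 proof (induction rule: lw_induct)
  case zero then show ?case using assms(2) by (simp add: q_zero A.neg_zero)
 next
  case (diff x y)
  then have c: "q x \<in>. A" "q y \<in>. A" using amapc[OF q_amap] by (auto simp: lw_def)
  have f: "q x \<in> fl n" "q y \<in> fl n" using diff(1,2) unfolding fl_def by auto
  have "q (x - y) = q x \<oplus>\<^sub>A \<ominus>\<^sub>A q y" "\<ominus>\<^sub>A q (x - y) = \<ominus>\<^sub>A q x \<oplus>\<^sub>A q y" using diff(1,2) c by (simp_all add: q_diff lw_def a_minus_def A.minus_add)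
  then show ?case using assms(3)[of "q x" n "\<ominus>\<^sub>A q y"] assms(3)[of "\<ominus>\<^sub>A q x" n "q y"] f fl_neg diff(3,4) by simp
 next
  case (of u al)
  have "q (fof (u, \<ominus>\<^sub>K al)) \<oplus>\<^sub>A q (fof (u, al)) = q (fof (u, \<zero>\<^sub>K))"
   using q_rel3[OF word_rels1[of u "\<ominus>\<^sub>K al" al]] of by (simp add: l_neg)
  moreover have "q (fof (u, \<zero>\<^sub>K)) = \<zero>\<^sub>A"
   using q_rel3[OF word_rels1[of u "\<zero>\<^sub>K" "\<zero>\<^sub>K"]] of q_of_closed[of u "\<zero>\<^sub>K"] by (simp add: A.add.r_cancel_one')
  ultimately have "\<ominus>\<^sub>A q (fof (u, al)) = q (fof (u, \<ominus>\<^sub>K al))" using of by (intro A.minus_equality) auto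
  then show ?case using w of by simp
 qed
 then show ?thesis by (simp add: t)
qed

lemma part_amap: "amap FW FW (part n)"
 unfolding part_def by (rule W.F_extend_amap[OF W.fragg_axioms]) (auto simp: W.F_carr_iff)

lemma part_of: "part n (fof p) = (if length (fst p) = n then fof p else 0)"
 by (simp add: part_def)

lemma part_diff: "part n (x - y) = part n x - part n y"
 by (simp add: part_def frag_extend_diff)

lemma part_lw: "lw n s ==> part n s = 0"
 by (induction rule: lw_induct) (auto simp: part_diff part_of, simp add: part_def)

lemma part_rest: "lw (Suc n) t ==> lw n (t - part n t)"
proof (induction rule: lw_induct)
 case zero then show ?case by (simp add: part_def lw_0)
next
 case (diff x y)
 have e: "x - y - part n (x - y) = (x - part n x) - (y - part n y)" by (simp add: part_diff)
 show ?case unfolding e by (rule lw_diff[OF diff(3,4)])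
next
 case (of u al)
 then have "length u \<noteq> n ==> lw n (fof (u, al))" by (simp add: lw_def)
 then show ?case by (simp add: part_of lw_0)
qed

lemma wm_length: "length (fst (wm p r)) = length (fst p) + length (fst r)"
 by (cases "(K, M, p, r)" rule: word_mult.cases) auto

lemma part_mult1: "t \<in>. FW ==> part n (fof w \<otimes>\<^sub>FW t) = (if length (fst w) \<le> n then fof w \<otimes>\<^sub>FW part (n - length (fst w)) t else 0)"
 by (induction rule: W.F_induct) (auto simp: FW_mult part_def frag_extend_diff wm_length)

lemma part_mult2: "t \<in>. FW ==> part n (t \<otimes>\<^sub>FW fof w) = (if length (fst w) \<le> n then part (n - length (fst w)) t \<otimes>\<^sub>FW fof w else 0)"
 by (induction rule: W.F_induct) (auto simp: FW_mult part_def frag_extend_diff wm_length)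

lemma lw_mult: assumes w: "w \<in> WB" and t: "lw n t"
 shows "lw (length (fst w) + n) (fof w \<otimes>\<^sub>FW t)" "lw (length (fst w) + n) (t \<otimes>\<^sub>FW fof w)"
proof -
 have tc: "t \<in>. FW" using t by (simp add: lw_def)
 have "fof w \<otimes>\<^sub>FW t \<in>. FW" "t \<otimes>\<^sub>FW fof w \<in>. FW"
  using amapc[OF FW_amapL tc] amapc[OF FW_amapR tc] w by auto
 then show "lw (length (fst w) + n) (fof w \<otimes>\<^sub>FW t)" "lw (length (fst w) + n) (t \<otimes>\<^sub>FW fof w)"
  using t keys_frag_extend[of "%r. fof (wm w r)" t] keys_frag_extend[of "%r. fof (wm r w)" t]
  unfolding lw_def by (fastforce simp: FW_mult wm_length)+
qed

lemma fl_mult: assumes w: "w \<in> WB" and t: "t \<in>. FW" "q t \<in> fl n"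
 shows "q (fof w \<otimes>\<^sub>FW t) \<in> fl (length (fst w) + n)" "q (t \<otimes>\<^sub>FW fof w) \<in> fl (length (fst w) + n)"
proof -
 obtain s where s: "lw n s" "q t = q s" using t(2) unfolding fl_def by blast
 have wc: "fof w \<in>. FW" using w by simp
 have "q (fof w \<otimes>\<^sub>FW t) = q (fof w \<otimes>\<^sub>FW s)" "q (t \<otimes>\<^sub>FW fof w) = q (s \<otimes>\<^sub>FW fof w)"
  using s t(1) wc by (simp_all add: q_mult lw_def)
 then show "q (fof w \<otimes>\<^sub>FW t) \<in> fl (length (fst w) + n)" "q (t \<otimes>\<^sub>FW fof w) \<in> fl (length (fst w) + n)"
  using lw_mult[OF w s(1)] unfolding fl_def by auto
qed

lemma Hf_diff: assumes "x \<in> Hf" "y \<in> Hf" shows "x - y \<in> Hf"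
 using assms fl_diff amapc[OF part_amap] unfolding Hf_def
 by (auto simp: part_diff q_diff intro: W.F_diff_closed)

lemma Hf_0: "0 \<in> Hf"
 by (simp add: Hf_def W.F_carr_iff part_def q_zero fl_zero)

text \<open>Multiplication by a single word shifts all lengths by the same amount, so it commutes
  with taking parts up to that shift.\<close>

lemma Hf_ideal: "ideal Hf FW"
proof (rule idealI[OF FW_ring])
 have neg: "- x \<in> Hf" if "x \<in> Hf" for x using Hf_diff[OF Hf_0 that] by simp
 have sub: "Hf <= carrier FW" unfolding Hf_def by blast
 have "additive_subgroup Hf FW"
 proof (rule additive_subgroupI'[OF W.F_group sub])
  show "\<zero>\<^sub>FW \<in> Hf" using Hf_0 by (simp add: W.F_zero)
  fix x y assume x: "x \<in> Hf" and y: "y \<in> Hf"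
  show "x \<oplus>\<^sub>FW y \<in> Hf" using Hf_diff[OF x neg[OF y]] by (simp add: W.F_plus)
 next
  fix x assume x: "x \<in> Hf" then show "\<ominus>\<^sub>FW x \<in> Hf" using neg[OF x] sub by (simp add: W.F_neg subset_iff)
 qed
 then show "subgroup Hf (add_monoid FW)" by (rule additive_subgroup.a_subgroup)
 fix t x assume t: "t \<in> Hf" and x: "x \<in>. FW"
 have tc: "t \<in>. FW" using t sub by blast
 have pc: "part n t \<in>. FW" for n by (rule amapc[OF part_amap tc])
 have pf: "q (part n t) \<in> fl n" for n using t unfolding Hf_def by blast
 show "x \<otimes>\<^sub>FW t \<in> Hf" using x
 proof (induction rule: W.F_induct)
  case zero then show ?case using Hf_0 by (simp add: FW_mult)
 next
  case (diff x y) then show ?case using Hf_diff by (simp add: FW_mult frag_extend_diff)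
 next
  case (of w)
  have "q (part n (fof w \<otimes>\<^sub>FW t)) \<in> fl n" for n
   using fl_mult(1)[OF of pc pf, of "n - length (fst w)"] by (cases "length (fst w) \<le> n") (simp_all add: part_mult1[OF tc] q_zero fl_zero)
  then show ?case using amapc[OF FW_amapL tc, of "fof w"] of by (simp add: Hf_def)
 qed
 show "t \<otimes>\<^sub>FW x \<in> Hf" using x
 proof (induction rule: W.F_induct)
  case zero then show ?case using Hf_0 W.F_amap_zero[OF FW_amapL[OF tc] W.F_group] by (simp add: W.F_zero)
 next
  case (diff x y) then show ?case using Hf_diff W.F_amap_diff[OF FW_amapL[OF tc] W.F_group diff(1,2)] amapc[OF FW_amapL[OF tc]] by (simp add: W.F_minus)
 next
  case (of w)
  have "q (part n (t \<otimes>\<^sub>FW fof w)) \<in> fl n" for n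
   using fl_mult(2)[OF of pc pf, of "n - length (fst w)"] by (cases "length (fst w) \<le> n") (simp_all add: part_mult2[OF tc] q_zero fl_zero)
  then show ?case using amapc[OF FW_amapR tc, of "fof w"] amapc[OF FW_amapL[OF tc], of "fof w"] of by (simp add: Hf_def)
 qed
qed

lemma Hf_homog: assumes "t \<in>. FW" "!!n. part n t = (if n = k then t else 0)" "q t \<in> fl k" shows "t \<in> Hf"
 unfolding Hf_def using assms by (simp add: q_zero fl_zero)

text \<open>Each relation of the tensor algebra is homogeneous in the length, and its image in A is
  zero.\<close>

lemma Hf_rels: "WR <= Hf"
proof
 fix r assume r: "r \<in> WR"
 have rc: "r \<in>. FW" using r word_rels_sub by blast
 have z: "q r \<in> fl k" for k using q_rels[OF r] fl_zero by simp
 show "r \<in> Hf" using r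
 proof (cases rule: word_rels_cases)
  case (1 u al ga) then show ?thesis by (intro Hf_homog[OF rc _ z[of "length u"]]) (auto simp: part_diff part_of)
 next
  case (2 u v X Y al) then show ?thesis by (intro Hf_homog[OF rc _ z[of "Suc (length u + length v)"]]) (auto simp: part_diff part_of)
 next
  case (3 u v X Y al ga) then show ?thesis by (intro Hf_homog[OF rc _ z[of "Suc (Suc (length u + length v))"]]) (auto simp: part_diff part_of)
 next
  case (4 u X al ga) then show ?thesis by (intro Hf_homog[OF rc _ z[of "Suc (length u)"]]) (auto simp: part_diff part_of)
 qed
qed

end

section \<open>The endomorphism superalgebra; linearity of the operators in a\<close>

context supermodule begin

lemma lscale_lin: "al \<in> hpart K i ==> lin K M M i (lscale K M al)"
 unfolding lin_def using KG.hpc lscale_amap1 lscale_hp by (auto simp: lscale_scale)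

lemma sEnd_simps:
 "carrier (sEnd K M) = carrier (sHom K M M)" "F \<otimes>\<^sub>(sEnd K M) H = compose (carrier M) F H"
 "\<one>\<^sub>(sEnd K M) = (\<lambda>x \<in> carrier M. x)" "\<zero>\<^sub>(sEnd K M) = (\<lambda>x \<in> carrier M. \<zero>\<^sub>M)"
 "F \<oplus>\<^sub>(sEnd K M) H = (\<lambda>x \<in> carrier M. F x \<oplus>\<^sub>M H x)" "hpart (sEnd K M) i = hpart (sHom K M M) i"
 "F \<bullet>\<^sub>(sEnd K M) al = (\<lambda>x \<in> carrier M. F (lscale K M al x))"
 by (simp_all add: sEnd_def sHom_def)

lemma sHomD: assumes "F \<in>. (sHom K M M)"
 shows "x \<in>. M ==> F x \<in>. M" "[|x \<in>. M; y \<in>. M|] ==> F (x \<oplus>\<^sub>M y) = F x \<oplus>\<^sub>M F y"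
  "[|x \<in>. M; al \<in>. K|] ==> F (x \<bullet>\<^sub>M al) = F x \<bullet>\<^sub>M al" "F \<in> extensional (carrier M)"
 using assms unfolding sHom_carrier by (auto simp: PiE_def)

lemma sHomI: assumes "!!x. x \<in>. M ==> F x \<in>. M" "!!x y. [|x \<in>. M; y \<in>. M|] ==> F (x \<oplus>\<^sub>M y) = F x \<oplus>\<^sub>M F y"
  "!!x al. [|x \<in>. M; al \<in>. K|] ==> F (x \<bullet>\<^sub>M al) = F x \<bullet>\<^sub>M al"
 shows "restrict F (carrier M) \<in>. (sHom K M M)"
 unfolding sHom_carrier using assms by (auto simp: scale_closed)

lemma sHom_eqI: "[|F \<in> extensional (carrier M); H \<in> extensional (carrier M); !!x. x \<in>. M ==> F x = H x|] ==> F = H"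
 by (rule extensionalityI)

lemma sEnd_ring: "ring (sEnd K M)"
proof (rule ringI)
 note D = sHomD
 have cl: "(\<lambda>x \<in> carrier M. F x \<oplus>\<^sub>M H x) \<in>. (sHom K M M)" if "F \<in>. (sHom K M M)" "H \<in>. (sHom K M M)" for F H
  by (rule sHomI) (simp_all add: D[OF that(1)] D[OF that(2)] M.add4 scale_add_left)
 have z: "(\<lambda>x \<in> carrier M. \<zero>\<^sub>M) \<in>. (sHom K M M)" by (rule sHomI) simp_all
 have n: "(\<lambda>x \<in> carrier M. \<ominus>\<^sub>M F x) \<in>. (sHom K M M)" if "F \<in>. (sHom K M M)" for F
  by (rule sHomI) (simp_all add: D[OF that] M.minus_add scale_neg1)
 have co: "compose (carrier M) F H \<in>. (sHom K M M)" if "F \<in>. (sHom K M M)" "H \<in>. (sHom K M M)" for F H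
  unfolding compose_def by (rule sHomI) (simp_all add: D[OF that(1)] D[OF that(2)])
 have o: "(\<lambda>x \<in> carrier M. x) \<in>. (sHom K M M)" by (rule sHomI) simp_all
 show "abelian_group (sEnd K M)"
 proof (rule abelian_groupI)
  fix F H J assume "F \<in>. (sEnd K M)" "H \<in>. (sEnd K M)" "J \<in>. (sEnd K M)"
  then have d: "F \<in>. (sHom K M M)" "H \<in>. (sHom K M M)" "J \<in>. (sHom K M M)" by (simp_all add: sEnd_simps)
  show "F \<oplus>\<^sub>(sEnd K M) H \<oplus>\<^sub>(sEnd K M) J = F \<oplus>\<^sub>(sEnd K M) (H \<oplus>\<^sub>(sEnd K M) J)"
   by (rule sHom_eqI) (simp_all add: sEnd_simps D(1)[OF d(1)] D(1)[OF d(2)] D(1)[OF d(3)] M.a_assoc)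
  show "F \<oplus>\<^sub>(sEnd K M) H = H \<oplus>\<^sub>(sEnd K M) F"
   by (rule sHom_eqI) (simp_all add: sEnd_simps D(1)[OF d(1)] D(1)[OF d(2)] M.a_comm)
  show "\<zero>\<^sub>(sEnd K M) \<oplus>\<^sub>(sEnd K M) F = F"
   by (rule sHom_eqI) (simp_all add: sEnd_simps D[OF d(1)])
  show "\<exists>H\<in>carrier (sEnd K M). H \<oplus>\<^sub>(sEnd K M) F = \<zero>\<^sub>(sEnd K M)"
   by (rule bexI[of _ "\<lambda>x \<in> carrier M. \<ominus>\<^sub>M F x"], rule sHom_eqI) (simp_all add: sEnd_simps D(1)[OF d(1)] M.l_neg n[OF d(1)])
 qed (simp_all add: sEnd_simps cl z)
 show "monoid (sEnd K M)"
 proof (rule monoidI)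
  fix F H J assume "F \<in>. (sEnd K M)" "H \<in>. (sEnd K M)" "J \<in>. (sEnd K M)"
  then have d: "F \<in>. (sHom K M M)" "H \<in>. (sHom K M M)" "J \<in>. (sHom K M M)" by (simp_all add: sEnd_simps)
  show "F \<otimes>\<^sub>(sEnd K M) H \<otimes>\<^sub>(sEnd K M) J = F \<otimes>\<^sub>(sEnd K M) (H \<otimes>\<^sub>(sEnd K M) J)"
   by (rule sHom_eqI) (simp_all add: sEnd_simps compose_def D(1)[OF d(3)])
  show "\<one>\<^sub>(sEnd K M) \<otimes>\<^sub>(sEnd K M) F = F" by (rule sHom_eqI) (simp_all add: sEnd_simps compose_def D[OF d(1)])
  show "F \<otimes>\<^sub>(sEnd K M) \<one>\<^sub>(sEnd K M) = F" by (rule sHom_eqI) (simp_all add: sEnd_simps compose_def D[OF d(1)])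
 qed (simp_all add: sEnd_simps co o)
 fix F H J assume "F \<in>. (sEnd K M)" "H \<in>. (sEnd K M)" "J \<in>. (sEnd K M)"
 then have d: "F \<in>. (sHom K M M)" "H \<in>. (sHom K M M)" "J \<in>. (sHom K M M)" by (simp_all add: sEnd_simps)
 show "(F \<oplus>\<^sub>(sEnd K M) H) \<otimes>\<^sub>(sEnd K M) J = F \<otimes>\<^sub>(sEnd K M) J \<oplus>\<^sub>(sEnd K M) H \<otimes>\<^sub>(sEnd K M) J"
  by (rule sHom_eqI) (simp_all add: sEnd_simps compose_def D(1)[OF d(3)])
 show "J \<otimes>\<^sub>(sEnd K M) (F \<oplus>\<^sub>(sEnd K M) H) = J \<otimes>\<^sub>(sEnd K M) F \<oplus>\<^sub>(sEnd K M) J \<otimes>\<^sub>(sEnd K M) H"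
  by (rule sHom_eqI) (simp_all add: sEnd_simps compose_def D(1)[OF d(1)] D(1)[OF d(2)] D(2)[OF d(3)])
qed

end

text \<open>Left multiplication of the argument by a scalar can be performed on the second tensor
  factor instead. The sign for crossing the first factor is what \<open>tw\<close> gains when the
  parity index grows from d to d + i.\<close>

lemma (in coalg) conv_lscale:
 assumes B1: "supermodule K B1" and B2: "supermodule K B2" and P: "supermodule K P" and B: "bil K B1 B2 P B"
  and "x \<in>. A" "lin K A B1 df f" "lin K A B2 d h" and al: "al \<in> hpart K i"
 shows "conv P B f (%y. h (lscale K A al y)) (d + i) x = conv P B f h d (lscale K A al x)"
 using assms(5-7)
proof (induction x arbitrary: f df h d rule: A_induct)
 interpret P: supermodule K P by fact
 note bx = B1 B2 P B and a = KG.hpc[OF al]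
 note lal = AT.lscale_lin[OF al]
 {
  case (\<eta> j ga)
  note c = KG.hpc[OF \<eta>(1)]
  have hl: "lin K A B2 (d + i) (%y. h (lscale K A al y))" using lin_comp[OF lal \<eta>(3)] by (simp add: add.commute)
  have e: "lscale K A al (\<eta> ga) = \<eta> (al \<otimes>\<^sub>K ga)" using a c by (simp add: AT.lscale_e[symmetric] ring_hom_mult[OF \<eta>_hom])
  have o: "lscale K A al \<one>\<^sub>A = \<one>\<^sub>A \<bullet>\<^sub>A al" using a by (simp add: lscale_one_A one_scale_A)
  have cc: "f \<one>\<^sub>A \<in>. B1" "h \<one>\<^sub>A \<in>. B2" using linc[OF \<eta>(2)] linc[OF \<eta>(3)] by auto
  show ?case unfolding conv_\<eta>[OF bx \<eta>(2) hl c] e using a c cc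
   by (simp add: conv_\<eta>[OF bx \<eta>(2,3)] o lin_scale[OF \<eta>(3)] bil_scale[OF B] P.scale_mult bil_closed[OF B])
 next
  case (gen p X x)
  note f = gen(4) and h = gen(5) and X = gen(1) and x = gen(2)
  note fX = LX_comp[OF f X] and hX = LX_comp[OF h X]
  have hl: "lin K A B2 (d + i) (%y. h (lscale K A al y))" using lin_comp[OF lal h] by (simp add: add.commute)
  have hXl: "lin K A B2 (d + p + i) (%y. h (LX X (lscale K A al y)))" using lin_comp[OF lal hX] by (simp add: add.commute)
  have sw: "lscale K A al (LX X y) = sg A (i * p) (LX X (lscale K A al y))" if "y \<in>. A" for y
   using lin_lscale[OF AT.smx AT.smx LX_lin[OF X] al that] a that MG.hpc[OF X] by (simp add: A.sg_sg)
  have xl: "lscale K A al x \<in>. A" using a x by simp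
  note am = conv_amap[OF bx f h]
  have 1: "conv P B f (%y. h (lscale K A al (LX X y))) (d + i + p) x = sg P (i * p) (conv P B f (%y. h (LX X (lscale K A al y))) (d + p + i) x)"
  proof -
   have "conv P B f (%y. h (lscale K A al (LX X y))) (d + i + p) x = conv P B f (%y. sg B2 (i * p) (h (LX X (lscale K A al y)))) (d + p + i) x"
    unfolding add.assoc add.commute[of i p] using a MG.hpc[OF X]
    by (intro conv_cong) (simp_all add: sw amap_sg[OF lin_amap[OF h] A.ag supermodule.axioms(2)[OF B2]])
   then show ?thesis by (simp only: conv_sg2[OF bx f hXl x])
  qed
  note c = conv_closed[OF bx fX hl x] conv_closed[OF bx f hXl x]
  show ?case unfolding conv_gen[OF bx f hl X x] 1 sw[OF x] amap_sg[OF am A.ag P.M.ag A.m_closed[OF gen_closed[OF MG.hpc[OF X]] xl]]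
    conv_gen[OF bx f h X xl] gen(3)[OF fX h, symmetric] gen(3)[OF f hX, symmetric]
   using c by (cases i; cases p; cases d) (simp_all add: P.M.minus_add)
 next
  case (add x y)
  have hl: "lin K A B2 (d + i) (%y. h (lscale K A al y))" using lin_comp[OF lal add(6)] by (simp add: add.commute)
  show ?case using add(1,2) a
   by (simp add: ama[OF conv_amap[OF bx add(5) hl]] ama[OF conv_amap[OF bx add(5,6)]] ama[OF AT.lscale_amap1] add(3)[OF add(5,6)] add(4)[OF add(5,6)])
 }
qed

context hl begin

lemma ep_lscale: assumes "al \<in> hpart K i" "y \<in>. S" shows "SW.ep (lscale K S al y) = al \<otimes>\<^sub>K SW.ep y"
proof -
 note a = KG.hpc[OF assms(1)]
 show ?thesis
 proof (rule SC.AT.MG.amap_eqI[OF amc[OF SC.AT.lscale_amap1[OF a] SW.ep_amap] amc[OF SW.ep_amap ring_amapL[OF ring_axioms a]] _ assms(2)])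
  fix j y assume y: "y \<in> hpart S j"
  note yc = SC.AT.MG.hpc[OF y]
  have "SW.ep (lscale K S al y) = sg K (i * j) (SW.ep y \<otimes>\<^sub>K al)" using yc a
   by (simp add: SC.AT.lscale_homog2[OF assms(1) y] amap_sg[OF SW.ep_amap SC.A.ag ag] SC.AT.scale_closed SW.ep_simps(3))
  then show "SW.ep (lscale K S al y) = al \<otimes>\<^sub>K SW.ep y" using supercomm[OF assms(1) SW.ep_hp[OF y]] by simp
 qed
qed

text \<open>At the bottom, (a al) \<epsilon>(y) = a \<epsilon>(al y), and
  \<open>SC.conv_lscale\<close> carries this through each bracket with x. Scaling a thus amounts to
  composing with left multiplication, as in the module structure of \<open>sEnd\<close>.\<close>

lemma psi_scale: assumes a: "a \<in> hpart g p" and al: "al \<in> hpart K i" and y: "y \<in>. S"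
 shows "psi (a \<bullet> al) (p + i) n y = psi a p n (lscale K S al y)"
 using y
proof (induction n arbitrary: y)
 case 0 then show ?case using MG.hpc[OF a] KG.hpc[OF al] by (simp add: SW.const_def ep_lscale[OF al] scale_mult)
next
 case (Suc n)
 have "psi (a \<bullet> al) (p + i) (Suc n) y = AD (%y. psi a p n (lscale K S al y)) (p + i) y"
  by (simp, rule SC.conv_cong[OF refl Suc(1)])
 then show ?case using SC.conv_lscale[OF bx Suc(2) SW.xx_lin psi_lin[OF a] al] by simp
qed

lemma psi_add: assumes a: "a \<in> hpart g p" "b \<in> hpart g p" and y: "y \<in>. S"
 shows "psi (a \<oplus> b) p n y = psi a p n y \<oplus> psi b p n y"
 using y
proof (induction n arbitrary: y)
 case 0 then show ?case using MG.hpc[OF a(1)] MG.hpc[OF a(2)] by (simp add: SW.const_def scale_add_left)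
next
 case (Suc n)
 have "psi (a \<oplus> b) p (Suc n) y = AD (%y. psi a p n y \<oplus> psi b p n y) p y"
  by (simp, rule SC.conv_cong[OF refl Suc(1)])
 then show ?case using SC.conv_plus2[OF bx SW.xx_lin psi_lin[OF a(1)] psi_lin[OF a(2)] Suc(2)] by simp
qed

lemma phs_scale: assumes "a \<in> hpart g p" "al \<in> hpart K i" "y \<in>. S"
 shows "phs (a \<bullet> al) (p + i) cs y = phs a p cs (lscale K S al y)"
proof -
 have "psm (a \<bullet> al) (p + i) cs n y = psm a p cs n (lscale K S al y)" for n
  by (induction n) (simp_all only: psm.simps psi_scale[OF assms])
 then show ?thesis unfolding phs_def psi_scale[OF assms] .
qed

lemma phs_add: assumes "a \<in> hpart g p" "b \<in> hpart g p" "ev cs" "y \<in>. S"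
 shows "phs (a \<oplus> b) p cs y = phs a p cs y \<oplus> phs b p cs y"
proof (rule word_eqI[OF lin_amap[OF phs_lin[OF MG.hp_add[OF assms(1,2)] assms(3)]] lin_amap[OF lin_plus[OF smx phs_lin[OF assms(1,3)] phs_lin[OF assms(2,3)]]] assms(4)])
 fix n y assume y: "y \<in> Wd n"
 note yc = Wd_closed[OF y]
 show "phs (a \<oplus> b) p cs y = phs a p cs y \<oplus> phs b p cs y"
  unfolding phs_Wd(1)[OF assms(1,3) y] phs_Wd(1)[OF assms(2,3) y] phs_Wd(1)[OF MG.hp_add[OF assms(1,2)] assms(3) y] psi_add[OF assms(1,2) yc]
  by (rule scale_add_left[OF linc[OF psi_lin[OF assms(1)] yc] linc[OF psi_lin[OF assms(2)] yc] evD(2)[OF assms(3)]])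
qed

lemma PHp_add: assumes "a \<in> hpart g p" "b \<in> hpart g p" "ev cs" "y \<in>. S"
 shows "SC.PH (phs (a \<oplus> b) p cs) p y = SC.PH (phs a p cs) p y \<oplus>\<^sub>S SC.PH (phs b p cs) p y"
proof -
 have "SC.PH (phs (a \<oplus> b) p cs) p y = SC.PH (%y. phs a p cs y \<oplus> phs b p cs y) p y"
  unfolding SC.PH_def by (rule SC.conv_cong[OF refl phs_add[OF assms(1-3)]])
 then show ?thesis using PH_plus[OF phs_lin[OF assms(1,3)] phs_lin[OF assms(2,3)] assms(4)] by simp
qed

lemma PHp_scale: assumes "a \<in> hpart g p" "al \<in> hpart K i" "ev cs" "y \<in>. S"
 shows "SC.PH (phs (a \<bullet> al) (p + i) cs) (p + i) y = SC.PH (phs a p cs) p (lscale K S al y)"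
proof -
 have "SC.PH (phs (a \<bullet> al) (p + i) cs) (p + i) y = SC.PH (%y. phs a p cs (lscale K S al y)) (p + i) y"
  unfolding SC.PH_def by (rule SC.conv_cong[OF refl phs_scale[OF assms(1,2)]])
 then show ?thesis unfolding SC.PH_def using SC.conv_lscale[OF SC.gmx assms(4) lin_id phs_lin[OF assms(1,3)] assms(2)] by simp
qed

lemma PHp_zero: assumes "ev cs" "y \<in>. S" shows "SC.PH (phs \<zero> p cs) p y = \<zero>\<^sub>S"
 using PHp_add[OF MG.hp_zero MG.hp_zero assms, of p] linc[OF SC.PH_lin[OF phs_lin[OF MG.hp_zero assms(1)]] assms(2)]
 by (simp add: SC.A.add.l_cancel_one')

lemma PHS_homog: assumes "a \<in> hpart g p" "ev cs" "y \<in>. S" shows "PHS a cs y = SC.PH (phs a p cs) p y"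
 using linc[OF SC.PH_lin[OF phs_lin[OF assms(1,2)]] assms(3)]
 by (cases p) (simp_all add: PHS_def MG.hc_homog[OF assms(1)] PHp_zero[OF assms(2,3)])

lemma PHS_add: assumes "a \<in>. g" "b \<in>. g" "ev cs" "y \<in>. S"
 shows "PHS (a \<oplus> b) cs y = PHS a cs y \<oplus>\<^sub>S PHS b cs y"
proof -
 have c: "SC.PH (phs (hcomp g i a) i cs) i y \<in>. S" if "a \<in>. g" for i a
  by (rule linc[OF SC.PH_lin[OF phs_lin[OF MG.hc_in[OF that] assms(3)]] assms(4)])
 show ?thesis unfolding PHS_def MG.hc_add[OF assms(1,2)] PHp_add[OF MG.hc_in[OF assms(1)] MG.hc_in[OF assms(2)] assms(3,4)]
  by (rule SC.A.add4[OF c c c c]) (rule assms)+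
qed

end

section \<open>The symbol map\<close>

context supermodule begin

lemma sEnd_sg: assumes "F \<in>. (sHom K M M)" "x \<in>. M" shows "sg (sEnd K M) i F x = sg M i (F x)"
proof -
 interpret R: ring "sEnd K M" by (rule sEnd_ring)
 have c: "F \<in>. (sEnd K M)" using assms(1) by (simp add: sEnd_simps)
 have "(\<ominus>\<^sub>(sEnd K M) F \<oplus>\<^sub>(sEnd K M) F) x = \<zero>\<^sub>M" using assms(2) R.l_neg[OF c] by (simp only: sEnd_simps restrict_apply if_True)
 then have "(\<ominus>\<^sub>(sEnd K M) F) x \<oplus>\<^sub>M F x = \<zero>\<^sub>M" using assms(2) by (simp add: sEnd_simps)
 moreover have "(\<ominus>\<^sub>(sEnd K M) F) x \<in>. M" using sHomD(1)[of "\<ominus>\<^sub>(sEnd K M) F"] R.a_inv_closed[OF c] assms(2) by (simp add: sEnd_simps)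
 ultimately have "(\<ominus>\<^sub>(sEnd K M) F) x = \<ominus>\<^sub>M F x" using sHomD(1)[OF assms] M.minus_equality by metis
 then show ?thesis by (cases i) simp_all
qed

end

section \<open>The operators and the length filtration\<close>

context hl begin

lemma PH_zero: assumes "y \<in>. S" shows "SC.PH (%y. \<zero>) d y = \<zero>\<^sub>S"
 unfolding SC.PH_def
 by (rule SC.conv_ext[OF SC.gmx lin_id lin_zero[OF smx] amap_const0[OF SC.A.ag] assms])
   (simp add: amap_zero[OF SC.gen_amap M.ag SC.A.ag])

lemma PH_const: assumes a: "a \<in> hpart g p" and y: "y \<in>. S" shows "SC.PH (SW.const a) p y = LX a y"
 using y
proof (induction y rule: SC.A_induct)
 case (\<eta> i al) then show ?case by (simp add: SC.PH_\<eta>[OF SW.const_lin[OF a]] KG.hpc const_one MG.hpc[OF a])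
next
 case (gen q X y)
 note ac = MG.hpc[OF a] and Xc = MG.hpc[OF gen(1)]
 have "SC.PH (%y. SW.const a (LX X y)) (p + q) y = SC.PH (%y. \<zero>) (p + q) y"
  unfolding SC.PH_def by (rule SC.conv_cong) (simp_all add: const_LX ac Xc)
 then have "SC.PH (SW.const a) p (LX X y) = sg S (p * q) (LX X (LX a y))"
  using gen(2) ac Xc by (simp add: SC.PH_gen[OF SW.const_lin[OF a] gen(1,2)] gen(3) PH_zero)
 also have "... = LX a (LX X y)"
  using SW.S_rel[OF a gen(1)] ac Xc gen(2) amap_sg[OF ring_amapR[OF SC.A.ring_axioms gen(2)] SC.A.ag SC.A.ag, of "SC.gen X \<otimes>\<^sub>S SC.gen a" "p * q"]
  by (simp add: SC.A.m_assoc[symmetric])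
 finally show ?case .
next
 case (add x y)
 then show ?case using MG.hpc[OF a] by (simp add: lin_add[OF SC.PH_lin[OF SW.const_lin[OF a]]] SC.A.r_distr)
qed

lemma \<eta>_fl: "al \<in>. K ==> SC.\<eta> al \<in> SC.fl (Suc n)"
 unfolding SC.\<eta>_def by (rule SC.fl_of) simp_all

lemma PH_fl: assumes "y \<in> SC.fl n" "L c \<chi>" shows "SC.PH \<chi> c y \<in> SC.fl (Suc n)"
 using assms
proof (induction arbitrary: \<chi> c rule: SC.fl_induct)
 case (zero n) then show ?case using amap_zero[OF lin_amap[OF SC.PH_lin[OF zero]] SC.A.ag SC.A.ag] SC.fl_zero by simp
next
 case (add n x y) then show ?case using SC.fl_closed by (simp add: lin_add[OF SC.PH_lin[OF add(5)]] SC.fl_add)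
next
 case (\<eta> n al)
 then show ?case using SC.fl_gen[OF linc[OF \<eta>(2) SC.A.one_closed] \<eta>_fl[of al n]] by (simp add: SC.PH_\<eta>)
next
 case (gen n X p x)
 show ?case unfolding SC.PH_gen[OF gen(4) gen(1) SC.fl_closed[OF gen(2)]]
  by (rule SC.fl_add[OF SC.fl_sg[OF SC.fl_gen[OF MG.hpc[OF gen(1)] gen(3)[OF gen(4)]]] SC.fl_mono[OF gen(3)[OF SC.LX_comp[OF gen(4,1)]]]]) simp
qed

text \<open>A map \<chi> that vanishes at 1 consumes at least one letter for the one it returns, so
  the length does not grow.\<close>

lemma PH_fl0: assumes "y \<in> SC.fl n" "L c \<chi>" "\<chi> \<one>\<^sub>S = \<zero>" shows "SC.PH \<chi> c y \<in> SC.fl n"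
 using assms
proof (induction arbitrary: \<chi> c rule: SC.fl_induct)
 case (zero n) then show ?case using amap_zero[OF lin_amap[OF SC.PH_lin[OF zero(1)]] SC.A.ag SC.A.ag] SC.fl_zero by simp
next
 case (add n x y) then show ?case using SC.fl_closed by (simp add: lin_add[OF SC.PH_lin[OF add(5)]] SC.fl_add)
next
 case (\<eta> n al)
 then show ?case using amap_zero[OF SC.gen_amap M.ag SC.A.ag] SC.fl_zero by (simp add: SC.PH_\<eta>)
next
 case (gen n X p x)
 show ?case unfolding SC.PH_gen[OF gen(4) gen(1) SC.fl_closed[OF gen(2)]]
  by (rule SC.fl_add[OF SC.fl_sg[OF SC.fl_gen[OF MG.hpc[OF gen(1)] gen(3)[OF gen(4,5)]]] PH_fl[OF gen(2) SC.LX_comp[OF gen(4,1)]]])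
qed

text \<open>A supercommutator of two letters equals the single letter [v, w] in U(g). For odd u one
  has 2 u u = [u, u], so u u is a single letter when 2 is a unit; in the purely even case u is
  zero.\<close>

lemma Gsym_Hf: "Gsym <= UC.Hf"
proof
 have w: "fof ([v], \<one>\<^sub>K) \<otimes>\<^sub>FW fof ([w], \<one>\<^sub>K) = fof ([v, w], \<one>\<^sub>K)" if "w \<in>. g" for v w using that by simp
 have q2: "qU (fof ([v, w], \<one>\<^sub>K)) = UC.gen v \<otimes>\<^sub>U UC.gen w" if "v \<in>. g" "w \<in>. g" for v w
  using UC.q_Cons[OF that(1), of "[w]" "\<one>\<^sub>K"] that by (simp add: UC.gen_def)
 have g2: "UC.gen X \<in> UC.fl 2" if "X \<in>. g" for X unfolding UC.gen_def by (rule UC.fl_of) (use that in simp_all)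
 fix r assume "r \<in> Gsym"
 then consider (1) v w i j where "r = fof ([v], \<one>\<^sub>K) \<otimes>\<^sub>FW fof ([w], \<one>\<^sub>K) \<ominus>\<^sub>FW sg FW (i * j) (fof ([w], \<one>\<^sub>K) \<otimes>\<^sub>FW fof ([v], \<one>\<^sub>K))" "v \<in> hpart g i" "w \<in> hpart g j"
  | (2) u where "r = fof ([u], \<one>\<^sub>K) \<otimes>\<^sub>FW fof ([u], \<one>\<^sub>K)" "u \<in> hpart g 1" unfolding Gsym_def by blast
 then show "r \<in> UC.Hf"
 proof cases
  case 1
  note c = MG.hpc[OF 1(2)] MG.hpc[OF 1(3)]
  define s :: int where "s = (if i * j = 1 then - 1 else 1)"
  have cw: "fof ([v, w], \<one>\<^sub>K) \<in>. FW" "fof ([w, v], \<one>\<^sub>K) \<in>. FW" using c by simp_all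
  let ?y = "sg FW (i * j) (fof ([w, v], \<one>\<^sub>K))"
  have yc: "?y \<in>. FW" by (rule abelian_group.sg_closed[OF W.F_group cw(2)])
  have r: "r = fof ([v, w], \<one>\<^sub>K) - ?y" unfolding 1(1) w[OF c(1)] w[OF c(2)] by (rule W.F_minus[OF yc])
  have py: "UC.part n ?y = (if n = 2 then ?y else 0)" for n
   using cw(2) by (cases "i * j") (auto simp: UC.part_of W.F_neg UC.part_def frag_extend_minus)
  have qr: "qU r = UC.gen (bracket g v w)"
   using c amapc[OF UC.q_amap yc] amap_sg[OF UC.q_amap W.F_group UC.A.ag cw(2), of "i * j"] U_rel[OF 1(2,3)] br_closed[OF c]
   unfolding r UC.q_diff[OF cw(1) yc] by (simp add: q2 a_minus_def UC.A.a_ac UC.A.r_neg UC.A.r_neg2)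
  show ?thesis
  proof (rule UC.Hf_homog)
   show "r \<in>. FW" unfolding r by (rule W.F_diff_closed[OF cw(1) yc])
   show "UC.part n r = (if n = 2 then r else 0)" for n unfolding r by (simp add: UC.part_diff py UC.part_of)
   show "qU r \<in> UC.fl 2" unfolding qr by (rule g2[OF br_closed[OF c]])
  qed
 next
  case 2
  note c = MG.hpc[OF 2(2)]
  have r: "r = fof ([u, u], \<one>\<^sub>K)" using 2(1) w[OF c] by simp
  let ?x = "UC.gen u \<otimes>\<^sub>U UC.gen u"
  have x: "?x \<in>. U" using c by simp
  have "?x \<in> UC.fl 2" using half
  proof
   assume h: "[(2::nat)] \<cdot>\<^sub>K \<one>\<^sub>K \<in> Units K"
   let ?h = "inv\<^bsub>K\<^esub> ([(2::nat)] \<cdot>\<^sub>K \<one>\<^sub>K)"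
   have hc: "?h \<in>. K" using h by (rule Units_inv_closed)
   have "?x = UC.gen (bracket g u u) \<oplus>\<^sub>U \<ominus>\<^sub>U ?x" using U_rel[OF 2(2,2)] c br_closed[OF c c] UC.A.a_comm by simp
   then have "?x \<oplus>\<^sub>U ?x = UC.gen (bracket g u u)" using x br_closed[OF c c]
    by (metis UC.A.a_assoc UC.A.a_inv_closed UC.A.l_neg UC.A.r_zero UC.gen_closed)
   moreover have "?x \<bullet>\<^sub>U ([(2::nat)] \<cdot>\<^sub>K \<one>\<^sub>K) = ?x \<oplus>\<^sub>U ?x"
    using UC.AT.scale_add_right[OF x one_closed one_closed] UC.AT.scale_one[OF x] by (simp add: numeral_2_eq_2)
   ultimately have "?x = UC.gen (bracket g u u) \<bullet>\<^sub>U ?h"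
    using UC.AT.scale_mult[OF x Units_closed[OF h] hc] UC.AT.scale_one[OF x] Units_r_inv[OF h] by simp
   then have "?x = UC.gen (bracket g u u \<bullet> ?h)" using hc br_closed[OF c c] by (simp add: UC.gen_scale')
   then show ?thesis using g2[OF scale_closed[OF br_closed[OF c c] hc]] by simp
  next
   assume "carrier K = hpart K 0 \<and> carrier g = hpart g 0"
   then have "u = \<zero>" using MG.hp_inter[of u] 2(2) c by simp
   then show ?thesis using amap_zero[OF UC.gen_amap M.ag UC.A.ag] UC.fl_zero by simp
  qed
  then show ?thesis using c unfolding r by (intro UC.Hf_homog[where k=2]) (auto simp: UC.part_of q2)
 qed
qed

end

section \<open>Existence of the symbol map\<close>

context hln begin

lemma phi_coeff_1: "phi_coeff K N \<one>\<^sub>K = cs1"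
proof
 fix n
 have 1: "inv\<^bsub>K\<^esub> \<one>\<^sub>K = \<one>\<^sub>K" by simp
 have rc: "rat_in K (bern n) \<in>. K" if "\<not> N \<le> enat n" using that by (intro good_closed bern_goodN) simp
 show "phi_coeff K N \<one>\<^sub>K n = cs1 n"
 \<comment> \<open>In the zero ring the test c = 0 in \<open>phi_coeff\<close> succeeds for c = 1,
   but there all scalars coincide.\<close>
 proof (cases "\<one>\<^sub>K = \<zero>\<^sub>K")
  case True
  then have z: "x = \<zero>\<^sub>K" if "x \<in>. K" for x using that r_one[OF that] by simp
  have "phi_coeff K N \<one>\<^sub>K n = \<zero>\<^sub>K \<or> phi_coeff K N \<one>\<^sub>K n = \<ominus>\<^sub>K \<zero>\<^sub>K"
   unfolding phi_coeff_def by (cases "N \<le> enat n"; cases "n = 1") (simp_all only: True simp_thms if_True if_False)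
  then have "phi_coeff K N \<one>\<^sub>K n \<in>. K" by (elim disjE) simp_all
  from z[OF this] z[OF evD(2)[OF ev_cs1]] show ?thesis by simp
 next
  case False
  then show ?thesis using rc by (auto simp: phi_coeff_def cs1_def)
 qed
qed

abbreviation P1 where "P1 a \<equiv> PHS a cs1"
abbreviation EE where "EE \<equiv> sEnd K S"

lemma P1_amap: assumes "a \<in>. g" shows "amap S S (P1 a)"
 unfolding PHS_def[abs_def] by (intro amap_plus SC.A.ag lin_amap[OF SC.PH_lin[OF phs_lin[OF MG.hc_in[OF assms] ev_cs1]]])

lemma P1_scale: assumes "a \<in>. g" "y \<in>. S" "al \<in>. K" shows "P1 a (y \<bullet>\<^sub>S al) = P1 a y \<bullet>\<^sub>S al"
proof -
 note l = SC.PH_lin[OF phs_lin[OF MG.hc_in[OF assms(1)] ev_cs1]]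
 show ?thesis unfolding PHS_def lin_scale[OF l assms(2,3)]
  by (rule SC.AT.scale_add_left[OF linc[OF l assms(2)] linc[OF l assms(2)] assms(3), symmetric])
qed

lemma P1_amap2: assumes "y \<in>. S" shows "amap g S (%a. P1 a y)"
 by (rule amapI) (simp_all add: amapc[OF P1_amap] assms PHS_add ev_cs1)

lemma P1_homog: "[|a \<in> hpart g p; y \<in>. S|] ==> P1 a y = SC.PH (phs a p cs1) p y"
 by (rule PHS_homog[OF _ ev_cs1])

lemma P1_sHom: "a \<in>. g ==> restrict (P1 a) (carrier S) \<in>. (sHom K S S)"
 by (rule SC.AT.sHomI) (simp_all add: amapc[OF P1_amap] ama[OF P1_amap] P1_scale)

lemma ls_sHom: "al \<in>. K ==> restrict (lscale K S al) (carrier S) \<in>. (sHom K S S)"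
 by (rule SC.AT.sHomI) (simp_all add: ama[OF SC.AT.lscale_amap1] SC.AT.lscale_scale)

text \<open>Scalars are represented by left multiplication on S(g), in accordance with the scalar
  action of \<open>sEnd\<close>. Both compatibility conditions reduce to linearity of the operators
  in a and to \<open>lin_lscale\<close>.\<close>

lemma ev_whom: "whom K g EE (%a. restrict (P1 a) (carrier S)) (%al. restrict (lscale K S al) (carrier S))"
proof (intro whom.intro whom_axioms.intro smx SC.AT.sEnd_ring)
 show "(%al. restrict (lscale K S al) (carrier S)) \<in> ring_hom K EE"
  by (rule ring_hom_memI; (simp add: SC.AT.sEnd_simps(1) ls_sHom)?; rule SC.AT.sHom_eqI)
    (auto simp: SC.AT.sEnd_simps compose_def SC.AT.lscale_mult ama[OF SC.AT.lscale_amap2])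
 show "amap g EE (%a. restrict (P1 a) (carrier S))"
  by (rule amapI; (simp add: SC.AT.sEnd_simps(1) P1_sHom)?; rule SC.AT.sHom_eqI) (auto simp: SC.AT.sEnd_simps ama[OF P1_amap2])
 fix Y al assume Y: "Y \<in>. g" and a: "al \<in>. K"
 have 1: "P1 (Y \<bullet> al) y = P1 Y (lscale K S al y)" if y: "y \<in>. S" for y
 proof (rule MG.amap_eqI[OF amc[OF scale_amap1[OF a] P1_amap2[OF y]] P1_amap2 _ Y])
  show "lscale K S al y \<in>. S" using a y by simp
  fix p X assume X: "X \<in> hpart g p"
  show "P1 (X \<bullet> al) y = P1 X (lscale K S al y)"
  proof (rule KG.amap_eqI[OF amc[OF scale_amap2[OF MG.hpc[OF X]] P1_amap2[OF y]] amc[OF SC.AT.lscale_amap2[OF y] P1_amap[OF MG.hpc[OF X]]] _ a])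
   fix i c assume c: "c \<in> hpart K i"
   show "P1 (X \<bullet> c) y = P1 X (lscale K S c y)"
    using KG.hpc[OF c] y by (simp add: P1_homog[OF scale_parity[OF X c]] P1_homog[OF X] PHp_scale[OF X c ev_cs1])
  qed
 qed
 show "restrict (P1 (Y \<bullet> al)) (carrier S) = restrict (P1 Y) (carrier S) \<otimes>\<^sub>EE restrict (lscale K S al) (carrier S)"
  by (rule SC.AT.sHom_eqI) (use a in \<open>auto simp: SC.AT.sEnd_simps compose_def 1\<close>)
 have 2: "lscale K S al (P1 Y y) = P1 (lscale K g al Y) y" if y: "y \<in>. S" for y
 proof (rule MG.amap_eqI[OF amc[OF P1_amap2[OF y] SC.AT.lscale_amap1[OF a]] amc[OF lscale_amap1[OF a] P1_amap2[OF y]] _ Y])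
  fix p X assume X: "X \<in> hpart g p"
  note Xc = MG.hpc[OF X]
  note Py = amapc[OF P1_amap[OF Xc] y]
  show "lscale K S al (P1 X y) = P1 (lscale K g al X) y"
  proof (rule KG.amap_eqI[OF SC.AT.lscale_amap2[OF Py] amc[OF lscale_amap2[OF Xc] P1_amap2[OF y]] _ a])
   fix i c assume c: "c \<in> hpart K i"
   note cc = KG.hpc[OF c]
   have "P1 (lscale K g c X) y = sg S (i * p) (SC.PH (phs X p cs1) p (lscale K S c y))"
    using y cc Xc amap_sg[OF P1_amap2[OF y] M.ag SC.A.ag, of "X \<bullet> c" "i * p"]
    by (simp add: lscale_homog2[OF c X] P1_homog[OF scale_parity[OF X c]] PHp_scale[OF X c ev_cs1] scale_closed)
   also have "... = lscale K S c (SC.PH (phs X p cs1) p y)"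
    using lin_lscale[OF SC.AT.smx SC.AT.smx SC.PH_lin[OF phs_lin[OF X ev_cs1]] c y] cc linc[OF SC.PH_lin[OF phs_lin[OF X ev_cs1]] y]
    by (simp add: SC.A.sg_sg)
   finally show "lscale K S c (P1 X y) = P1 (lscale K g c X) y" using y by (simp add: P1_homog[OF X])
  qed
 qed
 show "restrict (lscale K S al) (carrier S) \<otimes>\<^sub>EE restrict (P1 Y) (carrier S) = restrict (P1 (lscale K g al Y)) (carrier S)"
  by (rule SC.AT.sHom_eqI) (use amapc[OF P1_amap[OF Y]] in \<open>auto simp: SC.AT.sEnd_simps compose_def 2\<close>)
qed

text \<open>The operators satisfy the relations of U(g) by \<open>PH_rep\<close>, hence extend; a
  morphism is determined by its values on letters, so the description in \<open>Phi_env\<close> has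
  a unique solution.\<close>

lemma Phi_env: "Phi_env K g N \<in> superalg_hom K U EE" "a \<in>. g ==> Phi_env K g N (UC.gen a) = restrict (P1 a) (carrier S)"
proof -
 let ?f = "%a. restrict (P1 a) (carrier S)" and ?e = "%al. restrict (lscale K S al) (carrier S)"
 interpret R: ring EE by (rule SC.AT.sEnd_ring)
 obtain h where h: "h \<in> ring_hom U EE" "!!X. X \<in>. g ==> h (UC.gen X) = ?f X" "!!al. al \<in>. K ==> h (UC.\<eta> al) = ?e al"
 proof (rule UC.universal[OF ev_whom])
  fix h r assume a: "h \<in> ring_hom FW EE" "!!w. w \<in> lists (carrier g) \<times> carrier K ==> h (fof w) = wev EE ?f ?e w" "r \<in> Genv"
  show "h r = \<zero>\<^sub>EE"
  proof (rule U_kill[OF SC.AT.sEnd_ring a(1) UC.letter_hom[OF ev_whom a(2)] _ a(3)])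
   fix v w i j assume v: "v \<in> hpart g i" and w: "w \<in> hpart g j"
   note c = MG.hpc[OF v] MG.hpc[OF w]
   note s = P1_sHom[OF c(1)] P1_sHom[OF c(2)] P1_sHom[OF br_closed[OF c]]
   have m: "?f w \<otimes>\<^sub>EE ?f v \<in>. (sHom K S S)" using R.m_closed[of "?f w" "?f v"] s by (simp add: SC.AT.sEnd_simps(1))
   show "?f v \<otimes>\<^sub>EE ?f w = sg EE (i * j) (?f w \<otimes>\<^sub>EE ?f v) \<oplus>\<^sub>EE ?f (bracket g v w)"
   proof (rule SC.AT.sHom_eqI)
    fix y assume y: "y \<in>. S"
    note l = amapc[OF P1_amap[OF c(1)] y] amapc[OF P1_amap[OF c(2)] y]
    have "(sg EE (i * j) (?f w \<otimes>\<^sub>EE ?f v) \<oplus>\<^sub>EE ?f (bracket g v w)) y = sg S (i * j) (P1 w (P1 v y)) \<oplus>\<^sub>S P1 (bracket g v w) y"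
     using y SC.AT.sEnd_sg[OF m y, of "i * j"] l by (simp add: SC.AT.sEnd_simps(2,5) compose_def)
    also have "... = P1 v (P1 w y)" using PH_rep[OF v w y] l y by (simp add: P1_homog[OF v] P1_homog[OF w] P1_homog[OF br_parity[OF v w]])
    finally show "(?f v \<otimes>\<^sub>EE ?f w) y = (sg EE (i * j) (?f w \<otimes>\<^sub>EE ?f v) \<oplus>\<^sub>EE ?f (bracket g v w)) y"
     using y l by (simp add: SC.AT.sEnd_simps(2) compose_def)
   qed (simp_all add: SC.AT.sEnd_simps(2,5) compose_def)
  qed
 qed blast
 have hc: "h x \<in>. (sHom K S S)" if "x \<in>. U" for x using ring_hom_closed[OF h(1) that] by (simp add: SC.AT.sEnd_simps)
 have hp: "h x \<in> hpart EE i" if "x \<in> hpart U i" for x i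
  using that
 proof (induction rule: UC.A_hinduct)
  case (\<eta> i al)
  show ?case unfolding h(3)[OF KG.hpc[OF \<eta>]] SC.AT.sEnd_simps by (rule lin_sHom[OF SC.AT.smx SC.AT.lscale_lin[OF \<eta>]])
 next
  case (gen i j X x)
  note xc = UC.A_hp_closed(1)[OF gen(2)] and Xc = MG.hpc[OF gen(1)]
  have lx: "lin K S S j (h x)" using gen(3) by (intro sHom_lin) (simp add: SC.AT.sEnd_simps)
  have "lin K S S (j + i) (%y. P1 X (h x y))"
   by (rule lin_cong[OF SC.AT.smx lin_comp[OF lx SC.PH_lin[OF phs_lin[OF gen(1) ev_cs1]]]]) (rule P1_homog[OF gen(1) linc[OF lx]])
  from lin_sHom[OF SC.AT.smx this] have "restrict (%y. P1 X (h x y)) (carrier S) \<in> hpart (sHom K S S) (i + j)" by (simp only: add.commute)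
  moreover have "h (UC.gen X \<otimes>\<^sub>U x) = restrict (%y. P1 X (h x y)) (carrier S)"
   unfolding ring_hom_mult[OF h(1) UC.gen_closed[OF Xc] xc] h(2)[OF Xc] SC.AT.sEnd_simps(2) compose_def
   by (rule restrict_ext) (simp add: linc[OF lx])
  ultimately show ?case by (simp only: SC.AT.sEnd_simps(6))
 next
  case (add j x y)
  note c = UC.A_hp_closed(1)[OF add(1)] UC.A_hp_closed(1)[OF add(2)]
  have l: "lin K S S j (h x)" "lin K S S j (h y)" using add(3,4) by (intro sHom_lin, simp add: SC.AT.sEnd_simps)+
  show ?case unfolding ring_hom_add[OF h(1) c] SC.AT.sEnd_simps(5,6)
   by (rule lin_sHom[OF SC.AT.smx lin_plus[OF SC.AT.smx l]])
 qed
 have hs: "h (x \<bullet>\<^sub>U al) = h x \<bullet>\<^sub>EE al" if "x \<in>. U" "al \<in>. K" for x al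
  unfolding UC.scale_\<eta>[OF that] ring_hom_mult[OF h(1) that(1) UC.\<eta>_closed[OF that(2)]] h(3)[OF that(2)] SC.AT.sEnd_simps(2,7) compose_def
  by (rule restrict_ext) simp
 let ?Q = "%F. F \<in> superalg_hom K U EE \<and> (\<forall>a \<in> carrier g. F (UC.gen a) = Phi K g N \<one>\<^sub>K a)"
 have Ph: "Phi K g N \<one>\<^sub>K a = ?f a" if "a \<in>. g" for a
  using Phi_PHS[OF that, of N "\<one>\<^sub>K"] ev_cs1 unfolding phi_coeff_1 by blast
 have Q: "?Q (restrict h (carrier U))"
  using UC.superalg_hom_restrict[OF h(1) hs hp] by (simp add: h(2) Ph)
 have "Phi_env K g N = restrict h (carrier U)"
  unfolding Phi_env_def ugen_gen
 proof (rule the_equality[where P="?Q"], rule Q)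
  fix F assume "?Q F" then show "F = restrict h (carrier U)" using Q by (intro UC.superalg_hom_unique[of F EE "restrict h (carrier U)"]) auto
 qed
 then show "Phi_env K g N \<in> superalg_hom K U EE" "a \<in>. g ==> Phi_env K g N (UC.gen a) = restrict (P1 a) (carrier S)"
  using Q Ph by auto
qed

abbreviation \<sigma> where "\<sigma> \<equiv> symbol_map K g N"

lemma sym_one: "\<sigma> \<one>\<^sub>U = \<one>\<^sub>S"
 using ring_hom_one[OF UC.superalg_homD(1)[OF Phi_env(1)]] by (simp add: symbol_map_def SC.AT.sEnd_simps)

lemma env_sHom: "u \<in>. U ==> Phi_env K g N u \<in>. (sHom K S S)"
 using ring_hom_closed[OF UC.superalg_homD(1)[OF Phi_env(1)]] by (simp add: SC.AT.sEnd_simps)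

lemma sym_gen: assumes "a \<in>. g" "u \<in>. U" shows "\<sigma> (UC.gen a \<otimes>\<^sub>U u) = P1 a (\<sigma> u)"
 using ring_hom_mult[OF UC.superalg_homD(1)[OF Phi_env(1)] UC.gen_closed[OF assms(1)] assms(2)] assms SC.AT.sHomD(1)[OF env_sHom[OF assms(2)]]
 by (simp add: symbol_map_def Phi_env(2) SC.AT.sEnd_simps compose_def)

lemma sym_lin: "lin K U S 0 \<sigma>"
 unfolding lin_def
proof (intro conjI amapI ballI allI)
 note F = UC.superalg_homD[OF Phi_env(1)]
 fix x assume x: "x \<in>. U"
 show "\<sigma> x \<in>. S" using SC.AT.sHomD(1)[OF env_sHom[OF x]] x by (simp add: symbol_map_def)
 fix y assume y: "y \<in>. U"
 show "\<sigma> (x \<oplus>\<^sub>U y) = \<sigma> x \<oplus>\<^sub>S \<sigma> y" using x y ring_hom_add[OF F(1) x y] by (simp add: symbol_map_def SC.AT.sEnd_simps)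
next
 note F = UC.superalg_homD[OF Phi_env(1)]
 fix x al assume x: "x \<in>. U" and a: "al \<in>. K"
 \<comment> \<open>Scaling an endomorphism precomposes it with left multiplication by al, and at 1
   the left and right actions of al agree.\<close>
 have "\<sigma> (x \<bullet>\<^sub>U al) = Phi_env K g N x (lscale K S al \<one>\<^sub>S)" using F(3)[OF x a] x a by (simp add: symbol_map_def UC.AT.scale_closed SC.AT.sEnd_simps)
 then show "\<sigma> (x \<bullet>\<^sub>U al) = \<sigma> x \<bullet>\<^sub>S al"
  using a x SC.AT.sHomD(3)[OF env_sHom[OF x] SC.A.one_closed a] by (simp add: SC.lscale_one_A SC.one_scale_A symbol_map_def)
next
 fix j x assume x: "x \<in> hpart U j"
 have "Phi_env K g N x \<in> hpart (sHom K S S) j" using UC.superalg_homD(4)[OF Phi_env(1) x] by (simp add: SC.AT.sEnd_simps)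
 from lin_hp[OF sHom_lin[OF this] SC.AT.one_hp] show "\<sigma> x \<in> hpart S (0 + j)" using UC.A_hp_closed(1)[OF x] by (simp add: symbol_map_def)
qed

text \<open>Subtracting \<open>const\<close> of a from the series, whose constant coefficient is 1,
  leaves a map vanishing at 1, to which \<open>PH_fl0\<close> applies; by \<open>PH_const\<close>
  the subtracted operator is multiplication by a.\<close>

lemma P1_lead: assumes a: "a \<in>. g" and y: "y \<in> SC.fl n" shows "P1 a y \<ominus>\<^sub>S LX a y \<in> SC.fl n"
proof -
 note yc = SC.fl_closed[OF y]
 let ?a = "%i. hcomp g i a"
 have 1: "SC.PH (phs (?a i) i cs1) i y \<ominus>\<^sub>S LX (?a i) y \<in> SC.fl n" for i
 proof -
  note h = MG.hc_in[OF a, of i] and ac = MG.hc_closed[OF a, of i]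
  note l = phs_lin[OF h ev_cs1] and s = lin_sg[OF smx SW.const_lin[OF h], of 1]
  have "phs (?a i) i cs1 \<one>\<^sub>S = ?a i" using ac by (simp add: phs_Wd(1)[OF h ev_cs1 one_Wd] const_one cs1_0 scale_one)
  then have "SC.PH (%y. phs (?a i) i cs1 y \<oplus> sg g 1 (SW.const (?a i) y)) i y \<in> SC.fl n"
   using ac by (intro PH_fl0[OF y lin_plus[OF smx l s]]) (simp add: const_one M.r_neg)
  moreover have "SC.PH (%y. phs (?a i) i cs1 y \<oplus> sg g 1 (SW.const (?a i) y)) i y = SC.PH (phs (?a i) i cs1) i y \<oplus>\<^sub>S sg S 1 (LX (?a i) y)"
   by (simp only: PH_plus[OF l s yc] PH_sg[OF SW.const_lin[OF h] yc] PH_const[OF h yc])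
  ultimately show ?thesis by (simp add: a_minus_def)
 qed
 have c: "SC.PH (phs (?a i) i cs1) i y \<in>. S" "LX (?a i) y \<in>. S" for i
  using linc[OF SC.PH_lin[OF phs_lin[OF MG.hc_in[OF a] ev_cs1]] yc] a yc by auto
 have "LX a y = LX (?a 0) y \<oplus>\<^sub>S LX (?a 1) y"
  using a yc ama[OF SC.gen_amap, of "?a 0" "?a 1"] MG.hc_sum[OF a] by (simp add: SC.A.l_distr[symmetric])
 then have "P1 a y \<ominus>\<^sub>S LX a y = (SC.PH (phs (?a 0) 0 cs1) 0 y \<ominus>\<^sub>S LX (?a 0) y) \<oplus>\<^sub>S (SC.PH (phs (?a 1) 1 cs1) 1 y \<ominus>\<^sub>S LX (?a 1) y)"
  using c by (simp add: PHS_def a_minus_def SC.A.minus_add SC.A.a_ac)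
 then show ?thesis using SC.fl_add[OF 1 1] by simp
qed

lemma P1_fl: "[|a \<in>. g; y \<in> SC.fl n|] ==> P1 a y \<in> SC.fl (Suc n)"
 unfolding PHS_def by (intro SC.fl_add PH_fl phs_lin MG.hc_in ev_cs1)

text \<open>One and the same combination t of words is read in U(g) and in S(g). Comparing
  representatives avoids any map between the two algebras other than \<sigma>.\<close>

lemma sym_lead: assumes "UC.lw (Suc n) t" shows "\<sigma> (qU t) \<ominus>\<^sub>S qS t \<in> SC.fl n"
proof -
 have w: "\<sigma> (qU (fof (u, al))) \<ominus>\<^sub>S qS (fof (u, al)) \<in> SC.fl (length u)" if "set u <= carrier g" and a: "al \<in>. K" for u al
  using that(1)
 proof (induction u)
  case Nil
  have "\<sigma> (UC.\<eta> al) = SC.\<eta> al" using lin_scale[OF sym_lin UC.A.one_closed a] by (simp add: UC.one_scale_A SC.one_scale_A a sym_one)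
  then show ?case using SC.\<eta>_closed[OF a] SC.fl_zero unfolding UC.\<eta>_def SC.\<eta>_def by (simp add: a_minus_def SC.A.r_neg)
 next
  case (Cons X u)
  let ?s = "qS (fof (u, al))" and ?u = "qU (fof (u, al))"
  have X: "X \<in>. g" and ul: "u \<in> lists (carrier g)" using Cons(2) by (auto simp: lists_eq_set)
  have c: "?s \<in>. S" "?u \<in>. U" by (rule SC.q_of_closed[OF ul a], rule UC.q_of_closed[OF ul a])
  define l where "l = \<sigma> ?u \<ominus>\<^sub>S ?s"
  have l: "l \<in> SC.fl (length u)" unfolding l_def using Cons by simp
  note lc = SC.fl_closed[OF l] and sc = linc[OF sym_lin c(2)]
  have "\<sigma> ?u = ?s \<oplus>\<^sub>S l" unfolding l_def a_minus_def using c(1) sc by (subst SC.A.a_lcomm) (simp_all add: SC.A.r_neg)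
  then have "\<sigma> (UC.gen X \<otimes>\<^sub>U ?u) \<ominus>\<^sub>S LX X ?s = (P1 X ?s \<ominus>\<^sub>S LX X ?s) \<oplus>\<^sub>S P1 X l"
   using X c lc amapc[OF P1_amap[OF X]] by (simp add: sym_gen ama[OF P1_amap[OF X]] a_minus_def SC.A.a_ac)
  moreover have "P1 X ?s \<ominus>\<^sub>S LX X ?s \<in> SC.fl (Suc (length u))" by (rule P1_lead[OF X SC.fl_of[OF ul a]]) simp
  ultimately show ?case using SC.fl_add[OF _ P1_fl[OF X l]] unfolding UC.q_Cons[OF X ul a] SC.q_Cons[OF X ul a] by simp
 qed
 show ?thesis using assms
 proof (induction rule: UC.lw_induct)
  case zero
  then show ?case using amap_zero[OF lin_amap[OF sym_lin] UC.A.ag SC.A.ag] SC.fl_zero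
   unfolding UC.q_zero SC.q_zero by (simp add: a_minus_def SC.A.neg_zero)
 next
  case (diff x y)
  then have f: "x \<in>. FW" "y \<in>. FW" by (auto simp: UC.lw_def)
  note cU = amapc[OF UC.q_amap f(1)] amapc[OF UC.q_amap f(2)] and cS = amapc[OF SC.q_amap f(1)] amapc[OF SC.q_amap f(2)]
  note cs = linc[OF sym_lin cU(1)] linc[OF sym_lin cU(2)]
  have "\<sigma> (qU (x - y)) \<ominus>\<^sub>S qS (x - y) = (\<sigma> (qU x) \<ominus>\<^sub>S qS x) \<ominus>\<^sub>S (\<sigma> (qU y) \<ominus>\<^sub>S qS y)"
   unfolding UC.q_diff[OF f] SC.q_diff[OF f] amap_minus[OF lin_amap[OF sym_lin] UC.A.ag SC.A.ag cU]
   using cs cS by (simp add: a_minus_def SC.A.minus_add SC.A.a_ac)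
  then show ?case using SC.fl_diff[OF diff(3,4)] by simp
 next
  case (of u al)
  then show ?case using SC.fl_mono[OF w[of u al], of n] by (simp add: lists_eq_set subset_iff)
 qed
qed

text \<open>The error term of \<open>sym_lead\<close> is shorter and lies in the image by induction;
  subtracting a preimage of it corrects the class of t in U(g).\<close>

lemma sym_surj: "y \<in> SC.fl n ==> \<exists>u\<in>carrier U. \<sigma> u = y"
proof (induction n arbitrary: y)
 case 0
 then show ?case using SC.fl_00 amap_zero[OF lin_amap[OF sym_lin] UC.A.ag SC.A.ag] by (intro bexI[of _ "\<zero>\<^sub>U"]) auto
next
 case (Suc n)
 obtain t where t: "SC.lw (Suc n) t" "y = qS t" using Suc(2) unfolding SC.fl_def by blast
 then have f: "t \<in>. FW" by (simp add: SC.lw_def)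
 obtain v where v: "v \<in>. U" "\<sigma> v = \<sigma> (qU t) \<ominus>\<^sub>S qS t" using Suc(1)[OF sym_lead[OF t(1)]] by blast
 note cU = amapc[OF UC.q_amap f] and cS = amapc[OF SC.q_amap f]
 have "\<sigma> (qU t \<ominus>\<^sub>U v) = qS t"
  unfolding amap_minus[OF lin_amap[OF sym_lin] UC.A.ag SC.A.ag cU v(1)] v(2)
  using cS linc[OF sym_lin cU] by (simp add: a_minus_def SC.A.minus_add SC.A.r_neg2)
 then show ?case using cU v(1) t(2) by (intro bexI[of _ "qU t \<ominus>\<^sub>U v"]) (simp_all add: a_minus_def)
qed

text \<open>If the leading term of \<open>u\<close> vanishes in \<open>S(g)\<close>, it lies in \<open>Hf\<close>, so that \<open>u\<close> has smaller length.\<close>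

lemma sym_inj: "[|u \<in> UC.fl n; \<sigma> u = \<zero>\<^sub>S |] ==> u = \<zero>\<^sub>U"
proof (induction n)
 case 0 then show ?case using UC.fl_00 by simp
next
 case (Suc n)
 obtain t where t: "UC.lw (Suc n) t" "u = qU t" using Suc(2) unfolding UC.fl_def by blast
 then have f: "t \<in>. FW" by (simp add: UC.lw_def)
 have "qS t \<in> SC.fl n" using SC.fl_neg[OF sym_lead[OF t(1)]] Suc(3) amapc[OF SC.q_amap f] unfolding t(2) by (simp add: a_minus_def)
 then obtain s where s: "UC.lw n s" "qS t = qS s" unfolding SC.fl_def by blast
 then have sf: "s \<in>. FW" by (simp add: UC.lw_def)
 have "qS (t - s) = \<zero>\<^sub>S" unfolding SC.q_diff[OF f sf] s(2) using amapc[OF SC.q_amap sf] by (simp add: a_minus_def SC.A.r_neg)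
 then have "t - s \<in> UC.Hf" by (rule SC.q_min[OF UC.Hf_ideal UC.Hf_rels Gsym_Hf W.F_diff_closed[OF f sf]])
 then have "qU (UC.part n (t - s)) \<in> UC.fl n" unfolding UC.Hf_def by blast
 then have p: "qU (UC.part n t) \<in> UC.fl n" by (simp add: UC.part_diff UC.part_lw[OF s(1)])
 note pc = amapc[OF UC.part_amap f, of n]
 have r: "qU (t - UC.part n t) \<in> UC.fl n" using UC.part_rest[OF t(1)] unfolding UC.fl_def by blast
 have "u = qU (t - UC.part n t) \<oplus>\<^sub>U qU (UC.part n t)"
  unfolding t(2) UC.q_diff[OF f pc] using amapc[OF UC.q_amap f] amapc[OF UC.q_amap pc] by (simp add: a_minus_def UC.A.a_assoc UC.A.l_neg)
 then have "u \<in> UC.fl n" using UC.fl_add[OF r p] by simp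
 then show ?case using Suc(1,3) by blast
qed

lemma sym_bij: "bij_betw \<sigma> (carrier U) (carrier S)"
 unfolding bij_betw_def
proof
 show "inj_on \<sigma> (carrier U)"
 proof (rule inj_onI)
  fix u v assume u: "u \<in>. U" and v: "v \<in>. U" and e: "\<sigma> u = \<sigma> v"
  have d: "u \<ominus>\<^sub>U v \<in>. U" using u v by simp
  have "\<sigma> (u \<ominus>\<^sub>U v) = \<zero>\<^sub>S"
   unfolding amap_minus[OF lin_amap[OF sym_lin] UC.A.ag SC.A.ag u v] e using linc[OF sym_lin v] by (simp add: a_minus_def SC.A.r_neg)
  then have "u \<ominus>\<^sub>U v = \<zero>\<^sub>U" using UC.fl_ex[OF d] sym_inj by blast
  then show "u = v" by (rule UC.A.minus_zero_eq[OF _ u v])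
 qed
 show "\<sigma> ` carrier U = carrier S"
  using linc[OF sym_lin] SC.fl_ex sym_surj by (auto simp: image_iff) (metis)
qed

end

section \<open>Comultiplications and coderivations\<close>

lemma lin_tw: assumes "supermodule K M" "supermodule K N" "lin K M N 0 f" "v \<in>. M"
 shows "f (graded.tw M d v) = graded.tw N d (f v)"
proof -
 interpret M: supermodule K M by fact
 interpret N: supermodule K N by fact
 show ?thesis
 proof (rule M.MG.amap_eqI[OF amc[OF M.MG.tw_amap lin_amap[OF assms(3)]] amc[OF lin_amap[OF assms(3)] N.MG.tw_amap] _ assms(4)])
  fix i x assume x: "x \<in> hpart M i"
  have "f x \<in> hpart N i" using lin_hp[OF assms(3) x] by simp
  then show "f (M.MG.tw d x) = N.MG.tw d (f x)"
   using amap_sg[OF lin_amap[OF assms(3)] M.M.ag N.M.ag M.MG.hpc[OF x]] by (simp add: M.MG.tw_homog[OF x] N.MG.tw_homog)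
 qed
qed

context hl begin

text \<open>\<open>(F \<otimes> H) \<circ> (s \<otimes> s) = (F s \<otimes> H s)\<close> for an even map \<open>s\<close> that intertwines the comultiplications at \<open>u\<close>.\<close>

lemma conv_transport:
 assumes B: "supermodule K B" and s: "lin K U S 0 s" and u: "u \<in>. U"
  and D: "sym_comult K g (s u) = UC.conv (tensor K S S) (pure K S S) s s 0 u"
  and F: "lin K S B df F" and H: "lin K S B d H"
 shows "UC.conv (tensor K B B) (pure K B B) (%u. F (s u)) (%u. H (s u)) d u = SC.conv (tensor K B B) (pure K B B) F H d (s u)"
proof -
 interpret B: supermodule K B by fact
 interpret tB: tens K B B ..
 interpret TB: supermodule K "tensor K B B" by (rule tB.T_supermodule)
 note bx = B B tB.T_supermodule tB.pu_bil
 note px = SC.AT.smx SC.AT.smx SC.AT.T_supermodule SC.AT.pu_bil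
 have Fs: "lin K U B df (%u. F (s u))" and Hs: "lin K U B d (%u. H (s u))" using lin_comp[OF s F] lin_comp[OF s H] by simp_all
 note sc = linc[OF s]
 note a1 = UC.cx(1)[OF px s s] and a2 = SC.cx(1)[OF bx F H]
 show ?thesis unfolding SC.conv_def D UC.conv_def[of "tensor K S S"]
  by (rule UC.conv_ext[OF bx Fs Hs amc[OF a1 a2] u])
    (simp add: UC.cx(2)[OF px s s] SC.cx(2)[OF bx F H] sc lin_tw[OF UC.AT.smx SC.AT.smx s])
qed

end

section \<open>Transport along the symbol map\<close>

context hln begin

lemma sym_comult_symbol: assumes "u \<in>. U"
 shows "sym_comult K g (\<sigma> u) = UC.conv (tensor K S S) (pure K S S) \<sigma> \<sigma> 0 u"
proof -
 note px = SC.AT.smx SC.AT.smx SC.AT.T_supermodule SC.AT.pu_bil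
 note am = UC.conv_amap[OF px sym_lin sym_lin]
 show ?thesis using assms
 proof (induction u rule: UC.A_induct)
  case (\<eta> i al)
  note a = KG.hpc[OF \<eta>]
  have "\<sigma> (UC.\<eta> al) = SC.\<eta> al" using lin_scale[OF sym_lin UC.A.one_closed a] by (simp add: UC.one_scale_A SC.one_scale_A a sym_one)
  then show ?case using a by (simp add: SC.D_\<eta> UC.conv_\<eta>[OF px sym_lin sym_lin] sym_one SC.AT.pu_scale SC.one_scale_A)
 next
  case (gen p X u)
  note X = gen(1) and u = gen(2) and Xc = MG.hpc[OF gen(1)]
  note l = SC.PH_lin[OF phs_lin[OF X ev_cs1]]
  let ?P = "SC.PH (phs X p cs1) p"
  note yc = linc[OF sym_lin u]
  have sX: "\<sigma> (UC.gen X \<otimes>\<^sub>U v) = ?P (\<sigma> v)" if "v \<in>. U" for v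
   using that by (simp add: sym_gen[OF Xc] P1_homog[OF X] linc[OF sym_lin])
  have c1: "UC.conv (tensor K S S) (pure K S S) (%v. \<sigma> (UC.gen X \<otimes>\<^sub>U v)) \<sigma> 0 u = UC.conv (tensor K S S) (pure K S S) (%v. ?P (\<sigma> v)) \<sigma> 0 u"
   by (rule UC.conv_cong) (simp_all add: sX)
  have c2: "UC.conv (tensor K S S) (pure K S S) \<sigma> (%v. \<sigma> (UC.gen X \<otimes>\<^sub>U v)) p u = UC.conv (tensor K S S) (pure K S S) \<sigma> (%v. ?P (\<sigma> v)) p u"
   by (rule UC.conv_cong) (simp_all add: sX)
  have "UC.conv (tensor K S S) (pure K S S) \<sigma> \<sigma> 0 (UC.gen X \<otimes>\<^sub>U u)
   = UC.conv (tensor K S S) (pure K S S) (%v. ?P (\<sigma> v)) \<sigma> 0 u \<oplus>\<^sub>(tensor K S S) UC.conv (tensor K S S) (pure K S S) \<sigma> (%v. ?P (\<sigma> v)) p u"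
   using UC.conv_gen[OF px sym_lin sym_lin X u] by (simp add: c1 c2)
  \<comment> \<open>The induction hypothesis at u lets \<open>conv_transport\<close> move both
    convolutions to S(g), where \<open>SC.D_PH\<close> recognises their sum.\<close>
  also have "... = SC.conv (tensor K S S) (pure K S S) ?P (%y. y) 0 (\<sigma> u) \<oplus>\<^sub>(tensor K S S) SC.conv (tensor K S S) (pure K S S) (%y. y) ?P p (\<sigma> u)"
   using conv_transport[OF SC.AT.smx sym_lin u gen(3) l lin_id] conv_transport[OF SC.AT.smx sym_lin u gen(3) lin_id l] by simp
  also have "... = sym_comult K g (?P (\<sigma> u))" by (rule SC.D_PH[OF phs_lin[OF X ev_cs1] yc, symmetric])
  finally show ?case by (simp add: sX[OF u])
 next
  case (add x y)
  then show ?case by (simp add: lin_add[OF sym_lin] ama[OF SC.D_amap] ama[OF am] linc[OF sym_lin])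
 qed
qed

abbreviation \<beta> where "\<beta> \<equiv> symmetrization K g N"

lemma sym_inv: "x \<in>. S ==> \<beta> x \<in>. U" "x \<in>. S ==> \<sigma> (\<beta> x) = x" "u \<in>. U ==> \<beta> (\<sigma> u) = u"
proof -
 show "\<beta> x \<in>. U" "\<sigma> (\<beta> x) = x" if "x \<in>. S"
  using sym_bij that inv_into_into[of x \<sigma> "carrier U"] f_inv_into_f[of x \<sigma> "carrier U"] unfolding symmetrization_def bij_betw_def by simp_all
 show "\<beta> (\<sigma> u) = u" if "u \<in>. U"
  using that linc[OF sym_lin that] sym_bij unfolding symmetrization_def bij_betw_def by simp
qed

lemma beta_lin: "lin K S U 0 \<beta>"
 unfolding lin_def
proof (intro conjI amapI ballI allI)
 fix x assume x: "x \<in>. S"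
 show "\<beta> x \<in>. U" by (rule sym_inv(1)[OF x])
 fix y assume y: "y \<in>. S"
 have "\<beta> (\<sigma> (\<beta> x \<oplus>\<^sub>U \<beta> y)) = \<beta> x \<oplus>\<^sub>U \<beta> y" using sym_inv(1)[OF x] sym_inv(1)[OF y] by (intro sym_inv(3)) simp
 then show "\<beta> (x \<oplus>\<^sub>S y) = \<beta> x \<oplus>\<^sub>U \<beta> y" unfolding lin_add[OF sym_lin sym_inv(1)[OF x] sym_inv(1)[OF y]] sym_inv(2)[OF x] sym_inv(2)[OF y] .
next
 fix x al assume x: "x \<in>. S" and a: "al \<in>. K"
 have "\<beta> (\<sigma> (\<beta> x \<bullet>\<^sub>U al)) = \<beta> x \<bullet>\<^sub>U al" by (rule sym_inv(3)[OF UC.AT.scale_closed[OF sym_inv(1)[OF x] a]])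
 then show "\<beta> (x \<bullet>\<^sub>S al) = \<beta> x \<bullet>\<^sub>U al" unfolding lin_scale[OF sym_lin sym_inv(1)[OF x] a] sym_inv(2)[OF x] .
next
 fix j x assume x: "x \<in> hpart S j"
 note xc = SC.AT.MG.hpc[OF x]
 note uc = sym_inv(1)[OF xc]
 \<comment> \<open>\<sigma> is even, so it sends the components of \<beta> x to the components of x;
   the wrong one is zero in S(g), and injectivity carries this back.\<close>
 obtain y z where yz: "y \<in> hpart U j" "z \<in> hpart U (j + 1)" "\<beta> x = y \<oplus>\<^sub>U z" using UC.AT.MG.decomp[OF uc] by blast
 note c = UC.AT.MG.hpc[OF yz(1)] UC.AT.MG.hpc[OF yz(2)]
 have sy: "\<sigma> y \<in> hpart S j" "\<sigma> z \<in> hpart S (j + 1)" using lin_hp[OF sym_lin yz(1)] lin_hp[OF sym_lin yz(2)] by simp_all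
 have "x = \<sigma> y \<oplus>\<^sub>S \<sigma> z" using sym_inv(2)[OF xc] unfolding yz(3) lin_add[OF sym_lin c] by simp
 then have "\<sigma> y = x" using SC.AT.MG.hc_eq[OF sy] SC.AT.MG.hc_homog[OF x, of j] by simp
 then have "\<beta> x = y" using sym_inv(3)[OF c(1)] by simp
 then show "\<beta> x \<in> hpart U (0 + j)" using yz(1) by simp
qed

text \<open>The compatibility of \<sigma> read backwards: the comultiplication of U(g) is the
  convolution of the identity with itself, the identity is \<beta> \<circ> \<sigma>, and \<sigma> is
  removed by transport.\<close>

lemma env_comult_beta: assumes x: "x \<in>. S"
 shows "env_comult K g (\<beta> x) = SC.conv (tensor K U U) (pure K U U) \<beta> \<beta> 0 x"
proof -
 note u = sym_inv(1)[OF x]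
 have "env_comult K g (\<beta> x) = UC.conv (tensor K U U) (pure K U U) (%u. \<beta> (\<sigma> u)) (%u. \<beta> (\<sigma> u)) 0 (\<beta> x)"
  unfolding UC.D_conv[OF u, symmetric] by (rule UC.conv_cong) (simp_all add: sym_inv(3))
 also have "... = SC.conv (tensor K U U) (pure K U U) \<beta> \<beta> 0 (\<sigma> (\<beta> x))"
  by (rule conv_transport[OF UC.AT.smx sym_lin u sym_comult_symbol[OF u] beta_lin beta_lin])
 finally show ?thesis by (simp only: sym_inv(2)[OF x])
qed

lemma conv_zeroL: assumes "supermodule K B" "lin K U B d h" "u \<in>. U"
 shows "UC.conv (tensor K B B) (pure K B B) (%x. \<zero>\<^sub>B) h d u = \<zero>\<^sub>(tensor K B B)"
proof -
 interpret B: supermodule K B by fact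
 interpret tB: tens K B B ..
 interpret TB: supermodule K "tensor K B B" by (rule tB.T_supermodule)
 show ?thesis
  by (rule UC.conv_ext[OF assms(1,1) tB.T_supermodule tB.pu_bil lin_zero[OF assms(1)] assms(2) amap_const0[OF TB.M.ag] assms(3)])
    (auto simp: amap_zero[OF tB.pu_amap1 B.M.ag TB.M.ag] linc[OF assms(2)])
qed

lemma comult_symmetrization: assumes x: "x \<in>. S"
 shows "env_comult K g (\<beta> x) = tensor_map K S S U U \<beta> \<beta> (sym_comult K g x)"
proof -
 note um = UC.AT.smx
 interpret TU: supermodule K "tensor K U U" by (rule UC.AT.T_supermodule)
 note px = um um UC.AT.T_supermodule UC.AT.pu_bil
 have z: "SC.conv (tensor K U U) (pure K U U) f h d x = \<zero>\<^sub>(tensor K U U)"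
  if "lin K S U df f" "lin K S U d h" "f = (%x. \<zero>\<^sub>U) \<or> h = (%x. \<zero>\<^sub>U)" for f h d df
  by (rule SC.conv_ext[OF px that(1,2) amap_const0[OF TU.M.ag] x])
    (use that in \<open>auto simp: amap_zero[OF UC.AT.pu_amap1 UC.A.ag TU.M.ag]
     amap_zero[OF UC.AT.pu_amap2 UC.A.ag TU.M.ag] linc[OF beta_lin] linc[OF that(1)] linc[OF that(2)]\<close>)
 \<comment> \<open>\<beta> is even, so its odd component in \<open>SC.tensor_map_conv\<close> is the
   zero map and three of the four terms vanish.\<close>
 note z0 = lin_zero[OF um]
 have e: "\<beta> \<in> extensional (carrier S)" by (simp add: symmetrization_def)
 note c = SC.conv_closed[OF px beta_lin beta_lin x]
 show ?thesis unfolding env_comult_beta[OF x]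
  by (subst SC.tensor_map_conv[OF um beta_lin z0 beta_lin z0 _ e _ x])
    (use c in \<open>simp_all add: z[OF z0 beta_lin] z[OF beta_lin z0] z[OF z0 z0] sym_inv(1)\<close>)
qed

lemma phi_coeff_even: assumes c: "c \<in> even_units K \<union> {\<zero>\<^sub>K}" shows "ev (phi_coeff K N c)"
proof -
 have o: "\<one>\<^sub>K \<in> hpart K 0" by (rule one_even)
 have "c \<otimes>\<^sub>K (inv\<^bsub>K\<^esub> c) [^]\<^sub>K n \<in> hpart K 0" if nz: "c \<noteq> \<zero>\<^sub>K" for n :: nat
 proof -
  obtain d where d: "c \<in> hpart K 0" "d \<in> hpart K 0" "c \<otimes>\<^sub>K d = \<one>\<^sub>K" "d \<otimes>\<^sub>K c = \<one>\<^sub>K" using c nz unfolding even_units_def by blast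
  note cc = KG.hpc[OF d(1)] KG.hpc[OF d(2)]
  have u: "c \<in> Units K" unfolding Units_def using cc d(3,4) by blast
  have "inv\<^bsub>K\<^esub> c = d" by (rule inv_unique[OF Units_l_inv[OF u] d(3) cc(1) Units_inv_closed[OF u] cc(2)])
  moreover have "d [^]\<^sub>K n \<in> hpart K 0"
  proof (induction n)
   case (Suc n) then show ?case using mult_parity[OF Suc d(2)] by simp
  qed (simp add: o)
  ultimately show ?thesis using mult_parity[OF d(1), of "d [^]\<^sub>K n" 0] by simp
 qed
 moreover have "rat_in K (bern n) \<in> hpart K 0" if "\<not> N \<le> enat n" for n using that by (intro good_even bern_goodN) simp
 ultimately show ?thesis unfolding ev_def phi_coeff_def using mult_parity[of _ 0 _ 0] KG.hp_neg[OF o] by auto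
qed

text \<open>The comultiplication of U(g) after \<beta> is the convolution of \<beta> with itself,
  and \<open>SC.PH_derivation\<close> applies to it for each parity component of a. The coefficients
  enter through their evenness, so every c is handled by the one map \<beta> built from c =
  1.\<close>

lemma coderivation_conj:
 assumes a: "a \<in>. g" and c: "c \<in> even_units K \<union> {\<zero>\<^sub>K}"
 shows "coderivation K U (env_comult K g) (compose (carrier U) \<beta> (compose (carrier U) (Phi K g N c a) (inv_into (carrier S) \<beta>)))"
  (is "coderivation K U _ ?D")
proof -
 let ?cs = "phi_coeff K N c"
 note cs = phi_coeff_even[OF c]
 let ?\<chi> = "%i. phs (hcomp g i a) i ?cs"
 let ?P = "%i. SC.PH (?\<chi> i) i" and ?Di = "%i u. \<beta> (SC.PH (phs (hcomp g i a) i ?cs) i (\<sigma> u))"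
 note lx = phs_lin[OF MG.hc_in[OF a] cs]
 note um = UC.AT.smx
 interpret TU: supermodule K "tensor K U U" by (rule UC.AT.T_supermodule)
 note px = um um UC.AT.T_supermodule UC.AT.pu_bil
 have lP: "lin K S U i (%y. \<beta> (?P i y))" for i using lin_comp[OF SC.PH_lin[OF lx] beta_lin, of i] by simp
 have lD: "lin K U U i (?Di i)" for i using lin_comp[OF sym_lin lP, of i] by simp
 have inj: "inj_on \<beta> (carrier S)" by (rule inj_on_inverseI[of _ \<sigma>]) (rule sym_inv(2))
 have inv: "inv_into (carrier S) \<beta> u = \<sigma> u" if "u \<in>. U" for u
  using inv_into_f_f[OF inj linc[OF sym_lin that]] by (simp add: sym_inv(3)[OF that])
 have D: "?D u = ?Di 0 u \<oplus>\<^sub>U ?Di 1 u" if u: "u \<in>. U" for u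
 proof -
  note p = linc[OF SC.PH_lin[OF lx] linc[OF sym_lin u]]
  show ?thesis using u linc[OF sym_lin u] lin_add[OF beta_lin p p] by (simp add: compose_def inv Phi_PHS[OF a cs] PHS_def)
 qed
 have De: "?D \<in> extensional (carrier U)" by (simp add: compose_def)
 show ?thesis unfolding coderivation_def
 proof (intro conjI ballI)
  show "?D \<in>. (sHom K U U)"
  proof -
   have "restrict (%u. ?Di 0 u \<oplus>\<^sub>U ?Di 1 u) (carrier U) \<in>. (sHom K U U)"
   proof (rule UC.AT.sHomI)
    fix x y assume xy: "x \<in>. U" "y \<in>. U"
    show "?Di 0 (x \<oplus>\<^sub>U y) \<oplus>\<^sub>U ?Di 1 (x \<oplus>\<^sub>U y) = (?Di 0 x \<oplus>\<^sub>U ?Di 1 x) \<oplus>\<^sub>U (?Di 0 y \<oplus>\<^sub>U ?Di 1 y)"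
     unfolding lin_add[OF lD xy] by (rule UC.A.add4) (intro linc[OF lD] xy)+
   next
    fix x al assume xa: "x \<in>. U" "al \<in>. K"
    show "?Di 0 (x \<bullet>\<^sub>U al) \<oplus>\<^sub>U ?Di 1 (x \<bullet>\<^sub>U al) = (?Di 0 x \<oplus>\<^sub>U ?Di 1 x) \<bullet>\<^sub>U al"
     unfolding lin_scale[OF lD xa] by (rule UC.AT.scale_add_left[symmetric]) (intro linc[OF lD] xa)+
   qed (intro UC.A.a_closed linc[OF lD])
   moreover have "?D = restrict (%u. ?Di 0 u \<oplus>\<^sub>U ?Di 1 u) (carrier U)"
    by (rule extensionalityI[OF De restrict_extensional]) (simp only: D restrict_apply if_True)
   ultimately show ?thesis by simp
  qed
  fix u assume u: "u \<in>. U"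
  note y = linc[OF sym_lin u]
  let ?cv = "UC.conv (tensor K U U) (pure K U U)"
  note cl = UC.conv_closed[OF px lD lin_id u] UC.conv_closed[OF px lin_id lD u]
  have t: "env_comult K g (?Di i u) = ?cv (?Di i) (%u. u) 0 u \<oplus>\<^sub>(tensor K U U) ?cv (%u. u) (?Di i) i u" for i
  proof -
   have "env_comult K g (?Di i u) = SC.conv (tensor K U U) (pure K U U) \<beta> \<beta> 0 (?P i (\<sigma> u))"
    by (rule env_comult_beta[OF linc[OF SC.PH_lin[OF lx] y]])
   also have "... = SC.conv (tensor K U U) (pure K U U) (%y. \<beta> (?P i y)) \<beta> 0 (\<sigma> u) \<oplus>\<^sub>(tensor K U U) SC.conv (tensor K U U) (pure K U U) \<beta> (%y. \<beta> (?P i y)) i (\<sigma> u)"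
    using SC.PH_derivation[OF px y beta_lin beta_lin lx, of i] by simp
   also have "... = ?cv (%u. \<beta> (?P i (\<sigma> u))) (%u. \<beta> (\<sigma> u)) 0 u \<oplus>\<^sub>(tensor K U U) ?cv (%u. \<beta> (\<sigma> u)) (%u. \<beta> (?P i (\<sigma> u))) i u"
    by (simp only: conv_transport[OF um sym_lin u sym_comult_symbol[OF u] lP beta_lin] conv_transport[OF um sym_lin u sym_comult_symbol[OF u] beta_lin lP])
   also have "?cv (%u. \<beta> (?P i (\<sigma> u))) (%u. \<beta> (\<sigma> u)) 0 u = ?cv (?Di i) (%u. u) 0 u" by (rule UC.conv_cong) (simp_all only: sym_inv(3))
   also have "?cv (%u. \<beta> (\<sigma> u)) (%u. \<beta> (?P i (\<sigma> u))) i u = ?cv (%u. u) (?Di i) i u" by (rule UC.conv_cong) (simp_all only: sym_inv(3))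
   finally show ?thesis .
  qed
  have z2: "?cv f (%x. \<zero>\<^sub>U) d u = \<zero>\<^sub>(tensor K U U)" if "lin K U U df f" for f df d
   by (rule UC.conv_ext[OF px that lin_zero[OF um] amap_const0[OF TU.M.ag] u])
     (auto simp: amap_zero[OF UC.AT.pu_amap2 UC.A.ag TU.M.ag] linc[OF that])
  note z0 = lin_zero[OF um]
  \<comment> \<open>The identity is even, so the terms with its odd component vanish, while the
    conjugated operator contributes both of its parity components.\<close>
  have m1: "tensor_map K U U U U ?D (\<lambda>y \<in> carrier U. y) (env_comult K g u) = ?cv (?Di 0) (%u. u) 0 u \<oplus>\<^sub>(tensor K U U) ?cv (?Di 1) (%u. u) 0 u"
  proof -
   have "tensor_map K U U U U ?D (\<lambda>y \<in> carrier U. y) (env_comult K g u) =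
     (?cv (?Di 0) (%u. u) 0 u \<oplus>\<^sub>(tensor K U U) ?cv (?Di 1) (%u. u) 0 u) \<oplus>\<^sub>(tensor K U U) (?cv (?Di 0) (%u. \<zero>\<^sub>U) 1 u \<oplus>\<^sub>(tensor K U U) ?cv (?Di 1) (%u. \<zero>\<^sub>U) 1 u)"
    by (rule UC.tensor_map_conv[OF um lD lD lin_id z0 D _ _ u]) simp_all
   then show ?thesis using cl by (simp add: z2[OF lD])
  qed
  have m2: "tensor_map K U U U U (\<lambda>y \<in> carrier U. y) ?D (env_comult K g u) = ?cv (%u. u) (?Di 0) 0 u \<oplus>\<^sub>(tensor K U U) ?cv (%u. u) (?Di 1) 1 u"
  proof -
   have "tensor_map K U U U U (\<lambda>y \<in> carrier U. y) ?D (env_comult K g u) =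
     (?cv (%u. u) (?Di 0) 0 u \<oplus>\<^sub>(tensor K U U) ?cv (%u. \<zero>\<^sub>U) (?Di 0) 0 u) \<oplus>\<^sub>(tensor K U U) (?cv (%u. u) (?Di 1) 1 u \<oplus>\<^sub>(tensor K U U) ?cv (%u. \<zero>\<^sub>U) (?Di 1) 1 u)"
    by (rule UC.tensor_map_conv[OF um lin_id z0 lD lD _ De D u]) simp_all
   then show ?thesis using cl by (simp add: conv_zeroL[OF um lD u])
  qed
  show "env_comult K g (?D u) = tensor_map K U U U U ?D (\<lambda>y \<in> carrier U. y) (env_comult K g u) \<oplus>\<^sub>(tensor K U U) tensor_map K U U U U (\<lambda>y \<in> carrier U. y) ?D (env_comult K g u)"
   unfolding m1 m2 D[OF u] ama[OF UC.D_amap linc[OF lD u] linc[OF lD u]] t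
   by (rule TU.M.add4[OF cl cl])
 qed
qed

end

theorem theorem8p2:
  fixes K :: "('k, 'm) graded_ring_scheme"
    and g :: "('g, 'k, 'n) lie_super_scheme"
    and N :: enat
  assumes "lie_superalgebra K g"
    and "[(2::nat)] \<cdot>\<^bsub>K\<^esub> \<one>\<^bsub>K\<^esub> \<in> Units K \<or> (carrier K = hpart K 0 \<and> carrier g = hpart g 0)"
    and "(N = \<infinity> \<and> (\<forall>m::nat. m > 0 \<longrightarrow> [m] \<cdot>\<^bsub>K\<^esub> \<one>\<^bsub>K\<^esub> \<in> Units K)) \<or>
         (\<exists>n::nat. n \<ge> 2 \<and> N = enat n \<and> lie_nilpotent g n \<and>
            (\<forall>m \<in> {2..n}. [m] \<cdot>\<^bsub>K\<^esub> \<one>\<^bsub>K\<^esub> \<in> Units K))"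
  shows "let S = Sym K g; U = Env K g; \<beta> = symmetrization K g N in
           (\<forall>x \<in> carrier S.
              env_comult K g (\<beta> x) = tensor_map K S S U U \<beta> \<beta> (sym_comult K g x)) \<and>
           (\<forall>a \<in> carrier g. \<forall>c \<in> even_units K \<union> {\<zero>\<^bsub>K\<^esub>}.
              coderivation K U (env_comult K g)
                (compose (carrier U) \<beta>
                  (compose (carrier U) (Phi K g N c a) (inv_into (carrier S) \<beta>))))"
proof -
  interpret hln K g N
    by (intro hln.intro hln_axioms.intro hl.intro hl_axioms.intro assms)
  show ?thesis unfolding Let_def by (intro conjI ballI comult_symmetrization coderivation_conj)
qed

end
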